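(* Let $E$ be a real separable Hilbert space, $\mathcal{E}\subset E\subset\mathcal{E}'$ the Gel'fand triple given by a self-adjoint diagonal operator $A$ on $E$ with increasing eigenvalues greater than $1$ whose inverse is Hilbert--Schmidt, and let $\mu$ be the associated standard Gaussian probability measure on $\mathcal{E}'$. Let $T$ be a self-adjoint diagonal operator on $E$, commuting with $A$, such that $0\le T\le 2I$, where $I$ is the identity operator of $E$. Let $C$ and $D$ be two self-adjoint, diagonal, bounded operators on $E$, of operator norm at most $1$, commuting with $A$, such that $$(I-C^2)(I-D^2)\ \ge\ (T-I)^2C^2D^2 .$$ Let $p,q,r>1$. (1) Suppose that $$(r-1)I\ \le\ \frac{(p-1)(q-1)I-C^2D^2T^2}{(q-1)C^2+(p-1)D^2+2C^2D^2T},$$ or equivalently $$\frac{1}{(r-1)I+T}\ \ge\ \frac{1}{\frac{p-1}{C^2}+T}+\frac{1}{\frac{q-1}{D^2}+T}.$$ Then for all $\varphi\in L^p(\mathcal{E}',\mu)$ and $\psi\in L^q(\mathcal{E}',\mu)$, $\Gamma(C)\varphi\diamond_T\Gamma(D)\psi$ belongs to $L^r(\mathcal{E}',\mu)$ and $$\|\Gamma(C)\varphi\diamond_T\Gamma(D)\psi\|_r\ \le\ \|\varphi\|_p\cdot\|\psi\|_q .$$ (2) On the other hand, if $$(r-1)I\ \not\le\ \frac{(p-1)(q-1)I-C^2D^2T^2}{(q-1)C^2+(p-1)D^2+2C^2D^2T},$$ then the bilinear operator $(\varphi,\psi)\mapsto\Gamma(C)\varphi\diamond_T\Gamma(D)\psi$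 is not bounded from $L^p(\mathcal{E}',\mu)\times L^q(\mathcal{E}',\mu)$ to $L^r(\mathcal{E}',\mu)$.
   Context: Setting. $E$ is a real separable Hilbert space with inner product $(\cdot,\cdot)$ and norm $|\cdot|_0$. $A$ is a self-adjoint operator on $E$ with an orthonormal basis $\{e_n\}_{n\ge0}$ of eigenvectors, $Ae_n=\lambda_ne_n$, $1<\lambda_0<\lambda_1<\cdots$, and $A^{-1}$ Hilbert--Schmidt. For $k\ge0$, $|f|_k=|A^kf|_0$, $\mathcal{E}_k=\{f\in E: |f|_k<\infty\}$, $\mathcal{E}=\bigcap_{k\ge0}\mathcal{E}_k$ with the topology given by the norms $|\cdot|_k$; $\mathcal{E}'$ is its dual. $\mu$ is the unique probability measure on $\mathcal{E}'$ with $\int_{\mathcal{E}'}e^{i\langle x,\xi\rangle}d\mu(x)=e^{-|\xi|_0^2/2}$ for all $\xi\in\mathcal{E}$. For $f\in E$, $\langle\cdot,f\rangle$ is the $L^2(\mu)$-limit of $\langle\cdot,\xi_n\rangle$, $\xi_n\in\mathcal{E}$, $\xi_n\to f$ in $E$. The subscript $c$ denotes complexification, and $\langle\cdot,\cdot\rangle$ also denotes the complex-bilinear (not sesquilinear) extension of the inner product to $E_c$. $L^p(\mathcal{E}',\mu)$ consists of complex-valued functions with norm $\|\cdot\|_p$. Diagonal operators. A diagonal operator is one of the form $e_n\mapsto b_ne_n$ with real eigenvalues $b_n$ in the basis $\{e_n\}$ (extended complex-linearly to $E_c$). Products, functions, quotients and inequalities of such operators are understood eigenvalue by eigenvalue.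 Convention: on vectors in $\mathrm{Ker}(C)$ the fraction $1/(\frac{p-1}{C^2}+T)$ is $0$, and similarly on $\mathrm{Ker}(D)$ the fraction $1/(\frac{q-1}{D^2}+T)$ is $0$; correspondingly, on a basis vector where $C$ and $D$ both vanish the fraction bounding $(r-1)I$ is read as $+\infty$. Second quantization. Every $\varphi\in L^2(\mathcal{E}',\mu)$ has a unique Wiener--It\^o expansion $\varphi(x)=\sum_n\langle :x^{\otimes n}:,f_n\rangle$, $f_n\in E_c^{\hat\otimes n}$ (symmetric tensors), where $:x^{\otimes n}:$ is the Wick tensor and $\|\varphi\|_2^2=\sum_n n!|f_n|_0^2$. For a densely defined operator $B$ on $E$, $\Gamma(B)\varphi(x)=\sum_n\langle :x^{\otimes n}:,B^{\otimes n}f_n\rangle$. Exponential functions. For $\xi\in E_c$, $\varphi_\xi=\sum_n\frac1{n!}\langle :\cdot^{\otimes n}:,\xi^{\otimes n}\rangle$, i.e. $\varphi_\xi(x)=e^{\langle x,\xi\rangle-\frac12\langle\xi,\xi\rangle}$. $Exp$ is the complex linear span of $\{\varphi_\xi:\xi\in\mathcal{E}_c\}$; it is dense in $L^p(\mathcal{E}',\mu)$ for $1\le p<\infty$. $T$-Wick product. For a bounded diagonal $T>0$ and $\varphi,\psi\in Exp$, $\varphi\diamond_T\psi=\Gamma(1/\sqrt T)[\Gamma(\sqrt T)\varphi\cdot\Gamma(\sqrt T)\psi]$ (pointwise product inside the brackets). For $T\ge0$, $\varphi\diamond_T\psi=\lim_{\epsilon\to0^+}\varphi\diamond_{T_\epsilon}\psi$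 with $T_\epsilon=T+\epsilon P_{\mathrm{Ker}(T)}$, $P_{\mathrm{Ker}(T)}$ being the orthogonal projection onto $\mathrm{Ker}(T)$. Meaning for general $\varphi,\psi$. The bilinear map $(\varphi,\psi)\mapsto\Gamma(C)\varphi\diamond_T\Gamma(D)\psi$ is defined on $Exp\times Exp$. It is called bounded from $L^p\times L^q$ to $L^r$ if for some constant $k$ one has $\|\Gamma(C)\varphi\diamond_T\Gamma(D)\psi\|_r\le k\|\varphi\|_p\|\psi\|_q$ for all $\varphi,\psi\in Exp$; in that case $\Gamma(C)\varphi\diamond_T\Gamma(D)\psi\in L^r$ for $\varphi\in L^p$, $\psi\in L^q$ denotes the value of its unique continuous bilinear extension. *)

theory Defs
  imports "HOL-Probability.Probability"
begin

section \<open>The Gel'fand triple\<close>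

definition orthonormal_basis :: "(nat \<Rightarrow> 'a::{real_inner, banach}) \<Rightarrow> bool" where
  "orthonormal_basis e \<longleftrightarrow>
     (\<forall>m n. e m \<bullet> e n = (if m = n then 1 else 0)) \<and> closure (span (range e)) = UNIV"

text \<open>The self-adjoint, possibly unbounded operator with \<open>e n \<mapsto> b n *\<^sub>R e n\<close> is \<open>diag_op e b\<close>
  on the domain \<open>diag_dom e b\<close>; outside this domain \<open>diag_op\<close> has no meaning. Domains of powers
  of \<open>A\<close> are such domains too, as \<open>A\<^sup>k\<close> is diagonal with the eigenvalues \<open>lam n ^ k\<close>.\<close>

definition diag_dom :: "(nat \<Rightarrow> 'a::{real_inner, banach}) \<Rightarrow> (nat \<Rightarrow> real) \<Rightarrow> 'a set" where
  "diag_dom e b = {f. summable (\<lambda>n. (b n * (e n \<bullet> f))\<^sup>2)}"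

definition diag_op :: "(nat \<Rightarrow> 'a::{real_inner, banach}) \<Rightarrow> (nat \<Rightarrow> real) \<Rightarrow> 'a \<Rightarrow> 'a" where
  "diag_op e b f = (\<Sum>n. (b n * (e n \<bullet> f)) *\<^sub>R e n)"

text \<open>\<open>A = diag_op e lam\<close>. The last condition says that \<open>A\<inverse>\<close> is Hilbert--Schmidt, since
  \<open>norm (A\<inverse> (e n)) = 1 / lam n\<close>.\<close>

definition gelfand_data :: "(nat \<Rightarrow> 'a::{real_inner, banach}) \<Rightarrow> (nat \<Rightarrow> real) \<Rightarrow> bool" where
  "gelfand_data e lam \<longleftrightarrow>
     orthonormal_basis e \<and> 1 < lam 0 \<and> strict_mono lam \<and> summable (\<lambda>n. (1 / lam n)\<^sup>2)"

definition norm_k :: "(nat \<Rightarrow> 'a::{real_inner, banach}) \<Rightarrow> (nat \<Rightarrow> real) \<Rightarrow> nat \<Rightarrow> 'a \<Rightarrow> real" where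
  "norm_k e lam k f = norm (diag_op e (\<lambda>n. lam n ^ k) f)"

definition test_space :: "(nat \<Rightarrow> 'a::{real_inner, banach}) \<Rightarrow> (nat \<Rightarrow> real) \<Rightarrow> 'a set" where
  "test_space e lam = (\<Inter>k. diag_dom e (\<lambda>n. lam n ^ k))"

text \<open>A functional is a function on the test space, made total by \<open>extensional\<close>. The norms
  increase with \<open>k\<close> because \<open>lam n > 1\<close>, so a linear functional is continuous for the topology
  they generate iff it is bounded with respect to one of them.\<close>

definition dual_space ::
    "(nat \<Rightarrow> 'a::{real_inner, banach}) \<Rightarrow> (nat \<Rightarrow> real) \<Rightarrow> ('a \<Rightarrow> real) set" where
  "dual_space e lam =
     {x \<in> extensional (test_space e lam).
        (\<forall>f\<in>test_space e lam. \<forall>g\<in>test_space e lam. x (f + g) = x f + x g) \<and>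
        (\<forall>f\<in>test_space e lam. \<forall>a. x (a *\<^sub>R f) = a * x f) \<and>
        (\<exists>k K. \<forall>f\<in>test_space e lam. \<bar>x f\<bar> \<le> K * norm_k e lam k f)}"

text \<open>The \<open>\<sigma>\<close>-algebra is the one generated by the evaluations, which is the Borel
  \<open>\<sigma>\<close>-algebra of the (weak or strong) dual of this nuclear Frechet space.\<close>

definition white_noise_measure ::
    "(nat \<Rightarrow> 'a::{real_inner, banach}) \<Rightarrow> (nat \<Rightarrow> real) \<Rightarrow> ('a \<Rightarrow> real) measure \<Rightarrow> bool" where
  "white_noise_measure e lam M \<longleftrightarrow>
     prob_space M \<and>
     space M = dual_space e lam \<and>
     sets M = sigma_sets (dual_space e lam)
       {{x \<in> dual_space e lam. x \<xi> \<in> B} | \<xi> B. \<xi> \<in> test_space e lam \<and> B \<in> sets borel} \<and>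
     (\<forall>\<xi>\<in>test_space e lam.
        (\<integral>x. exp (\<i> * complex_of_real (x \<xi>)) \<partial>M) = complex_of_real (exp (- (norm \<xi>)\<^sup>2 / 2)))"


section \<open>\<open>L\<^sup>p\<close> spaces of complex functions\<close>

definition Lp :: "'x measure \<Rightarrow> real \<Rightarrow> ('x \<Rightarrow> complex) \<Rightarrow> bool" where
  "Lp M p f \<longleftrightarrow> f \<in> borel_measurable M \<and> integrable M (\<lambda>x. cmod (f x) powr p)"

definition Lp_norm :: "'x measure \<Rightarrow> real \<Rightarrow> ('x \<Rightarrow> complex) \<Rightarrow> real" where
  "Lp_norm M p f = (\<integral>x. cmod (f x) powr p \<partial>M) powr (1 / p)"

definition Lp_tendsto ::
    "'x measure \<Rightarrow> real \<Rightarrow> ('i \<Rightarrow> 'x \<Rightarrow> complex) \<Rightarrow> ('x \<Rightarrow> complex) \<Rightarrow> 'i filter \<Rightarrow> bool" where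
  "Lp_tendsto M p f g F \<longleftrightarrow>
     Lp M p g \<and> (\<forall>\<^sub>F i in F. Lp M p (f i)) \<and>
     ((\<lambda>i. Lp_norm M p (\<lambda>x. f i x - g x)) \<longlongrightarrow> 0) F"


section \<open>Wiener--Ito expansion and second quantization\<close>

text \<open>\<open>wick_tensor x [\<xi>\<^sub>1, \<dots>, \<xi>\<^sub>n]\<close> is the pairing of the Wick tensor \<open>:x\<^sup>n:\<close> with
  \<open>\<xi>\<^sub>1 \<otimes> \<dots> \<otimes> \<xi>\<^sub>n\<close>, computed by the recursion that subtracts from \<open>x \<otimes> :x\<^sup>n\<^sup>-\<^sup>1:\<close> the
  contractions (by the trace tensor) of the first factor with each of the others.\<close>

function wick_tensor :: "('a::real_inner \<Rightarrow> real) \<Rightarrow> 'a list \<Rightarrow> real" where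
  "wick_tensor x [] = 1"
| "wick_tensor x (\<xi> # \<xi>s) = x \<xi> * wick_tensor x \<xi>s -
     (\<Sum>j<length \<xi>s. (\<xi> \<bullet> \<xi>s ! j) * wick_tensor x (take j \<xi>s @ drop (Suc j) \<xi>s))"
  by pat_completeness auto
termination
  by (relation "Wellfounded.measure (\<lambda>(x, \<xi>s). length \<xi>s)") auto

text \<open>\<open>f\<close> collects all kernels: \<open>f [j\<^sub>1, \<dots>, j\<^sub>n]\<close> is the coefficient of the symmetric tensor
  \<open>f\<^sub>n\<close> at \<open>e j\<^sub>1 \<otimes> \<dots> \<otimes> e j\<^sub>n\<close>. Hence the sum over all lists below is the sum over \<open>n\<close> of
  \<open>n! |f\<^sub>n|\<^sup>2\<close>, and the \<open>L\<^sup>2\<close>-convergent unordered sum over all lists is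
  \<open>\<Sum>n. \<langle>:x\<^sup>n:, f\<^sub>n\<rangle>\<close>.\<close>

definition wiener_ito ::
    "(nat \<Rightarrow> 'a::real_inner) \<Rightarrow> ('a \<Rightarrow> real) measure \<Rightarrow> (('a \<Rightarrow> real) \<Rightarrow> complex) \<Rightarrow>
     (nat list \<Rightarrow> complex) \<Rightarrow> bool" where
  "wiener_ito e M \<phi> f \<longleftrightarrow>
     (\<forall>js ks. mset js = mset ks \<longrightarrow> f js = f ks) \<and>
     (\<lambda>js. fact (length js) * (cmod (f js))\<^sup>2) summable_on UNIV \<and>
     Lp_tendsto M 2
       (\<lambda>J x. \<Sum>js\<in>J. f js * complex_of_real (wick_tensor x (map e js))) \<phi>
       (finite_subsets_at_top UNIV)"

text \<open>\<open>Gamma e M b\<close> is the second quantization of the diagonal operator with eigenvalues \<open>b\<close>. It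
  is determined up to a null set, and the choice picks some version; for \<open>\<phi>\<close> outside the domain
  of the operator it has no meaning.\<close>

definition Gamma ::
    "(nat \<Rightarrow> 'a::real_inner) \<Rightarrow> ('a \<Rightarrow> real) measure \<Rightarrow> (nat \<Rightarrow> real) \<Rightarrow>
     (('a \<Rightarrow> real) \<Rightarrow> complex) \<Rightarrow> ('a \<Rightarrow> real) \<Rightarrow> complex" where
  "Gamma e M b \<phi> = (SOME G. \<exists>f. wiener_ito e M \<phi> f \<and>
     wiener_ito e M G (\<lambda>js. complex_of_real (prod_list (map b js)) * f js))"


section \<open>Exponential functions and the \<open>T\<close>-Wick product\<close>

text \<open>A pair \<open>(\<xi>, \<eta>)\<close> stands for \<open>\<xi> + \<i>\<eta>\<close> in the complexification.\<close>

definition cinner_bilinear :: "'a::real_inner \<times> 'a \<Rightarrow> 'a \<times> 'a \<Rightarrow> complex" where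
  "cinner_bilinear \<zeta> \<theta> =
     Complex (fst \<zeta> \<bullet> fst \<theta> - snd \<zeta> \<bullet> snd \<theta>) (fst \<zeta> \<bullet> snd \<theta> + snd \<zeta> \<bullet> fst \<theta>)"

definition exp_fun :: "'a::real_inner \<times> 'a \<Rightarrow> ('a \<Rightarrow> real) \<Rightarrow> complex" where
  "exp_fun \<zeta> x = exp (Complex (x (fst \<zeta>)) (x (snd \<zeta>)) - cinner_bilinear \<zeta> \<zeta> / 2)"

definition Exp ::
    "(nat \<Rightarrow> 'a::{real_inner, banach}) \<Rightarrow> (nat \<Rightarrow> real) \<Rightarrow> (('a \<Rightarrow> real) \<Rightarrow> complex) set" where
  "Exp e lam = {(\<lambda>x. \<Sum>\<zeta>\<in>S. a \<zeta> * exp_fun \<zeta> x) | S a.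
     finite S \<and> S \<subseteq> test_space e lam \<times> test_space e lam}"

definition wick_product_pos ::
    "(nat \<Rightarrow> 'a::real_inner) \<Rightarrow> ('a \<Rightarrow> real) measure \<Rightarrow> (nat \<Rightarrow> real) \<Rightarrow>
     (('a \<Rightarrow> real) \<Rightarrow> complex) \<Rightarrow> (('a \<Rightarrow> real) \<Rightarrow> complex) \<Rightarrow> ('a \<Rightarrow> real) \<Rightarrow> complex" where
  "wick_product_pos e M t \<phi> \<psi> =
     Gamma e M (\<lambda>n. 1 / sqrt (t n))
       (\<lambda>x. Gamma e M (\<lambda>n. sqrt (t n)) \<phi> x * Gamma e M (\<lambda>n. sqrt (t n)) \<psi> x)"

text \<open>The limit is taken in \<open>L\<^sup>2\<close>; some version is chosen. If all \<open>t n\<close> are positive then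
  \<open>T\<^sub>\<epsilon> = T\<close> and this is \<open>wick_product_pos e M t\<close> almost everywhere.\<close>

definition wick_product ::
    "(nat \<Rightarrow> 'a::real_inner) \<Rightarrow> ('a \<Rightarrow> real) measure \<Rightarrow> (nat \<Rightarrow> real) \<Rightarrow>
     (('a \<Rightarrow> real) \<Rightarrow> complex) \<Rightarrow> (('a \<Rightarrow> real) \<Rightarrow> complex) \<Rightarrow> ('a \<Rightarrow> real) \<Rightarrow> complex" where
  "wick_product e M t \<phi> \<psi> = (SOME G.
     Lp_tendsto M 2
       (\<lambda>\<epsilon>. wick_product_pos e M (\<lambda>n. t n + (if t n = 0 then \<epsilon> else 0)) \<phi> \<psi>) G (at_right 0))"


definition wick_Gamma ::
    "(nat \<Rightarrow> 'a::real_inner) \<Rightarrow> ('a \<Rightarrow> real) measure \<Rightarrow>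
     (nat \<Rightarrow> real) \<Rightarrow> (nat \<Rightarrow> real) \<Rightarrow> (nat \<Rightarrow> real) \<Rightarrow>
     (('a \<Rightarrow> real) \<Rightarrow> complex) \<Rightarrow> (('a \<Rightarrow> real) \<Rightarrow> complex) \<Rightarrow> ('a \<Rightarrow> real) \<Rightarrow> complex" where
  "wick_Gamma e M t c d \<phi> \<psi> = wick_product e M t (Gamma e M c \<phi>) (Gamma e M d \<psi>)"


section \<open>Boundedness and continuous extension\<close>

text \<open>Functions in \<open>L\<^sup>p\<close> are not identified modulo null sets, so identities between them are
  required almost everywhere.\<close>

definition bounded_Lp_on ::
    "'x measure \<Rightarrow> real \<Rightarrow> real \<Rightarrow> real \<Rightarrow> ('x \<Rightarrow> complex) set \<Rightarrow>
     (('x \<Rightarrow> complex) \<Rightarrow> ('x \<Rightarrow> complex) \<Rightarrow> 'x \<Rightarrow> complex) \<Rightarrow> bool" where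
  "bounded_Lp_on M p q r S B \<longleftrightarrow>
     (\<exists>k. \<forall>\<phi>\<in>S. \<forall>\<psi>\<in>S. Lp M r (B \<phi> \<psi>) \<and>
        Lp_norm M r (B \<phi> \<psi>) \<le> k * Lp_norm M p \<phi> * Lp_norm M q \<psi>)"

definition bounded_bilinear_Lp ::
    "'x measure \<Rightarrow> real \<Rightarrow> real \<Rightarrow> real \<Rightarrow>
     (('x \<Rightarrow> complex) \<Rightarrow> ('x \<Rightarrow> complex) \<Rightarrow> 'x \<Rightarrow> complex) \<Rightarrow> bool" where
  "bounded_bilinear_Lp M p q r F \<longleftrightarrow>
     (\<forall>\<phi> \<psi>. Lp M p \<phi> \<longrightarrow> Lp M q \<psi> \<longrightarrow> Lp M r (F \<phi> \<psi>)) \<and>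
     (\<forall>\<phi> \<phi>' \<psi>. Lp M p \<phi> \<longrightarrow> Lp M p \<phi>' \<longrightarrow> Lp M q \<psi> \<longrightarrow>
        (AE x in M. F (\<lambda>y. \<phi> y + \<phi>' y) \<psi> x = F \<phi> \<psi> x + F \<phi>' \<psi> x)) \<and>
     (\<forall>\<phi> \<psi> \<psi>'. Lp M p \<phi> \<longrightarrow> Lp M q \<psi> \<longrightarrow> Lp M q \<psi>' \<longrightarrow>
        (AE x in M. F \<phi> (\<lambda>y. \<psi> y + \<psi>' y) x = F \<phi> \<psi> x + F \<phi> \<psi>' x)) \<and>
     (\<forall>a \<phi> \<psi>. Lp M p \<phi> \<longrightarrow> Lp M q \<psi> \<longrightarrow>
        (AE x in M. F (\<lambda>y. a * \<phi> y) \<psi> x = a * F \<phi> \<psi> x) \<and>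
        (AE x in M. F \<phi> (\<lambda>y. a * \<psi> y) x = a * F \<phi> \<psi> x)) \<and>
     (\<exists>K. \<forall>\<phi> \<psi>. Lp M p \<phi> \<longrightarrow> Lp M q \<psi> \<longrightarrow>
        Lp_norm M r (F \<phi> \<psi>) \<le> K * Lp_norm M p \<phi> * Lp_norm M q \<psi>)"

definition continuous_bilinear_extension ::
    "'x measure \<Rightarrow> real \<Rightarrow> real \<Rightarrow> real \<Rightarrow> ('x \<Rightarrow> complex) set \<Rightarrow>
     (('x \<Rightarrow> complex) \<Rightarrow> ('x \<Rightarrow> complex) \<Rightarrow> 'x \<Rightarrow> complex) \<Rightarrow>
     (('x \<Rightarrow> complex) \<Rightarrow> ('x \<Rightarrow> complex) \<Rightarrow> 'x \<Rightarrow> complex) \<Rightarrow> bool" where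
  "continuous_bilinear_extension M p q r S B F \<longleftrightarrow>
     bounded_bilinear_Lp M p q r F \<and> (\<forall>\<phi>\<in>S. \<forall>\<psi>\<in>S. AE x in M. F \<phi> \<psi> x = B \<phi> \<psi> x)"


section \<open>The conditions on the exponents\<close>

text \<open>For one joint eigenvector, with eigenvalues \<open>c\<close>, \<open>d\<close>, \<open>t\<close> of \<open>C\<close>, \<open>D\<close>, \<open>T\<close>. For
  \<open>t \<ge> 0\<close> and \<open>p, q > 1\<close> the denominator vanishes only if \<open>c = d = 0\<close>, where the fraction is
  read as \<open>\<infinity>\<close>.\<close>

definition exponent_cond :: "real \<Rightarrow> real \<Rightarrow> real \<Rightarrow> real \<Rightarrow> real \<Rightarrow> real \<Rightarrow> bool" where
  "exponent_cond p q r c d t \<longleftrightarrow>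
     (c = 0 \<and> d = 0) \<or>
     r - 1 \<le> ((p - 1) * (q - 1) - c\<^sup>2 * d\<^sup>2 * t\<^sup>2) /
             ((q - 1) * c\<^sup>2 + (p - 1) * d\<^sup>2 + 2 * c\<^sup>2 * d\<^sup>2 * t)"

text \<open>\<open>1 / ((p - 1) / c\<^sup>2 + t)\<close> is read as \<open>0\<close> for \<open>c = 0\<close>.\<close>

definition recip_term :: "real \<Rightarrow> real \<Rightarrow> real \<Rightarrow> real" where
  "recip_term p c t = (if c = 0 then 0 else 1 / ((p - 1) / c\<^sup>2 + t))"

definition exponent_cond_recip :: "real \<Rightarrow> real \<Rightarrow> real \<Rightarrow> real \<Rightarrow> real \<Rightarrow> real \<Rightarrow> bool" where
  "exponent_cond_recip p q r c d t \<longleftrightarrow>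
     1 / (r - 1 + t) \<ge> recip_term p c t + recip_term q d t"

end

theory Submission
  imports Defs "HOL-Complex_Analysis.Complex_Analysis" "HOL-Combinatorics.Multiset_Permutations"
begin

text \<open>On exponential functions the operator is a conditional expectation: it maps \<open>\<phi>, \<psi>\<close> to
  \<open>x \<mapsto> E (\<phi> (U) \<psi> (V))\<close>, where \<open>U = c x + \<alpha> y\<close> and \<open>V = d x + \<gamma> (\<beta> y + \<delta> z)\<close> with \<open>y, z\<close> independent of
  law \<open>\<mu>\<close>, the coefficients being chosen so that \<open>U\<close> and \<open>V\<close> have law \<open>\<mu>\<close> and covariance \<open>t c d\<close>;
  this is where \<open>(I - C\<^sup>2) (I - D\<^sup>2) \<ge> (T - I)\<^sup>2 C\<^sup>2 D\<^sup>2\<close> enters. By duality the bound is a Hoelder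
  inequality for the three Gaussian fields \<open>U, V, x\<close> with the weights \<open>1/p, 1/q, 1 - 1/r\<close>. It
  follows from the inequality \<open>Var (\<Sum> \<theta>\<^sub>i l\<^sub>i) \<le> \<Sum> \<theta>\<^sub>i Var l\<^sub>i\<close> for linear functionals by splitting the
  fields into \<open>n\<close> independent increments of size \<open>1 / sqrt n\<close>: to second order one increment only
  sees the linear parts, and the errors of order \<open>n\<^sup>-\<^sup>3\<^sup>/\<^sup>2\<close> disappear as \<open>n \<rightarrow> \<infinity>\<close>. Eigenvalue by
  eigenvalue the variance inequality is the condition on the exponents, and if it fails, then
  exponential functions of growing vectors violate every bound.\<close>

section \<open>\<open>L\<^sup>p\<close> spaces\<close>

text \<open>The three weights may add up to more than 1, where the ordinary Hoelder inequality says
  nothing; the partial independence of \<open>U\<close>, \<open>V\<close> and \<open>x\<close> has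
  to pay for the excess. Eliminating the third functional by completing a square turns the variance
  inequality into a quadratic form in two real variables per eigenvector, whose discriminant
  inequality is the exponent condition. Where that form is negative, it supplies the direction of
  the unbounded exponential functions. The second-order comparison needs functions that are bounded,
  bounded away from 0 and have a uniform quadratic Taylor remainder, and these bounds must survive
  every step. Hence it is made for (|f|^2 + \<epsilon>)^(p/2) with trigonometric polynomials f:
  Gaussian averaging preserves all constants. Density and Fatou's lemma lead to L^p.
  \<open>Gamma\<close> and \<open>wick_product\<close> are chosen versions, the latter of a limit.
  On exponential functions all this collapses to finite sums whose scalars are exponentials of the
  pairing of C \<zeta> with T D \<theta>, and the covariance of \<open>U\<close> and
  \<open>V\<close> reproduces exactly these.\<close>

lemma powr_add_le_weighted:
  fixes a b A B p :: real
  assumes "0 \<le> a" "0 \<le> b" "0 < A" "0 < B" "1 \<le> p"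
  shows "((a + b) / (A + B)) powr p \<le> A / (A + B) * (a / A) powr p + B / (A + B) * (b / B) powr p"
proof -
  define l where "l = A / (A + B)"
  have l: "0 < l" "l < 1" "1 - l = B / (A + B)" using assms by (auto simp: l_def field_simps)
  have eq: "(a + b) / (A + B) = l * (a / A) + (1 - l) * (b / B)"
    unfolding l(3) unfolding l_def using assms by (simp add: add_divide_distrib)
  have small: "x powr p \<le> x" if "0 \<le> x" "x \<le> 1" for x :: real
    using powr_mono'[of 1 p x] that assms by auto
  have "(l * (a / A) + (1 - l) * (b / B)) powr p \<le> l * (a / A) powr p + (1 - l) * (b / B) powr p"
  \<comment> \<open>Convexity is used on the open half-line; if a term vanishes, what remains is m^p
    <= m for a weight m in [0, 1].\<close>
  proof (cases "a = 0 \<or> b = 0")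
    case True
    have *: "(m * x) powr p \<le> m * x powr p" if "0 \<le> m" "m \<le> 1" "0 \<le> x" for m x :: real
      using small[OF that(1,2)] that by (simp add: powr_mult mult_right_mono)
    have "(l * (a / A)) powr p \<le> l * (a / A) powr p"
      "((1 - l) * (b / B)) powr p \<le> (1 - l) * (b / B) powr p"
      using *[of l "a / A"] *[of "1 - l" "b / B"] l(1,2) assms by auto
    then show ?thesis using True assms by (elim disjE) (simp_all del: times_divide_eq_right)
  next
    case False
    then have "0 < a / A" "0 < b / B" using assms by auto
    then show ?thesis
      using powr_convex[OF assms(5)] l unfolding convex_on_def
      by (smt (verit) greaterThan_iff real_scaleR_def)
  qed
  then show ?thesis unfolding eq l(3)[symmetric] l_def[symmetric] by simp
qed

lemma Lp_measurable: "Lp M p f \<Longrightarrow> f \<in> borel_measurable M"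
  and Lp_integrable: "Lp M p f \<Longrightarrow> integrable M (\<lambda>x. cmod (f x) powr p)"
  by (auto simp: Lp_def)

lemma Lp_norm_nonneg [simp]: "0 \<le> Lp_norm M p f"
  by (simp add: Lp_norm_def)

lemma Lp_norm_powr:
  assumes "0 < p"
  shows "Lp_norm M p f powr p = (\<integral>x. cmod (f x) powr p \<partial>M)"
  using assms by (simp add: Lp_norm_def powr_powr integral_nonneg_AE)

lemma Lp_norm_le_iff:
  assumes "0 < p" "0 \<le> K"
  shows "Lp_norm M p f \<le> K \<longleftrightarrow> (\<integral>x. cmod (f x) powr p \<partial>M) \<le> K powr p"
  using assms Lp_norm_powr[OF assms(1), of M f]
  by (smt (verit) Lp_norm_nonneg powr_less_mono2 powr_mono2)

lemma Lp_norm_AE_cong: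
  assumes "AE x in M. f x = g x" "f \<in> borel_measurable M" "g \<in> borel_measurable M"
  shows "Lp_norm M p f = Lp_norm M p g"
  unfolding Lp_norm_def
  by (intro arg_cong2[where f="(powr)"] integral_cong_AE) (use assms in auto)

lemma Lp_AE_cong:
  assumes "Lp M p f" "AE x in M. f x = g x" "g \<in> borel_measurable M"
  shows "Lp M p g"
  using assms unfolding Lp_def
  by (auto elim!: integrable_cong_AE_imp)

lemma Lp_zero [simp]: "Lp M p (\<lambda>x. 0)"
  by (simp add: Lp_def)

lemma Lp_norm_zero [simp]: "Lp_norm M p (\<lambda>x. 0) = 0"
  by (simp add: Lp_norm_def)

lemma Lp_cmult:
  assumes "Lp M p f"
  shows "Lp M p (\<lambda>x. a * f x)"
  using assms by (auto simp: Lp_def norm_mult powr_mult)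

lemma Lp_norm_cmult:
  assumes "0 < p"
  shows "Lp_norm M p (\<lambda>x. a * f x) = cmod a * Lp_norm M p f"
  using assms
  by (simp add: Lp_norm_def norm_mult powr_mult powr_powr integral_nonneg_AE)

lemma Lp_norm_eq_0:
  assumes "Lp M p f" "Lp_norm M p f = 0"
  shows "AE x in M. f x = 0"
proof -
  have "(\<integral>x. cmod (f x) powr p \<partial>M) = 0"
    using assms(2) by (simp add: Lp_norm_def)
  then have "AE x in M. cmod (f x) powr p = 0"
    using integral_nonneg_eq_0_iff_AE[OF Lp_integrable[OF assms(1)]] by auto
  then show ?thesis by eventually_elim simp
qed

lemma Lp_add:
  assumes "Lp M p f" "Lp M p g" "1 \<le> p"
  shows "Lp M p (\<lambda>x. f x + g x)"
proof -
  have [measurable]: "f \<in> borel_measurable M" "g \<in> borel_measurable M"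
    using assms by (auto simp: Lp_def)
  have "integrable M (\<lambda>x. cmod (f x + g x) powr p)"
  proof (rule Bochner_Integration.integrable_bound)
    show "integrable M (\<lambda>x. 2 powr p * (cmod (f x) powr p + cmod (g x) powr p))"
      using assms by (auto simp: Lp_def)
    show "AE x in M. norm (cmod (f x + g x) powr p)
        \<le> norm (2 powr p * (cmod (f x) powr p + cmod (g x) powr p))"
    proof (rule AE_I2)
      fix x
      have "cmod (f x + g x) powr p \<le> (cmod (f x) + cmod (g x)) powr p"
        using assms by (intro powr_mono2) (auto simp: norm_triangle_ineq)
      also have "\<dots> = 2 powr p * ((cmod (f x) + cmod (g x)) / (1 + 1)) powr p"
        by (simp add: powr_divide)
      also have "\<dots> \<le> 2 powr p * (cmod (f x) powr p + cmod (g x) powr p)"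
      proof (intro mult_left_mono)
        have "((cmod (f x) + cmod (g x)) / (1 + 1)) powr p \<le> cmod (f x) powr p / 2 + cmod (g x) powr p / 2"
          using powr_add_le_weighted[of "cmod (f x)" "cmod (g x)" 1 1 p] assms(3) by simp
        moreover have "0 \<le> cmod (f x) powr p" "0 \<le> cmod (g x) powr p" by simp_all
        ultimately show "((cmod (f x) + cmod (g x)) / (1 + 1)) powr p \<le> cmod (f x) powr p + cmod (g x) powr p"
          by linarith
      qed simp
      finally show "norm (cmod (f x + g x) powr p)
        \<le> norm (2 powr p * (cmod (f x) powr p + cmod (g x) powr p))" by simp
    qed
  qed measurable
  then show ?thesis by (simp add: Lp_def)
qed

text \<open>Minkowski's inequality by normalisation: pointwise, (|f| + |g|) / (A + B) is a convex
  combination of |f| / A and |g| / B, so convexity of the power can be integrated. Zero norms are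
  split off because of the divisions.\<close>

lemma Lp_norm_triangle:
  assumes f: "Lp M p f" and g: "Lp M p g" and p: "1 \<le> p"
  shows "Lp_norm M p (\<lambda>x. f x + g x) \<le> Lp_norm M p f + Lp_norm M p g"
proof -
  have [measurable]: "f \<in> borel_measurable M" "g \<in> borel_measurable M"
    using assms by (auto simp: Lp_def)
  define A B where "A = Lp_norm M p f" and "B = Lp_norm M p g"
  have AB: "0 \<le> A" "0 \<le> B" by (auto simp: A_def B_def)
  consider "A = 0" | "B = 0" | "0 < A" "0 < B" using AB by linarith
  then show ?thesis
  proof cases
    case 1
    then have "AE x in M. f x = 0" using Lp_norm_eq_0[OF f] by (simp add: A_def)
    then have "AE x in M. f x + g x = g x" by eventually_elim simp
    then show ?thesis
      using Lp_norm_AE_cong[of "\<lambda>x. f x + g x" g M p] AB by (simp add: A_def)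
  next
    case 2
    then have "AE x in M. g x = 0" using Lp_norm_eq_0[OF g] by (simp add: B_def)
    then have "AE x in M. f x + g x = f x" by eventually_elim simp
    then show ?thesis
      using Lp_norm_AE_cong[of "\<lambda>x. f x + g x" f M p] AB by (simp add: B_def)
  next
    case 3
    have pp: "0 < p" using p by simp
    have If: "(\<integral>x. cmod (f x) powr p \<partial>M) = A powr p"
      and Ig: "(\<integral>x. cmod (g x) powr p \<partial>M) = B powr p"
      by (simp_all add: A_def B_def Lp_norm_powr[OF pp])
    have "(\<integral>x. cmod (f x + g x) powr p \<partial>M) \<le>
        (\<integral>x. (A + B) powr p * (A / (A + B) * (cmod (f x) powr p / A powr p)
           + B / (A + B) * (cmod (g x) powr p / B powr p)) \<partial>M)"
    proof (rule integral_mono)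
      show "integrable M (\<lambda>x. cmod (f x + g x) powr p)"
        using Lp_add[OF f g p] by (simp add: Lp_def)
      show "integrable M (\<lambda>x. (A + B) powr p * (A / (A + B) * (cmod (f x) powr p / A powr p)
           + B / (A + B) * (cmod (g x) powr p / B powr p)))"
        using f g by (auto simp: Lp_def)
      fix x
      have "cmod (f x + g x) powr p \<le> (cmod (f x) + cmod (g x)) powr p"
        using p by (intro powr_mono2) (auto simp: norm_triangle_ineq)
      also have "\<dots> = (A + B) powr p * ((cmod (f x) + cmod (g x)) / (A + B)) powr p"
        using 3 by (simp add: powr_mult[symmetric])
      also have "\<dots> \<le> (A + B) powr p * (A / (A + B) * (cmod (f x) / A) powr p
           + B / (A + B) * (cmod (g x) / B) powr p)"
        by (intro mult_left_mono powr_add_le_weighted) (use 3 p in auto)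
      finally show "cmod (f x + g x) powr p \<le> (A + B) powr p *
          (A / (A + B) * (cmod (f x) powr p / A powr p)
           + B / (A + B) * (cmod (g x) powr p / B powr p))"
        using 3 by (simp add: powr_divide)
    qed
    also have "\<dots> = (A + B) powr p * (A / (A + B) * (A powr p / A powr p)
           + B / (A + B) * (B powr p / B powr p))"
      using f g by (simp add: Lp_def If Ig)
    also have "\<dots> = (A + B) powr p"
      using 3 by (simp add: add_divide_distrib[symmetric])
    finally have "Lp_norm M p (\<lambda>x. f x + g x) \<le> A + B"
      using Lp_norm_le_iff[OF pp, of "A + B" M "\<lambda>x. f x + g x"] 3 by linarith
    then show ?thesis by (simp add: A_def B_def)
  qed
qed

lemma Lp_diff:
  assumes "Lp M p f" "Lp M p g" "1 \<le> p"
  shows "Lp M p (\<lambda>x. f x - g x)"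
  using Lp_add[OF assms(1) Lp_cmult[OF assms(2), of "-1"] assms(3)] by simp

lemma Lp_norm_minus_commute: "Lp_norm M p (\<lambda>x. f x - g x) = Lp_norm M p (\<lambda>x. g x - f x)"
  by (simp add: Lp_norm_def norm_minus_commute)

lemma Lp_norm_triangle3:
  assumes "Lp M p f" "Lp M p g" "Lp M p h" "1 \<le> p"
  shows "Lp_norm M p (\<lambda>x. f x - h x) \<le> Lp_norm M p (\<lambda>x. f x - g x) + Lp_norm M p (\<lambda>x. g x - h x)"
  using Lp_norm_triangle[OF Lp_diff[OF assms(1,2,4)] Lp_diff[OF assms(2,3,4)] assms(4)] by simp

lemma Lp_norm_triangle_sub:
  assumes "Lp M p f" "Lp M p g" "1 \<le> p"
  shows "Lp_norm M p f \<le> Lp_norm M p g + Lp_norm M p (\<lambda>x. f x - g x)"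
  using Lp_norm_triangle[OF assms(2) Lp_diff[OF assms(1,2,3)] assms(3)] by simp

lemma Lp_norm_abs_diff:
  assumes "Lp M p f" "Lp M p g" "1 \<le> p"
  shows "\<bar>Lp_norm M p f - Lp_norm M p g\<bar> \<le> Lp_norm M p (\<lambda>x. f x - g x)"
  using Lp_norm_triangle_sub[OF assms] Lp_norm_triangle_sub[OF assms(2,1,3)]
  by (simp add: Lp_norm_minus_commute[of M p g])

lemma Lp_sum:
  assumes "finite S" "\<And>i. i \<in> S \<Longrightarrow> Lp M p (f i)" "1 \<le> p"
  shows "Lp M p (\<lambda>x. \<Sum>i\<in>S. f i x)"
  using assms by (induction S rule: finite_induct) (auto intro: Lp_add)

text \<open>Lower semicontinuity of the norm under convergence almost everywhere. It removes the
  truncation in \<open>ker_bound\<close>.\<close>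

lemma Lp_fatou:
  assumes f: "\<And>n. Lp M p (f n)" and lim: "AE x in M. (\<lambda>n. f n x) \<longlonglongrightarrow> g x"
    and [measurable]: "g \<in> borel_measurable M" and K: "\<And>n. Lp_norm M p (f n) \<le> K" and p: "0 < p"
  shows "Lp M p g" "Lp_norm M p g \<le> K"
proof -
  have [measurable]: "\<And>n. f n \<in> borel_measurable M" using f by (simp add: Lp_def)
  have K0: "0 \<le> K" using K[of 0] Lp_norm_nonneg[of M p "f 0"] by linarith
  have "(\<integral>\<^sup>+x. ennreal (cmod (g x) powr p) \<partial>M) \<le> (\<integral>\<^sup>+x. liminf (\<lambda>n. ennreal (cmod (f n x) powr p)) \<partial>M)"
  proof (rule nn_integral_mono_AE)
    show "AE x in M. ennreal (cmod (g x) powr p) \<le> liminf (\<lambda>n. ennreal (cmod (f n x) powr p))"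
      using lim
    proof eventually_elim
      case (elim x)
      then have "(\<lambda>n. ennreal (cmod (f n x) powr p)) \<longlonglongrightarrow> ennreal (cmod (g x) powr p)"
        using p by (intro tendsto_ennrealI tendsto_powr' tendsto_norm tendsto_const) auto
      then show ?case using lim_imp_Liminf[of sequentially] by fastforce
    qed
  qed
  also have "\<dots> \<le> liminf (\<lambda>n. (\<integral>\<^sup>+x. ennreal (cmod (f n x) powr p) \<partial>M))"
    by (intro nn_integral_liminf) measurable
  also have "\<dots> \<le> liminf (\<lambda>n::nat. ennreal (K powr p))"
  proof (intro Liminf_mono always_eventually allI)
    fix n
    have "(\<integral>\<^sup>+x. ennreal (cmod (f n x) powr p) \<partial>M) = ennreal (\<integral>x. cmod (f n x) powr p \<partial>M)"
      using f[of n] by (intro nn_integral_eq_integral) (auto simp: Lp_def)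
    also have "\<dots> \<le> ennreal (K powr p)"
      using K[of n] Lp_norm_le_iff[OF p K0, of M "f n"] by (intro ennreal_leI) auto
    finally show "(\<integral>\<^sup>+x. ennreal (cmod (f n x) powr p) \<partial>M) \<le> ennreal (K powr p)" .
  qed
  finally have le: "(\<integral>\<^sup>+x. ennreal (cmod (g x) powr p) \<partial>M) \<le> ennreal (K powr p)"
    by (simp add: Liminf_const)
  have int: "integrable M (\<lambda>x. cmod (g x) powr p)"
    using le by (intro integrableI_nonneg) (auto simp: less_top[symmetric] top_unique intro: le_less_trans)
  then show "Lp M p g" by (simp add: Lp_def)
  have "ennreal (\<integral>x. cmod (g x) powr p \<partial>M) \<le> ennreal (K powr p)"
    using le nn_integral_eq_integral[OF int] by simp
  then have "(\<integral>x. cmod (g x) powr p \<partial>M) \<le> K powr p"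
    by (subst (asm) ennreal_le_iff) auto
  then show "Lp_norm M p g \<le> K" using Lp_norm_le_iff[OF p K0] by blast
qed

section \<open>Convergence in L^p\<close>

lemma Lp_tendsto_unique:
  assumes "Lp_tendsto M p f g F" "Lp_tendsto M p f h F" "F \<noteq> bot" "1 \<le> p"
  shows "AE x in M. g x = h x"
proof -
  have L: "Lp M p g" "Lp M p h" using assms by (auto simp: Lp_tendsto_def)
  have "\<forall>\<^sub>F i in F. Lp_norm M p (\<lambda>x. g x - h x) \<le> Lp_norm M p (\<lambda>x. f i x - g x) + Lp_norm M p (\<lambda>x. f i x - h x)"
    using assms(1) unfolding Lp_tendsto_def
    by (auto elim!: eventually_mono intro: order_trans[OF Lp_norm_triangle3[OF L(1) _ L(2) assms(4)]]
        simp: Lp_norm_minus_commute[of M p g "f _"])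
  moreover have "((\<lambda>i. Lp_norm M p (\<lambda>x. f i x - g x) + Lp_norm M p (\<lambda>x. f i x - h x)) \<longlongrightarrow> 0 + 0) F"
    using assms unfolding Lp_tendsto_def by (intro tendsto_add) auto
  ultimately have "Lp_norm M p (\<lambda>x. g x - h x) \<le> 0 + 0"
    using tendsto_lowerbound[OF _ _ assms(3)] by blast
  then have "Lp_norm M p (\<lambda>x. g x - h x) = 0" using Lp_norm_nonneg[of M p "\<lambda>x. g x - h x"] by simp
  then show ?thesis using Lp_norm_eq_0[OF Lp_diff[OF L assms(4)]] by simp
qed

lemma Lp_tendsto_add:
  assumes "Lp_tendsto M p f g F" "Lp_tendsto M p f' g' F" "1 \<le> p"
  shows "Lp_tendsto M p (\<lambda>i x. f i x + f' i x) (\<lambda>x. g x + g' x) F"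
proof -
  have L: "Lp M p g" "Lp M p g'" using assms by (auto simp: Lp_tendsto_def)
  have ev: "\<forall>\<^sub>F i in F. Lp M p (f i) \<and> Lp M p (f' i)"
    using assms by (auto simp: Lp_tendsto_def intro: eventually_conj)
  have "((\<lambda>i. Lp_norm M p (\<lambda>x. f i x + f' i x - (g x + g' x))) \<longlongrightarrow> 0) F"
  proof (rule tendsto_sandwich[of "\<lambda>_. 0"])
    show "\<forall>\<^sub>F i in F. Lp_norm M p (\<lambda>x. f i x + f' i x - (g x + g' x)) \<le>
        Lp_norm M p (\<lambda>x. f i x - g x) + Lp_norm M p (\<lambda>x. f' i x - g' x)"
      using ev
    proof eventually_elim
      case (elim i)
      have "(\<lambda>x. f i x + f' i x - (g x + g' x)) = (\<lambda>x. (f i x - g x) + (f' i x - g' x))" by auto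
      then show ?case using Lp_norm_triangle[OF Lp_diff[OF _ L(1) assms(3)] Lp_diff[OF _ L(2) assms(3)] assms(3)] elim by metis
    qed
    have "((\<lambda>i. Lp_norm M p (\<lambda>x. f i x - g x) + Lp_norm M p (\<lambda>x. f' i x - g' x)) \<longlongrightarrow> 0 + 0) F"
      using assms by (intro tendsto_add) (auto simp: Lp_tendsto_def)
    then show "((\<lambda>i. Lp_norm M p (\<lambda>x. f i x - g x) + Lp_norm M p (\<lambda>x. f' i x - g' x)) \<longlongrightarrow> 0) F" by simp
  qed auto
  then show ?thesis
    using ev L assms(3) unfolding Lp_tendsto_def
    by (auto intro: Lp_add elim!: eventually_mono)
qed

lemma Lp_tendsto_cmult:
  assumes "Lp_tendsto M p f g F" "0 < p"
  shows "Lp_tendsto M p (\<lambda>i x. a * f i x) (\<lambda>x. a * g x) F"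
proof -
  have "Lp_norm M p (\<lambda>x. a * f i x - a * g x) = cmod a * Lp_norm M p (\<lambda>x. f i x - g x)" for i
    using Lp_norm_cmult[OF assms(2), of M a "\<lambda>x. f i x - g x"] by (simp add: right_diff_distrib)
  then show ?thesis
    using assms unfolding Lp_tendsto_def
    by (auto intro: Lp_cmult tendsto_mult_right_zero elim!: eventually_mono)
qed

lemma Lp_tendsto_AE_cong:
  assumes "Lp_tendsto M p f g F" "AE x in M. g x = h x" "h \<in> borel_measurable M" "1 \<le> p"
  shows "Lp_tendsto M p f h F"
proof -
  have L: "Lp M p g" using assms by (auto simp: Lp_tendsto_def)
  have "\<forall>\<^sub>F i in F. Lp_norm M p (\<lambda>x. f i x - g x) = Lp_norm M p (\<lambda>x. f i x - h x)"
  proof -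
    have "\<forall>\<^sub>F i in F. Lp M p (f i)" using assms by (auto simp: Lp_tendsto_def)
    then show ?thesis
    proof eventually_elim
      case (elim i)
      then have [measurable]: "f i \<in> borel_measurable M" "g \<in> borel_measurable M" "h \<in> borel_measurable M"
        using L assms by (auto simp: Lp_def)
      show ?case using assms(2) by (intro Lp_norm_AE_cong) auto
    qed
  qed
  moreover have "((\<lambda>i. Lp_norm M p (\<lambda>x. f i x - g x)) \<longlongrightarrow> 0) F" using assms by (simp add: Lp_tendsto_def)
  ultimately have "((\<lambda>i. Lp_norm M p (\<lambda>x. f i x - h x)) \<longlongrightarrow> 0) F" using tendsto_cong by force
  then show ?thesis using assms(1) Lp_AE_cong[OF L assms(2,3)] by (auto simp: Lp_tendsto_def)
qed

section \<open>Density of function algebras and uniqueness of measures\<close>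

text \<open>Two measures are treated at once, so that approximation in both of them also gives the
  uniqueness of a measure with prescribed integrals over the algebra \<open>T\<close>.\<close>

locale function_algebra =
  fixes M N :: "'x measure" and p :: real and T :: "('x \<Rightarrow> complex) set"
    and X :: "('x \<Rightarrow> real) set"
  assumes fin: "finite_measure M" "finite_measure N"
    and sets_N: "sets N = sets M"
    and p: "0 < p"
    and T_meas: "\<And>g. g \<in> T \<Longrightarrow> g \<in> borel_measurable M"
    and T_bounded: "\<And>g. g \<in> T \<Longrightarrow> \<exists>K. \<forall>x\<in>space M. cmod (g x) \<le> K"
    and T_const: "\<And>a. (\<lambda>x. a) \<in> T"
    and T_add: "\<And>f g. f \<in> T \<Longrightarrow> g \<in> T \<Longrightarrow> (\<lambda>x. f x + g x) \<in> T"
    and T_mult: "\<And>f g. f \<in> T \<Longrightarrow> g \<in> T \<Longrightarrow> (\<lambda>x. f x * g x) \<in> T"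
    and T_sin: "\<And>f s. f \<in> X \<Longrightarrow> (\<lambda>x. complex_of_real (sin (s * f x))) \<in> T"
    and X_meas: "\<And>f. f \<in> X \<Longrightarrow> f \<in> borel_measurable M"
    and sets_M: "sets M = sigma_sets (space M) {f -` B \<inter> space M | f B. f \<in> X \<and> B \<in> sets borel}"
begin

lemma space_N: "space N = space M"
  using sets_N by (rule sets_eq_imp_space_eq)

lemma meas_N: "borel_measurable N = (borel_measurable M :: ('x \<Rightarrow> complex) set)"
  by (rule measurable_cong_sets) (auto simp: sets_N)

definition bm :: "('x \<Rightarrow> complex) \<Rightarrow> bool" where
  "bm h \<longleftrightarrow> h \<in> borel_measurable M \<and> (\<exists>K. \<forall>x\<in>space M. cmod (h x) \<le> K)"

text \<open>The p-th powers of both norms are added and no root is taken: a distance that works for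
  every p > 0 and for both measures at once, with the factor 2^p of \<open>Ip_add\<close> in the
  place of the triangle inequality.\<close>

definition Ip :: "('x \<Rightarrow> complex) \<Rightarrow> real" where
  "Ip h = (\<integral>x. cmod (h x) powr p \<partial>M) + (\<integral>x. cmod (h x) powr p \<partial>N)"

definition approximable :: "('x \<Rightarrow> complex) \<Rightarrow> bool" where
  "approximable h \<longleftrightarrow> bm h \<and> (\<forall>\<epsilon>>0. \<exists>g\<in>T. Ip (\<lambda>x. h x - g x) < \<epsilon>)"

lemma bm_const: "bm (\<lambda>x. a)"
  by (auto simp: bm_def)

lemma bm_add: "bm f \<Longrightarrow> bm g \<Longrightarrow> bm (\<lambda>x. f x + g x)"
  unfolding bm_def by (auto intro!: borel_measurable_add) (meson add_mono norm_triangle_le)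

lemma bm_mult: "bm f \<Longrightarrow> bm g \<Longrightarrow> bm (\<lambda>x. f x * g x)"
  unfolding bm_def by (auto intro!: borel_measurable_times simp: norm_mult)
    (meson mult_mono' norm_ge_zero)

lemma bm_diff: "bm f \<Longrightarrow> bm g \<Longrightarrow> bm (\<lambda>x. f x - g x)"
  using bm_add[of f "\<lambda>x. (-1) * g x"] bm_mult[OF bm_const, of g "-1"] by simp

lemma T_bm: "g \<in> T \<Longrightarrow> bm g"
  using T_meas T_bounded by (auto simp: bm_def)

lemma bm_integrable:
  assumes "bm h"
  shows "integrable M (\<lambda>x. cmod (h x) powr p)" "integrable N (\<lambda>x. cmod (h x) powr p)"
proof -
  from assms obtain K where [measurable]: "h \<in> borel_measurable M"
    and K: "\<And>x. x \<in> space M \<Longrightarrow> cmod (h x) \<le> K" by (auto simp: bm_def)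
  then have [measurable]: "h \<in> borel_measurable N" by (simp add: meas_N)
  have le: "cmod (h x) powr p \<le> K powr p" if "x \<in> space M" for x
    using K[OF that] p by (intro powr_mono2) auto
  show "integrable M (\<lambda>x. cmod (h x) powr p)"
    by (rule finite_measure.integrable_const_bound[OF fin(1), of _ "K powr p"]) (auto simp: le)
  show "integrable N (\<lambda>x. cmod (h x) powr p)"
    by (rule finite_measure.integrable_const_bound[OF fin(2), of _ "K powr p"]) (auto simp: le space_N)
qed

lemma Ip_mono:
  assumes "bm f" "bm g" "0 \<le> c" "\<And>x. x \<in> space M \<Longrightarrow> cmod (f x) powr p \<le> c * cmod (g x) powr p"
  shows "Ip f \<le> c * Ip g"
proof -
  have "(\<integral>x. cmod (f x) powr p \<partial>M) \<le> (\<integral>x. c * cmod (g x) powr p \<partial>M)"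
    using assms by (intro integral_mono) (auto intro: bm_integrable)
  moreover have "(\<integral>x. cmod (f x) powr p \<partial>N) \<le> (\<integral>x. c * cmod (g x) powr p \<partial>N)"
    using assms by (intro integral_mono) (auto intro: bm_integrable simp: space_N)
  ultimately show ?thesis by (simp add: Ip_def algebra_simps)
qed

lemma Ip_add:
  assumes "bm f" "bm g"
  shows "Ip (\<lambda>x. f x + g x) \<le> 2 powr p * (Ip f + Ip g)"
proof -
  have le: "cmod (f x + g x) powr p \<le> 2 powr p * (cmod (f x) powr p + cmod (g x) powr p)" for x
  proof -
    have "cmod (f x + g x) \<le> 2 * max (cmod (f x)) (cmod (g x))"
      using norm_triangle_ineq[of "f x" "g x"] by linarith
    then have "cmod (f x + g x) powr p \<le> (2 * max (cmod (f x)) (cmod (g x))) powr p"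
      using p by (intro powr_mono2) auto
    also have "\<dots> = 2 powr p * max (cmod (f x)) (cmod (g x)) powr p" by (simp add: powr_mult)
    also have "\<dots> \<le> 2 powr p * (cmod (f x) powr p + cmod (g x) powr p)"
      by (intro mult_left_mono) (auto simp: max_def)
    finally show ?thesis .
  qed
  have "(\<integral>x. cmod (f x + g x) powr p \<partial>M) \<le> (\<integral>x. 2 powr p * (cmod (f x) powr p + cmod (g x) powr p) \<partial>M)"
    using assms by (intro integral_mono le) (auto intro: bm_integrable bm_add)
  moreover have "(\<integral>x. cmod (f x + g x) powr p \<partial>N) \<le> (\<integral>x. 2 powr p * (cmod (f x) powr p + cmod (g x) powr p) \<partial>N)"
    using assms by (intro integral_mono le) (auto intro: bm_integrable bm_add)
  ultimately show ?thesis
    using bm_integrable[OF assms(1)] bm_integrable[OF assms(2)] by (simp add: Ip_def algebra_simps)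
qed

section \<open>The approximable functions form a closed algebra\<close>

lemma approximable_bm: "approximable h \<Longrightarrow> bm h"
  by (simp add: approximable_def)

lemma approximable_close:
  assumes "bm f" "\<And>\<epsilon>. 0 < \<epsilon> \<Longrightarrow> \<exists>h. approximable h \<and> Ip (\<lambda>x. f x - h x) < \<epsilon>"
  shows "approximable f"
  unfolding approximable_def
proof (intro conjI allI impI assms(1))
  fix e :: real assume "0 < e"
  \<comment> \<open>Two errors below \<open>d\<close> cost less than 2^p (d + d) = e by
    \<open>Ip_add\<close>.\<close>
  define d where "d = e / (2 * 2 powr p)"
  have d: "0 < d" using \<open>0 < e\<close> by (simp add: d_def)
  obtain h where h: "approximable h" "Ip (\<lambda>x. f x - h x) < d" using assms(2)[OF d] by auto
  obtain g where g: "g \<in> T" "Ip (\<lambda>x. h x - g x) < d" using h d by (auto simp: approximable_def)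
  have "Ip (\<lambda>x. (f x - h x) + (h x - g x)) \<le> 2 powr p * (Ip (\<lambda>x. f x - h x) + Ip (\<lambda>x. h x - g x))"
    using assms(1) h g by (intro Ip_add bm_diff) (auto intro: approximable_bm T_bm)
  also have "\<dots> < 2 powr p * (d + d)"
    using h g by (intro mult_strict_left_mono add_strict_mono) auto
  also have "\<dots> = e" by (simp add: d_def)
  finally show "\<exists>g\<in>T. Ip (\<lambda>x. f x - g x) < e" using g by auto
qed

lemma T_approximable: "g \<in> T \<Longrightarrow> approximable g"
  using p unfolding approximable_def by (auto simp: T_bm Ip_def intro!: bexI[of _ g])

lemma approximable_add:
  assumes f: "approximable f" and g: "approximable g"
  shows "approximable (\<lambda>x. f x + g x)"
  unfolding approximable_def
proof (intro conjI allI impI bm_add approximable_bm assms)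
  fix e :: real assume "0 < e"
  define d where "d = e / (2 * 2 powr p)"
  have d: "0 < d" using \<open>0 < e\<close> by (simp add: d_def)
  obtain f' where f': "f' \<in> T" "Ip (\<lambda>x. f x - f' x) < d" using f d by (auto simp: approximable_def)
  obtain g' where g': "g' \<in> T" "Ip (\<lambda>x. g x - g' x) < d" using g d by (auto simp: approximable_def)
  have "Ip (\<lambda>x. (f x - f' x) + (g x - g' x)) \<le> 2 powr p * (Ip (\<lambda>x. f x - f' x) + Ip (\<lambda>x. g x - g' x))"
    using f g f' g' by (intro Ip_add bm_diff) (auto intro: approximable_bm T_bm)
  also have "\<dots> < 2 powr p * (d + d)"
    using f' g' by (intro mult_strict_left_mono add_strict_mono) auto
  also have "\<dots> = e" by (simp add: d_def)
  finally have "Ip (\<lambda>x. f x + g x - (f' x + g' x)) < e" by (simp add: algebra_simps)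
  then show "\<exists>h\<in>T. Ip (\<lambda>x. f x + g x - h x) < e"
    using T_add[OF f'(1) g'(1)] by (intro bexI[of _ "\<lambda>x. f' x + g' x"])
qed

text \<open>Multiplication by a bounded function is continuous for \<open>Ip\<close>, so testing it
  on the algebra is enough. \<open>approximable_mult\<close> uses this twice: with a factor from
  \<open>T\<close>, and with a factor that is merely approximable.\<close>

lemma approximable_mult_T:
  assumes f: "approximable f" and k: "bm k" and
    kT: "\<And>g. g \<in> T \<Longrightarrow> approximable (\<lambda>x. k x * g x)"
  shows "approximable (\<lambda>x. k x * f x)"
proof (rule approximable_close)
  show "bm (\<lambda>x. k x * f x)" using bm_mult[OF k approximable_bm[OF f]] .
  fix e :: real assume e: "0 < e"
  obtain K where K: "\<And>x. x \<in> space M \<Longrightarrow> cmod (k x) \<le> K" using k by (auto simp: bm_def)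
  define c where "c = \<bar>K\<bar> powr p + 1"
  have c: "0 < c" by (simp add: c_def add_nonneg_pos)
  obtain g where g: "g \<in> T" "Ip (\<lambda>x. f x - g x) < e / c"
    using f divide_pos_pos[OF e c] unfolding approximable_def by blast
  have "Ip (\<lambda>x. k x * f x - k x * g x) \<le> c * Ip (\<lambda>x. f x - g x)"
  proof (rule Ip_mono)
    show "bm (\<lambda>x. k x * f x - k x * g x)" "bm (\<lambda>x. f x - g x)"
      using k approximable_bm[OF f] T_bm[OF g(1)] by (auto intro: bm_diff bm_mult)
    show "0 \<le> c" using c by simp
    fix x assume "x \<in> space M"
    then have "cmod (k x) powr p \<le> \<bar>K\<bar> powr p" using K[of x] p by (intro powr_mono2) auto
    then have "cmod (k x) powr p \<le> c" by (simp add: c_def)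
    then show "cmod (k x * f x - k x * g x) powr p \<le> c * cmod (f x - g x) powr p"
      by (simp add: right_diff_distrib[symmetric] norm_mult powr_mult mult_right_mono)
  qed
  also have "\<dots> < e" using g(2) c by (simp add: field_simps)
  finally show "\<exists>h. approximable h \<and> Ip (\<lambda>x. k x * f x - h x) < e" using kT[OF g(1)] by blast
qed

lemma approximable_mult:
  assumes "approximable f" "approximable g"
  shows "approximable (\<lambda>x. f x * g x)"
proof (rule approximable_mult_T[OF assms(2) approximable_bm[OF assms(1)]])
  fix h assume h: "h \<in> T"
  have "approximable (\<lambda>x. h x * f x)"
    by (rule approximable_mult_T[OF assms(1) T_bm[OF h]]) (auto intro: T_approximable T_mult h)
  then show "approximable (\<lambda>x. f x * h x)" by (simp add: mult.commute)
qed

lemma approximable_const: "approximable (\<lambda>x. a)"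
  by (intro T_approximable T_const)

lemma approximable_cmult: "approximable f \<Longrightarrow> approximable (\<lambda>x. a * f x)"
  by (intro approximable_mult approximable_const)

lemma approximable_diff: "approximable f \<Longrightarrow> approximable g \<Longrightarrow> approximable (\<lambda>x. f x - g x)"
  using approximable_add[of f "\<lambda>x. (-1) * g x"] approximable_cmult[of g "-1"] by simp

lemma approximable_sum:
  "finite S \<Longrightarrow> (\<And>i. i \<in> S \<Longrightarrow> approximable (f i)) \<Longrightarrow> approximable (\<lambda>x. \<Sum>i\<in>S. f i x)"
  by (induction S rule: finite_induct) (auto intro: approximable_const approximable_add)

lemma Ip_tendsto_0:
  assumes "\<And>n. f n \<in> borel_measurable M" "\<And>x. x \<in> space M \<Longrightarrow> (\<lambda>n. f n x) \<longlonglongrightarrow> 0"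
    and "integrable M w" "integrable N w" "\<And>n x. x \<in> space M \<Longrightarrow> cmod (f n x) powr p \<le> w x"
  shows "(\<lambda>n. Ip (f n)) \<longlonglongrightarrow> 0"
proof -
  have [measurable]: "\<And>n. f n \<in> borel_measurable M" "\<And>n. f n \<in> borel_measurable N"
    using assms(1) by (auto simp: meas_N)
  have lim: "(\<lambda>n. cmod (f n x) powr p) \<longlonglongrightarrow> 0" if "x \<in> space M" for x
    using tendsto_powr'[OF tendsto_norm_zero[OF assms(2)[OF that]] tendsto_const[of p]] p by simp
  have 1: "(\<lambda>n. \<integral>x. cmod (f n x) powr p \<partial>M) \<longlonglongrightarrow> (\<integral>x. 0 \<partial>M)"
    by (rule integral_dominated_convergence[where w=w]) (use assms lim in \<open>auto intro!: AE_I2\<close>)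
  have 2: "(\<lambda>n. \<integral>x. cmod (f n x) powr p \<partial>N) \<longlonglongrightarrow> (\<integral>x. 0 \<partial>N)"
    by (rule integral_dominated_convergence[where w=w])
      (use assms lim in \<open>auto intro!: AE_I2 simp: space_N\<close>)
  show ?thesis using tendsto_add[OF 1 2] by (simp add: Ip_def)
qed

text \<open>Dominated convergence, for both measures. Closure under bounded pointwise limits carries
  approximability from continuous functions to indicators and through countable unions.\<close>

lemma approximable_limit:
  assumes f: "\<And>n. approximable (f n)" and K: "\<And>n x. x \<in> space M \<Longrightarrow> cmod (f n x) \<le> K"
    and lim: "\<And>x. x \<in> space M \<Longrightarrow> (\<lambda>n. f n x) \<longlonglongrightarrow> g x"
  shows "approximable g"
proof (rule approximable_close)
  have fm[measurable]: "\<And>n. f n \<in> borel_measurable M" using approximable_bm[OF f] by (simp add: bm_def)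
  have gm[measurable]: "g \<in> borel_measurable M"
    by (rule borel_measurable_LIMSEQ_metric[OF fm lim])
  have gK: "cmod (g x) \<le> K" if "x \<in> space M" for x
    using LIMSEQ_le_const2[OF tendsto_norm[OF lim[OF that]]] K[OF that] by blast
  show "bm g" using gK by (auto simp: bm_def)
  have "(\<lambda>n. Ip (\<lambda>x. g x - f n x)) \<longlonglongrightarrow> 0"
  proof (rule Ip_tendsto_0[where w="\<lambda>_. (2 * K) powr p"])
    show "integrable M (\<lambda>_. (2 * K) powr p)" "integrable N (\<lambda>_. (2 * K) powr p)"
      using fin by (auto simp: finite_measure.integrable_const)
    show "(\<lambda>n. g x - f n x) \<longlonglongrightarrow> 0" if "x \<in> space M" for x
      using tendsto_diff[OF tendsto_const[of "g x"] lim[OF that]] by simp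
    show "cmod (g x - f n x) powr p \<le> (2 * K) powr p" if "x \<in> space M" for n x
      using p norm_triangle_ineq4[of "g x" "f n x"] gK[OF that] K[OF that, of n]
      by (intro powr_mono2) auto
  qed measurable
  then have "\<exists>n. Ip (\<lambda>x. g x - f n x) < e" if "0 < e" for e
    using order_tendstoD(2)[OF _ that] eventually_happens'[OF sequentially_bot] by blast
  then show "\<exists>h. approximable h \<and> Ip (\<lambda>x. g x - h x) < e" if "0 < e" for e
    using f that by meson
qed

lemma approximable_cong:
  assumes "approximable f" "\<And>x. x \<in> space M \<Longrightarrow> f x = g x"
  shows "approximable g"
proof -
  obtain K where "\<And>x. x \<in> space M \<Longrightarrow> cmod (f x) \<le> K"
    using approximable_bm[OF assms(1)] by (auto simp: bm_def)
  then show ?thesis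
    using assms by (intro approximable_limit[of "\<lambda>_. f" K g]) auto
qed

section \<open>From trigonometric functions to indicators\<close>

lemma T_polynomial:
  assumes "real_polynomial_function P" "(\<lambda>x. complex_of_real (u x)) \<in> T"
  shows "(\<lambda>x. complex_of_real (P (u x))) \<in> T"
  using assms
proof induction
  case (linear f)
  then have "f y = y * f 1" for y
    using linear_scale[of f y 1] bounded_linear.linear by fastforce
  then have "(\<lambda>x. complex_of_real (f (u x))) = (\<lambda>x. complex_of_real (u x) * complex_of_real (f 1))"
    by (metis of_real_mult)
  then show ?case using T_mult[OF linear.prems T_const] by simp
qed (auto intro: T_const T_add T_mult)

text \<open>The function sin (s f) / s lies in the algebra and has its values in the compact
  interval [-1/s, 1/s], where the Weierstrass theorem replaces \<open>h\<close> by a polynomial;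
  \<open>f\<close> itself may be unbounded.\<close>

lemma approximable_continuous_sin:
  assumes f: "f \<in> X" and h: "continuous_on UNIV h" "\<And>y. \<bar>h y\<bar> \<le> K" and s: "0 < s"
  shows "approximable (\<lambda>x. complex_of_real (h (sin (s * f x) / s)))"
proof (rule approximable_close)
  have [measurable]: "f \<in> borel_measurable M" "h \<in> borel_measurable borel"
    using X_meas[OF f] borel_measurable_continuous_onI[OF h(1)] by auto
  define u where "u x = sin (s * f x) / s" for x
  have [measurable]: "u \<in> borel_measurable M" unfolding u_def by measurable
  have uT: "(\<lambda>x. complex_of_real (u x)) \<in> T"
    using T_mult[OF T_sin[OF f, of s] T_const[of "complex_of_real (1 / s)"]] by (simp add: u_def)
  have ub: "u x \<in> {-1/s..1/s}" for x
    using divide_right_mono[OF sin_le_one[of "s * f x"], of s] s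
      divide_right_mono[OF sin_ge_minus_one[of "s * f x"], of s]
    by (auto simp: u_def)
  have bmh: "bm (\<lambda>x. complex_of_real (h (u x)))" using h(2) by (auto simp: bm_def)
  then show "bm (\<lambda>x. complex_of_real (h (sin (s * f x) / s)))" by (simp add: u_def)
  fix e :: real assume e: "0 < e"
  define m where "m = measure M (space M) + measure N (space N) + 1"
  have m: "0 < m" by (simp add: m_def add_nonneg_pos)
  \<comment> \<open>A uniform error \<open>d\<close> costs d^p (m - 1), as m - 1 is the total mass
    of both measures; the added 1 keeps the quotient defined.\<close>
  define d where "d = (e / (2 * m)) powr (1 / p)"
  have d: "0 < d" "d powr p = e / (2 * m)" using e m p by (auto simp: d_def powr_powr)
  obtain P where P: "real_polynomial_function P" "\<And>y. y \<in> {-1/s..1/s} \<Longrightarrow> \<bar>h y - P y\<bar> < d"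
    using Stone_Weierstrass_real_polynomial_function[of "{-1/s..1/s}" h d] d
      continuous_on_subset[OF h(1)] by auto
  have PT: "(\<lambda>x. complex_of_real (P (u x))) \<in> T" by (rule T_polynomial[OF P(1) uT])
  have "Ip (\<lambda>x. complex_of_real (h (u x)) - complex_of_real (P (u x))) \<le> d powr p * Ip (\<lambda>x. 1)"
  proof (rule Ip_mono)
    show "bm (\<lambda>x. complex_of_real (h (u x)) - complex_of_real (P (u x)))"
      by (intro bm_diff bmh T_bm PT)
    show "bm (\<lambda>x. 1)" by (rule bm_const)
    fix x
    have "\<bar>h (u x) - P (u x)\<bar> powr p \<le> d powr p"
      using P(2)[OF ub[of x]] p by (intro powr_mono2) auto
    then show "cmod (complex_of_real (h (u x)) - complex_of_real (P (u x))) powr p \<le> d powr p * cmod 1 powr p"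
      by (simp add: of_real_diff[symmetric] del: of_real_diff)
  qed simp
  also have "\<dots> = d powr p * (m - 1)"
    by (simp add: Ip_def m_def)
  also have "\<dots> < e"
  proof -
    have "d powr p * (m - 1) = e / 2 - e / (2 * m)" using m d(2) by (simp add: field_simps)
    moreover have "0 < e / (2 * m)" using e m by simp
    ultimately show ?thesis using e by linarith
  qed
  finally show "\<exists>g. approximable g \<and> Ip (\<lambda>x. complex_of_real (h (sin (s * f x) / s)) - g x) < e"
    using T_approximable[OF PT] unfolding u_def by blast
qed

text \<open>As s tends to 0, sin (s y) / s tends to y, so the cut-off functions of
  \<open>approximable_continuous_sin\<close> converge pointwise to \<open>h (f x)\<close>, all with
  the bound \<open>K\<close>.\<close>

lemma approximable_continuous:
  assumes f: "f \<in> X" and h: "continuous_on UNIV h" "\<And>y. \<bar>h y\<bar> \<le> K"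
  shows "approximable (\<lambda>x. complex_of_real (h (f x)))"
proof (rule approximable_limit)
  show "approximable (\<lambda>x. complex_of_real (h (sin (1 / real (Suc n) * f x) / (1 / real (Suc n)))))" for n
    by (rule approximable_continuous_sin[OF f h]) simp
  show "cmod (complex_of_real (h (sin (1 / real (Suc n) * f x) / (1 / real (Suc n))))) \<le> K" for n x
    using h(2) by simp
  fix x
  have "((\<lambda>t. sin (t * f x) / t) \<longlongrightarrow> f x) (at 0)"
  proof -
    have "((\<lambda>t. sin (t * f x)) has_real_derivative cos (0 * f x) * f x) (at 0)"
      by (auto intro!: derivative_eq_intros)
    then show ?thesis by (simp add: has_field_derivative_iff)
  qed
  moreover have "filterlim (\<lambda>n. 1 / real (Suc n)) (at 0) sequentially"
    by (intro filterlim_atI LIMSEQ_Suc[OF lim_1_over_n]) auto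
  ultimately have "(\<lambda>n. sin (1 / real (Suc n) * f x) / (1 / real (Suc n))) \<longlonglongrightarrow> f x"
    by (rule filterlim_compose)
  then show "(\<lambda>n. complex_of_real (h (sin (1 / real (Suc n) * f x) / (1 / real (Suc n)))))
      \<longlonglongrightarrow> complex_of_real (h (f x))"
    using h(1) by (intro tendsto_of_real isCont_tendsto_compose[of _ h])
      (auto simp: continuous_on_eq_continuous_at)
qed

lemma approximable_halfline:
  assumes f: "f \<in> X"
  shows "approximable (indicator (f -` {..a} \<inter> space M))"
proof (rule approximable_limit)
  \<comment> \<open>For n > 0 a ramp that equals 1 up to \<open>a\<close> and has come down to 0 at
    a + 1/n.\<close>
  let ?h = "\<lambda>n y. max 0 (min 1 (1 - real n * (y - a)))"
  show "approximable (\<lambda>x. complex_of_real (?h n (f x)))" for n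
    by (rule approximable_continuous[OF f, of _ 1]) (auto intro!: continuous_intros)
  show "cmod (complex_of_real (?h n (f x))) \<le> 1" for n x unfolding norm_of_real by auto
  fix x assume x: "x \<in> space M"
  have "(\<lambda>n. ?h n (f x)) \<longlonglongrightarrow> indicator (f -` {..a} \<inter> space M) x"
  proof (cases "f x \<le> a")
    case True
    then have "?h n (f x) = 1" for n by (simp add: mult_nonneg_nonpos)
    then show ?thesis using True x by simp
  next
    case False
    then obtain k where k: "1 / (f x - a) < real k" using reals_Archimedean2 by blast
    have "\<forall>\<^sub>F n in sequentially. ?h n (f x) = 0"
      using eventually_ge_at_top[of k]
    proof eventually_elim
      case (elim n)
      then have "1 / (f x - a) < real n" using k by linarith
      then have "1 \<le> real n * (f x - a)" using False by (simp add: field_simps)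
      then show ?case by simp
    qed
    then show ?thesis using False by (simp add: tendsto_eventually)
  qed
  then have "(\<lambda>n. complex_of_real (?h n (f x))) \<longlonglongrightarrow> complex_of_real (indicator (f -` {..a} \<inter> space M) x)"
    by (rule tendsto_of_real)
  then show "(\<lambda>n. complex_of_real (?h n (f x))) \<longlonglongrightarrow> indicator (f -` {..a} \<inter> space M) x"
    by (simp add: of_real_indicator)
qed

lemma approximable_compl:
  assumes "approximable (indicator A)"
  shows "approximable (indicator (space M - A))"
  by (rule approximable_cong[OF approximable_diff[OF approximable_const[of 1] assms]])
    (auto simp: indicator_def)

lemma approximable_Un:
  assumes "approximable (indicator A)" "approximable (indicator B)"
  shows "approximable (indicator (A \<union> B))"
  by (rule approximable_cong[OF approximable_diff[OF approximable_add[OF assms] approximable_mult[OF assms]]])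
    (auto simp: indicator_def)

lemma approximable_UN:
  assumes "\<And>i::nat. approximable (indicator (A i))"
  shows "approximable (indicator (\<Union>i. A i))"
proof (rule approximable_limit)
  show "approximable (indicator (\<Union>i<n. A i))" for n
  proof (induction n)
    case 0
    then show ?case using approximable_const[of 0] by (simp add: indicator_def)
  next
    case (Suc n)
    then show ?case using approximable_Un[OF assms[of n] Suc] by (simp add: lessThan_Suc)
  qed
  show "cmod (indicator (\<Union>i<n. A i) x) \<le> 1" for n x by (simp add: indicator_def)
  show "(\<lambda>n. indicator (\<Union>i<n. A i) x :: complex) \<longlonglongrightarrow> indicator (\<Union>i. A i) x" for x
    by (rule LIMSEQ_indicator_UN)
qed

lemma approximable_vimage:
  assumes f: "f \<in> X" and B: "B \<in> sets borel"
  shows "approximable (indicator (f -` B \<inter> space M))"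
proof -
  have "B \<in> sigma_sets UNIV (range (\<lambda>a::real. {..a}))"
    using B by (simp add: borel_eq_atMost)
  then show ?thesis
  proof induction
    case (Basic a)
    then show ?case using approximable_halfline[OF f] by auto
  next
    case Empty
    then show ?case using approximable_const[of 0] by (simp add: indicator_def)
  next
    case (Compl a)
    have "f -` (UNIV - a) \<inter> space M = space M - (f -` a \<inter> space M)" by auto
    then show ?case using approximable_compl[OF Compl.IH] by simp
  next
    case (Union a)
    have "f -` (\<Union>i. a i) \<inter> space M = (\<Union>i. f -` a i \<inter> space M)" by auto
    then show ?case using approximable_UN[OF Union.IH] by simp
  qed
qed

lemma approximable_indicator:
  assumes "A \<in> sets M"
  shows "approximable (indicator A)"
proof -
  have "A \<in> sigma_sets (space M) {f -` B \<inter> space M | f B. f \<in> X \<and> B \<in> sets borel}"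
    using assms unfolding sets_M .
  then show ?thesis
  proof induction
    case (Basic a)
    then show ?case using approximable_vimage by auto
  next
    case Empty
    then show ?case using approximable_const[of 0] by (simp add: indicator_def)
  next
    case (Compl a)
    then show ?case using approximable_compl by simp
  next
    case (Union a)
    then show ?case using approximable_UN by simp
  qed
qed

lemma Lp_approximation:
  assumes f: "Lp M p f" and NM: "N = M" and p1: "1 \<le> p" and e: "0 < e"
  shows "\<exists>g\<in>T. Lp_norm M p (\<lambda>x. f x - g x) < e"
proof -
  have [measurable]: "f \<in> borel_measurable M" using f by (simp add: Lp_def)
  \<comment> \<open>The reference point 0 makes the simple functions at most 2 |f|, so that the
    errors are dominated by 3 |f|.\<close>
  have "\<exists>F. (\<forall>i. simple_function M (F i)) \<and> (\<forall>x\<in>space M. (\<lambda>i. F i x) \<longlonglongrightarrow> f x) \<and>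
      (\<forall>i. \<forall>x\<in>space M. cmod (F i x) \<le> 2 * cmod (f x))"
    using borel_measurable_implies_sequence_metric[of f M 0] by simp
  then obtain F where F': "(\<forall>i. simple_function M (F i)) \<and> (\<forall>x\<in>space M. (\<lambda>i. F i x) \<longlonglongrightarrow> f x) \<and>
      (\<forall>i. \<forall>x\<in>space M. cmod (F i x) \<le> 2 * cmod (f x))" ..
  have F: "simple_function M (F i)" "x \<in> space M \<Longrightarrow> (\<lambda>i. F i x) \<longlonglongrightarrow> f x"
    "x \<in> space M \<Longrightarrow> cmod (F i x) \<le> 2 * cmod (f x)" for i x
    using F' by auto
  have [measurable]: "F i \<in> borel_measurable M" for i using F(1) by (rule borel_measurable_simple_function)
  have FA: "approximable (F i)" for i
  proof (rule approximable_cong)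
    show "approximable (\<lambda>x. \<Sum>y\<in>F i ` space M. y * indicator (F i -` {y} \<inter> space M) x)"
      using simple_functionD[OF F(1)[of i]]
      by (intro approximable_sum approximable_cmult approximable_indicator) auto
    fix x assume "x \<in> space M"
    then show "(\<Sum>y\<in>F i ` space M. y * indicator (F i -` {y} \<inter> space M) x) = F i x"
      using simple_functionD(1)[OF F(1)[of i]]
      by (subst sum.remove[of _ "F i x"]) (auto intro!: sum.neutral simp: indicator_def)
  qed
  define d where "d = (e / 2) powr p"
  have d: "0 < d" using e by (simp add: d_def)
  have "(\<lambda>n. Ip (\<lambda>x. f x - F n x)) \<longlonglongrightarrow> 0"
  proof (rule Ip_tendsto_0[where w="\<lambda>x. 3 powr p * cmod (f x) powr p"])
    show "integrable M (\<lambda>x. 3 powr p * cmod (f x) powr p)"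
      "integrable N (\<lambda>x. 3 powr p * cmod (f x) powr p)"
      using f NM by (auto simp: Lp_def)
    show "(\<lambda>n. f x - F n x) \<longlonglongrightarrow> 0" if "x \<in> space M" for x
      using tendsto_diff[OF tendsto_const[of "f x"] F(2)[OF that]] by simp
    show "cmod (f x - F n x) powr p \<le> 3 powr p * cmod (f x) powr p" if "x \<in> space M" for n x
    proof -
      have "cmod (f x - F n x) \<le> 3 * cmod (f x)"
        using norm_triangle_ineq4[of "f x" "F n x"] F(3)[OF that, of n] by linarith
      then have "cmod (f x - F n x) powr p \<le> (3 * cmod (f x)) powr p" using p by (intro powr_mono2) auto
      then show ?thesis by (simp add: powr_mult)
    qed
  qed measurable
  then obtain n where n: "Ip (\<lambda>x. f x - F n x) < d"
    using order_tendstoD(2)[OF _ d] eventually_happens'[OF sequentially_bot] by blast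
  obtain g where g: "g \<in> T" "Ip (\<lambda>x. F n x - g x) < d" using FA[of n] d by (auto simp: approximable_def)
  have small: "Lp_norm M p h < e / 2" if "Ip h < d" for h
  proof -
    have "Lp_norm M p h powr p < d"
    proof -
      have "(\<integral>x. cmod (h x) powr p \<partial>M) \<le> Ip h" unfolding Ip_def by simp
      then show ?thesis using that Lp_norm_powr[OF p, of M h] by linarith
    qed
    then show ?thesis using p e unfolding d_def
      using powr_mono2[of p "e / 2" "Lp_norm M p h"] by linarith
  qed
  have Lb: "Lp M p h" if "bm h" for h using bm_integrable[OF that] that by (auto simp: Lp_def bm_def)
  have "Lp_norm M p (\<lambda>x. f x - g x) \<le> Lp_norm M p (\<lambda>x. f x - F n x) + Lp_norm M p (\<lambda>x. F n x - g x)"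
    by (intro Lp_norm_triangle3 f p1 Lb approximable_bm FA T_bm g)
  also have "\<dots> < e" using small[OF n] small[OF g(2)] by simp
  finally show ?thesis using g by blast
qed

text \<open>One and the same element of \<open>T\<close> approximates the indicator of a set in the
  L^1 sense of both measures, and its two integrals agree; hence the two measures of the set differ
  by less than any positive number.\<close>

lemma measure_unique:
  assumes p1: "p = 1" and eq: "\<And>g. g \<in> T \<Longrightarrow> (\<integral>x. g x \<partial>M) = (\<integral>x. g x \<partial>N)"
  shows "M = N"
proof (rule measure_eqI)
  interpret M: finite_measure M by (rule fin)
  interpret N: finite_measure N by (rule fin)
  show "sets M = sets N" by (simp add: sets_N)
  fix A assume A: "A \<in> sets M"
  then have AN: "A \<in> sets N" by (simp add: sets_N)
  have "\<bar>measure M A - measure N A\<bar> \<le> e" if e: "0 < e" for e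
  proof -
    obtain g where g: "g \<in> T" "Ip (\<lambda>x. indicator A x - g x) < e"
      using approximable_indicator[OF A] e by (auto simp: approximable_def)
    have bmg: "bm (\<lambda>x. indicator A x - g x)" "bm g" "bm (indicator A)"
      using g(1) approximable_indicator[OF A] by (auto intro: bm_diff approximable_bm T_bm)
    have int: "integrable M f" "integrable N f" if "bm f" for f
      using bm_integrable[OF that] that p1
      by (auto simp: bm_def integrable_norm_iff meas_N)
    have ind: "(\<integral>x. indicator A x \<partial>R) = complex_of_real (measure R A)" if "A \<in> sets R" for R
      using integral_complex_of_real[of R "indicator A"] that sets.sets_into_space[OF that]
      by (simp add: of_real_indicator Int_absorb2)
    have "complex_of_real (measure M A - measure N A) = (\<integral>x. indicator A x \<partial>M) - (\<integral>x. indicator A x \<partial>N)"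
      by (simp add: ind[OF A] ind[OF AN])
    also have "\<dots> = (\<integral>x. indicator A x - g x \<partial>M) - (\<integral>x. indicator A x - g x \<partial>N)"
      using eq[OF g(1)] int[OF bmg(2)] int[OF bmg(3)] by simp
    also have "cmod \<dots> \<le> cmod (\<integral>x. indicator A x - g x \<partial>M) + cmod (\<integral>x. indicator A x - g x \<partial>N)"
      by (rule norm_triangle_ineq4)
    also have "\<dots> \<le> (\<integral>x. cmod (indicator A x - g x) \<partial>M) + (\<integral>x. cmod (indicator A x - g x) \<partial>N)"
      by (intro add_mono integral_norm_bound)
    also have "\<dots> = Ip (\<lambda>x. indicator A x - g x)" unfolding Ip_def by (simp add: p1)
    also have "\<dots> < e" by (rule g(2))
    finally show ?thesis by (simp del: of_real_diff)
  qed
  then have "measure M A = measure N A"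
    by (rule_tac ccontr, drule_tac x="\<bar>measure M A - measure N A\<bar> / 2" in meta_spec, simp)
  then show "emeasure M A = emeasure N A" by (simp add: M.emeasure_eq_measure N.emeasure_eq_measure)
qed

end

section \<open>The Gel'fand triple\<close>

definition bounded_seq :: "(nat \<Rightarrow> real) \<Rightarrow> bool" where
  "bounded_seq b \<longleftrightarrow> (\<exists>K. \<forall>n. \<bar>b n\<bar> \<le> K)"

lemma bounded_seqI: "(\<And>n. \<bar>b n\<bar> \<le> K) \<Longrightarrow> bounded_seq b"
  by (auto simp: bounded_seq_def)

lemma bounded_seq_const [simp]: "bounded_seq (\<lambda>n. s)"
  by (auto simp: bounded_seq_def)

lemma bounded_seq_mult [simp]:
  assumes "bounded_seq a" "bounded_seq b"
  shows "bounded_seq (\<lambda>n. a n * b n)"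
proof -
  obtain K L where "\<And>n. \<bar>a n\<bar> \<le> K" "\<And>n. \<bar>b n\<bar> \<le> L" using assms by (auto simp: bounded_seq_def)
  then have "\<bar>a n * b n\<bar> \<le> K * L" for n
    by (metis abs_ge_zero abs_mult mult_mono')
  then show ?thesis by (rule bounded_seqI)
qed

locale gelfand_triple =
  fixes e :: "nat \<Rightarrow> 'a::{real_inner, banach}" and lam :: "nat \<Rightarrow> real"
  assumes gelfand: "gelfand_data e lam"
begin

lemma e_inner: "e m \<bullet> e n = (if m = n then 1 else 0)"
  using gelfand by (auto simp: gelfand_data_def orthonormal_basis_def)

lemma e_dense: "closure (span (range e)) = UNIV"
  using gelfand by (auto simp: gelfand_data_def orthonormal_basis_def)

lemma lam_gt_1: "1 < lam n"
  using gelfand unfolding gelfand_data_def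
  by (metis le0 le_less less_trans strict_mono_less)

section \<open>Fourier series with respect to the basis\<close>

lemma norm_finite_sum:
  assumes "finite S"
  shows "(norm (\<Sum>n\<in>S. a n *\<^sub>R e n))\<^sup>2 = (\<Sum>n\<in>S. (a n)\<^sup>2)"
  using assms unfolding power2_norm_eq_inner
  by (simp add: inner_sum_left inner_sum_right e_inner if_distrib power2_eq_square cong: if_cong)

lemma summable_scaled_basis:
  assumes "summable (\<lambda>n. (a n)\<^sup>2)"
  shows "summable (\<lambda>n. a n *\<^sub>R e n)"
  unfolding summable_Cauchy
proof (intro allI impI)
  fix \<epsilon> :: real assume "0 < \<epsilon>"
  then have "0 < \<epsilon>\<^sup>2" by simp
  then obtain N where N: "\<And>m n. m \<ge> N \<Longrightarrow> norm (\<Sum>k=m..<n. (a k)\<^sup>2) < \<epsilon>\<^sup>2"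
    using assms unfolding summable_Cauchy by blast
  have "norm (\<Sum>k=m..<n. a k *\<^sub>R e k) < \<epsilon>" if "m \<ge> N" for m n
  proof -
    have "(norm (\<Sum>k=m..<n. a k *\<^sub>R e k))\<^sup>2 < \<epsilon>\<^sup>2"
      using N[OF that, of n] by (simp add: norm_finite_sum)
    then show ?thesis using \<open>0 < \<epsilon>\<close> power2_less_imp_less by fastforce
  qed
  then show "\<exists>N. \<forall>m\<ge>N. \<forall>n. norm (\<Sum>k=m..<n. a k *\<^sub>R e k) < \<epsilon>" by blast
qed

lemma inner_suminf_basis:
  assumes "summable (\<lambda>n. (a n)\<^sup>2)"
  shows "e m \<bullet> (\<Sum>n. a n *\<^sub>R e n) = a m"
proof -
  have "(\<lambda>n. e m \<bullet> (a n *\<^sub>R e n)) sums (e m \<bullet> (\<Sum>n. a n *\<^sub>R e n))"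
    by (rule bounded_linear.sums[OF bounded_linear_inner_right])
      (rule summable_sums[OF summable_scaled_basis[OF assms]])
  moreover have "(\<lambda>n. e m \<bullet> (a n *\<^sub>R e n)) sums a m"
  proof -
    have "(\<lambda>n. e m \<bullet> (a n *\<^sub>R e n)) = (\<lambda>n. if n = m then a n else 0)"
      by (auto simp: e_inner)
    then show ?thesis using sums_single[of m a] by simp
  qed
  ultimately show ?thesis by (rule sums_unique2)
qed

text \<open>Bessel's inequality: the squared distance of \<open>f\<close> from its partial Fourier
  sum \<open>g\<close> is nonnegative, and it equals |f|^2 minus the partial sum of the
  squares.\<close>

lemma summable_coeff: "summable (\<lambda>n. (e n \<bullet> f)\<^sup>2)"
proof (rule summableI_nonneg_bounded)
  fix n
  define g where "g = (\<Sum>k<n. (e k \<bullet> f) *\<^sub>R e k)"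
  have "0 \<le> (norm (f - g))\<^sup>2" by simp
  also have "\<dots> = (norm f)\<^sup>2 - 2 * (f \<bullet> g) + (norm g)\<^sup>2"
    by (simp add: power2_norm_eq_inner inner_diff_left inner_diff_right inner_commute)
  also have "f \<bullet> g = (\<Sum>k<n. (e k \<bullet> f)\<^sup>2)"
    by (simp add: g_def inner_sum_right power2_eq_square inner_commute)
  also have "(norm g)\<^sup>2 = (\<Sum>k<n. (e k \<bullet> f)\<^sup>2)"
    by (simp add: g_def norm_finite_sum)
  finally show "(\<Sum>k<n. (e k \<bullet> f)\<^sup>2) \<le> (norm f)\<^sup>2" by simp
qed simp

text \<open>Orthogonality to a dense subspace extends by continuity to the whole space, in
  particular to \<open>f\<close> itself. This is where completeness of the basis enters.\<close>

lemma coeff_zero: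
  assumes "\<And>n. e n \<bullet> f = 0"
  shows "f = 0"
proof -
  have "orthogonal f g" if "g \<in> closure (span (range e))" for g
  proof -
    have "closure (span (range e)) \<subseteq> {g. f \<bullet> g = 0}"
    proof (rule closure_minimal)
      show "span (range e) \<subseteq> {g. f \<bullet> g = 0}"
        by (rule span_minimal) (use assms in \<open>auto simp: subspace_def inner_add_left inner_commute[of f]\<close>)
      show "closed {g. f \<bullet> g = 0}" by (intro closed_Collect_eq continuous_intros)
    qed
    then show ?thesis using that by (auto simp: orthogonal_def)
  qed
  then have "orthogonal f f" by (simp add: e_dense)
  then show ?thesis by (simp add: orthogonal_def)
qed

lemma coeff_eqI: "(\<And>n. e n \<bullet> f = e n \<bullet> g) \<Longrightarrow> f = g"
  using coeff_zero[of "f - g"] by (simp add: inner_diff_right)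

lemma fourier_sums: "(\<lambda>n. (e n \<bullet> f) *\<^sub>R e n) sums f"
proof -
  have "(\<Sum>n. (e n \<bullet> f) *\<^sub>R e n) = f"
    by (rule coeff_eqI) (simp add: inner_suminf_basis summable_coeff)
  then show ?thesis using summable_sums[OF summable_scaled_basis[OF summable_coeff[of f]]] by simp
qed

lemma inner_sums: "(\<lambda>n. (e n \<bullet> f) * (e n \<bullet> g)) sums (f \<bullet> g)"
  using bounded_linear.sums[OF bounded_linear_inner_left fourier_sums[of f], of g] by simp

lemma norm_sums: "(\<lambda>n. (e n \<bullet> f)\<^sup>2) sums (norm f)\<^sup>2"
  using inner_sums[of f f] by (simp add: power2_eq_square power2_norm_eq_inner[symmetric])

section \<open>Diagonal operators and the test space\<close>

abbreviation dg :: "(nat \<Rightarrow> real) \<Rightarrow> 'a \<Rightarrow> 'a" where "dg \<equiv> diag_op e"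

lemma coeff_dg_dom: "f \<in> diag_dom e b \<Longrightarrow> e n \<bullet> dg b f = b n * (e n \<bullet> f)"
  unfolding diag_op_def diag_dom_def by (intro inner_suminf_basis) simp

lemma bounded_diag_dom:
  assumes "bounded_seq b" "f \<in> diag_dom e l"
  shows "summable (\<lambda>n. (l n * (b n * (e n \<bullet> f)))\<^sup>2)"
proof -
  obtain K where K: "\<And>n. \<bar>b n\<bar> \<le> K" using assms by (auto simp: bounded_seq_def)
  show ?thesis
  proof (rule summable_comparison_test')
    show "summable (\<lambda>n. K\<^sup>2 * (l n * (e n \<bullet> f))\<^sup>2)"
      using assms(2) by (intro summable_mult) (simp add: diag_dom_def)
    fix n
    have "(b n)\<^sup>2 \<le> K\<^sup>2" using K[of n] by (metis abs_ge_zero order_trans power2_abs power_mono)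
    then have "(b n)\<^sup>2 * (l n * (e n \<bullet> f))\<^sup>2 \<le> K\<^sup>2 * (l n * (e n \<bullet> f))\<^sup>2"
      by (rule mult_right_mono) simp
    then show "norm ((l n * (b n * (e n \<bullet> f)))\<^sup>2) \<le> K\<^sup>2 * (l n * (e n \<bullet> f))\<^sup>2"
      by (simp add: power_mult_distrib mult_ac)
  qed
qed

lemma coeff_dg [simp]:
  assumes "bounded_seq b"
  shows "e n \<bullet> dg b f = b n * (e n \<bullet> f)"
proof (rule coeff_dg_dom)
  have "f \<in> diag_dom e (\<lambda>_. 1)" using summable_coeff by (simp add: diag_dom_def)
  then show "f \<in> diag_dom e b" using bounded_diag_dom[OF assms, of f "\<lambda>_. 1"] by (simp add: diag_dom_def)
qed

lemma dg_add: "bounded_seq b \<Longrightarrow> dg b (f + g) = dg b f + dg b g"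
  by (rule coeff_eqI) (simp add: inner_add_right algebra_simps)

lemma dg_scaleR: "bounded_seq b \<Longrightarrow> dg b (s *\<^sub>R f) = s *\<^sub>R dg b f"
  by (rule coeff_eqI) simp

lemma dg_const [simp]: "dg (\<lambda>n. s) f = s *\<^sub>R f"
  by (rule coeff_eqI) simp

lemma dg_dg: "bounded_seq a \<Longrightarrow> bounded_seq b \<Longrightarrow> dg a (dg b f) = dg (\<lambda>n. a n * b n) f"
  by (rule coeff_eqI) simp

lemma inner_dg_left: "bounded_seq b \<Longrightarrow> dg b f \<bullet> g = f \<bullet> dg b g"
  using inner_sums[of "dg b f" g] inner_sums[of f "dg b g"]
  by (simp add: mult_ac sums_unique2)

abbreviation tests :: "'a set" where "tests \<equiv> test_space e lam"

lemma tests_iff: "f \<in> tests \<longleftrightarrow> (\<forall>k. summable (\<lambda>n. (lam n ^ k * (e n \<bullet> f))\<^sup>2))"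
  by (simp add: test_space_def diag_dom_def)

lemma tests_dom: "f \<in> tests \<Longrightarrow> f \<in> diag_dom e (\<lambda>n. lam n ^ k)"
  by (simp add: test_space_def)

lemma tests_dg [simp, intro]: "bounded_seq b \<Longrightarrow> f \<in> tests \<Longrightarrow> dg b f \<in> tests"
  using bounded_diag_dom[OF _ tests_dom] by (simp add: tests_iff)

lemma tests_scaleR [simp, intro]: "f \<in> tests \<Longrightarrow> s *\<^sub>R f \<in> tests"
  using tests_dg[OF bounded_seq_const[of s]] by simp

lemma tests_add [simp, intro]:
  assumes "f \<in> tests" "g \<in> tests"
  shows "f + g \<in> tests"
  unfolding tests_iff
proof
  fix k
  show "summable (\<lambda>n. (lam n ^ k * (e n \<bullet> (f + g)))\<^sup>2)"
  proof (rule summable_comparison_test')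
    show "summable (\<lambda>n. 2 * (lam n ^ k * (e n \<bullet> f))\<^sup>2 + 2 * (lam n ^ k * (e n \<bullet> g))\<^sup>2)"
      using assms by (intro summable_add summable_mult) (auto simp: tests_iff)
    fix n
    have "(u + v)\<^sup>2 \<le> 2 * u\<^sup>2 + 2 * v\<^sup>2" for u v :: real
      using sum_squares_bound[of u v] by (simp add: power2_sum)
    then show "norm ((lam n ^ k * (e n \<bullet> (f + g)))\<^sup>2)
        \<le> 2 * (lam n ^ k * (e n \<bullet> f))\<^sup>2 + 2 * (lam n ^ k * (e n \<bullet> g))\<^sup>2"
      by (simp add: inner_add_right distrib_left)
  qed
qed

lemma tests_zero [simp, intro]: "0 \<in> tests"
  by (simp add: tests_iff)

lemma tests_e [simp, intro]: "e m \<in> tests"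
  unfolding tests_iff
  by (auto intro!: summable_finite[of "{m}"] simp: e_inner split: if_splits)

lemma tests_minus [simp, intro]: "f \<in> tests \<Longrightarrow> - f \<in> tests"
  using tests_scaleR[of f "-1"] by simp

lemma tests_diff [simp, intro]: "f \<in> tests \<Longrightarrow> g \<in> tests \<Longrightarrow> f - g \<in> tests"
  using tests_add[of f "- g"] by simp

lemma tests_sum [simp, intro]: "(\<And>i. i \<in> S \<Longrightarrow> f i \<in> tests) \<Longrightarrow> (\<Sum>i\<in>S. f i) \<in> tests"
  by (induction S rule: infinite_finite_induct) auto

lemma norm_k_sums:
  assumes "f \<in> tests"
  shows "(\<lambda>n. (lam n ^ k * (e n \<bullet> f))\<^sup>2) sums (norm_k e lam k f)\<^sup>2"
  using norm_sums[of "dg (\<lambda>n. lam n ^ k) f"] coeff_dg_dom[OF tests_dom[OF assms], of _ k]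
  by (simp add: norm_k_def)

lemma norm_k_nonneg [simp]: "0 \<le> norm_k e lam k f"
  by (simp add: norm_k_def)

lemma norm_k_mono:
  assumes "f \<in> tests" "k \<le> l"
  shows "norm_k e lam k f \<le> norm_k e lam l f"
proof (rule power2_le_imp_le[OF sums_le[OF _ norm_k_sums[OF assms(1)] norm_k_sums[OF assms(1)]]])
  fix n
  have "lam n ^ k \<le> lam n ^ l" "0 \<le> lam n ^ k" using lam_gt_1[of n] assms(2) by (auto intro: power_increasing)
  then show "(lam n ^ k * (e n \<bullet> f))\<^sup>2 \<le> (lam n ^ l * (e n \<bullet> f))\<^sup>2"
    by (auto simp: power_mult_distrib intro!: mult_right_mono power_mono)
qed simp

lemma norm_k_dg:
  assumes "f \<in> tests" "\<And>n. \<bar>b n\<bar> \<le> K"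
  shows "norm_k e lam k (dg b f) \<le> K * norm_k e lam k f"
proof (rule power2_le_imp_le)
  have b: "bounded_seq b" using assms(2) by (rule bounded_seqI)
  have K: "0 \<le> K" using assms(2)[of 0] by linarith
  then show "0 \<le> K * norm_k e lam k f" by simp
  have "(norm_k e lam k (dg b f))\<^sup>2 \<le> K\<^sup>2 * (norm_k e lam k f)\<^sup>2"
  proof (rule sums_le[OF _ norm_k_sums[OF tests_dg[OF b assms(1)]] sums_mult[OF norm_k_sums[OF assms(1)]]])
    fix n
    have "(b n)\<^sup>2 \<le> K\<^sup>2" using assms(2)[of n] by (metis abs_ge_zero order_trans power2_abs power_mono)
    then have "(b n)\<^sup>2 * (lam n ^ k * (e n \<bullet> f))\<^sup>2 \<le> K\<^sup>2 * (lam n ^ k * (e n \<bullet> f))\<^sup>2"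
      by (rule mult_right_mono) simp
    then show "(lam n ^ k * (e n \<bullet> dg b f))\<^sup>2 \<le> K\<^sup>2 * (lam n ^ k * (e n \<bullet> f))\<^sup>2"
      using b by (simp add: power_mult_distrib mult_ac)
  qed
  then show "(norm_k e lam k (dg b f))\<^sup>2 \<le> (K * norm_k e lam k f)\<^sup>2" by (simp add: power_mult_distrib)
qed

section \<open>The dual space\<close>

abbreviation duals :: "('a \<Rightarrow> real) set" where "duals \<equiv> dual_space e lam"

lemma dual_add: "x \<in> duals \<Longrightarrow> f \<in> tests \<Longrightarrow> g \<in> tests \<Longrightarrow> x (f + g) = x f + x g"
  and dual_scaleR: "x \<in> duals \<Longrightarrow> f \<in> tests \<Longrightarrow> x (s *\<^sub>R f) = s * x f"
  by (auto simp: dual_space_def)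

lemma dual_zero [simp]: "x \<in> duals \<Longrightarrow> x 0 = 0"
  using dual_scaleR[of x 0 0] by simp

text \<open>This prepares continuity for two functionals at once: the index may be raised freely,
  because the norms increase, and the constant is made nonnegative.\<close>

lemma dual_bound:
  assumes "x \<in> duals"
  obtains k K where "0 \<le> K" "\<And>f l. f \<in> tests \<Longrightarrow> k \<le> l \<Longrightarrow> \<bar>x f\<bar> \<le> K * norm_k e lam l f"
proof -
  have "\<exists>k K. \<forall>f\<in>tests. \<bar>x f\<bar> \<le> K * norm_k e lam k f"
    using assms by (simp add: dual_space_def)
  then obtain k K where K: "\<And>f. f \<in> tests \<Longrightarrow> \<bar>x f\<bar> \<le> K * norm_k e lam k f" by blast
  show ?thesis
  proof (rule that)
    show "0 \<le> \<bar>K\<bar>" by simp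
    fix f l assume f: "f \<in> tests" and "k \<le> l"
    have "K * norm_k e lam k f \<le> \<bar>K\<bar> * norm_k e lam k f" by (intro mult_right_mono) auto
    also have "\<dots> \<le> \<bar>K\<bar> * norm_k e lam l f" by (intro mult_left_mono norm_k_mono f \<open>k \<le> l\<close>) auto
    finally show "\<bar>x f\<bar> \<le> \<bar>K\<bar> * norm_k e lam l f" using K[OF f] by linarith
  qed
qed

text \<open>\<open>dcomb a b x y\<close> is \<open>A x + B y\<close>, where the diagonal operators \<open>A\<close> and \<open>B\<close> act on the dual space
  by transposition.\<close>

definition dcomb :: "(nat \<Rightarrow> real) \<Rightarrow> (nat \<Rightarrow> real) \<Rightarrow> ('a \<Rightarrow> real) \<Rightarrow> ('a \<Rightarrow> real) \<Rightarrow> 'a \<Rightarrow> real" where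
  "dcomb a b x y = restrict (\<lambda>f. x (dg a f) + y (dg b f)) tests"

lemma dcomb_apply: "f \<in> tests \<Longrightarrow> dcomb a b x y f = x (dg a f) + y (dg b f)"
  by (simp add: dcomb_def)

lemma dcomb_dual [simp, intro]:
  assumes a: "bounded_seq a" and b: "bounded_seq b" and x: "x \<in> duals" and y: "y \<in> duals"
  shows "dcomb a b x y \<in> duals"
proof -
  obtain k K where K: "0 \<le> K" "\<And>f l. f \<in> tests \<Longrightarrow> k \<le> l \<Longrightarrow> \<bar>x f\<bar> \<le> K * norm_k e lam l f"
    by (rule dual_bound[OF x]) blast
  obtain m L where L: "0 \<le> L" "\<And>f l. f \<in> tests \<Longrightarrow> m \<le> l \<Longrightarrow> \<bar>y f\<bar> \<le> L * norm_k e lam l f"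
    by (rule dual_bound[OF y]) blast
  obtain A B where A: "\<And>n. \<bar>a n\<bar> \<le> A" and B: "\<And>n. \<bar>b n\<bar> \<le> B" using a b by (auto simp: bounded_seq_def)
  have "\<bar>dcomb a b x y f\<bar> \<le> (K * A + L * B) * norm_k e lam (max k m) f" if f: "f \<in> tests" for f
  proof -
    have "\<bar>x (dg a f)\<bar> \<le> K * (A * norm_k e lam (max k m) f)"
      using K(2)[OF tests_dg[OF a f], of "max k m"] mult_left_mono[OF norm_k_dg[OF f A] K(1)]
      by (meson max.cobounded1 order_trans)
    moreover have "\<bar>y (dg b f)\<bar> \<le> L * (B * norm_k e lam (max k m) f)"
      using L(2)[OF tests_dg[OF b f], of "max k m"] mult_left_mono[OF norm_k_dg[OF f B] L(1)]
      by (meson max.cobounded2 order_trans)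
    ultimately show ?thesis using f by (simp add: dcomb_apply algebra_simps)
  qed
  moreover have "dcomb a b x y \<in> extensional tests" by (simp add: dcomb_def)
  ultimately show ?thesis
    using a b x y unfolding dual_space_def mem_Collect_eq
    by (intro conjI) (auto simp: dcomb_apply dg_add dg_scaleR dual_add dual_scaleR distrib_left)
qed

lemma dual_sum:
  assumes "x \<in> duals" "\<And>i. i \<in> S \<Longrightarrow> f i \<in> tests"
  shows "x (\<Sum>i\<in>S. f i) = (\<Sum>i\<in>S. x (f i))"
  using assms by (induction S rule: infinite_finite_induct) (auto simp: dual_add)

lemma dual_diff: "x \<in> duals \<Longrightarrow> f \<in> tests \<Longrightarrow> g \<in> tests \<Longrightarrow> x (f - g) = x f - x g"
  using dual_add[of x f "(-1) *\<^sub>R g"] dual_scaleR[of x g "-1"] by simp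

lemma eigenvalue_bound:
  assumes "bounded_linear C" "\<And>n. C (e n) = c n *\<^sub>R e n" "onorm C \<le> 1"
  shows "\<bar>c n\<bar> \<le> 1"
proof -
  have "norm (e n) = 1" by (simp add: norm_eq_sqrt_inner e_inner)
  then show ?thesis using onorm[OF assms(1), of "e n"] assms(2,3) by simp
qed

end

section \<open>The white noise measure\<close>

text \<open>Levy's uniqueness theorem. The law is expressed as the image of the standard normal law
  under scaling, not by a density, so that the degenerate case v = 0 is covered.\<close>

lemma (in prob_space) centered_normal_law:
  assumes [measurable]: "Z \<in> borel_measurable M"
    and char: "\<And>s. (\<integral>\<omega>. exp (\<i> * complex_of_real (s * Z \<omega>)) \<partial>M) = exp (- complex_of_real (s\<^sup>2 * v / 2))"
    and v: "0 \<le> v"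
  shows "distr M borel Z = distr std_normal_distribution borel (\<lambda>u. sqrt v * u)"
proof -
  interpret Z: real_distribution "distr M borel Z"
    by (rule real_distribution_distr) simp
  interpret N: real_distribution std_normal_distribution by (rule real_dist_normal_dist)
  interpret N': real_distribution "distr std_normal_distribution borel (\<lambda>u. sqrt v * u)"
    by (rule N.real_distribution_distr) simp
  show ?thesis
  proof (rule Levy_uniqueness)
    show "real_distribution (distr M borel Z)" by (rule Z.real_distribution_axioms)
    show "real_distribution (distr std_normal_distribution borel (\<lambda>u. sqrt v * u))"
      by (rule N'.real_distribution_axioms)
    show "char (distr M borel Z) = char (distr std_normal_distribution borel (\<lambda>u. sqrt v * u))"
    proof
      fix s
      have "char (distr M borel Z) s = exp (- complex_of_real (s\<^sup>2 * v / 2))"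
        unfolding char_def using char[of s] by (subst integral_distr) auto
      also have "\<dots> = char std_normal_distribution (s * sqrt v)"
      proof -
        have "(complex_of_real (sqrt v))\<^sup>2 = complex_of_real v"
          using v by (metis of_real_power real_sqrt_pow2)
        then show ?thesis
          by (simp add: char_std_normal_distribution power_mult_distrib exp_of_real[symmetric])
      qed
      also have "\<dots> = char (distr std_normal_distribution borel (\<lambda>u. sqrt v * u)) s"
        unfolding char_def by (subst integral_distr) (auto simp: mult_ac)
      finally show "char (distr M borel Z) s = char (distr std_normal_distribution borel (\<lambda>u. sqrt v * u)) s" .
    qed
  qed
qed

text \<open>Completing the square: the standard normal density times exp (s u) is a constant times
  the normal density with mean s.\<close>

lemma integrable_exp_std_normal: "integrable std_normal_distribution (\<lambda>u. exp (s * u))"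
proof -
  have "std_normal_density u * exp (s * u) = exp (s\<^sup>2 / 2) * normal_density s 1 u" for u
    by (simp add: normal_density_def mult_exp_exp power2_diff field_simps)
  moreover have "integrable lborel (\<lambda>u. exp (s\<^sup>2 / 2) * normal_density s 1 u)"
    by (intro integrable_mult_right integrable_normal_density) simp
  ultimately show ?thesis
    by (subst integrable_density) auto
qed

context prob_space begin

context
  fixes Z and v :: real
  assumes Z[measurable]: "Z \<in> borel_measurable M"
    and char: "\<And>s. (\<integral>\<omega>. exp (\<i> * complex_of_real (s * Z \<omega>)) \<partial>M) = exp (- complex_of_real (s\<^sup>2 * v / 2))"
    and v: "0 \<le> v"
begin

lemma centered_normal_transfer:
  fixes h :: "real \<Rightarrow> real"
  assumes [measurable]: "h \<in> borel_measurable borel"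
  shows "integrable M (\<lambda>\<omega>. h (Z \<omega>)) \<longleftrightarrow> integrable std_normal_distribution (\<lambda>u. h (sqrt v * u))"
    and "(\<integral>\<omega>. h (Z \<omega>) \<partial>M) = (\<integral>u. h (sqrt v * u) \<partial>std_normal_distribution)"
  using centered_normal_law[OF Z char v] integrable_distr_eq[of Z M borel h]
    integral_distr[of Z M borel h]
    integrable_distr_eq[of "\<lambda>u. sqrt v * u" std_normal_distribution borel h]
    integral_distr[of "\<lambda>u. sqrt v * u" std_normal_distribution borel h]
  by auto

lemma centered_normal_exp_integrable: "integrable M (\<lambda>\<omega>. exp (s * Z \<omega>))"
  using integrable_exp_std_normal[of "s * sqrt v"] centered_normal_transfer(1)[of "\<lambda>z. exp (s * z)"]
  by (simp add: mult_ac)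

lemma centered_normal_moments:
  "integrable M Z" "(\<integral>\<omega>. Z \<omega> \<partial>M) = 0" "integrable M (\<lambda>\<omega>. (Z \<omega>)\<^sup>2)" "(\<integral>\<omega>. (Z \<omega>)\<^sup>2 \<partial>M) = v"
proof -
  have m1: "(\<integral>u. u \<partial>std_normal_distribution) = 0"
    using integral_std_normal_distribution_moment_odd[of 1] by simp
  have m2: "(\<integral>u. u\<^sup>2 \<partial>std_normal_distribution) = 1"
    using std_normal_distribution_even_moments[of 1] by (simp add: fact_numeral)
  have i: "integrable std_normal_distribution (\<lambda>u. u)" "integrable std_normal_distribution (\<lambda>u. u\<^sup>2)"
    using integrable_std_normal_distribution_moment[of 1] integrable_std_normal_distribution_moment[of 2] by auto
  have sq: "(\<lambda>u. (sqrt v * u)\<^sup>2) = (\<lambda>u. v * u\<^sup>2)" using v by (simp add: power_mult_distrib)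
  have i2: "integrable std_normal_distribution (\<lambda>u. sqrt v * u)" by (rule integrable_mult_right[OF i(1)])
  have i3: "integrable std_normal_distribution (\<lambda>u. (sqrt v * u)\<^sup>2)"
    unfolding sq by (rule integrable_mult_right[OF i(2)])
  have b: "(\<lambda>z::real. z) \<in> borel_measurable borel" "(\<lambda>z::real. z\<^sup>2) \<in> borel_measurable borel" by measurable
  show "integrable M Z" using i2 centered_normal_transfer(1)[OF b(1)] by (rule iffD2[rotated])
  show "integrable M (\<lambda>\<omega>. (Z \<omega>)\<^sup>2)" using i3 centered_normal_transfer(1)[OF b(2)] by (rule iffD2[rotated])
  show "(\<integral>\<omega>. Z \<omega> \<partial>M) = 0" unfolding centered_normal_transfer(2)[OF b(1)] integral_mult_right_zero m1 by simp
  show "(\<integral>\<omega>. (Z \<omega>)\<^sup>2 \<partial>M) = v"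
    unfolding centered_normal_transfer(2)[OF b(2)] sq integral_mult_right_zero m2 by simp
qed

end

end

lemma (in prob_space) integral_product_of_pair:
  fixes f :: "'a \<Rightarrow> complex" and g :: "'b \<Rightarrow> complex"
  assumes N: "prob_space N" and f: "integrable M f" and g: "integrable N g"
  shows "integrable (M \<Otimes>\<^sub>M N) (\<lambda>z. f (fst z) * g (snd z))"
    and "(\<integral>z. f (fst z) * g (snd z) \<partial>(M \<Otimes>\<^sub>M N)) = (\<integral>x. f x \<partial>M) * (\<integral>y. g y \<partial>N)"
proof -
  interpret N: prob_space N by (rule N)
  interpret P: pair_prob_space M N ..
  have [measurable]: "f \<in> borel_measurable M" "g \<in> borel_measurable N" using f g by auto
  show int: "integrable (M \<Otimes>\<^sub>M N) (\<lambda>z. f (fst z) * g (snd z))"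
  proof (rule P.Fubini_integrable)
    show "integrable M (\<lambda>x. \<integral>y. norm (f (fst (x, y)) * g (snd (x, y))) \<partial>N)"
      using f g by (simp add: norm_mult)
    show "AE x in M. integrable N (\<lambda>y. f (fst (x, y)) * g (snd (x, y)))"
      using g by auto
  qed measurable
  show "(\<integral>z. f (fst z) * g (snd z) \<partial>(M \<Otimes>\<^sub>M N)) = (\<integral>x. f x \<partial>M) * (\<integral>y. g y \<partial>N)"
    using P.integral_fst'[OF int] by simp
qed

locale white_noise = gelfand_triple e lam
  for e :: "nat \<Rightarrow> 'a::{real_inner, banach}" and lam :: "nat \<Rightarrow> real" +
  fixes \<mu> :: "('a \<Rightarrow> real) measure"
  assumes white_noise: "white_noise_measure e lam \<mu>"
begin

sublocale prob_space \<mu>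
  using white_noise by (simp add: white_noise_measure_def)

lemma space_mu: "space \<mu> = duals"
  using white_noise by (simp add: white_noise_measure_def)

definition evals :: "(('a \<Rightarrow> real) \<Rightarrow> real) set" where
  "evals = (\<lambda>\<xi> x. x \<xi>) ` tests"

lemma sets_mu: "sets \<mu> = sigma_sets duals {f -` B \<inter> duals | f B. f \<in> evals \<and> B \<in> sets borel}"
proof -
  have "{{x \<in> duals. x \<xi> \<in> B} | \<xi> B. \<xi> \<in> tests \<and> B \<in> sets borel} =
      {f -` B \<inter> duals | f B. f \<in> evals \<and> B \<in> sets borel}"
    unfolding evals_def by (force simp: vimage_def Int_def conj_commute)
  then show ?thesis using white_noise by (simp add: white_noise_measure_def)
qed

lemma eval_measurable [measurable (raw)]: "\<xi> \<in> tests \<Longrightarrow> (\<lambda>x. x \<xi>) \<in> borel_measurable \<mu>"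
  by (rule measurableI)
    (auto simp: space_mu sets_mu evals_def intro!: sigma_sets.Basic)

lemma measurable_mu:
  assumes "\<And>\<omega>. \<omega> \<in> space N \<Longrightarrow> G \<omega> \<in> duals"
    and "\<And>\<xi>. \<xi> \<in> tests \<Longrightarrow> (\<lambda>\<omega>. G \<omega> \<xi>) \<in> borel_measurable N"
  shows "G \<in> measurable N \<mu>"
proof (rule measurable_sigma_sets[OF sets_mu])
  show "{f -` B \<inter> duals |f B. f \<in> evals \<and> B \<in> sets borel} \<subseteq> Pow duals" by auto
  show "G \<in> space N \<rightarrow> duals" using assms(1) by auto
  fix A assume "A \<in> {f -` B \<inter> duals |f B. f \<in> evals \<and> B \<in> sets borel}"
  then obtain \<xi> B where A: "\<xi> \<in> tests" "B \<in> sets borel" "A = (\<lambda>x. x \<xi>) -` B \<inter> duals"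
    by (auto simp: evals_def)
  have "G -` A \<inter> space N = (\<lambda>\<omega>. G \<omega> \<xi>) -` B \<inter> space N" using A assms(1) by auto
  then show "G -` A \<inter> space N \<in> sets N" using measurable_sets[OF assms(2)[OF A(1)] A(2)] by simp
qed

lemma char_mu:
  "\<xi> \<in> tests \<Longrightarrow> (\<integral>x. exp (\<i> * complex_of_real (x \<xi>)) \<partial>\<mu>) = exp (- complex_of_real ((norm \<xi>)\<^sup>2 / 2))"
  using white_noise unfolding white_noise_measure_def of_real_minus[symmetric] exp_of_real minus_divide_left
  by blast

subsection \<open>Trigonometric polynomials\<close>

text \<open>Membership restricts the values on the dual space only, since the rule x (\<xi> +
  \<eta>) = x \<xi> + x \<eta>, which makes this an algebra, holds only there. Lists permit repeated
  frequencies, so that no terms have to be merged.\<close>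

definition trigs :: "(('a \<Rightarrow> real) \<Rightarrow> complex) set" where
  "trigs = {g. \<exists>l. set l \<subseteq> UNIV \<times> tests \<and>
     (\<forall>x\<in>duals. g x = (\<Sum>(a, \<xi>)\<leftarrow>l. a * exp (\<i> * complex_of_real (x \<xi>))))}"

lemma trigs_zero: "(\<lambda>x. 0) \<in> trigs"
  unfolding trigs_def by (auto intro!: exI[of _ "[]"])

lemma trigs_Cons:
  assumes "\<xi> \<in> tests" "h \<in> trigs"
  shows "(\<lambda>x. a * exp (\<i> * complex_of_real (x \<xi>)) + h x) \<in> trigs"
proof -
  obtain l where "set l \<subseteq> UNIV \<times> tests" "\<And>x. x \<in> duals \<Longrightarrow> h x = (\<Sum>(a, \<xi>)\<leftarrow>l. a * exp (\<i> * complex_of_real (x \<xi>)))"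
    using assms by (auto simp: trigs_def)
  then show ?thesis using assms unfolding trigs_def by (auto intro!: exI[of _ "(a, \<xi>) # l"])
qed

lemma trigs_cong: "f \<in> trigs \<Longrightarrow> (\<And>x. x \<in> duals \<Longrightarrow> f x = g x) \<Longrightarrow> g \<in> trigs"
  by (auto simp: trigs_def)

lemma trigs_induct [consumes 1, case_names zero Cons cong]:
  assumes "g \<in> trigs"
    and zero: "P (\<lambda>x. 0)"
    and Cons: "\<And>a \<xi> h. \<xi> \<in> tests \<Longrightarrow> h \<in> trigs \<Longrightarrow> P h \<Longrightarrow> P (\<lambda>x. a * exp (\<i> * complex_of_real (x \<xi>)) + h x)"
    and cong: "\<And>f g. f \<in> trigs \<Longrightarrow> P f \<Longrightarrow> (\<And>x. x \<in> duals \<Longrightarrow> f x = g x) \<Longrightarrow> P g"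
  shows "P g"
proof -
  obtain l where l: "set l \<subseteq> UNIV \<times> tests"
    and g: "\<And>x. x \<in> duals \<Longrightarrow> g x = (\<Sum>(a, \<xi>)\<leftarrow>l. a * exp (\<i> * complex_of_real (x \<xi>)))"
    using assms(1) by (auto simp: trigs_def)
  let ?S = "\<lambda>l x. (\<Sum>(a, \<xi>)\<leftarrow>l. a * exp (\<i> * complex_of_real (x \<xi>)))"
  have "P (?S l) \<and> ?S l \<in> trigs"
    using l
  proof (induction l)
    case Nil
    then show ?case using zero trigs_zero by simp
  next
    case (Cons b l)
    then obtain a \<xi> where b: "b = (a, \<xi>)" "\<xi> \<in> tests" by (cases b) auto
    show ?case using Cons assms(3)[OF b(2), of "?S l" a] trigs_Cons[OF b(2), of "?S l" a] by (simp add: b)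
  qed
  then show ?thesis using cong[of "?S l" g] g by metis
qed

lemma trigs_monom: "\<xi> \<in> tests \<Longrightarrow> (\<lambda>x. a * exp (\<i> * complex_of_real (x \<xi>))) \<in> trigs"
  using trigs_Cons[OF _ trigs_zero, of \<xi> a] by simp

lemma trigs_const: "(\<lambda>x. a) \<in> trigs"
  by (rule trigs_cong[OF trigs_monom[OF tests_zero, of a]]) simp

lemma trigs_add: "f \<in> trigs \<Longrightarrow> g \<in> trigs \<Longrightarrow> (\<lambda>x. f x + g x) \<in> trigs"
proof (induction rule: trigs_induct)
  case (Cons a \<xi> h)
  then show ?case using trigs_Cons[of \<xi> "\<lambda>x. h x + g x" a] by (simp add: add.assoc)
next
  case (cong f f')
  then show ?case using trigs_cong[of "\<lambda>x. f x + g x" "\<lambda>x. f' x + g x"] by simp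
qed simp

lemma trigs_monom_mult:
  assumes "\<xi> \<in> tests"
  shows "g \<in> trigs \<Longrightarrow> (\<lambda>x. a * exp (\<i> * complex_of_real (x \<xi>)) * g x) \<in> trigs"
proof (induction rule: trigs_induct)
  case zero
  then show ?case by (simp add: trigs_zero)
next
  case (Cons b \<eta> h)
  have "(\<lambda>x. (a * b) * exp (\<i> * complex_of_real (x (\<xi> + \<eta>))) + a * exp (\<i> * complex_of_real (x \<xi>)) * h x) \<in> trigs"
    by (intro trigs_Cons tests_add assms Cons)
  then show ?case
    by (rule trigs_cong) (simp add: dual_add assms Cons distrib_left exp_add mult_ac)
next
  case (cong f g)
  then show ?case by (auto intro: trigs_cong)
qed

lemma trigs_mult: "f \<in> trigs \<Longrightarrow> g \<in> trigs \<Longrightarrow> (\<lambda>x. f x * g x) \<in> trigs"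
proof (induction rule: trigs_induct)
  case zero
  then show ?case by (simp add: trigs_zero)
next
  case (Cons a \<xi> h)
  then show ?case
    using trigs_add[OF trigs_monom_mult[of \<xi> g a] Cons.IH] by (simp add: distrib_right)
next
  case (cong f f')
  then show ?case using trigs_cong[of "\<lambda>x. f x * g x" "\<lambda>x. f' x * g x"] by simp
qed

lemma trigs_measurable: "g \<in> trigs \<Longrightarrow> g \<in> borel_measurable \<mu>"
proof (induction rule: trigs_induct)
  case (cong f g)
  then show ?case by (subst measurable_cong[of _ _ f]) (auto simp: space_mu)
qed measurable

lemma trigs_bounded: "g \<in> trigs \<Longrightarrow> \<exists>K. \<forall>x\<in>duals. cmod (g x) \<le> K"
proof (induction rule: trigs_induct)
  case (Cons a \<xi> h)
  then obtain K where "\<forall>x\<in>duals. cmod (h x) \<le> K" by blast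
  then show ?case
    by (intro exI[of _ "cmod a + K"]) (auto intro!: norm_triangle_le simp: norm_mult)
qed auto

lemma trigs_sin:
  assumes "\<xi> \<in> tests"
  shows "(\<lambda>x. complex_of_real (sin (s * x \<xi>))) \<in> trigs"
proof -
  have "(\<lambda>x. (1 / (2 * \<i>)) * exp (\<i> * complex_of_real (x (s *\<^sub>R \<xi>))) +
      (- 1 / (2 * \<i>)) * exp (\<i> * complex_of_real (x ((- s) *\<^sub>R \<xi>)))) \<in> trigs"
    by (intro trigs_add trigs_monom tests_scaleR assms)
  then show ?thesis
    by (rule trigs_cong)
      (simp add: dual_scaleR assms sin_of_real[symmetric] sin_exp_eq field_simps del: scaleR_minus_left)
qed

lemma trigs_function_algebra:
  assumes "finite_measure N" "sets N = sets \<mu>" "0 < p"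
  shows "function_algebra \<mu> N p trigs evals"
proof (rule function_algebra.intro)
  show "f \<in> evals \<Longrightarrow> f \<in> borel_measurable \<mu>" for f by (auto simp: evals_def)
  show "f \<in> evals \<Longrightarrow> (\<lambda>x. complex_of_real (sin (s * f x))) \<in> trigs" for f s
    by (auto simp: evals_def trigs_sin)
  show "g \<in> trigs \<Longrightarrow> \<exists>K. \<forall>x\<in>space \<mu>. cmod (g x) \<le> K" for g
    using trigs_bounded by (simp add: space_mu)
  show "sets \<mu> = sigma_sets (space \<mu>) {f -` B \<inter> space \<mu> |f B. f \<in> evals \<and> B \<in> sets borel}"
    by (simp add: space_mu sets_mu)
  show "finite_measure \<mu>" "finite_measure N" "sets N = sets \<mu>" "0 < p"
    by (rule finite_measure_axioms assms)+
qed (rule trigs_measurable trigs_const trigs_add trigs_mult; assumption)+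

lemma trigs_dense:
  assumes "Lp \<mu> p f" "1 \<le> p" "0 < \<epsilon>"
  shows "\<exists>g\<in>trigs. Lp_norm \<mu> p (\<lambda>x. f x - g x) < \<epsilon>"
proof -
  interpret function_algebra \<mu> \<mu> p trigs evals
    using assms by (intro trigs_function_algebra finite_measure_axioms) auto
  show ?thesis using Lp_approximation[OF assms(1) refl assms(2,3)] .
qed

text \<open>The hypothesis fixes the integrals of all trigonometric polynomials, and these determine
  the measure by \<open>measure_unique\<close>. The changes of variables below rest on this: a law
  is recognised as \<mu> by its characteristic functional.\<close>

lemma white_noise_law:
  assumes \<Omega>: "prob_space \<Omega>" and G: "G \<in> measurable \<Omega> \<mu>"
    and char: "\<And>\<xi>. \<xi> \<in> tests \<Longrightarrow> (\<integral>\<omega>. exp (\<i> * complex_of_real (G \<omega> \<xi>)) \<partial>\<Omega>) = exp (- complex_of_real ((norm \<xi>)\<^sup>2 / 2))"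
  shows "distr \<Omega> \<mu> G = \<mu>"
proof -
  interpret O: prob_space \<Omega> by (rule \<Omega>)
  interpret D: prob_space "distr \<Omega> \<mu> G" by (rule O.prob_space_distr[OF G])
  interpret function_algebra \<mu> "distr \<Omega> \<mu> G" 1 trigs evals
    by (intro trigs_function_algebra D.finite_measure_axioms) auto
  have "\<mu> = distr \<Omega> \<mu> G"
  proof (rule measure_unique)
    fix g assume "g \<in> trigs"
    then show "(\<integral>x. g x \<partial>\<mu>) = (\<integral>x. g x \<partial>distr \<Omega> \<mu> G)"
    proof (induction rule: trigs_induct)
      case (Cons a \<xi> h)
      have m: "(\<lambda>x. exp (\<i> * complex_of_real (x \<xi>))) \<in> borel_measurable \<mu>" using Cons by measurable
      have hm: "h \<in> borel_measurable \<mu>" using Cons trigs_measurable by auto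
      obtain K where K: "\<forall>x\<in>duals. cmod (h x) \<le> K" using trigs_bounded[OF Cons(2)] by blast
      have ih: "integrable \<mu> h" "integrable (distr \<Omega> \<mu> G) h"
        using hm K
        by (auto intro!: integrable_const_bound[where B=K] D.integrable_const_bound[where B=K] AE_I2 simp: space_mu)
      have ie: "integrable \<mu> (\<lambda>x. exp (\<i> * complex_of_real (x \<xi>)))"
        "integrable (distr \<Omega> \<mu> G) (\<lambda>x. exp (\<i> * complex_of_real (x \<xi>)))"
        using m by (auto intro!: integrable_const_bound[where B=1] D.integrable_const_bound[where B=1])
      have "(\<integral>x. exp (\<i> * complex_of_real (x \<xi>)) \<partial>distr \<Omega> \<mu> G) = (\<integral>x. exp (\<i> * complex_of_real (x \<xi>)) \<partial>\<mu>)"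
        using char[OF Cons(1)] char_mu[OF Cons(1)] integral_distr[OF G m] by simp
      then show ?case using ih ie Cons.IH by simp
    next
      case (cong f g)
      have "(\<integral>x. f x \<partial>\<mu>) = (\<integral>x. g x \<partial>\<mu>)" "(\<integral>x. f x \<partial>distr \<Omega> \<mu> G) = (\<integral>x. g x \<partial>distr \<Omega> \<mu> G)"
        by (intro Bochner_Integration.integral_cong refl; simp add: space_mu cong(2))+
      then show ?case using cong.IH by simp
    qed simp
  qed simp
  then show ?thesis by simp
qed

end

subsection \<open>Exponentially bounded functions\<close>

lemma norm_exp_partial_sum_le:
  fixes w :: complex
  shows "cmod (\<Sum>k<n. w ^ k / fact k) \<le> exp (cmod w)"
proof -
  have "cmod (\<Sum>k<n. w ^ k / fact k) \<le> (\<Sum>k<n. cmod w ^ k / fact k)"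
    by (rule order_trans[OF norm_sum]) (simp add: norm_divide norm_power)
  also have "\<dots> \<le> exp (cmod w)"
    unfolding exp_def
    using sum_le_suminf[OF summable_exp_generic[of "cmod w"], of "{..<n}"] by (simp add: field_simps)
  finally show ?thesis .
qed

lemma cb_commute: "cinner_bilinear \<zeta> \<theta> = cinner_bilinear \<theta> \<zeta>"
  by (simp add: cinner_bilinear_def inner_commute)

lemma cb_add_left: "cinner_bilinear (\<zeta> + \<theta>) \<kappa> = cinner_bilinear \<zeta> \<kappa> + cinner_bilinear \<theta> \<kappa>"
  by (simp add: cinner_bilinear_def inner_add_left complex_eq_iff)

lemma cb_add_right: "cinner_bilinear \<kappa> (\<zeta> + \<theta>) = cinner_bilinear \<kappa> \<zeta> + cinner_bilinear \<kappa> \<theta>"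
  by (simp add: cinner_bilinear_def inner_add_right complex_eq_iff)

context white_noise
begin

text \<open>A product of factors 2 cosh (x \<xi>). For test vectors these weights are integrable;
  they are at least 1 and closed under products, so they serve as a common scale of
  majorants.\<close>

definition ew :: "'a list \<Rightarrow> ('a \<Rightarrow> real) \<Rightarrow> real" where
  "ew L x = (\<Prod>\<xi>\<leftarrow>L. exp (x \<xi>) + exp (- x \<xi>))"

lemma ew_Nil [simp]: "ew [] x = 1"
  and ew_Cons [simp]: "ew (\<xi> # L) x = (exp (x \<xi>) + exp (- x \<xi>)) * ew L x"
  by (simp_all add: ew_def)

lemma ew_append: "ew (L @ L') x = ew L x * ew L' x"
  by (simp add: ew_def)

lemma exp_plus_exp_ge: "1 \<le> exp y + exp (- y)" "\<bar>y\<bar> \<le> exp y + exp (- y)" for y :: real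
  using exp_ge_add_one_self[of y] exp_ge_add_one_self[of "- y"] exp_gt_zero[of y] exp_gt_zero[of "- y"]
  by linarith+

lemma ew_ge_1: "1 \<le> ew L x"
proof (induction L)
  case (Cons \<xi> L)
  then show ?case using mult_mono[OF exp_plus_exp_ge(1)[of "x \<xi>"] Cons] by simp
qed simp

lemma ew_pos [simp]: "0 < ew L x" "0 \<le> ew L x"
  using ew_ge_1[of L x] by linarith+

lemma ew_measurable: "set L \<subseteq> tests \<Longrightarrow> ew L \<in> borel_measurable \<mu>"
  unfolding ew_def[abs_def] by (induction L) auto

lemma char_line:
  assumes "\<xi> \<in> tests"
  shows "(\<integral>x. exp (\<i> * complex_of_real (s * x \<xi>)) \<partial>\<mu>) = exp (- complex_of_real (s\<^sup>2 * (norm \<xi>)\<^sup>2 / 2))"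
proof -
  have "(\<integral>x. exp (\<i> * complex_of_real (s * x \<xi>)) \<partial>\<mu>) = (\<integral>x. exp (\<i> * complex_of_real (x (s *\<^sub>R \<xi>))) \<partial>\<mu>)"
    by (intro Bochner_Integration.integral_cong refl) (simp add: space_mu dual_scaleR assms)
  then show ?thesis using char_mu[OF tests_scaleR[OF assms, of s]] by (simp add: power_mult_distrib)
qed

lemma integrable_exp_eval: "\<xi> \<in> tests \<Longrightarrow> integrable \<mu> (\<lambda>x. exp (s * x \<xi>))"
  by (rule centered_normal_exp_integrable[OF eval_measurable char_line]) auto

text \<open>The factor exp (x \<eta>) is there for the induction: multiplication by 2 cosh (x \<xi>)
  only replaces \<eta> by \<eta> + \<xi> and \<eta> - \<xi>.\<close>

lemma integrable_ew_exp:
  assumes "set L \<subseteq> tests" "\<eta> \<in> tests"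
  shows "integrable \<mu> (\<lambda>x. ew L x * exp (x \<eta>))"
  using assms
proof (induction L arbitrary: \<eta>)
  case Nil
  then show ?case using integrable_exp_eval[of \<eta> 1] by simp
next
  case (Cons \<xi> L)
  have "integrable \<mu> (\<lambda>x. ew L x * exp (x (\<eta> + \<xi>)) + ew L x * exp (x (\<eta> - \<xi>)))"
    using Cons.prems by (intro Bochner_Integration.integrable_add Cons.IH) auto
  moreover have "ew L x * exp (x (\<eta> + \<xi>)) + ew L x * exp (x (\<eta> - \<xi>)) = ew (\<xi> # L) x * exp (x \<eta>)"
    if "x \<in> duals" for x
    using Cons.prems that by (simp add: dual_add dual_diff exp_add exp_diff exp_minus field_simps)
  ultimately show ?case
    by (subst (asm) Bochner_Integration.integrable_cong[OF refl]) (auto simp: space_mu)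
qed

lemma integrable_ew: "set L \<subseteq> tests \<Longrightarrow> integrable \<mu> (ew L)"
  using integrable_ew_exp[of L 0] Bochner_Integration.integrable_cong[of \<mu> \<mu> "\<lambda>x. ew L x * exp (x 0)" "ew L"]
  by (auto simp: space_mu)

text \<open>An algebra inside every L^p, p > 0, that contains the bounded measurable functions, the
  evaluations and the exponential functions and is stable under powers of the modulus. Most
  integrability claims below are read off from it.\<close>

definition expbdd :: "(('a \<Rightarrow> real) \<Rightarrow> complex) \<Rightarrow> bool" where
  "expbdd f \<longleftrightarrow> f \<in> borel_measurable \<mu> \<and>
     (\<exists>K L. 0 \<le> K \<and> set L \<subseteq> tests \<and> (\<forall>x\<in>duals. cmod (f x) \<le> K * ew L x))"

lemma expbddI:
  assumes "f \<in> borel_measurable \<mu>" "set L \<subseteq> tests" "0 \<le> K" "\<And>x. x \<in> duals \<Longrightarrow> cmod (f x) \<le> K * ew L x"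
  shows "expbdd f"
  using assms unfolding expbdd_def by blast

lemma expbddE:
  assumes "expbdd f"
  obtains K L where "0 \<le> K" "set L \<subseteq> tests" "\<And>x. x \<in> duals \<Longrightarrow> cmod (f x) \<le> K * ew L x"
  using assms unfolding expbdd_def by blast

lemma expbdd_measurable: "expbdd f \<Longrightarrow> f \<in> borel_measurable \<mu>"
  by (simp add: expbdd_def)

lemma expbdd_integrable:
  assumes "expbdd f"
  shows "integrable \<mu> f"
proof -
  obtain K L where *: "0 \<le> K" "set L \<subseteq> tests" "\<And>x. x \<in> duals \<Longrightarrow> cmod (f x) \<le> K * ew L x"
    using assms by (rule expbddE) blast
  show ?thesis
    by (rule Bochner_Integration.integrable_bound[OF integrable_mult_right[OF integrable_ew[OF *(2)], of K]])
      (use assms * in \<open>auto simp: expbdd_def space_mu intro!: AE_I2\<close>)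
qed

lemma expbdd_const: "expbdd (\<lambda>x. a)"
  by (rule expbddI[of _ "[]" "cmod a"]) auto

lemma expbdd_add:
  assumes "expbdd f" "expbdd g"
  shows "expbdd (\<lambda>x. f x + g x)"
proof -
  obtain K L where f: "0 \<le> K" "set L \<subseteq> tests" "\<And>x. x \<in> duals \<Longrightarrow> cmod (f x) \<le> K * ew L x"
    using assms(1) by (rule expbddE) blast
  obtain K' L' where g: "0 \<le> K'" "set L' \<subseteq> tests" "\<And>x. x \<in> duals \<Longrightarrow> cmod (g x) \<le> K' * ew L' x"
    using assms(2) by (rule expbddE) blast
  show ?thesis
  proof (rule expbddI[of _ "L @ L'" "K + K'"])
    fix x assume x: "x \<in> duals"
    have "K * ew L x * 1 \<le> K * ew L x * ew L' x" "K' * ew L' x * 1 \<le> K' * ew L' x * ew L x"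
      by (intro mult_left_mono ew_ge_1 mult_nonneg_nonneg ew_pos f(1) g(1))+
    then show "cmod (f x + g x) \<le> (K + K') * ew (L @ L') x"
      using norm_triangle_ineq[of "f x" "g x"] f(3)[OF x] g(3)[OF x]
      by (simp add: ew_append algebra_simps)
  qed (use f g assms in \<open>auto simp: expbdd_measurable intro!: borel_measurable_add\<close>)
qed

lemma expbdd_mult:
  assumes "expbdd f" "expbdd g"
  shows "expbdd (\<lambda>x. f x * g x)"
proof -
  obtain K L where f: "0 \<le> K" "set L \<subseteq> tests" "\<And>x. x \<in> duals \<Longrightarrow> cmod (f x) \<le> K * ew L x"
    using assms(1) by (rule expbddE) blast
  obtain K' L' where g: "0 \<le> K'" "set L' \<subseteq> tests" "\<And>x. x \<in> duals \<Longrightarrow> cmod (g x) \<le> K' * ew L' x"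
    using assms(2) by (rule expbddE) blast
  show ?thesis
  proof (rule expbddI[of _ "L @ L'" "K * K'"])
    fix x assume x: "x \<in> duals"
    show "cmod (f x * g x) \<le> K * K' * ew (L @ L') x"
      using mult_mono[OF f(3)[OF x] g(3)[OF x]] f(1) by (simp add: norm_mult ew_append mult_ac)
  qed (use f g assms in \<open>auto simp: expbdd_measurable intro!: borel_measurable_times\<close>)
qed

lemma expbdd_cmult: "expbdd f \<Longrightarrow> expbdd (\<lambda>x. a * f x)"
  by (intro expbdd_mult expbdd_const)

lemma expbdd_sum: "finite S \<Longrightarrow> (\<And>i. i \<in> S \<Longrightarrow> expbdd (f i)) \<Longrightarrow> expbdd (\<lambda>x. \<Sum>i\<in>S. f i x)"
  by (induction S rule: finite_induct) (auto intro: expbdd_const expbdd_add)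

lemma expbdd_power: "expbdd f \<Longrightarrow> expbdd (\<lambda>x. f x ^ n)"
  by (induction n) (auto intro: expbdd_const expbdd_mult)

lemma expbdd_norm: "expbdd f \<Longrightarrow> expbdd (\<lambda>x. complex_of_real (cmod (f x)))"
  unfolding expbdd_def by auto

lemma expbdd_cnj: "expbdd f \<Longrightarrow> expbdd (\<lambda>x. cnj (f x))"
  unfolding expbdd_def by (auto intro: measurable_compose[OF _ borel_measurable_continuous_onI[OF continuous_on_cnj[OF continuous_on_id]]])

lemma expbdd_bounded:
  "f \<in> borel_measurable \<mu> \<Longrightarrow> (\<And>x. x \<in> duals \<Longrightarrow> cmod (f x) \<le> K) \<Longrightarrow> expbdd f"
  by (rule expbddI[of _ "[]" "\<bar>K\<bar>"]) (auto intro: order_trans[OF _ abs_ge_self])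

lemma expbdd_le:
  assumes "expbdd g" "f \<in> borel_measurable \<mu>" "\<And>x. x \<in> duals \<Longrightarrow> cmod (f x) \<le> cmod (g x)"
  shows "expbdd f"
proof -
  obtain K L where *: "0 \<le> K" "set L \<subseteq> tests" "\<And>x. x \<in> duals \<Longrightarrow> cmod (g x) \<le> K * ew L x"
    using assms(1) by (rule expbddE) blast
  show ?thesis by (rule expbddI[OF assms(2) *(2,1)]) (meson assms(3) *(3) order_trans)
qed

lemma expbdd_eval: "\<xi> \<in> tests \<Longrightarrow> expbdd (\<lambda>x. complex_of_real (x \<xi>))"
  using exp_plus_exp_ge(2) by (intro expbddI[of _ "[\<xi>]" 1]) auto

lemma expbdd_powr:
  assumes f: "expbdd f" and p: "0 < p"
  shows "expbdd (\<lambda>x. complex_of_real (cmod (f x) powr p))"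
proof (rule expbdd_le)
  \<comment> \<open>A real power is majorised by the next integer power, once 1 has been added to
    make the base at least 1.\<close>
  show "expbdd (\<lambda>x. (1 + complex_of_real (cmod (f x))) ^ nat \<lceil>p\<rceil>)"
    by (intro expbdd_power expbdd_add expbdd_const expbdd_norm f)
  show "(\<lambda>x. complex_of_real (cmod (f x) powr p)) \<in> borel_measurable \<mu>"
    using expbdd_measurable[OF f] by measurable
  fix x
  have "cmod (f x) powr p \<le> (1 + cmod (f x)) powr p" using p by (intro powr_mono2) auto
  also have "\<dots> \<le> (1 + cmod (f x)) powr (real (nat \<lceil>p\<rceil>))" by (intro powr_mono) (auto simp: real_nat_ceiling_ge)
  also have "\<dots> = (1 + cmod (f x)) ^ nat \<lceil>p\<rceil>" by (intro powr_realpow add_pos_nonneg) auto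
  also have "\<dots> = cmod ((1 + complex_of_real (cmod (f x))) ^ nat \<lceil>p\<rceil>)"
    by (metis abs_of_nonneg add_nonneg_nonneg norm_ge_zero norm_of_real norm_power of_real_1 of_real_add zero_le_one)
  finally show "cmod (complex_of_real (cmod (f x) powr p)) \<le> cmod ((1 + complex_of_real (cmod (f x))) ^ nat \<lceil>p\<rceil>)"
    by simp
qed

lemma expbdd_Lp: "expbdd f \<Longrightarrow> 0 < p \<Longrightarrow> Lp \<mu> p f"
  using expbdd_integrable[OF expbdd_powr, of f p] expbdd_measurable[of f]
  by (auto simp: Lp_def complex_of_real_integrable_eq)

subsection \<open>The Gaussian moment generating function\<close>

text \<open>Expansion under the integral, dominated by exp (|s| x \<xi>) + exp (- |s| x \<xi>). The
  result is a power series in the complex variable \<open>s\<close> that converges everywhere, and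
  this is how the integral in \<open>mgf\<close> is seen to be analytic.\<close>

lemma mgf_power_series:
  assumes \<xi>: "\<xi> \<in> tests" and \<eta>: "\<eta> \<in> tests"
  shows "(\<lambda>n. (\<integral>x. complex_of_real (x \<xi>) ^ n * exp (\<i> * complex_of_real (x \<eta>)) \<partial>\<mu>) / fact n * s ^ n)
    sums (\<integral>x. exp (s * complex_of_real (x \<xi>)) * exp (\<i> * complex_of_real (x \<eta>)) \<partial>\<mu>)"
proof -
  have [measurable]: "(\<lambda>x. x \<xi>) \<in> borel_measurable \<mu>" "(\<lambda>x. x \<eta>) \<in> borel_measurable \<mu>"
    using assms by auto
  let ?E = "\<lambda>x. exp (\<i> * complex_of_real (x \<eta>))"
  have ebd: "expbdd ?E" by (rule expbdd_bounded[of _ 1]) auto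
  have int: "integrable \<mu> (\<lambda>x. complex_of_real (x \<xi>) ^ k * ?E x)" for k
    by (intro expbdd_integrable expbdd_mult expbdd_power expbdd_eval ebd \<xi>)
  let ?f = "\<lambda>n x. (\<Sum>k<n. (s * complex_of_real (x \<xi>)) ^ k / fact k) * ?E x"
  have "(\<lambda>n. \<integral>x. ?f n x \<partial>\<mu>) \<longlonglongrightarrow> (\<integral>x. exp (s * complex_of_real (x \<xi>)) * ?E x \<partial>\<mu>)"
  proof (rule integral_dominated_convergence[where w="\<lambda>x. exp (cmod s * x \<xi>) + exp ((- cmod s) * x \<xi>)"])
    show "integrable \<mu> (\<lambda>x. exp (cmod s * x \<xi>) + exp ((- cmod s) * x \<xi>))"
      by (intro Bochner_Integration.integrable_add integrable_exp_eval \<xi>)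
    show "AE x in \<mu>. (\<lambda>n. ?f n x) \<longlonglongrightarrow> exp (s * complex_of_real (x \<xi>)) * ?E x"
    proof (rule AE_I2)
      fix x
      have "(\<lambda>k. (s * complex_of_real (x \<xi>)) ^ k / fact k) sums exp (s * complex_of_real (x \<xi>))"
        using exp_converges[of "s * complex_of_real (x \<xi>)"] by (simp add: scaleR_conv_of_real field_simps)
      then show "(\<lambda>n. ?f n x) \<longlonglongrightarrow> exp (s * complex_of_real (x \<xi>)) * ?E x"
        unfolding sums_def by (intro tendsto_intros)
    qed
    fix n
    show "AE x in \<mu>. norm (?f n x) \<le> exp (cmod s * x \<xi>) + exp ((- cmod s) * x \<xi>)"
    proof (rule AE_I2)
      fix x
      have "norm (?f n x) \<le> exp (cmod (s * complex_of_real (x \<xi>)))"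
        using norm_exp_partial_sum_le[of "s * complex_of_real (x \<xi>)" n] by (simp add: norm_mult)
      also have "\<dots> = exp (cmod s * \<bar>x \<xi>\<bar>)" by (simp add: norm_mult)
      also have "\<dots> \<le> exp (cmod s * x \<xi>) + exp ((- cmod s) * x \<xi>)" by (cases "x \<xi> \<ge> 0") auto
      finally show "norm (?f n x) \<le> exp (cmod s * x \<xi>) + exp ((- cmod s) * x \<xi>)" .
    qed
  qed measurable
  moreover have "(\<integral>x. ?f n x \<partial>\<mu>) = (\<Sum>k<n. (\<integral>x. complex_of_real (x \<xi>) ^ k * ?E x \<partial>\<mu>) / fact k * s ^ k)" for n
  proof -
    have "(\<integral>x. ?f n x \<partial>\<mu>) = (\<integral>x. (\<Sum>k<n. (s ^ k / fact k) * (complex_of_real (x \<xi>) ^ k * ?E x)) \<partial>\<mu>)"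
      by (intro Bochner_Integration.integral_cong refl, subst sum_distrib_right)
        (simp add: power_mult_distrib mult_ac)
    also have "\<dots> = (\<Sum>k<n. (s ^ k / fact k) * (\<integral>x. complex_of_real (x \<xi>) ^ k * ?E x \<partial>\<mu>))"
      using int by (subst Bochner_Integration.integral_sum) auto
    finally show ?thesis by (simp add: mult_ac)
  qed
  ultimately show ?thesis by (simp add: sums_def)
qed

text \<open>Both sides are entire in \<open>s\<close>. For imaginary s = i u the claim is the given
  characteristic functional at u \<xi> + \<eta>, and the imaginary axis accumulates at 0, so
  analytic continuation reaches all \<open>s\<close>. The value s = 1 yields the exponentials of
  complex test vectors.\<close>

lemma mgf:
  assumes \<xi>: "\<xi> \<in> tests" and \<eta>: "\<eta> \<in> tests"
  shows "(\<integral>x. exp (s * complex_of_real (x \<xi>)) * exp (\<i> * complex_of_real (x \<eta>)) \<partial>\<mu>) =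
    exp ((s\<^sup>2 * complex_of_real (\<xi> \<bullet> \<xi>) + 2 * \<i> * s * complex_of_real (\<xi> \<bullet> \<eta>) - complex_of_real (\<eta> \<bullet> \<eta>)) / 2)"
proof -
  define G where "G s = (\<integral>x. exp (s * complex_of_real (x \<xi>)) * exp (\<i> * complex_of_real (x \<eta>)) \<partial>\<mu>)" for s
  define H where "H s = exp ((s\<^sup>2 * complex_of_real (\<xi> \<bullet> \<xi>) + 2 * \<i> * s * complex_of_real (\<xi> \<bullet> \<eta>)
    - complex_of_real (\<eta> \<bullet> \<eta>)) / 2)" for s
  have "G holomorphic_on ball 0 r" for r
    by (rule power_series_holomorphic[where a="\<lambda>n. (\<integral>x. complex_of_real (x \<xi>) ^ n * exp (\<i> * complex_of_real (x \<eta>)) \<partial>\<mu>) / fact n"])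
      (use mgf_power_series[OF \<xi> \<eta>] in \<open>simp add: G_def\<close>)
  then have "G field_differentiable at s" for s
    by (rule holomorphic_on_imp_differentiable_at[of _ "ball 0 (cmod s + 1)"]) auto
  then have G: "G holomorphic_on UNIV" by (auto simp: holomorphic_on_def field_differentiable_at_within)
  have H: "H holomorphic_on UNIV" unfolding H_def by (intro holomorphic_intros) auto
  have "G s - H s = 0" for s
  proof (rule analytic_continuation[of "\<lambda>s. G s - H s" UNIV "range (\<lambda>u. \<i> * complex_of_real u)" 0])
    show "0 islimpt range (\<lambda>u. \<i> * complex_of_real u)"
      unfolding islimpt_sequential
    proof (intro exI conjI allI)
      have "\<i> * complex_of_real (1 / real (Suc n)) \<noteq> 0" for n by (simp del: of_nat_Suc)
      then show "\<i> * complex_of_real (1 / real (Suc n)) \<in> range (\<lambda>u. \<i> * complex_of_real u) - {0}" for n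
        by blast
      have "(\<lambda>n. \<i> * complex_of_real (1 / real (Suc n))) \<longlonglongrightarrow> \<i> * complex_of_real 0"
        by (intro tendsto_mult tendsto_const tendsto_of_real LIMSEQ_Suc[OF lim_1_over_n])
      then show "(\<lambda>n. \<i> * complex_of_real (1 / real (Suc n))) \<longlonglongrightarrow> 0" by simp
    qed
    fix z assume "z \<in> range (\<lambda>u. \<i> * complex_of_real u)"
    then obtain u where z: "z = \<i> * complex_of_real u" by auto
    have "G z = (\<integral>x. exp (\<i> * complex_of_real (x (u *\<^sub>R \<xi> + \<eta>))) \<partial>\<mu>)"
      unfolding G_def z using assms
      by (intro Bochner_Integration.integral_cong refl)
        (simp add: space_mu dual_add dual_scaleR mult_exp_exp distrib_left mult_ac add_ac)
    also have "\<dots> = exp (- complex_of_real ((norm (u *\<^sub>R \<xi> + \<eta>))\<^sup>2 / 2))"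
      using assms by (intro char_mu) auto
    also have "\<dots> = H z"
    proof -
      have n: "(norm (u *\<^sub>R \<xi> + \<eta>))\<^sup>2 = u\<^sup>2 * (\<xi> \<bullet> \<xi>) + 2 * u * (\<xi> \<bullet> \<eta>) + \<eta> \<bullet> \<eta>"
        unfolding power2_norm_eq_inner
        by (simp add: inner_add_left inner_add_right inner_commute[of \<eta> \<xi>] power2_eq_square algebra_simps)
      have m: "z\<^sup>2 * complex_of_real (\<xi> \<bullet> \<xi>) + 2 * \<i> * z * complex_of_real (\<xi> \<bullet> \<eta>) - complex_of_real (\<eta> \<bullet> \<eta>)
          = - complex_of_real (u\<^sup>2 * (\<xi> \<bullet> \<xi>) + 2 * u * (\<xi> \<bullet> \<eta>) + \<eta> \<bullet> \<eta>)"
        by (simp add: z power_mult_distrib)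
      show ?thesis unfolding H_def m n of_real_divide of_real_numeral minus_divide_left ..
    qed
    finally show "G z - H z = 0" by simp
  qed (auto intro!: holomorphic_intros G H)
  then show ?thesis by (simp add: G_def H_def)
qed

section \<open>Exponentials of complex test vectors\<close>

abbreviation ctests :: "('a \<times> 'a) set" where "ctests \<equiv> tests \<times> tests"

definition ceval :: "'a \<times> 'a \<Rightarrow> ('a \<Rightarrow> real) \<Rightarrow> complex" where
  "ceval \<zeta> x = Complex (x (fst \<zeta>)) (x (snd \<zeta>))"

lemma ceval_alt: "ceval \<zeta> x = complex_of_real (x (fst \<zeta>)) + \<i> * complex_of_real (x (snd \<zeta>))"
  by (simp add: ceval_def complex_eq_iff)

lemma exp_fun_ceval: "exp_fun \<zeta> x = exp (ceval \<zeta> x) * exp (- cinner_bilinear \<zeta> \<zeta> / 2)"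
  by (simp add: exp_fun_def ceval_def mult_exp_exp)

lemma ceval_add: "\<zeta> \<in> ctests \<Longrightarrow> \<theta> \<in> ctests \<Longrightarrow> x \<in> duals \<Longrightarrow> ceval (\<zeta> + \<theta>) x = ceval \<zeta> x + ceval \<theta> x"
  by (auto simp: ceval_def dual_add complex_eq_iff)

lemma ctests_add [simp, intro]: "\<zeta> \<in> ctests \<Longrightarrow> \<theta> \<in> ctests \<Longrightarrow> \<zeta> + \<theta> \<in> ctests"
  by auto

lemma expbdd_exp_ceval: "\<zeta> \<in> ctests \<Longrightarrow> expbdd (\<lambda>x. exp (ceval \<zeta> x))"
  by (rule expbddI[of _ "[fst \<zeta>]" 1]) (auto simp: ceval_alt)

lemma integral_exp_ceval:
  assumes "\<zeta> \<in> ctests"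
  shows "(\<integral>x. exp (ceval \<zeta> x) \<partial>\<mu>) = exp (cinner_bilinear \<zeta> \<zeta> / 2)"
proof -
  have "(\<integral>x. exp (ceval \<zeta> x) \<partial>\<mu>) =
      exp ((complex_of_real (fst \<zeta> \<bullet> fst \<zeta>) + 2 * \<i> * complex_of_real (fst \<zeta> \<bullet> snd \<zeta>) - complex_of_real (snd \<zeta> \<bullet> snd \<zeta>)) / 2)"
    using mgf[of "fst \<zeta>" "snd \<zeta>" 1] assms by (auto simp: ceval_alt exp_add)
  also have "complex_of_real (fst \<zeta> \<bullet> fst \<zeta>) + 2 * \<i> * complex_of_real (fst \<zeta> \<bullet> snd \<zeta>) - complex_of_real (snd \<zeta> \<bullet> snd \<zeta>) = cinner_bilinear \<zeta> \<zeta>"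
    by (simp add: cinner_bilinear_def complex_eq_iff inner_commute)
  finally show ?thesis .
qed

lemma expbdd_exp_fun: "\<zeta> \<in> ctests \<Longrightarrow> expbdd (exp_fun \<zeta>)"
  unfolding exp_fun_ceval[abs_def] by (intro expbdd_mult expbdd_exp_ceval expbdd_const)

lemma integral_exp_fun: "\<zeta> \<in> ctests \<Longrightarrow> (\<integral>x. exp_fun \<zeta> x \<partial>\<mu>) = 1"
  using expbdd_integrable[OF expbdd_exp_ceval, of \<zeta>] exp_minus_inverse[of "cinner_bilinear \<zeta> \<zeta> / 2"]
  unfolding exp_fun_ceval by (simp add: integral_exp_ceval)

text \<open>The normalising exponents are quadratic in the vector, and the scalar factor is their
  polarisation. The product formulas below come from it.\<close>

lemma exp_fun_mult:
  assumes "\<zeta> \<in> ctests" "\<theta> \<in> ctests" "x \<in> duals"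
  shows "exp_fun \<zeta> x * exp_fun \<theta> x = exp (cinner_bilinear \<zeta> \<theta>) * exp_fun (\<zeta> + \<theta>) x"
proof -
  have "ceval \<zeta> x + - cinner_bilinear \<zeta> \<zeta> / 2 + (ceval \<theta> x + - cinner_bilinear \<theta> \<theta> / 2) =
      cinner_bilinear \<zeta> \<theta> + (ceval (\<zeta> + \<theta>) x + - cinner_bilinear (\<zeta> + \<theta>) (\<zeta> + \<theta>) / 2)"
    using assms
    by (simp add: ceval_add cb_add_left cb_add_right cb_commute[of \<theta> \<zeta>] field_simps)
  then show ?thesis unfolding exp_fun_ceval mult_exp_exp by simp
qed

lemma exp_fun_cnj:
  assumes "\<zeta> \<in> ctests" "x \<in> duals"
  shows "cnj (exp_fun \<zeta> x) = exp_fun (fst \<zeta>, - snd \<zeta>) x"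
proof -
  have "x (- snd \<zeta>) = - x (snd \<zeta>)" using assms dual_scaleR[of x "snd \<zeta>" "-1"] by auto
  then show ?thesis
    unfolding exp_fun_def exp_cnj
    by (intro arg_cong[where f=exp]) (simp add: cinner_bilinear_def complex_eq_iff)
qed

definition cdg :: "(nat \<Rightarrow> real) \<Rightarrow> 'a \<times> 'a \<Rightarrow> 'a \<times> 'a" where
  "cdg b \<zeta> = (dg b (fst \<zeta>), dg b (snd \<zeta>))"

lemma cdg_ctests [simp, intro]: "bounded_seq b \<Longrightarrow> \<zeta> \<in> ctests \<Longrightarrow> cdg b \<zeta> \<in> ctests"
  by (auto simp: cdg_def)

lemma cdg_cdg: "bounded_seq a \<Longrightarrow> bounded_seq b \<Longrightarrow> cdg a (cdg b \<zeta>) = cdg (\<lambda>n. a n * b n) \<zeta>"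
  by (simp add: cdg_def dg_dg)

lemma cdg_add: "bounded_seq b \<Longrightarrow> cdg b (\<zeta> + \<theta>) = cdg b \<zeta> + cdg b \<theta>"
  by (simp add: cdg_def dg_add)

lemma cb_cdg: "bounded_seq a \<Longrightarrow> bounded_seq b \<Longrightarrow>
    cinner_bilinear (cdg a \<zeta>) (cdg b \<theta>) = cinner_bilinear \<zeta> (cdg (\<lambda>n. a n * b n) \<theta>)"
  by (simp add: cinner_bilinear_def cdg_def inner_dg_left dg_dg)

lemma inner_dg_add:
  assumes "bounded_seq a" "bounded_seq b"
  shows "f \<bullet> dg (\<lambda>n. a n + b n) g = f \<bullet> dg a g + f \<bullet> dg b g"
proof -
  have "bounded_seq (\<lambda>n. a n + b n)"
  proof -
    obtain K L where "\<And>n. \<bar>a n\<bar> \<le> K" "\<And>n. \<bar>b n\<bar> \<le> L" using assms by (auto simp: bounded_seq_def)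
    then have "\<bar>a n + b n\<bar> \<le> K + L" for n
      using abs_triangle_ineq[of "a n" "b n"] by (meson add_mono order_trans)
    then show ?thesis by (rule bounded_seqI)
  qed
  then have "dg (\<lambda>n. a n + b n) g = dg a g + dg b g"
    using assms by (intro coeff_eqI) (simp add: inner_add_right distrib_right)
  then show ?thesis by (simp add: inner_add_right)
qed

lemma cb_cdg_add:
  assumes "bounded_seq a" "bounded_seq b"
  shows "cinner_bilinear \<zeta> (cdg (\<lambda>n. a n + b n) \<theta>) = cinner_bilinear \<zeta> (cdg a \<theta>) + cinner_bilinear \<zeta> (cdg b \<theta>)"
  by (simp add: cinner_bilinear_def cdg_def inner_dg_add[OF assms] complex_eq_iff)

lemma cdg_1 [simp]: "cdg (\<lambda>n. 1) \<zeta> = \<zeta>"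
  by (simp add: cdg_def)

subsection \<open>Gaussian rotations\<close>

lemma measurable_eval [measurable (raw)]:
  "f \<in> measurable N \<mu> \<Longrightarrow> \<xi> \<in> tests \<Longrightarrow> (\<lambda>\<omega>. f \<omega> \<xi>) \<in> borel_measurable N"
  using measurable_compose[OF _ eval_measurable] by blast

lemma measurable_dcomb [measurable (raw)]:
  assumes "f \<in> measurable N \<mu>" "g \<in> measurable N \<mu>" "bounded_seq a" "bounded_seq b"
  shows "(\<lambda>\<omega>. dcomb a b (f \<omega>) (g \<omega>)) \<in> measurable N \<mu>"
proof (rule measurable_mu)
  show "dcomb a b (f \<omega>) (g \<omega>) \<in> duals" if "\<omega> \<in> space N" for \<omega>
    using measurable_space[OF assms(1) that] measurable_space[OF assms(2) that] assms
    by (auto simp: space_mu)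
  show "(\<lambda>\<omega>. dcomb a b (f \<omega>) (g \<omega>) \<xi>) \<in> borel_measurable N" if "\<xi> \<in> tests" for \<xi>
    using assms that by (simp add: dcomb_apply) measurable
qed

text \<open>As the operators are diagonal, each eigenvector may be rotated by its own angle: the
  squared norms of \<open>dg a \<xi>\<close> and \<open>dg b \<xi>\<close> add up to that of \<xi>,
  so the two characteristic functionals multiply to that of \<mu>.\<close>

lemma distr_dcomb:
  assumes a: "bounded_seq a" and b: "bounded_seq b" and ab: "\<And>n. (a n)\<^sup>2 + (b n)\<^sup>2 = 1"
  shows "distr (\<mu> \<Otimes>\<^sub>M \<mu>) \<mu> (\<lambda>z. dcomb a b (fst z) (snd z)) = \<mu>"
proof (rule white_noise_law)
  interpret P: pair_prob_space \<mu> \<mu> ..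
  show "prob_space (\<mu> \<Otimes>\<^sub>M \<mu>)" by (rule P.prob_space_axioms)
  show "(\<lambda>z. dcomb a b (fst z) (snd z)) \<in> \<mu> \<Otimes>\<^sub>M \<mu> \<rightarrow>\<^sub>M \<mu>" using a b by measurable
  fix \<xi> assume \<xi>: "\<xi> \<in> tests"
  have i: "integrable \<mu> (\<lambda>x. exp (\<i> * complex_of_real (x \<eta>)))" if "\<eta> \<in> tests" for \<eta>
    using that by (intro integrable_const_bound[where B=1]) auto
  have "(\<integral>z. exp (\<i> * complex_of_real (dcomb a b (fst z) (snd z) \<xi>)) \<partial>(\<mu> \<Otimes>\<^sub>M \<mu>)) =
      (\<integral>z. exp (\<i> * complex_of_real (fst z (dg a \<xi>))) * exp (\<i> * complex_of_real (snd z (dg b \<xi>))) \<partial>(\<mu> \<Otimes>\<^sub>M \<mu>))"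
    by (simp add: dcomb_apply \<xi> mult_exp_exp distrib_left)
  also have "\<dots> = exp (- complex_of_real ((norm (dg a \<xi>))\<^sup>2 / 2)) * exp (- complex_of_real ((norm (dg b \<xi>))\<^sup>2 / 2))"
    using integral_product_of_pair(2)[OF prob_space_axioms i[OF tests_dg[OF a \<xi>]] i[OF tests_dg[OF b \<xi>]]]
      char_mu[OF tests_dg[OF a \<xi>]] char_mu[OF tests_dg[OF b \<xi>]] by simp
  also have "\<dots> = exp (- complex_of_real ((norm \<xi>)\<^sup>2 / 2))"
  proof -
    have "(norm (dg a \<xi>))\<^sup>2 + (norm (dg b \<xi>))\<^sup>2 = \<xi> \<bullet> dg (\<lambda>n. (a n)\<^sup>2 + (b n)\<^sup>2) \<xi>"
      using a b unfolding power2_norm_eq_inner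
      by (simp add: inner_dg_left dg_dg inner_dg_add power2_eq_square)
    then have "(norm \<xi>)\<^sup>2 = (norm (dg a \<xi>))\<^sup>2 + (norm (dg b \<xi>))\<^sup>2" by (simp add: ab power2_norm_eq_inner)
    then show ?thesis by (simp add: mult_exp_exp add_divide_distrib)
  qed
  finally show "(\<integral>z. exp (\<i> * complex_of_real (dcomb a b (fst z) (snd z) \<xi>)) \<partial>(\<mu> \<Otimes>\<^sub>M \<mu>)) = exp (- complex_of_real ((norm \<xi>)\<^sup>2 / 2))" .
qed

end

section \<open>Wick tensors and the Wiener--Ito expansion\<close>

text \<open>The product rule, written with one list position deleted so that it has the shape of the
  contraction sum in \<open>wick_tensor\<close>.\<close>

lemma DERIV_prod_list_affine:
  fixes a b :: "'b \<Rightarrow> complex"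
  shows "((\<lambda>s. \<Prod>i\<leftarrow>js. a i + s * b i) has_field_derivative
    (\<Sum>i<length js. b (js ! i) * (\<Prod>k\<leftarrow>take i js @ drop (Suc i) js. a k))) (at 0)"
proof (induction js)
  case (Cons j js)
  have "((\<lambda>s. (a j + s * b j) * (\<Prod>i\<leftarrow>js. a i + s * b i)) has_field_derivative
      b j * (\<Prod>k\<leftarrow>js. a k) + (\<Sum>i<length js. b (js ! i) * (\<Prod>k\<leftarrow>take i js @ drop (Suc i) js. a k)) * a j) (at 0)"
    by (rule derivative_eq_intros Cons | simp)+
  moreover have "(\<Sum>i<length (j # js). b ((j # js) ! i) * (\<Prod>k\<leftarrow>take i (j # js) @ drop (Suc i) (j # js). a k)) =
      b j * (\<Prod>k\<leftarrow>js. a k) + (\<Sum>i<length js. b (js ! i) * (\<Prod>k\<leftarrow>take i js @ drop (Suc i) js. a k)) * a j"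
    unfolding length_Cons by (subst sum.lessThan_Suc_shift) (simp add: sum_distrib_left sum_distrib_right mult_ac)
  ultimately show ?case by simp
qed simp

text \<open>The probabilists' Hermite polynomials. At n = 0 the truncated index n - 1 is harmless,
  because its term has the factor 0.\<close>

fun hermite :: "nat \<Rightarrow> real \<Rightarrow> real" where
  "hermite 0 y = 1"
| "hermite (Suc n) y = y * hermite n y - real n * hermite (n - 1) y"

text \<open>The Wick tensors on basis vectors in terms of occupation numbers, see
  \<open>wt_wick_mset\<close>. Symmetry in the indices is built in, and orthogonality becomes a
  statement about multisets.\<close>

definition wick_mset :: "(nat \<Rightarrow> 'a) \<Rightarrow> nat multiset \<Rightarrow> ('a \<Rightarrow> real) \<Rightarrow> real" where
  "wick_mset e A x = (\<Prod>k\<in>set_mset A. hermite (count A k) (x (e k)))"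

lemma wick_mset_superset:
  "finite K \<Longrightarrow> set_mset A \<subseteq> K \<Longrightarrow> wick_mset e A x = (\<Prod>k\<in>K. hermite (count A k) (x (e k)))"
  unfolding wick_mset_def by (rule prod.mono_neutral_left) (auto simp: not_in_iff)

lemma wick_mset_empty [simp]: "wick_mset e {#} x = 1"
  by (simp add: wick_mset_def)

lemma wick_mset_add:
  "wick_mset e (add_mset j A) x = x (e j) * wick_mset e A x - real (count A j) * wick_mset e (A - {#j#}) x"
proof -
  let ?K = "insert j (set_mset A)"
  let ?P = "\<Prod>k\<in>?K - {j}. hermite (count A k) (x (e k))"
  have s: "wick_mset e B x = hermite (count B j) (x (e j)) * (\<Prod>k\<in>?K - {j}. hermite (count B k) (x (e k)))"
    if "set_mset B \<subseteq> ?K" for B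
    using wick_mset_superset[of ?K B e x] that by (simp add: prod.remove[of ?K j])
  have 1: "wick_mset e (add_mset j A) x = hermite (Suc (count A j)) (x (e j)) * ?P"
    by (subst s) (auto intro!: prod.cong)
  have 2: "wick_mset e A x = hermite (count A j) (x (e j)) * ?P"
    by (rule s) auto
  have 3: "wick_mset e (A - {#j#}) x = hermite (count A j - 1) (x (e j)) * ?P"
    by (subst s) (auto intro!: prod.cong dest: in_diffD)
  show ?thesis unfolding 1 2 3 by (simp add: algebra_simps)
qed

lemma mset_take_drop:
  assumes "i < length js"
  shows "mset (take i js @ drop (Suc i) js) = mset js - {#js ! i#}"
proof -
  have "js = take i js @ js ! i # drop (Suc i) js" using assms by (rule id_take_nth_drop)
  then have "mset js = mset (take i js) + add_mset (js ! i) (mset (drop (Suc i) js))"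
    by (metis mset.simps(2) mset_append)
  then show ?thesis by simp
qed

text \<open>The product of the factorials of the occupation numbers; by
  \<open>wick_mset_orthogonal\<close> it is the squared L^2 norm of
  \<open>wick_mset e A\<close>.\<close>

definition mset_fact :: "nat multiset \<Rightarrow> nat" where
  "mset_fact A = (\<Prod>k\<in>set_mset A. fact (count A k))"

lemma mset_fact_empty [simp]: "mset_fact {#} = 1"
  by (simp add: mset_fact_def)

lemma mset_fact_add: "mset_fact (add_mset j A) = (count A j + 1) * mset_fact A"
proof -
  let ?K = "insert j (set_mset A)"
  have s: "mset_fact B = fact (count B j) * (\<Prod>k\<in>?K - {j}. fact (count B k))" if "set_mset B \<subseteq> ?K" for B
  proof -
    have "mset_fact B = (\<Prod>k\<in>?K. fact (count B k))"
      unfolding mset_fact_def using that by (intro prod.mono_neutral_left) (auto simp: not_in_iff)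
    then show ?thesis by (simp add: prod.remove[of ?K j])
  qed
  have "mset_fact (add_mset j A) = fact (Suc (count A j)) * (\<Prod>k\<in>?K - {j}. fact (count A k))"
    by (subst s) (auto intro!: prod.cong)
  moreover have "mset_fact A = fact (count A j) * (\<Prod>k\<in>?K - {j}. fact (count A k))"
    by (rule s) auto
  ultimately show ?thesis by (simp add: algebra_simps)
qed

lemma mset_fact_remove: "j \<in># A \<Longrightarrow> count A j * mset_fact (A - {#j#}) = mset_fact A"
  using mset_fact_add[of j "A - {#j#}"] by simp

text \<open>Orbit and stabiliser: the rearrangements of a list, times the permutations of positions
  that fix it. This reconciles sums over lists, in which kernels are written, with norms computed
  per multiset.\<close>

lemma mset_fact_card: "card {ks. mset ks = mset js} * mset_fact (mset js) = fact (length js)"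
  using card_permutations_of_multiset_aux[of "mset js"]
  by (simp add: mset_fact_def permutations_of_multiset_def)

context white_noise
begin

abbreviation wt :: "nat list \<Rightarrow> ('a \<Rightarrow> real) \<Rightarrow> real" where
  "wt js x \<equiv> wick_tensor x (map e js)"

lemma wt_Cons:
  "wt (j # js) x = x (e j) * wt js x
    - (\<Sum>i<length js. (if j = js ! i then 1 else 0) * wt (take i js @ drop (Suc i) js) x)"
  by (auto intro!: sum.cong simp: e_inner take_map drop_map)

text \<open>A contraction with the first index is 1 exactly at the positions that carry the same
  index. By the induction hypothesis these \<open>count\<close> many terms coincide, and what is
  left is the Hermite recursion in that one index.\<close>

lemma wt_wick_mset: "wt js x = wick_mset e (mset js) x"
proof (induction js rule: measure_induct_rule[of length])
  case (less js)
  show ?case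
  proof (cases js)
    case (Cons j ks)
    have "(\<Sum>i<length ks. (if j = ks ! i then 1 else 0) * wt (take i ks @ drop (Suc i) ks) x)
        = (\<Sum>i<length ks. (if j = ks ! i then 1 else 0) * wick_mset e (mset ks - {#j#}) x)"
      by (intro sum.cong refl) (use less[of "take _ ks @ drop (Suc _) ks"] in
          \<open>auto simp: Cons mset_take_drop simp del: mset_append map_append\<close>)
    also have "\<dots> = real (count (mset ks) j) * wick_mset e (mset ks - {#j#}) x"
    proof -
      have "(\<Sum>i<length ks. if j = ks ! i then 1 else 0) = real (card {i. i < length ks \<and> j = ks ! i})"
        by (simp add: sum.If_cases Int_def)
      also have "card {i. i < length ks \<and> j = ks ! i} = count (mset ks) j"
        by (simp add: count_mset length_filter_conv_card count_list_eq_length_filter)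
      finally show ?thesis by (simp add: sum_distrib_right[symmetric])
    qed
    finally show ?thesis
      using less[of ks] by (simp add: Cons wt_Cons wick_mset_add del: wick_tensor.simps list.map)
  qed simp
qed

lemma expbdd_wick_mset: "expbdd (\<lambda>x. complex_of_real (wick_mset e A x))"
proof -
  have "expbdd (\<lambda>x. complex_of_real (hermite n (x (e k))))" for n k
  proof (induction n rule: less_induct)
    case (less n)
    show ?case
    proof (cases n)
      case 0
      then show ?thesis by (simp add: expbdd_const)
    next
      case (Suc m)
      have "expbdd (\<lambda>x. complex_of_real (x (e k)) * complex_of_real (hermite m (x (e k)))
          + (- complex_of_real (real m)) * complex_of_real (hermite (m - 1) (x (e k))))"
        using less Suc by (intro expbdd_add expbdd_mult expbdd_eval expbdd_const) auto
      then show ?thesis by (simp add: Suc)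
    qed
  qed
  note hermite = this
  have "expbdd (\<lambda>x. \<Prod>k\<in>K. complex_of_real (hermite (count A k) (x (e k))))" if "finite K" for K
    using that by (induction K rule: finite_induct) (auto intro: expbdd_const expbdd_mult hermite)
  then show ?thesis by (simp add: wick_mset_def)
qed

lemma expbdd_wt: "expbdd (\<lambda>x. complex_of_real (wt js x))"
  by (simp add: wt_wick_mset expbdd_wick_mset)

definition ccoeff :: "'a \<times> 'a \<Rightarrow> nat \<Rightarrow> complex" where
  "ccoeff \<zeta> j = Complex (e j \<bullet> fst \<zeta>) (e j \<bullet> snd \<zeta>)"

text \<open>Multiplication by exp (s x_j) moves \<zeta> by s e_j, up to an explicit scalar. It
  permits differentiation in the direction e_j without leaving the exponential functions.\<close>

lemma exp_fun_shift:
  assumes "\<zeta> \<in> ctests" "x \<in> duals"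
  shows "exp_fun \<zeta> x * exp (complex_of_real (s * x (e j))) =
    exp (complex_of_real s * ccoeff \<zeta> j + complex_of_real (s\<^sup>2 / 2)) * exp_fun (\<zeta> + (s *\<^sub>R e j, 0)) x"
proof -
  let ?\<theta> = "(s *\<^sub>R e j, 0)"
  have \<theta>: "?\<theta> \<in> ctests" by auto
  have "exp_fun ?\<theta> x = exp (complex_of_real (s * x (e j)) - complex_of_real (s\<^sup>2 / 2))"
    using assms unfolding exp_fun_def
    by (intro arg_cong[where f=exp]) (simp add: cinner_bilinear_def complex_eq_iff dual_scaleR e_inner power2_eq_square)
  then have "exp (complex_of_real (s * x (e j))) = exp_fun ?\<theta> x * exp (complex_of_real (s\<^sup>2 / 2))"
    by (simp add: exp_diff)
  moreover have "cinner_bilinear \<zeta> ?\<theta> = complex_of_real s * ccoeff \<zeta> j"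
    by (simp add: cinner_bilinear_def ccoeff_def complex_eq_iff inner_commute)
  ultimately show ?thesis
    using exp_fun_mult[OF assms(1) \<theta> assms(2)] by (simp add: exp_add mult_ac)
qed

text \<open>Differentiating the formula for \<open>js\<close> at \<open>\<zeta> + s e\<^sub>j\<close> gives the formula for \<open>j # js\<close>,
  because the derivative of the product cancels the contractions in the recursion.\<close>

lemma integral_wt_exp_fun:
  assumes "\<zeta> \<in> ctests"
  shows "(\<integral>x. complex_of_real (wt js x) * exp_fun \<zeta> x \<partial>\<mu>) = (\<Prod>j\<leftarrow>js. ccoeff \<zeta> j)"
  using assms
proof (induction js arbitrary: \<zeta> rule: measure_induct_rule[of length])
  case (less js \<zeta>)
  note \<zeta> = \<open>\<zeta> \<in> ctests\<close>
  show ?case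
  proof (cases js)
    case Nil
    then show ?thesis using integral_exp_fun[OF \<zeta>] by simp
  next
    case (Cons j ks)
    let ?W = "\<lambda>x. complex_of_real (wt ks x) * exp_fun \<zeta> x"
    let ?D = "\<Sum>i<length ks. (if j = ks ! i then 1 else 0) * (\<Prod>k\<leftarrow>take i ks @ drop (Suc i) ks. ccoeff \<zeta> k)"
    define s where "s n = 1 / real (Suc n)" for n
    have s: "s \<longlonglongrightarrow> 0" "\<And>n. 0 < s n" "\<And>n. s n \<le> 1"
      unfolding s_def using LIMSEQ_Suc[OF lim_1_over_n] by auto
    have W: "expbdd ?W" by (intro expbdd_mult expbdd_wt expbdd_exp_fun \<zeta>)
    have EW: "(\<integral>x. complex_of_real (wt ks x) * exp_fun \<zeta> x \<partial>\<mu>) = (\<Prod>j\<leftarrow>ks. ccoeff \<zeta> j)" if "\<zeta> \<in> ctests" for \<zeta>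
      using less.IH[of ks \<zeta>] that Cons by simp
    \<comment> \<open>A difference quotient: pointwise it tends to \<open>?W\<close> times x_j, the
      leading term of the recursion, while its integral is known from the induction hypothesis at
      \<zeta> and at \<zeta> + s e_j.\<close>
    define Q where "Q n x = ?W x * complex_of_real ((exp (s n * x (e j)) - 1) / s n)" for n x
    have Wm[measurable]: "?W \<in> borel_measurable \<mu>" using W by (rule expbdd_measurable)
    have [measurable]: "(\<lambda>x. x (e j)) \<in> borel_measurable \<mu>" by (rule eval_measurable) auto
    have "(\<lambda>n. \<integral>x. Q n x \<partial>\<mu>) \<longlonglongrightarrow> (\<integral>x. ?W x * complex_of_real (x (e j)) \<partial>\<mu>)"
    proof (rule integral_dominated_convergence[where w="\<lambda>x. cmod (?W x) * (ew [e j, e j] x)"])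
      have "expbdd (\<lambda>x. complex_of_real (cmod (?W x)) * complex_of_real (ew [e j, e j] x))"
      proof (rule expbdd_mult[OF expbdd_norm[OF W]])
        show "expbdd (\<lambda>x. complex_of_real (ew [e j, e j] x))"
        proof (rule expbddI[of _ "[e j, e j]" 1])
          show "cmod (complex_of_real (ew [e j, e j] x)) \<le> 1 * ew [e j, e j] x" for x
            using ew_pos(2)[of "[e j, e j]" x] by (simp del: ew_Cons)
          show "(\<lambda>x. complex_of_real (ew [e j, e j] x)) \<in> borel_measurable \<mu>"
            by (rule measurable_compose[OF _ borel_measurable_of_real]) (rule ew_measurable, auto)
        qed auto
      qed
      then show "integrable \<mu> (\<lambda>x. cmod (?W x) * (ew [e j, e j] x))"
        unfolding of_real_mult[symmetric]
        by (rule complex_of_real_integrable_eq[THEN iffD1, OF expbdd_integrable])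
      show "AE x in \<mu>. (\<lambda>n. Q n x) \<longlonglongrightarrow> ?W x * complex_of_real (x (e j))"
      proof (rule AE_I2)
        fix x
        have "((\<lambda>u. exp (u * x (e j))) has_real_derivative exp (0 * x (e j)) * x (e j)) (at 0)"
          by (auto intro!: derivative_eq_intros)
        then have "((\<lambda>u. (exp (u * x (e j)) - 1) / u) \<longlongrightarrow> x (e j)) (at 0)"
          by (simp add: has_field_derivative_iff)
        moreover have "filterlim s (at 0) sequentially"
          using s(1) by (intro filterlim_atI) (auto intro: less_imp_neq[symmetric] s(2) simp: s(2) less_imp_neq[OF s(2), symmetric])
        ultimately have "(\<lambda>n. (exp (s n * x (e j)) - 1) / s n) \<longlonglongrightarrow> x (e j)"
          by (rule filterlim_compose)
        then show "(\<lambda>n. Q n x) \<longlonglongrightarrow> ?W x * complex_of_real (x (e j))"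
          unfolding Q_def by (intro tendsto_intros)
      qed
      show "(\<lambda>x. ?W x * complex_of_real (x (e j))) \<in> borel_measurable \<mu>" by measurable
      show "Q n \<in> borel_measurable \<mu>" for n unfolding Q_def by measurable
      fix n
      \<comment> \<open>Because 0 < s n <= 1, the quotient is at most |y| exp |y|; one factor 2 cosh
        y absorbs |y| and the other one the exponential.\<close>
      have bd: "\<bar>(exp (s n * y) - 1) / s n\<bar> \<le> (exp y + exp (- y)) * (exp y + exp (- y))" for y
      proof -
        have "\<bar>exp (s n * y) - 1\<bar> \<le> \<bar>s n * y\<bar> * (exp y + exp (- y))"
        proof -
          obtain \<tau> where \<tau>: "\<bar>\<tau>\<bar> \<le> \<bar>s n * y\<bar>" "exp (s n * y) = (\<Sum>m<1. (s n * y) ^ m / fact m) + exp \<tau> / fact 1 * (s n * y) ^ 1"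
            using Maclaurin_exp_le[of "s n * y" 1] by blast
          have "\<bar>s n * y\<bar> \<le> \<bar>y\<bar>" using s(2)[of n] s(3)[of n] by (simp add: abs_mult mult_left_le_one_le)
          then have "\<tau> \<le> \<bar>y\<bar>" using \<tau>(1) by linarith
          then have "exp \<tau> \<le> exp \<bar>y\<bar>" by simp
          also have "\<dots> \<le> exp y + exp (- y)" by (cases "y \<ge> 0") auto
          finally have "\<bar>s n * y\<bar> * exp \<tau> \<le> \<bar>s n * y\<bar> * (exp y + exp (- y))" by (intro mult_left_mono) auto
          then show ?thesis using \<tau>(2) by (simp add: abs_mult mult_ac)
        qed
        also have "\<dots> = s n * (\<bar>y\<bar> * (exp y + exp (- y)))" using s(2)[of n] by (simp add: abs_mult)
        finally have "\<bar>(exp (s n * y) - 1) / s n\<bar> \<le> \<bar>y\<bar> * (exp y + exp (- y))"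
          using s(2)[of n] by (simp add: abs_divide divide_le_eq mult_ac)
        also have "\<dots> \<le> (exp y + exp (- y)) * (exp y + exp (- y))"
          using exp_plus_exp_ge(2)[of y] by (intro mult_right_mono) (auto simp: add_nonneg_nonneg)
        finally show ?thesis .
      qed
      show "AE x in \<mu>. norm (Q n x) \<le> cmod (?W x) * (ew [e j, e j] x)"
        unfolding Q_def norm_mult norm_of_real using bd
        by (intro AE_I2 mult_left_mono) auto
    qed
    moreover have "(\<integral>x. Q n x \<partial>\<mu>) = (exp (complex_of_real (s n) * ccoeff \<zeta> j + complex_of_real ((s n)\<^sup>2 / 2)) *
        (\<Prod>i\<leftarrow>ks. ccoeff \<zeta> i + complex_of_real (s n) * (if j = i then 1 else 0)) - (\<Prod>i\<leftarrow>ks. ccoeff \<zeta> i)) / complex_of_real (s n)" for n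
    proof -
      let ?\<theta> = "\<zeta> + (s n *\<^sub>R e j, 0)"
      let ?c = "exp (complex_of_real (s n) * ccoeff \<zeta> j + complex_of_real ((s n)\<^sup>2 / 2))"
      have \<theta>: "?\<theta> \<in> ctests" using \<zeta> by (intro ctests_add) auto
      have cc: "ccoeff ?\<theta> i = ccoeff \<zeta> i + complex_of_real (s n) * (if j = i then 1 else 0)" for i
        by (simp add: ccoeff_def inner_add_right e_inner complex_eq_iff)
      have "(\<integral>x. Q n x \<partial>\<mu>) = (\<integral>x. (?c * (complex_of_real (wt ks x) * exp_fun ?\<theta> x) - ?W x) / complex_of_real (s n) \<partial>\<mu>)"
      proof (intro Bochner_Integration.integral_cong refl)
        fix x assume "x \<in> space \<mu>"
        then have x: "x \<in> duals" by (simp add: space_mu)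
        have "Q n x = (complex_of_real (wt ks x) * (exp_fun \<zeta> x * exp (complex_of_real (s n * x (e j)))) - ?W x) / complex_of_real (s n)"
          unfolding Q_def of_real_divide of_real_diff of_real_1 exp_of_real[symmetric]
          by (simp add: algebra_simps)
        then show "Q n x = (?c * (complex_of_real (wt ks x) * exp_fun ?\<theta> x) - ?W x) / complex_of_real (s n)"
          unfolding exp_fun_shift[OF \<zeta> x] by (simp only: mult_ac)
      qed
      also have "\<dots> = (?c * (\<integral>x. complex_of_real (wt ks x) * exp_fun ?\<theta> x \<partial>\<mu>) - (\<integral>x. ?W x \<partial>\<mu>)) / complex_of_real (s n)"
        using expbdd_integrable[OF expbdd_mult[OF expbdd_wt expbdd_exp_fun[OF \<theta>]], of ks] expbdd_integrable[OF W] by simp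
      finally show ?thesis unfolding EW[OF \<theta>] EW[OF \<zeta>] cc .
    qed
    moreover have "(\<lambda>n. (exp (complex_of_real (s n) * ccoeff \<zeta> j + complex_of_real ((s n)\<^sup>2 / 2)) *
        (\<Prod>i\<leftarrow>ks. ccoeff \<zeta> i + complex_of_real (s n) * (if j = i then 1 else 0)) - (\<Prod>i\<leftarrow>ks. ccoeff \<zeta> i)) / complex_of_real (s n))
        \<longlonglongrightarrow> ccoeff \<zeta> j * (\<Prod>i\<leftarrow>ks. ccoeff \<zeta> i) + ?D"
    proof -
      let ?f = "\<lambda>u. exp (u * ccoeff \<zeta> j + u\<^sup>2 / 2) * (\<Prod>i\<leftarrow>ks. ccoeff \<zeta> i + u * (if j = i then 1 else 0))"
      have "((\<lambda>u. exp (u * ccoeff \<zeta> j + u\<^sup>2 / 2)) has_field_derivative ccoeff \<zeta> j) (at 0)"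
        by (auto intro!: derivative_eq_intros)
      from DERIV_mult[OF this DERIV_prod_list_affine[of "ccoeff \<zeta>" "\<lambda>i. if j = i then 1 else 0" ks]]
      have "(?f has_field_derivative ccoeff \<zeta> j * (\<Prod>i\<leftarrow>ks. ccoeff \<zeta> i) + ?D) (at 0)"
        by simp
      then have "((\<lambda>u. (?f u - (\<Prod>i\<leftarrow>ks. ccoeff \<zeta> i)) / u) \<longlongrightarrow> ccoeff \<zeta> j * (\<Prod>i\<leftarrow>ks. ccoeff \<zeta> i) + ?D) (at 0)"
        by (simp add: has_field_derivative_iff)
      moreover have "filterlim (\<lambda>n. complex_of_real (s n)) (at 0) sequentially"
        using tendsto_of_real[OF s(1)] s(2) by (intro filterlim_atI) (auto simp: less_imp_neq[OF s(2), symmetric])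
      ultimately have "(\<lambda>n. (?f (complex_of_real (s n)) - (\<Prod>i\<leftarrow>ks. ccoeff \<zeta> i)) / complex_of_real (s n))
          \<longlonglongrightarrow> ccoeff \<zeta> j * (\<Prod>i\<leftarrow>ks. ccoeff \<zeta> i) + ?D" by (rule filterlim_compose)
      then show ?thesis by simp
    qed
    ultimately have lim: "(\<integral>x. ?W x * complex_of_real (x (e j)) \<partial>\<mu>) = ccoeff \<zeta> j * (\<Prod>i\<leftarrow>ks. ccoeff \<zeta> i) + ?D"
      by (simp only: LIMSEQ_unique)
    have i1: "integrable \<mu> (\<lambda>x. ?W x * complex_of_real (x (e j)))"
      by (intro expbdd_integrable expbdd_mult[OF W] expbdd_eval) auto
    have i2: "integrable \<mu> (\<lambda>x. complex_of_real (wt l x) * exp_fun \<zeta> x)" for l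
      by (intro expbdd_integrable expbdd_mult expbdd_wt expbdd_exp_fun \<zeta>)
    have of_real_delta: "complex_of_real (if P then 1 else 0) = (if P then 1 else 0)" for P by simp
    have "(\<integral>x. complex_of_real (wt js x) * exp_fun \<zeta> x \<partial>\<mu>) = (\<integral>x. ?W x * complex_of_real (x (e j))
        - (\<Sum>i<length ks. (if j = ks ! i then 1 else 0) * (complex_of_real (wt (take i ks @ drop (Suc i) ks) x) * exp_fun \<zeta> x)) \<partial>\<mu>)"
      unfolding Cons wt_Cons
      by (intro Bochner_Integration.integral_cong refl)
        (simp only: of_real_diff of_real_mult of_real_sum of_real_delta right_diff_distrib sum_distrib_left mult_ac)
    also have "\<dots> = (\<integral>x. ?W x * complex_of_real (x (e j)) \<partial>\<mu>)
        - (\<Sum>i<length ks. (if j = ks ! i then 1 else 0) * (\<integral>x. complex_of_real (wt (take i ks @ drop (Suc i) ks) x) * exp_fun \<zeta> x \<partial>\<mu>))"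
      by (subst Bochner_Integration.integral_diff[OF i1])
        (simp_all add: Bochner_Integration.integral_sum Bochner_Integration.integrable_sum integrable_mult_right i2 del: map_append)
    also have "(\<Sum>i<length ks. (if j = ks ! i then 1 else 0) * (\<integral>x. complex_of_real (wt (take i ks @ drop (Suc i) ks) x) * exp_fun \<zeta> x \<partial>\<mu>)) = ?D"
      by (intro sum.cong refl arg_cong2[where f="(*)"] less.IH \<zeta>) (auto simp: Cons)
    finally show ?thesis using lim by (simp add: Cons)
  qed
qed

text \<open>Pairing with the exponential function of the vector 0, which is the constant 1 on the
  dual space; each index in \<open>A\<close> contributes a coefficient 0.\<close>

lemma integral_wick_mset: "(\<integral>x. wick_mset e A x \<partial>\<mu>) = (if A = {#} then 1 else 0)"
proof -
  obtain js where js: "mset js = A" using ex_mset by blast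
  have "exp_fun (0, 0) x = 1" if "x \<in> duals" for x
    using that by (simp add: exp_fun_def cinner_bilinear_def zero_complex.code[symmetric])
  then have "(\<integral>x. complex_of_real (wick_mset e A x) \<partial>\<mu>) = (\<integral>x. complex_of_real (wt js x) * exp_fun (0, 0) x \<partial>\<mu>)"
    by (intro Bochner_Integration.integral_cong refl) (simp add: wt_wick_mset js space_mu)
  also have "\<dots> = (\<Prod>j\<leftarrow>js. ccoeff (0, 0) j)" by (rule integral_wt_exp_fun) auto
  also have "\<dots> = complex_of_real (if A = {#} then 1 else 0)"
    using js by (cases js) (auto simp: ccoeff_def zero_complex.code[symmetric])
  finally show ?thesis unfolding integral_complex_of_real of_real_eq_iff .
qed

section \<open>Orthogonality of the Wick polynomials\<close>

lemma integrable_wick_mset_mult: "integrable \<mu> (\<lambda>x. wick_mset e A x * wick_mset e B x)"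
  using expbdd_integrable[OF expbdd_mult[OF expbdd_wick_mset expbdd_wick_mset], of A B]
  unfolding of_real_mult[symmetric] complex_of_real_integrable_eq .

text \<open>Expanding \<open>x\<^sub>j W\<^sub>A W\<^sub>B\<close> in two ways relates the four neighbouring inner products.\<close>

lemma wick_mset_three_term:
  "(\<integral>x. wick_mset e (add_mset j A) x * wick_mset e B x \<partial>\<mu>) +
     real (count A j) * (\<integral>x. wick_mset e (A - {#j#}) x * wick_mset e B x \<partial>\<mu>) =
   (\<integral>x. wick_mset e A x * wick_mset e (add_mset j B) x \<partial>\<mu>) +
     real (count B j) * (\<integral>x. wick_mset e A x * wick_mset e (B - {#j#}) x \<partial>\<mu>)"
proof -
  have "(\<integral>x. wick_mset e (add_mset j A) x * wick_mset e B x + real (count A j) * (wick_mset e (A - {#j#}) x * wick_mset e B x) \<partial>\<mu>) =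
    (\<integral>x. wick_mset e A x * wick_mset e (add_mset j B) x + real (count B j) * (wick_mset e A x * wick_mset e (B - {#j#}) x) \<partial>\<mu>)"
    by (intro Bochner_Integration.integral_cong refl) (simp add: wick_mset_add algebra_simps)
  then show ?thesis by (simp add: integrable_wick_mset_mult)
qed

text \<open>With A = M + {j} the three-term identity moves \<open>j\<close> from A to B. By
  induction the second term on its left and the first term on its right are both
  \<open>mset_fact M\<close> if M = B + {j} and 0 otherwise, so they cancel. What remains is the
  removal of \<open>j\<close> from B.\<close>

lemma wick_mset_orthogonal:
  "(\<integral>x. wick_mset e A x * wick_mset e B x \<partial>\<mu>) = (if A = B then real (mset_fact A) else 0)"
proof (induction A arbitrary: B rule: measure_induct_rule[of size])
  case (less A B)
  show ?case
  proof (cases A)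
    case empty
    then show ?thesis using integral_wick_mset[of B] by auto
  next
    case (add j M)
    have sM: "size M < size A" using add by simp
    have rem: "real (count M j) * (\<integral>x. wick_mset e (M - {#j#}) x * wick_mset e B x \<partial>\<mu>) =
        (if M = add_mset j B then real (mset_fact M) else 0)"
    proof (cases "j \<in># M")
      case True
      then have "size (M - {#j#}) < size A" using sM by (simp add: size_Diff_singleton)
      moreover have "M - {#j#} = B \<longleftrightarrow> M = add_mset j B" using True by (metis add_mset_remove_trivial insert_DiffM)
      moreover have "real (count M j) * real (mset_fact (M - {#j#})) = real (mset_fact M)"
        by (metis mset_fact_remove[OF True] of_nat_mult)
      ultimately show ?thesis using less[of "M - {#j#}" B] by auto
    next
      case False
      then show ?thesis by (auto simp: not_in_iff)
    qed
    have rem2: "real (count B j) * (\<integral>x. wick_mset e M x * wick_mset e (B - {#j#}) x \<partial>\<mu>) =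
        (if A = B then real (mset_fact A) else 0)"
    proof (cases "j \<in># B")
      case True
      have "M = B - {#j#} \<longleftrightarrow> A = B" using True add by (metis add_mset_remove_trivial insert_DiffM)
      moreover have "real (count B j) * real (mset_fact (B - {#j#})) = real (mset_fact B)"
        by (metis mset_fact_remove[OF True] of_nat_mult)
      ultimately show ?thesis using less[OF sM, of "B - {#j#}"] by auto
    next
      case False
      then have "count B j = 0" "A \<noteq> B" using add by (auto simp: not_in_iff)
      then show ?thesis by simp
    qed
    show ?thesis
      using wick_mset_three_term[of j M B] rem rem2 less[OF sM, of "add_mset j B"]
      by (simp add: add)
  qed
qed

end

lemma Lp2_mult:
  assumes f: "Lp M 2 f" and g: "Lp M 2 g"
  shows "integrable M (\<lambda>x. f x * g x)" "cmod (\<integral>x. f x * g x \<partial>M) \<le> Lp_norm M 2 f * Lp_norm M 2 g"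
proof -
  have [measurable]: "f \<in> borel_measurable M" "g \<in> borel_measurable M" using f g by (auto simp: Lp_def)
  have i: "integrable M (\<lambda>x. (cmod (f x))\<^sup>2)" "integrable M (\<lambda>x. (cmod (g x))\<^sup>2)"
    using f g by (auto simp: Lp_def)
  show int: "integrable M (\<lambda>x. f x * g x)"
  proof (rule Bochner_Integration.integrable_bound)
    show "integrable M (\<lambda>x. (cmod (f x))\<^sup>2 + (cmod (g x))\<^sup>2)" using i by auto
    show "AE x in M. norm (f x * g x) \<le> norm ((cmod (f x))\<^sup>2 + (cmod (g x))\<^sup>2)"
    proof (rule AE_I2)
      fix x
      have "2 * (cmod (f x) * cmod (g x)) \<le> (cmod (f x))\<^sup>2 + (cmod (g x))\<^sup>2"
        using sum_squares_bound[of "cmod (f x)" "cmod (g x)"] by simp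
      moreover have "0 \<le> cmod (f x) * cmod (g x)" by simp
      ultimately have "cmod (f x) * cmod (g x) \<le> (cmod (f x))\<^sup>2 + (cmod (g x))\<^sup>2" by linarith
      then show "norm (f x * g x) \<le> norm ((cmod (f x))\<^sup>2 + (cmod (g x))\<^sup>2)" by (simp add: norm_mult)
    qed
  qed measurable
  define A B where "A = Lp_norm M 2 f" and "B = Lp_norm M 2 g"
  have A2: "(\<integral>x. (cmod (f x))\<^sup>2 \<partial>M) = A\<^sup>2" and B2: "(\<integral>x. (cmod (g x))\<^sup>2 \<partial>M) = B\<^sup>2"
    using Lp_norm_powr[of 2 M f] Lp_norm_powr[of 2 M g] by (simp_all add: A_def B_def)
  have AB: "0 \<le> A" "0 \<le> B" by (simp_all add: A_def B_def)
  \<comment> \<open>A positive \<delta> keeps both normalising constants \<open>a\<close> and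
    \<open>b\<close> positive; it tends to 0 at the end.\<close>
  have "cmod (\<integral>x. f x * g x \<partial>M) \<le> (A + \<delta>) * (B + \<delta>)" if \<delta>: "0 < \<delta>" for \<delta>
  proof -
    define a b where "a = A + \<delta>" and "b = B + \<delta>"
    have ab: "0 < a" "0 < b" "A\<^sup>2 \<le> a\<^sup>2" "B\<^sup>2 \<le> b\<^sup>2" using AB \<delta> by (auto simp: a_def b_def intro!: power_mono)
    have "cmod (\<integral>x. f x * g x \<partial>M) \<le> (\<integral>x. cmod (f x * g x) \<partial>M)" by (rule integral_norm_bound)
    also have "\<dots> \<le> (\<integral>x. (a * b / 2) * ((cmod (f x))\<^sup>2 / a\<^sup>2 + (cmod (g x))\<^sup>2 / b\<^sup>2) \<partial>M)"
    proof (rule integral_mono)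
      fix x
      have "2 * (cmod (f x) / a) * (cmod (g x) / b) \<le> (cmod (f x) / a)\<^sup>2 + (cmod (g x) / b)\<^sup>2"
        by (rule sum_squares_bound)
      then have "(a * b / 2) * (2 * (cmod (f x) / a) * (cmod (g x) / b)) \<le> (a * b / 2) * ((cmod (f x) / a)\<^sup>2 + (cmod (g x) / b)\<^sup>2)"
        using ab by (intro mult_left_mono) auto
      then show "cmod (f x * g x) \<le> (a * b / 2) * ((cmod (f x))\<^sup>2 / a\<^sup>2 + (cmod (g x))\<^sup>2 / b\<^sup>2)"
        using ab by (simp add: norm_mult power_divide)
    qed (use int i in auto)
    also have "\<dots> = (a * b / 2) * (A\<^sup>2 / a\<^sup>2 + B\<^sup>2 / b\<^sup>2)" using i by (simp add: A2 B2)
    also have "\<dots> \<le> (a * b / 2) * (1 + 1)"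
      using ab by (intro mult_left_mono add_mono) (auto simp: divide_le_eq_1)
    finally show ?thesis by (simp add: a_def b_def)
  qed
  then have *: "\<forall>\<^sub>F \<delta> in at_right 0. cmod (\<integral>x. f x * g x \<partial>M) \<le> (A + \<delta>) * (B + \<delta>)"
    by (auto simp: eventually_at_right_less intro: eventually_at_rightI[of 0 1])
  have "((\<lambda>\<delta>. (A + \<delta>) * (B + \<delta>)) \<longlongrightarrow> (A + 0) * (B + 0)) (at_right 0)"
    by (intro tendsto_intros)
  from tendsto_lowerbound[OF this *]
  show "cmod (\<integral>x. f x * g x \<partial>M) \<le> Lp_norm M 2 f * Lp_norm M 2 g"
    by (simp add: A_def B_def)
qed

lemma sum_power_lists:
  fixes w :: "nat \<Rightarrow> real"
  shows "(\<Sum>js | length js = n \<and> set js \<subseteq> {..<m}. \<Prod>j\<leftarrow>js. w j) = (\<Sum>j<m. w j) ^ n"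
proof (induction n)
  case 0
  have "{js. length js = 0 \<and> set js \<subseteq> {..<m}} = {[]}" by auto
  then show ?case by simp
next
  case (Suc n)
  let ?L = "\<lambda>n. {js. length js = n \<and> set js \<subseteq> {..<m}}"
  have "?L (Suc n) = (\<lambda>(j, js). j # js) ` ({..<m} \<times> ?L n)"
    by (auto simp: length_Suc_conv image_iff)
  then have "(\<Sum>js\<in>?L (Suc n). \<Prod>j\<leftarrow>js. w j) = (\<Sum>(j, js)\<in>{..<m} \<times> ?L n. w j * (\<Prod>j\<leftarrow>js. w j))"
    by (simp add: sum.reindex inj_on_def split_def)
  also have "\<dots> = (\<Sum>j<m. w j) * (\<Sum>js\<in>?L n. \<Prod>j\<leftarrow>js. w j)"
    by (simp add: sum.cartesian_product[symmetric] sum_product)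
  finally show ?case using Suc by simp
qed

context white_noise
begin

section \<open>Kernels, their uniqueness, and second quantization\<close>

lemma integral_wt_wt:
  "(\<integral>x. complex_of_real (wt js x) * complex_of_real (wt ks x) \<partial>\<mu>) =
    (if mset js = mset ks then complex_of_real (real (mset_fact (mset js))) else 0)"
  unfolding of_real_mult[symmetric] integral_complex_of_real
  by (simp add: wt_wick_mset wick_mset_orthogonal)

definition wick_sum :: "nat list set \<Rightarrow> (nat list \<Rightarrow> complex) \<Rightarrow> ('a \<Rightarrow> real) \<Rightarrow> complex" where
  "wick_sum J f x = (\<Sum>js\<in>J. f js * complex_of_real (wt js x))"

lemma wiener_ito_alt: "wiener_ito e \<mu> \<phi> f \<longleftrightarrow>
     (\<forall>js ks. mset js = mset ks \<longrightarrow> f js = f ks) \<and>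
     (\<lambda>js. fact (length js) * (cmod (f js))\<^sup>2) summable_on UNIV \<and>
     Lp_tendsto \<mu> 2 (\<lambda>J. wick_sum J f) \<phi> (finite_subsets_at_top UNIV)"
  unfolding wiener_ito_def wick_sum_def[abs_def] ..

lemma wiener_ito_tendsto:
    "wiener_ito e \<mu> \<phi> f \<Longrightarrow> Lp_tendsto \<mu> 2 (\<lambda>J. wick_sum J f) \<phi> (finite_subsets_at_top UNIV)"
  and wiener_ito_summable:
    "wiener_ito e \<mu> \<phi> f \<Longrightarrow> (\<lambda>js. fact (length js) * (cmod (f js))\<^sup>2) summable_on UNIV"
  and wiener_ito_sym: "wiener_ito e \<mu> \<phi> f \<Longrightarrow> mset js = mset ks \<Longrightarrow> f js = f ks"
  unfolding wiener_ito_alt by blast+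

lemma expbdd_wick_sum: "finite J \<Longrightarrow> expbdd (wick_sum J f)"
  unfolding wick_sum_def[abs_def] by (intro expbdd_sum expbdd_cmult expbdd_wt)

text \<open>Once \<open>J\<close> contains all rearrangements of \<open>ks\<close>, the pairing of
  its partial sum with \<open>wt ks\<close> no longer changes: each rearrangement contributes
  \<open>mset_fact\<close>, and their number completes this to the factorial. The L^2 limit keeps
  the value. Hence kernels are unique, and on this the meaning of \<open>Gamma\<close>
  rests.\<close>

lemma wiener_ito_coeff:
  assumes "wiener_ito e \<mu> \<phi> f"
  shows "(\<integral>x. \<phi> x * complex_of_real (wt ks x) \<partial>\<mu>) = fact (length ks) * f ks"
proof -
  have sym: "\<And>js. mset js = mset ks \<Longrightarrow> f js = f ks"
    and lim: "Lp_tendsto \<mu> 2 (\<lambda>J. wick_sum J f) \<phi> (finite_subsets_at_top UNIV)"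
    using wiener_ito_sym[OF assms] wiener_ito_tendsto[OF assms] by blast+
  let ?W = "\<lambda>x. complex_of_real (wt ks x)"
  let ?P = "{js. mset js = mset ks}"
  have finP: "finite ?P" by (metis permutations_of_multiset_def finite_permutations_of_multiset)
  have \<phi>: "Lp \<mu> 2 \<phi>" using lim by (simp add: Lp_tendsto_def)
  have W: "Lp \<mu> 2 ?W" by (intro expbdd_Lp expbdd_wt) simp
  have S: "Lp \<mu> 2 (wick_sum J f)" if "finite J" for J by (intro expbdd_Lp expbdd_wick_sum that) simp
  have val: "(\<integral>x. wick_sum J f x * ?W x \<partial>\<mu>) = fact (length ks) * f ks" if J: "finite J" "?P \<subseteq> J" for J
  proof -
    have "(\<integral>x. wick_sum J f x * ?W x \<partial>\<mu>) = (\<integral>x. (\<Sum>js\<in>J. f js * (complex_of_real (wt js x) * ?W x)) \<partial>\<mu>)"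
      unfolding wick_sum_def by (simp add: sum_distrib_right mult.assoc)
    also have "\<dots> = (\<Sum>js\<in>J. f js * (\<integral>x. complex_of_real (wt js x) * ?W x \<partial>\<mu>))"
      by (subst Bochner_Integration.integral_sum)
        (intro integrable_mult_right expbdd_integrable expbdd_mult[OF expbdd_wt expbdd_wt], simp)
    also have "\<dots> = (\<Sum>js\<in>J. if mset js = mset ks then f ks * complex_of_real (real (mset_fact (mset ks))) else 0)"
      unfolding integral_wt_wt by (intro sum.cong refl) (auto dest: sym)
    also have "\<dots> = (\<Sum>js\<in>?P. f ks * complex_of_real (real (mset_fact (mset ks))))"
      using J by (intro sum.mono_neutral_cong_right) auto
    also have "\<dots> = complex_of_real (real (card ?P * mset_fact (mset ks))) * f ks"
      by simp
    also have "\<dots> = fact (length ks) * f ks" by (subst mset_fact_card) simp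
    finally show ?thesis .
  qed
  have ev: "\<forall>\<^sub>F J in finite_subsets_at_top UNIV. cmod ((\<integral>x. \<phi> x * ?W x \<partial>\<mu>) - fact (length ks) * f ks)
      \<le> Lp_norm \<mu> 2 (\<lambda>x. wick_sum J f x - \<phi> x) * Lp_norm \<mu> 2 ?W"
    unfolding eventually_finite_subsets_at_top
  proof (intro exI[of _ ?P] conjI allI impI finP subset_UNIV)
    fix J :: "nat list set" assume J: "finite J \<and> ?P \<subseteq> J \<and> J \<subseteq> UNIV"
    have "(\<integral>x. \<phi> x * ?W x \<partial>\<mu>) - fact (length ks) * f ks = - (\<integral>x. (wick_sum J f x - \<phi> x) * ?W x \<partial>\<mu>)"
      using J Lp2_mult(1)[OF \<phi> W] Lp2_mult(1)[OF S W, of J] val[of J] by (simp add: left_diff_distrib)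
    then show "cmod ((\<integral>x. \<phi> x * ?W x \<partial>\<mu>) - fact (length ks) * f ks)
      \<le> Lp_norm \<mu> 2 (\<lambda>x. wick_sum J f x - \<phi> x) * Lp_norm \<mu> 2 ?W"
      using Lp2_mult(2)[OF Lp_diff[OF S \<phi>] W, of J] J by simp
  qed
  have "((\<lambda>J. Lp_norm \<mu> 2 (\<lambda>x. wick_sum J f x - \<phi> x) * Lp_norm \<mu> 2 ?W) \<longlongrightarrow> 0 * Lp_norm \<mu> 2 ?W) (finite_subsets_at_top UNIV)"
    using lim unfolding Lp_tendsto_def by (intro tendsto_intros) auto
  from tendsto_lowerbound[OF this ev finite_subsets_at_top_neq_bot]
  show ?thesis by simp
qed

lemma wiener_ito_measurable: "wiener_ito e \<mu> \<phi> f \<Longrightarrow> \<phi> \<in> borel_measurable \<mu>"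
  by (auto simp: wiener_ito_def Lp_tendsto_def Lp_def)

lemma wiener_ito_unique:
  assumes f: "wiener_ito e \<mu> \<phi> f" and g: "wiener_ito e \<mu> \<psi> g" and eq: "AE x in \<mu>. \<phi> x = \<psi> x"
  shows "f = g"
proof
  fix ks
  have [measurable]: "\<phi> \<in> borel_measurable \<mu>" "\<psi> \<in> borel_measurable \<mu>"
    "(\<lambda>x. complex_of_real (wt ks x)) \<in> borel_measurable \<mu>"
    using wiener_ito_measurable[OF f] wiener_ito_measurable[OF g] expbdd_measurable[OF expbdd_wt] by auto
  have "(\<integral>x. \<phi> x * complex_of_real (wt ks x) \<partial>\<mu>) = (\<integral>x. \<psi> x * complex_of_real (wt ks x) \<partial>\<mu>)"
    using eq by (intro integral_cong_AE) auto
  then show "f ks = g ks" using wiener_ito_coeff[OF f] wiener_ito_coeff[OF g] by simp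
qed

lemma wiener_ito_AE_unique:
  assumes "wiener_ito e \<mu> \<phi> f" "wiener_ito e \<mu> \<psi> f"
  shows "AE x in \<mu>. \<phi> x = \<psi> x"
  by (rule Lp_tendsto_unique[OF wiener_ito_tendsto[OF assms(1)] wiener_ito_tendsto[OF assms(2)]]) simp_all

lemma wiener_ito_AE_cong:
  assumes "wiener_ito e \<mu> \<phi> f" "AE x in \<mu>. \<phi> x = \<psi> x" "\<psi> \<in> borel_measurable \<mu>"
  shows "wiener_ito e \<mu> \<psi> f"
  unfolding wiener_ito_alt
proof (intro conjI)
  show "\<forall>js ks. mset js = mset ks \<longrightarrow> f js = f ks" using wiener_ito_sym[OF assms(1)] by blast
  show "(\<lambda>js. fact (length js) * (cmod (f js))\<^sup>2) summable_on UNIV" by (rule wiener_ito_summable[OF assms(1)])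
  show "Lp_tendsto \<mu> 2 (\<lambda>J. wick_sum J f) \<psi> (finite_subsets_at_top UNIV)"
    by (rule Lp_tendsto_AE_cong[OF wiener_ito_tendsto[OF assms(1)] assms(2,3)]) simp
qed

text \<open>The choice in \<open>Gamma\<close> hides a kernel of \<phi> besides the version
  \<open>G\<close>. Uniqueness of kernels removes the one ambiguity, and uniqueness of L^2 limits
  reduces the other to a null set.\<close>

lemma Gamma_eq:
  assumes \<phi>: "wiener_ito e \<mu> \<phi> f" and G: "wiener_ito e \<mu> G (\<lambda>js. complex_of_real (prod_list (map b js)) * f js)"
  shows "AE x in \<mu>. Gamma e \<mu> b \<phi> x = G x" "Gamma e \<mu> b \<phi> \<in> borel_measurable \<mu>"
proof -
  let ?P = "\<lambda>G. \<exists>f. wiener_ito e \<mu> \<phi> f \<and> wiener_ito e \<mu> G (\<lambda>js. complex_of_real (prod_list (map b js)) * f js)"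
  have "?P (Gamma e \<mu> b \<phi>)"
    unfolding Gamma_def using \<phi> G by (intro someI_ex[of ?P]) blast
  then obtain f' where f': "wiener_ito e \<mu> \<phi> f'"
    "wiener_ito e \<mu> (Gamma e \<mu> b \<phi>) (\<lambda>js. complex_of_real (prod_list (map b js)) * f' js)" by blast
  have "f' = f" by (rule wiener_ito_unique[OF f'(1) \<phi>]) simp
  then have *: "wiener_ito e \<mu> (Gamma e \<mu> b \<phi>) (\<lambda>js. complex_of_real (prod_list (map b js)) * f js)"
    using f'(2) by simp
  show "AE x in \<mu>. Gamma e \<mu> b \<phi> x = G x" by (rule wiener_ito_AE_unique[OF * G])
  show "Gamma e \<mu> b \<phi> \<in> borel_measurable \<mu>" by (rule wiener_ito_measurable[OF *])
qed

lemma wiener_ito_add: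
  assumes f: "wiener_ito e \<mu> \<phi> f" and g: "wiener_ito e \<mu> \<psi> g"
  shows "wiener_ito e \<mu> (\<lambda>x. \<phi> x + \<psi> x) (\<lambda>js. f js + g js)"
  unfolding wiener_ito_alt
proof (intro conjI)
  show "\<forall>js ks. mset js = mset ks \<longrightarrow> f js + g js = f ks + g ks"
    using wiener_ito_sym[OF f] wiener_ito_sym[OF g] by metis
  show "(\<lambda>js. fact (length js) * (cmod (f js + g js))\<^sup>2) summable_on UNIV"
  proof (rule summable_on_comparison_test)
    show "(\<lambda>js. 2 * (fact (length js) * (cmod (f js))\<^sup>2) + 2 * (fact (length js) * (cmod (g js))\<^sup>2)) summable_on UNIV"
      by (intro summable_on_add summable_on_cmult_right wiener_ito_summable[OF f] wiener_ito_summable[OF g])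
    fix js
    have "(cmod (f js + g js))\<^sup>2 \<le> (cmod (f js) + cmod (g js))\<^sup>2"
      by (intro power_mono norm_triangle_ineq) auto
    also have "\<dots> \<le> 2 * (cmod (f js))\<^sup>2 + 2 * (cmod (g js))\<^sup>2"
      using sum_squares_bound[of "cmod (f js)" "cmod (g js)"] by (simp add: power2_sum)
    finally have "fact (length js) * (cmod (f js + g js))\<^sup>2 \<le> fact (length js) * (2 * (cmod (f js))\<^sup>2 + 2 * (cmod (g js))\<^sup>2)"
      by (intro mult_left_mono) auto
    then show "fact (length js) * (cmod (f js + g js))\<^sup>2 \<le>
       2 * (fact (length js) * (cmod (f js))\<^sup>2) + 2 * (fact (length js) * (cmod (g js))\<^sup>2)"
      by (simp add: algebra_simps)
  qed auto
  have eq: "wick_sum J (\<lambda>js. f js + g js) = (\<lambda>x. wick_sum J f x + wick_sum J g x)" for J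
    by (auto simp: wick_sum_def distrib_right sum.distrib)
  show "Lp_tendsto \<mu> 2 (\<lambda>J. wick_sum J (\<lambda>js. f js + g js)) (\<lambda>x. \<phi> x + \<psi> x) (finite_subsets_at_top UNIV)"
    unfolding eq by (rule Lp_tendsto_add[OF wiener_ito_tendsto[OF f] wiener_ito_tendsto[OF g]]) simp
qed

lemma wiener_ito_cmult:
  assumes f: "wiener_ito e \<mu> \<phi> f"
  shows "wiener_ito e \<mu> (\<lambda>x. a * \<phi> x) (\<lambda>js. a * f js)"
  unfolding wiener_ito_alt
proof (intro conjI)
  show "\<forall>js ks. mset js = mset ks \<longrightarrow> a * f js = a * f ks"
    using wiener_ito_sym[OF f] by metis
  have "(\<lambda>js. (cmod a)\<^sup>2 * (fact (length js) * (cmod (f js))\<^sup>2)) summable_on UNIV"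
    by (intro summable_on_cmult_right wiener_ito_summable[OF f])
  then show "(\<lambda>js. fact (length js) * (cmod (a * f js))\<^sup>2) summable_on UNIV"
    by (simp add: norm_mult power_mult_distrib mult_ac)
  have eq: "wick_sum J (\<lambda>js. a * f js) = (\<lambda>x. a * wick_sum J f x)" for J
    by (auto simp: wick_sum_def sum_distrib_left mult_ac)
  show "Lp_tendsto \<mu> 2 (\<lambda>J. wick_sum J (\<lambda>js. a * f js)) (\<lambda>x. a * \<phi> x) (finite_subsets_at_top UNIV)"
    unfolding eq by (rule Lp_tendsto_cmult[OF wiener_ito_tendsto[OF f]]) simp
qed

lemma wiener_ito_zero: "wiener_ito e \<mu> (\<lambda>x. 0) (\<lambda>js. 0)"
  by (auto simp: wiener_ito_def Lp_tendsto_def)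

lemma wiener_ito_sum:
  assumes "finite S" "\<And>i. i \<in> S \<Longrightarrow> wiener_ito e \<mu> (\<phi> i) (f i)"
  shows "wiener_ito e \<mu> (\<lambda>x. \<Sum>i\<in>S. a i * \<phi> i x) (\<lambda>js. \<Sum>i\<in>S. a i * f i js)"
  using assms
proof (induction S rule: finite_induct)
  case (insert i S)
  then show ?case
    using wiener_ito_add[OF wiener_ito_cmult[of "\<phi> i" "f i" "a i"]] by simp
qed (simp add: wiener_ito_zero)

subsection \<open>The expansion of the exponential functions\<close>

definition ekern :: "'a \<times> 'a \<Rightarrow> nat list \<Rightarrow> complex" where
  "ekern \<zeta> js = (\<Prod>j\<leftarrow>js. ccoeff \<zeta> j) / fact (length js)"

text \<open>The squared norm of the complex vector; its exponential is the squared L^2 norm of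
  \<open>exp_fun \<zeta>\<close>.\<close>

definition energy :: "'a \<times> 'a \<Rightarrow> real" where
  "energy \<zeta> = (norm (fst \<zeta>))\<^sup>2 + (norm (snd \<zeta>))\<^sup>2"

lemma ekern_sym: "mset js = mset ks \<Longrightarrow> ekern \<zeta> js = ekern \<zeta> ks"
  unfolding ekern_def prod_mset_prod_list[symmetric] mset_map
  by (metis mset_eq_length)

lemma ccoeff_sums: "(\<lambda>j. (cmod (ccoeff \<zeta> j))\<^sup>2) sums energy \<zeta>"
proof -
  have "(cmod (ccoeff \<zeta> j))\<^sup>2 = (e j \<bullet> fst \<zeta>)\<^sup>2 + (e j \<bullet> snd \<zeta>)\<^sup>2" for j
    by (simp add: ccoeff_def cmod_def)
  then show ?thesis unfolding energy_def using sums_add[OF norm_sums norm_sums] by simp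
qed

lemma ekern_square: "fact (length js) * (cmod (ekern \<zeta> js))\<^sup>2 = (\<Prod>j\<leftarrow>js. (cmod (ccoeff \<zeta> j))\<^sup>2) / fact (length js)"
proof -
  have "(cmod (\<Prod>j\<leftarrow>js. ccoeff \<zeta> j))\<^sup>2 = (\<Prod>j\<leftarrow>js. (cmod (ccoeff \<zeta> j))\<^sup>2)"
    by (induction js) (auto simp: norm_mult power_mult_distrib)
  then show ?thesis by (simp add: ekern_def norm_divide power_divide power2_eq_square)
qed

lemma exp_fun_norm2:
  assumes "\<zeta> \<in> ctests"
  shows "(\<integral>x. exp_fun \<zeta> x * cnj (exp_fun \<zeta> x) \<partial>\<mu>) = complex_of_real (exp (energy \<zeta>))"
proof -
  let ?\<theta> = "(fst \<zeta>, - snd \<zeta>)"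
  have \<theta>: "?\<theta> \<in> ctests" using assms by auto
  have "(\<integral>x. exp_fun \<zeta> x * cnj (exp_fun \<zeta> x) \<partial>\<mu>) = (\<integral>x. exp (cinner_bilinear \<zeta> ?\<theta>) * exp_fun (\<zeta> + ?\<theta>) x \<partial>\<mu>)"
    by (intro Bochner_Integration.integral_cong refl)
      (simp only: space_mu exp_fun_cnj[OF assms] exp_fun_mult[OF assms \<theta>])
  also have "\<dots> = exp (cinner_bilinear \<zeta> ?\<theta>)"
    using integral_exp_fun[OF ctests_add[OF assms \<theta>]] by simp
  also have "cinner_bilinear \<zeta> ?\<theta> = complex_of_real (energy \<zeta>)"
    by (simp add: cinner_bilinear_def energy_def power2_norm_eq_inner complex_eq_iff inner_commute)
  finally show ?thesis by (simp add: exp_of_real)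
qed

text \<open>When the square is expanded, each of the two mixed terms gives exactly \<sigma>. The
  square of the partial sum gives at most \<sigma>, because \<open>J\<close> may contain only some
  of the rearrangements of a list, while \<sigma> weighs each list as if all of them were
  there.\<close>

lemma exp_fun_bessel:
  assumes \<zeta>: "\<zeta> \<in> ctests" and J: "finite J"
  shows "(\<integral>x. (cmod (wick_sum J (ekern \<zeta>) x - exp_fun \<zeta> x))\<^sup>2 \<partial>\<mu>) \<le>
    exp (energy \<zeta>) - (\<Sum>js\<in>J. fact (length js) * (cmod (ekern \<zeta> js))\<^sup>2)"
proof -
  let ?f = "ekern \<zeta>" and ?E = "exp_fun \<zeta>" and ?S = "wick_sum J (ekern \<zeta>)"
  define \<sigma> where "\<sigma> = (\<Sum>js\<in>J. fact (length js) * (cmod (?f js))\<^sup>2)"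
  have E: "expbdd ?E" and S: "expbdd ?S" using \<zeta> J by (auto intro: expbdd_exp_fun expbdd_wick_sum)
  have fE: "(\<integral>x. complex_of_real (wt js x) * ?E x \<partial>\<mu>) = fact (length js) * ?f js" for js
    using integral_wt_exp_fun[OF \<zeta>, of js] by (simp add: ekern_def)
  have cE: "(\<integral>x. cnj (?S x) * ?E x \<partial>\<mu>) = complex_of_real \<sigma>"
  proof -
    have "(\<integral>x. cnj (?S x) * ?E x \<partial>\<mu>) = (\<integral>x. (\<Sum>js\<in>J. cnj (?f js) * (complex_of_real (wt js x) * ?E x)) \<partial>\<mu>)"
      unfolding wick_sum_def by (simp add: sum_distrib_right mult.assoc)
    also have "\<dots> = (\<Sum>js\<in>J. cnj (?f js) * (fact (length js) * ?f js))"
      by (subst Bochner_Integration.integral_sum)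
        (intro integrable_mult_right expbdd_integrable expbdd_mult[OF expbdd_wt E], simp add: fE)
    also have "\<dots> = (\<Sum>js\<in>J. complex_of_real (fact (length js) * (cmod (?f js))\<^sup>2))"
      by (intro sum.cong refl) (simp only: of_real_mult of_real_fact complex_norm_square mult_ac)
    finally show ?thesis by (simp add: \<sigma>_def)
  qed
  have SS: "(\<integral>x. cnj (?S x) * ?S x \<partial>\<mu>) =
      (\<Sum>js\<in>J. \<Sum>ks\<in>J. cnj (?f js) * ?f ks * (if mset js = mset ks then complex_of_real (real (mset_fact (mset js))) else 0))"
  proof -
    have "cnj (?S x) * ?S x = (\<Sum>js\<in>J. \<Sum>ks\<in>J. cnj (?f js) * ?f ks * (complex_of_real (wt js x) * complex_of_real (wt ks x)))" for x
      unfolding wick_sum_def cnj_sum sum_product by (simp add: mult_ac)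
    then show ?thesis
      by (simp only:) (simp add: Bochner_Integration.integral_sum integral_wt_wt
          Bochner_Integration.integrable_sum integrable_mult_right expbdd_integrable expbdd_mult expbdd_wt)
  qed
  have SSle: "Re (\<integral>x. cnj (?S x) * ?S x \<partial>\<mu>) \<le> \<sigma>"
  proof -
    have "Re (\<integral>x. cnj (?S x) * ?S x \<partial>\<mu>) =
        (\<Sum>js\<in>J. \<Sum>ks\<in>J. if mset js = mset ks then (cmod (?f js))\<^sup>2 * real (mset_fact (mset js)) else 0)"
    proof -
      have "cnj (?f js) * ?f ks * (if mset js = mset ks then complex_of_real (real (mset_fact (mset js))) else 0) =
          complex_of_real (if mset js = mset ks then (cmod (?f js))\<^sup>2 * real (mset_fact (mset js)) else 0)" for js ks
        using ekern_sym[of js ks \<zeta>] complex_norm_square[of "?f ks"] by (simp add: mult_ac)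
      then show ?thesis unfolding SS by (simp only: of_real_sum[symmetric] Re_complex_of_real)
    qed
    also have "\<dots> \<le> (\<Sum>js\<in>J. fact (length js) * (cmod (?f js))\<^sup>2)"
    proof (rule sum_mono)
      fix js :: "nat list"
      have "finite {ks. mset ks = mset js}" by (metis permutations_of_multiset_def finite_permutations_of_multiset)
      then have c: "card {ks \<in> J. mset js = mset ks} \<le> card {ks. mset ks = mset js}"
        by (intro card_mono) auto
      have "(\<Sum>ks\<in>J. if mset js = mset ks then (cmod (?f js))\<^sup>2 * real (mset_fact (mset js)) else 0) =
          (\<Sum>ks\<in>{ks \<in> J. mset js = mset ks}. (cmod (?f js))\<^sup>2 * real (mset_fact (mset js)))"
        by (rule sum.inter_filter[OF J, symmetric])
      also have "\<dots> = real (card {ks \<in> J. mset js = mset ks} * mset_fact (mset js)) * (cmod (?f js))\<^sup>2"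
        unfolding sum_constant by simp
      also have "\<dots> \<le> real (card {ks. mset ks = mset js} * mset_fact (mset js)) * (cmod (?f js))\<^sup>2"
        using c by (intro mult_right_mono of_nat_mono mult_le_mono1) auto
      also have "\<dots> = fact (length js) * (cmod (?f js))\<^sup>2" by (subst mset_fact_card) simp
      finally show "(\<Sum>ks\<in>J. if mset js = mset ks then (cmod (?f js))\<^sup>2 * real (mset_fact (mset js)) else 0) \<le>
          fact (length js) * (cmod (?f js))\<^sup>2" .
    qed
    finally show ?thesis by (simp add: \<sigma>_def)
  qed
  have cE': "(\<integral>x. cnj (?E x) * ?S x \<partial>\<mu>) = complex_of_real \<sigma>"
  proof -
    have "(\<integral>x. cnj (?E x) * ?S x \<partial>\<mu>) = (\<integral>x. cnj (cnj (?S x) * ?E x) \<partial>\<mu>)" by (simp add: mult.commute)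
    also have "\<dots> = cnj (\<integral>x. cnj (?S x) * ?E x \<partial>\<mu>)" by (rule Bochner_Integration.integral_cnj)
    finally show ?thesis by (simp add: cE)
  qed
  have expand: "complex_of_real ((cmod (s - E))\<^sup>2) = cnj s * s - cnj s * E - cnj E * s + E * cnj E" for s E :: complex
    unfolding complex_norm_square by (simp add: algebra_simps)
  have "complex_of_real (\<integral>x. (cmod (?S x - ?E x))\<^sup>2 \<partial>\<mu>) = (\<integral>x. complex_of_real ((cmod (?S x - ?E x))\<^sup>2) \<partial>\<mu>)"
    by (rule integral_complex_of_real[symmetric])
  also have "\<dots> = (\<integral>x. cnj (?S x) * ?S x - cnj (?S x) * ?E x - cnj (?E x) * ?S x + ?E x * cnj (?E x) \<partial>\<mu>)"
    by (simp only: expand)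
  also have "\<dots> = (\<integral>x. cnj (?S x) * ?S x \<partial>\<mu>) - complex_of_real \<sigma> - complex_of_real \<sigma> + complex_of_real (exp (energy \<zeta>))"
    using expbdd_integrable[OF expbdd_mult[OF expbdd_cnj[OF S] S]] expbdd_integrable[OF expbdd_mult[OF expbdd_cnj[OF S] E]]
      expbdd_integrable[OF expbdd_mult[OF expbdd_cnj[OF E] S]] expbdd_integrable[OF expbdd_mult[OF E expbdd_cnj[OF E]]]
    by (simp add: cE cE' exp_fun_norm2[OF \<zeta>])
  finally have "(\<integral>x. (cmod (?S x - ?E x))\<^sup>2 \<partial>\<mu>) =
      Re ((\<integral>x. cnj (?S x) * ?S x \<partial>\<mu>) - complex_of_real \<sigma> - complex_of_real \<sigma> + complex_of_real (exp (energy \<zeta>)))"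
    by (metis Re_complex_of_real)
  then show ?thesis using SSle by (simp add: \<sigma>_def)
qed

text \<open>Parseval's identity. The bound from above is \<open>exp_fun_bessel\<close>. From below,
  the lists of length n over {..<m} give the n-th exponential term of a partial sum of the energy; m
  and then N tend to infinity. Together with \<open>exp_fun_bessel\<close> it forces the L^2
  convergence of the expansion.\<close>

lemma ekern_has_sum:
  assumes \<zeta>: "\<zeta> \<in> ctests"
  shows "((\<lambda>js. fact (length js) * (cmod (ekern \<zeta> js))\<^sup>2) has_sum exp (energy \<zeta>)) UNIV"
proof -
  let ?g = "\<lambda>js. fact (length js) * (cmod (ekern \<zeta> js))\<^sup>2"
  have le: "sum ?g J \<le> exp (energy \<zeta>)" if "finite J" for J
  proof -
    have "0 \<le> (\<integral>x. (cmod (wick_sum J (ekern \<zeta>) x - exp_fun \<zeta> x))\<^sup>2 \<partial>\<mu>)" by simp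
    then show ?thesis using exp_fun_bessel[OF \<zeta> that] by linarith
  qed
  have summ: "?g summable_on UNIV"
    by (rule nonneg_bdd_above_summable_on) (auto intro!: bdd_aboveI2[where M="exp (energy \<zeta>)"] le)
  have "infsum ?g UNIV \<le> exp (energy \<zeta>)"
    by (rule infsum_le_finite_sums[OF summ]) (use le in auto)
  moreover have "exp (energy \<zeta>) \<le> infsum ?g UNIV"
  proof -
    define w where "w j = (cmod (ccoeff \<zeta> j))\<^sup>2" for j
    have part: "(\<Sum>n<N. (\<Sum>j<m. w j) ^ n / fact n) \<le> infsum ?g UNIV" for N m
    proof -
      let ?L = "\<lambda>n. {js :: nat list. length js = n \<and> set js \<subseteq> {..<m}}"
      have fin: "finite (?L n)" for n using finite_lists_length_eq[of "{..<m}" n] by (simp add: conj_commute)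
      have "(\<Sum>n<N. (\<Sum>j<m. w j) ^ n / fact n) = (\<Sum>n<N. \<Sum>js\<in>?L n. ?g js)"
      proof (intro sum.cong refl)
        fix n
        have "(\<Sum>js\<in>?L n. ?g js) = (\<Sum>js\<in>?L n. (\<Prod>j\<leftarrow>js. w j) / fact n)"
          by (intro sum.cong refl) (auto simp: ekern_square w_def)
        then show "(\<Sum>j<m. w j) ^ n / fact n = (\<Sum>js\<in>?L n. ?g js)"
          by (simp add: sum_divide_distrib[symmetric] sum_power_lists)
      qed
      also have "\<dots> = sum ?g (\<Union>n<N. ?L n)"
        by (subst sum.UNION_disjoint) (auto simp: fin)
      also have "\<dots> \<le> infsum ?g UNIV"
        by (rule finite_sum_le_infsum[OF summ]) (auto simp: fin)
      finally show ?thesis .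
    qed
    have "(\<Sum>n<N. energy \<zeta> ^ n / fact n) \<le> infsum ?g UNIV" for N
    proof (rule tendsto_upperbound)
      have "(\<lambda>m. \<Sum>j<m. w j) \<longlonglongrightarrow> energy \<zeta>" using ccoeff_sums by (simp add: sums_def w_def)
      then show "(\<lambda>m. \<Sum>n<N. (\<Sum>j<m. w j) ^ n / fact n) \<longlonglongrightarrow> (\<Sum>n<N. energy \<zeta> ^ n / fact n)"
        by (intro tendsto_intros) auto
      show "\<forall>\<^sub>F m in sequentially. (\<Sum>n<N. (\<Sum>j<m. w j) ^ n / fact n) \<le> infsum ?g UNIV"
        using part by (intro always_eventually allI)
    qed simp
    moreover have "(\<lambda>N. \<Sum>n<N. energy \<zeta> ^ n / fact n) \<longlonglongrightarrow> exp (energy \<zeta>)"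
      using exp_converges[of "energy \<zeta>"] by (simp add: sums_def field_simps)
    ultimately show ?thesis using LIMSEQ_le_const2 by blast
  qed
  ultimately have "infsum ?g UNIV = exp (energy \<zeta>)" by simp
  then show ?thesis using has_sum_infsum[OF summ] by simp
qed

lemma wiener_ito_exp_fun:
  assumes \<zeta>: "\<zeta> \<in> ctests"
  shows "wiener_ito e \<mu> (exp_fun \<zeta>) (ekern \<zeta>)"
  unfolding wiener_ito_alt
proof (intro conjI)
  let ?g = "\<lambda>js. fact (length js) * (cmod (ekern \<zeta> js))\<^sup>2"
  show "\<forall>js ks. mset js = mset ks \<longrightarrow> ekern \<zeta> js = ekern \<zeta> ks" using ekern_sym by blast
  show "?g summable_on UNIV" using ekern_has_sum[OF \<zeta>] by (rule has_sum_imp_summable)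
  show "Lp_tendsto \<mu> 2 (\<lambda>J. wick_sum J (ekern \<zeta>)) (exp_fun \<zeta>) (finite_subsets_at_top UNIV)"
    unfolding Lp_tendsto_def
  proof (intro conjI)
    show "Lp \<mu> 2 (exp_fun \<zeta>)" by (intro expbdd_Lp expbdd_exp_fun \<zeta>) simp
    show "\<forall>\<^sub>F J in finite_subsets_at_top UNIV. Lp \<mu> 2 (wick_sum J (ekern \<zeta>))"
      by (intro eventually_finite_subsets_at_top_weakI expbdd_Lp expbdd_wick_sum) auto
    have lim0: "(sum ?g \<longlongrightarrow> exp (energy \<zeta>)) (finite_subsets_at_top UNIV)"
      using ekern_has_sum[OF \<zeta>] by (simp add: has_sum_def)
    have "((\<lambda>J. sqrt (exp (energy \<zeta>) - sum ?g J)) \<longlongrightarrow> sqrt (exp (energy \<zeta>) - exp (energy \<zeta>))) (finite_subsets_at_top UNIV)"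
      by (intro tendsto_intros lim0)
    then have lim: "((\<lambda>J. sqrt (exp (energy \<zeta>) - sum ?g J)) \<longlongrightarrow> 0) (finite_subsets_at_top UNIV)" by simp
    show "((\<lambda>J. Lp_norm \<mu> 2 (\<lambda>x. wick_sum J (ekern \<zeta>) x - exp_fun \<zeta> x)) \<longlongrightarrow> 0) (finite_subsets_at_top UNIV)"
    proof (rule tendsto_sandwich[OF _ _ tendsto_const lim])
      show "\<forall>\<^sub>F J in finite_subsets_at_top UNIV. Lp_norm \<mu> 2 (\<lambda>x. wick_sum J (ekern \<zeta>) x - exp_fun \<zeta> x) \<le> sqrt (exp (energy \<zeta>) - sum ?g J)"
      proof (intro eventually_finite_subsets_at_top_weakI)
        fix J :: "nat list set" assume "finite J"
        then show "Lp_norm \<mu> 2 (\<lambda>x. wick_sum J (ekern \<zeta>) x - exp_fun \<zeta> x) \<le> sqrt (exp (energy \<zeta>) - sum ?g J)"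
          using exp_fun_bessel[OF \<zeta>, of J] by (simp add: Lp_norm_def powr_half_sqrt)
      qed
    qed simp
  qed
qed

end

section \<open>The bilinear operator on the exponential functions\<close>

lemma Lp_tendsto_coeff:
  assumes "Lp M p f" "(c \<longlongrightarrow> c0) F" "0 < p"
  shows "Lp_tendsto M p (\<lambda>i x. c i * f x) (\<lambda>x. c0 * f x) F"
proof -
  have "Lp_norm M p (\<lambda>x. c i * f x - c0 * f x) = cmod (c i - c0) * Lp_norm M p f" for i
    using Lp_norm_cmult[OF assms(3), of M "c i - c0" f] by (simp add: left_diff_distrib)
  moreover have "((\<lambda>i. cmod (c i - c0) * Lp_norm M p f) \<longlongrightarrow> 0) F"
    using assms(2) by (intro tendsto_mult_left_zero) (simp add: tendsto_norm_zero_iff LIM_zero_iff)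
  ultimately show ?thesis
    using assms(1) unfolding Lp_tendsto_def by (simp add: Lp_cmult)
qed

lemma Lp_tendsto_zero: "Lp_tendsto M p (\<lambda>i x. 0) (\<lambda>x. 0) F"
  by (simp add: Lp_tendsto_def)

lemma Lp_tendsto_sum:
  assumes "finite S" "\<And>k. k \<in> S \<Longrightarrow> Lp_tendsto M p (f k) (g k) F" "1 \<le> p"
  shows "Lp_tendsto M p (\<lambda>i x. \<Sum>k\<in>S. f k i x) (\<lambda>x. \<Sum>k\<in>S. g k x) F"
  using assms
proof (induction S rule: finite_induct)
  case (insert k S)
  have "Lp_tendsto M p (\<lambda>i x. f k i x + (\<Sum>k\<in>S. f k i x)) (\<lambda>x. g k x + (\<Sum>k\<in>S. g k x)) F"
    using insert by (intro Lp_tendsto_add) auto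
  then show ?case using insert by simp
qed (simp add: Lp_tendsto_zero)

lemma Lp_tendsto_eventually_AE_cong:
  assumes f: "Lp_tendsto M p f g F" and ev: "\<forall>\<^sub>F i in F. (AE x in M. f i x = f' i x) \<and> f' i \<in> borel_measurable M"
  shows "Lp_tendsto M p f' g F"
proof -
  have g: "Lp M p g" using f by (simp add: Lp_tendsto_def)
  have both: "\<forall>\<^sub>F i in F. Lp M p (f i) \<and> (AE x in M. f i x = f' i x) \<and> f' i \<in> borel_measurable M"
    using f ev by (auto simp: Lp_tendsto_def intro: eventually_conj)
  have "\<forall>\<^sub>F i in F. Lp_norm M p (\<lambda>x. f i x - g x) = Lp_norm M p (\<lambda>x. f' i x - g x)"
    using both
  proof eventually_elim
    case (elim i)
    then have [measurable]: "f i \<in> borel_measurable M" "g \<in> borel_measurable M" "f' i \<in> borel_measurable M"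
      using g by (auto simp: Lp_def)
    have "AE x in M. f i x = f' i x" using elim by simp
    then have "AE x in M. f i x - g x = f' i x - g x" by eventually_elim simp
    then show ?case by (intro Lp_norm_AE_cong) auto
  qed
  then have "((\<lambda>i. Lp_norm M p (\<lambda>x. f' i x - g x)) \<longlongrightarrow> 0) F"
    using f tendsto_cong unfolding Lp_tendsto_def by force
  moreover have "\<forall>\<^sub>F i in F. Lp M p (f' i)"
    using both by eventually_elim (auto intro: Lp_AE_cong)
  ultimately show ?thesis using g by (simp add: Lp_tendsto_def)
qed

context white_noise
begin

lemma Exp_cases:
  assumes "\<phi> \<in> Exp e lam"
  obtains S a where "finite S" "S \<subseteq> ctests" "\<phi> = (\<lambda>x. \<Sum>\<zeta>\<in>S. a \<zeta> * exp_fun \<zeta> x)"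
  using assms unfolding Exp_def by blast

lemma ekern_scale:
  assumes "\<And>j. ccoeff \<zeta>' j = complex_of_real (b j) * ccoeff \<zeta> j"
  shows "ekern \<zeta>' js = complex_of_real (prod_list (map b js)) * ekern \<zeta> js"
proof -
  have "(\<Prod>j\<leftarrow>js. ccoeff \<zeta>' j) = complex_of_real (prod_list (map b js)) * (\<Prod>j\<leftarrow>js. ccoeff \<zeta> j)"
    by (induction js) (auto simp: assms)
  then show ?thesis by (simp add: ekern_def)
qed

lemma ccoeff_cdg: "bounded_seq b \<Longrightarrow> ccoeff (cdg b \<zeta>) j = complex_of_real (b j) * ccoeff \<zeta> j"
  by (simp add: ccoeff_def cdg_def complex_eq_iff)

text \<open>The form is made for repeated use: \<phi> is given only almost everywhere because it is
  often a chosen version itself, a family of vectors may repeat a vector, and \<open>Z'\<close> is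
  prescribed by its coefficients, which admits the possibly unbounded factor 1 / sqrt t.\<close>

lemma Gamma_exp_sum:
  assumes I: "finite I" and Z: "\<And>i. i \<in> I \<Longrightarrow> Z i \<in> ctests" and Z': "\<And>i. i \<in> I \<Longrightarrow> Z' i \<in> ctests"
    and cc: "\<And>i j. i \<in> I \<Longrightarrow> ccoeff (Z' i) j = complex_of_real (b j) * ccoeff (Z i) j"
    and \<phi>: "AE x in \<mu>. \<phi> x = (\<Sum>i\<in>I. a i * exp_fun (Z i) x)" "\<phi> \<in> borel_measurable \<mu>"
  shows "AE x in \<mu>. Gamma e \<mu> b \<phi> x = (\<Sum>i\<in>I. a i * exp_fun (Z' i) x)"
    "Gamma e \<mu> b \<phi> \<in> borel_measurable \<mu>"
proof -
  have 1: "wiener_ito e \<mu> \<phi> (\<lambda>js. \<Sum>i\<in>I. a i * ekern (Z i) js)"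
  proof (rule wiener_ito_AE_cong[OF _ _ \<phi>(2)])
    show "wiener_ito e \<mu> (\<lambda>x. \<Sum>i\<in>I. a i * exp_fun (Z i) x) (\<lambda>js. \<Sum>i\<in>I. a i * ekern (Z i) js)"
      by (intro wiener_ito_sum I wiener_ito_exp_fun Z)
    show "AE x in \<mu>. (\<Sum>i\<in>I. a i * exp_fun (Z i) x) = \<phi> x" using \<phi>(1) by eventually_elim simp
  qed
  have "(\<lambda>js. \<Sum>i\<in>I. a i * ekern (Z' i) js) =
      (\<lambda>js. complex_of_real (prod_list (map b js)) * (\<Sum>i\<in>I. a i * ekern (Z i) js))"
    using ekern_scale[OF cc] by (auto simp: sum_distrib_left mult_ac intro!: sum.cong)
  moreover have "wiener_ito e \<mu> (\<lambda>x. \<Sum>i\<in>I. a i * exp_fun (Z' i) x) (\<lambda>js. \<Sum>i\<in>I. a i * ekern (Z' i) js)"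
    by (intro wiener_ito_sum I wiener_ito_exp_fun Z')
  ultimately have 2: "wiener_ito e \<mu> (\<lambda>x. \<Sum>i\<in>I. a i * exp_fun (Z' i) x)
      (\<lambda>js. complex_of_real (prod_list (map b js)) * (\<Sum>i\<in>I. a i * ekern (Z i) js))" by simp
  show "AE x in \<mu>. Gamma e \<mu> b \<phi> x = (\<Sum>i\<in>I. a i * exp_fun (Z' i) x)"
    "Gamma e \<mu> b \<phi> \<in> borel_measurable \<mu>"
    by (rule Gamma_eq[OF 1 2])+
qed

lemma exp_sum_measurable:
  "(\<And>i. i \<in> I \<Longrightarrow> Z i \<in> ctests) \<Longrightarrow> (\<lambda>x. \<Sum>i\<in>I. a i * exp_fun (Z i) x) \<in> borel_measurable \<mu>"
  using expbdd_measurable[OF expbdd_exp_fun] by (intro borel_measurable_sum borel_measurable_times) auto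

lemma exp_sum_mult:
  assumes "\<And>i. i \<in> I \<Longrightarrow> Z i \<in> ctests" "\<And>k. k \<in> K \<Longrightarrow> Y k \<in> ctests" "x \<in> duals"
  shows "(\<Sum>i\<in>I. a i * exp_fun (Z i) x) * (\<Sum>k\<in>K. b k * exp_fun (Y k) x) =
    (\<Sum>(i, k)\<in>I \<times> K. a i * b k * exp (cinner_bilinear (Z i) (Y k)) * exp_fun (Z i + Y k) x)"
  unfolding sum_product sum.cartesian_product
proof (intro sum.cong refl, clarify)
  fix i k assume "i \<in> I" "k \<in> K"
  then show "a i * exp_fun (Z i) x * (b k * exp_fun (Y k) x) =
      a i * b k * exp (cinner_bilinear (Z i) (Y k)) * exp_fun (Z i + Y k) x"
    using exp_fun_mult[OF assms(1,2,3), of i k] by (simp add: mult_ac)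
qed

lemma bounded_seq_sqrt:
  assumes "bounded_seq t" shows "bounded_seq (\<lambda>n. sqrt (t n))"
proof -
  obtain K where "\<And>n. \<bar>t n\<bar> \<le> K" using assms by (auto simp: bounded_seq_def)
  then have "\<bar>sqrt (t n)\<bar> \<le> sqrt K" for n by (simp add: real_sqrt_abs2 flip: real_sqrt_abs')
  then show ?thesis by (rule bounded_seqI)
qed

text \<open>Multiplying the exponentials at sqrt T \<zeta> and sqrt T \<theta> produces the
  exponential of their pairing, which is the pairing of \<zeta> with T \<theta>; the outer operator
  then removes sqrt T from the sum of the vectors.\<close>

lemma wick_product_pos_exp_sum:
  assumes t: "bounded_seq t" "\<And>n. 0 < t n"
    and I: "finite I" "\<And>i. i \<in> I \<Longrightarrow> Z i \<in> ctests" and K: "finite K" "\<And>k. k \<in> K \<Longrightarrow> Y k \<in> ctests"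
    and \<phi>: "AE x in \<mu>. \<phi> x = (\<Sum>i\<in>I. a i * exp_fun (Z i) x)" "\<phi> \<in> borel_measurable \<mu>"
    and \<psi>: "AE x in \<mu>. \<psi> x = (\<Sum>k\<in>K. b k * exp_fun (Y k) x)" "\<psi> \<in> borel_measurable \<mu>"
  shows "AE x in \<mu>. wick_product_pos e \<mu> t \<phi> \<psi> x =
      (\<Sum>(i, k)\<in>I \<times> K. a i * b k * exp (cinner_bilinear (Z i) (cdg t (Y k))) * exp_fun (Z i + Y k) x)"
    "wick_product_pos e \<mu> t \<phi> \<psi> \<in> borel_measurable \<mu>"
proof -
  let ?s = "\<lambda>n. sqrt (t n)"
  have s: "bounded_seq ?s" by (rule bounded_seq_sqrt[OF t(1)])
  have tabs: "(\<lambda>n. \<bar>t n\<bar>) = t" using t(2) by (auto simp: less_imp_le)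
  have G1: "AE x in \<mu>. Gamma e \<mu> ?s \<phi> x = (\<Sum>i\<in>I. a i * exp_fun (cdg ?s (Z i)) x)"
    "Gamma e \<mu> ?s \<phi> \<in> borel_measurable \<mu>"
    by (rule Gamma_exp_sum[where Z'="\<lambda>i. cdg ?s (Z i)", OF I(1) _ _ _ \<phi>]; simp add: I(2) s ccoeff_cdg)+
  have G2: "AE x in \<mu>. Gamma e \<mu> ?s \<psi> x = (\<Sum>k\<in>K. b k * exp_fun (cdg ?s (Y k)) x)"
    "Gamma e \<mu> ?s \<psi> \<in> borel_measurable \<mu>"
    by (rule Gamma_exp_sum[where Z'="\<lambda>k. cdg ?s (Y k)", OF K(1) _ _ _ \<psi>]; simp add: K(2) s ccoeff_cdg)+
  let ?P = "\<lambda>x. Gamma e \<mu> ?s \<phi> x * Gamma e \<mu> ?s \<psi> x"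
  let ?c = "\<lambda>i k. a i * b k * exp (cinner_bilinear (Z i) (cdg t (Y k)))"
  have P: "AE x in \<mu>. ?P x = (\<Sum>z\<in>I \<times> K. (case z of (i, k) \<Rightarrow> ?c i k) * exp_fun (cdg ?s (Z (fst z)) + cdg ?s (Y (snd z))) x)"
    using G1(1) G2(1) AE_space
  proof eventually_elim
    case (elim x)
    then have x: "x \<in> duals" by (simp add: space_mu)
    show ?case
      unfolding elim
      by (subst exp_sum_mult[OF _ _ x])
        (auto intro!: sum.cong cdg_ctests simp: cb_cdg[OF s s] tabs s I K)
  qed
  have Pm: "?P \<in> borel_measurable \<mu>" using G1(2) G2(2) by measurable
  have cc: "ccoeff (Z i + Y k) j = complex_of_real (1 / sqrt (t j)) * ccoeff (cdg ?s (Z i) + cdg ?s (Y k)) j" for i k j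
    using t(2)[of j] s unfolding cdg_add[OF s, symmetric] ccoeff_cdg[OF s] by simp
  have Zc: "cdg ?s (Z (fst z)) + cdg ?s (Y (snd z)) \<in> ctests" "Z (fst z) + Y (snd z) \<in> ctests"
    if "z \<in> I \<times> K" for z
  proof -
    have z: "fst z \<in> I" "snd z \<in> K" using that by auto
    show "cdg ?s (Z (fst z)) + cdg ?s (Y (snd z)) \<in> ctests" "Z (fst z) + Y (snd z) \<in> ctests"
      by (intro ctests_add cdg_ctests s I(2)[OF z(1)] K(2)[OF z(2)])+
  qed
  note Gamma_product = Gamma_exp_sum[where I="I \<times> K" and Z'="\<lambda>z. Z (fst z) + Y (snd z)" and
      b="\<lambda>n. 1 / sqrt (t n)", OF finite_cartesian_product[OF I(1) K(1)] _ _ _ P Pm]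
  have Q: "AE x in \<mu>. Gamma e \<mu> (\<lambda>n. 1 / sqrt (t n)) ?P x =
      (\<Sum>z\<in>I \<times> K. (case z of (i, k) \<Rightarrow> ?c i k) * exp_fun (Z (fst z) + Y (snd z)) x)"
    "Gamma e \<mu> (\<lambda>n. 1 / sqrt (t n)) ?P \<in> borel_measurable \<mu>"
    by (rule Gamma_product; (erule Zc | rule cc))+
  have R: "(\<Sum>z\<in>I \<times> K. (case z of (i, k) \<Rightarrow> ?c i k) * exp_fun (Z (fst z) + Y (snd z)) x) =
      (\<Sum>(i, k)\<in>I \<times> K. ?c i k * exp_fun (Z i + Y k) x)" for x
    by (intro sum.cong refl) auto
  show "AE x in \<mu>. wick_product_pos e \<mu> t \<phi> \<psi> x = (\<Sum>(i, k)\<in>I \<times> K. ?c i k * exp_fun (Z i + Y k) x)"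
    "wick_product_pos e \<mu> t \<phi> \<psi> \<in> borel_measurable \<mu>"
    using Q unfolding wick_product_pos_def R by blast+
qed

text \<open>In the exponential sum for T_\<epsilon> only the scalars depend on \<epsilon>, and they
  are exponentials of affine functions of \<epsilon>. So the L^2 limit exists and is the same
  formula with T, also on the kernel of T.\<close>

lemma wick_product_exp_sum:
  assumes t: "bounded_seq t" "\<And>n. 0 \<le> t n"
    and I: "finite I" "\<And>i. i \<in> I \<Longrightarrow> Z i \<in> ctests" and K: "finite K" "\<And>k. k \<in> K \<Longrightarrow> Y k \<in> ctests"
    and \<phi>: "AE x in \<mu>. \<phi> x = (\<Sum>i\<in>I. a i * exp_fun (Z i) x)" "\<phi> \<in> borel_measurable \<mu>"
    and \<psi>: "AE x in \<mu>. \<psi> x = (\<Sum>k\<in>K. b k * exp_fun (Y k) x)" "\<psi> \<in> borel_measurable \<mu>"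
  shows "AE x in \<mu>. wick_product e \<mu> t \<phi> \<psi> x =
      (\<Sum>(i, k)\<in>I \<times> K. a i * b k * exp (cinner_bilinear (Z i) (cdg t (Y k))) * exp_fun (Z i + Y k) x)"
    "wick_product e \<mu> t \<phi> \<psi> \<in> borel_measurable \<mu>"
proof -
  \<comment> \<open>The eigenvalues of the projection onto the kernel of T.\<close>
  define \<kappa> :: "nat \<Rightarrow> real" where "\<kappa> n = (if t n = 0 then 1 else 0)" for n
  have \<kappa>: "bounded_seq \<kappa>" by (rule bounded_seqI[of _ 1]) (auto simp: \<kappa>_def)
  define T where "T \<epsilon> n = t n + (if t n = 0 then \<epsilon> else 0)" for \<epsilon> n
  have T_alt: "T \<epsilon> = (\<lambda>n. t n + \<epsilon> * \<kappa> n)" for \<epsilon> by (auto simp: T_def \<kappa>_def)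
  have Tb: "bounded_seq (T \<epsilon>)" for \<epsilon>
  proof -
    obtain L where L: "\<And>n. \<bar>t n\<bar> \<le> L" using t by (auto simp: bounded_seq_def)
    have "\<bar>t n + (if t n = 0 then \<epsilon> else 0)\<bar> \<le> \<bar>t n\<bar> + \<bar>\<epsilon>\<bar>" for n by simp
    then have "\<bar>T \<epsilon> n\<bar> \<le> L + \<bar>\<epsilon>\<bar>" for n unfolding T_def using L by (meson add_right_mono order_trans)
    then show ?thesis by (rule bounded_seqI)
  qed
  have Tpos: "0 < T \<epsilon> n" if "0 < \<epsilon>" for \<epsilon> n using t(2)[of n] that by (auto simp: T_def)
  have Tcb: "cinner_bilinear \<zeta> (cdg (T \<epsilon>) \<theta>) = cinner_bilinear \<zeta> (cdg t \<theta>) + complex_of_real \<epsilon> * cinner_bilinear \<zeta> (cdg \<kappa> \<theta>)" for \<epsilon> \<zeta> \<theta>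
  proof -
    have "cdg (\<lambda>n. \<epsilon> * \<kappa> n) \<theta> = (\<epsilon> *\<^sub>R fst (cdg \<kappa> \<theta>), \<epsilon> *\<^sub>R snd (cdg \<kappa> \<theta>))"
      using dg_dg[OF bounded_seq_const[of \<epsilon>] \<kappa>] by (simp add: cdg_def)
    then have "cinner_bilinear \<zeta> (cdg (\<lambda>n. \<epsilon> * \<kappa> n) \<theta>) = complex_of_real \<epsilon> * cinner_bilinear \<zeta> (cdg \<kappa> \<theta>)"
      by (simp add: cinner_bilinear_def complex_eq_iff algebra_simps)
    then show ?thesis
      unfolding T_alt using cb_cdg_add[OF t(1) bounded_seq_mult[OF bounded_seq_const[of \<epsilon>] \<kappa>]] by simp
  qed
  let ?R = "\<lambda>x. \<Sum>(i, k)\<in>I \<times> K. a i * b k * exp (cinner_bilinear (Z i) (cdg t (Y k))) * exp_fun (Z i + Y k) x"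
  let ?Q = "\<lambda>\<epsilon> x. \<Sum>(i, k)\<in>I \<times> K. a i * b k * exp (cinner_bilinear (Z i) (cdg (T \<epsilon>) (Y k))) * exp_fun (Z i + Y k) x"
  have "Lp_tendsto \<mu> 2 ?Q ?R (at_right 0)"
    unfolding split_def
  proof (intro Lp_tendsto_sum Lp_tendsto_coeff)
    show "finite (I \<times> K)" using I K by simp
    fix z assume "z \<in> I \<times> K"
    then show "Lp \<mu> 2 (exp_fun (Z (fst z) + Y (snd z)))"
      using I K by (intro expbdd_Lp expbdd_exp_fun ctests_add) auto
    have "((\<lambda>\<epsilon>. a (fst z) * b (snd z) * exp (cinner_bilinear (Z (fst z)) (cdg t (Y (snd z))) + complex_of_real \<epsilon> * cinner_bilinear (Z (fst z)) (cdg \<kappa> (Y (snd z)))))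
        \<longlongrightarrow> a (fst z) * b (snd z) * exp (cinner_bilinear (Z (fst z)) (cdg t (Y (snd z))) + complex_of_real 0 * cinner_bilinear (Z (fst z)) (cdg \<kappa> (Y (snd z))))) (at_right 0)"
      by (intro tendsto_intros)
    then show "((\<lambda>\<epsilon>. a (fst z) * b (snd z) * exp (cinner_bilinear (Z (fst z)) (cdg (T \<epsilon>) (Y (snd z)))))
        \<longlongrightarrow> a (fst z) * b (snd z) * exp (cinner_bilinear (Z (fst z)) (cdg t (Y (snd z))))) (at_right 0)"
      unfolding Tcb by simp
  qed auto
  then have lim: "Lp_tendsto \<mu> 2 (\<lambda>\<epsilon>. wick_product_pos e \<mu> (T \<epsilon>) \<phi> \<psi>) ?R (at_right 0)"
  proof (rule Lp_tendsto_eventually_AE_cong)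
    have "\<forall>\<^sub>F \<epsilon> in at_right (0::real). 0 < \<epsilon>" by (rule eventually_at_right_less)
    then show "\<forall>\<^sub>F \<epsilon> in at_right 0. (AE x in \<mu>. ?Q \<epsilon> x = wick_product_pos e \<mu> (T \<epsilon>) \<phi> \<psi> x) \<and>
        wick_product_pos e \<mu> (T \<epsilon>) \<phi> \<psi> \<in> borel_measurable \<mu>"
    proof eventually_elim
      case (elim \<epsilon>)
      note W = wick_product_pos_exp_sum[OF Tb Tpos[OF elim] I K \<phi> \<psi>]
      show ?case using W(1) W(2) by (auto elim!: eventually_mono)
    qed
  qed
  let ?L = "\<lambda>G. Lp_tendsto \<mu> 2 (\<lambda>\<epsilon>. wick_product_pos e \<mu> (T \<epsilon>) \<phi> \<psi>) G (at_right 0)"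
  have T_eq: "(\<lambda>n. t n + (if t n = 0 then \<epsilon> else 0)) = T \<epsilon>" for \<epsilon> by (auto simp: T_def)
  have L: "?L (wick_product e \<mu> t \<phi> \<psi>)"
    unfolding wick_product_def T_eq using lim by (rule someI[of ?L])
  show "AE x in \<mu>. wick_product e \<mu> t \<phi> \<psi> x = ?R x"
    by (rule Lp_tendsto_unique[OF L lim]) auto
  show "wick_product e \<mu> t \<phi> \<psi> \<in> borel_measurable \<mu>"
    using L by (simp add: Lp_tendsto_def Lp_def)
qed

lemma wick_Gamma_exp_sum:
  assumes t: "bounded_seq t" "\<And>n. 0 \<le> t n" and c: "bounded_seq c" and d: "bounded_seq d"
    and I: "finite I" "\<And>i. i \<in> I \<Longrightarrow> Z i \<in> ctests" and K: "finite K" "\<And>k. k \<in> K \<Longrightarrow> Y k \<in> ctests"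
  shows "AE x in \<mu>. wick_Gamma e \<mu> t c d (\<lambda>x. \<Sum>i\<in>I. a i * exp_fun (Z i) x) (\<lambda>x. \<Sum>k\<in>K. b k * exp_fun (Y k) x) x =
      (\<Sum>(i, k)\<in>I \<times> K. a i * b k * exp (cinner_bilinear (cdg c (Z i)) (cdg t (cdg d (Y k)))) * exp_fun (cdg c (Z i) + cdg d (Y k)) x)"
    "wick_Gamma e \<mu> t c d (\<lambda>x. \<Sum>i\<in>I. a i * exp_fun (Z i) x) (\<lambda>x. \<Sum>k\<in>K. b k * exp_fun (Y k) x) \<in> borel_measurable \<mu>"
proof -
  let ?\<phi> = "\<lambda>x. \<Sum>i\<in>I. a i * exp_fun (Z i) x" and ?\<psi> = "\<lambda>x. \<Sum>k\<in>K. b k * exp_fun (Y k) x"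
  have G1: "AE x in \<mu>. Gamma e \<mu> c ?\<phi> x = (\<Sum>i\<in>I. a i * exp_fun (cdg c (Z i)) x)"
    "Gamma e \<mu> c ?\<phi> \<in> borel_measurable \<mu>"
    by (rule Gamma_exp_sum[where Z=Z and a=a and Z'="\<lambda>i. cdg c (Z i)", OF I(1) _ _ _ AE_I2[OF refl] exp_sum_measurable]; simp add: I(2) c ccoeff_cdg)+
  have G2: "AE x in \<mu>. Gamma e \<mu> d ?\<psi> x = (\<Sum>k\<in>K. b k * exp_fun (cdg d (Y k)) x)"
    "Gamma e \<mu> d ?\<psi> \<in> borel_measurable \<mu>"
    by (rule Gamma_exp_sum[where Z=Y and a=b and Z'="\<lambda>k. cdg d (Y k)", OF K(1) _ _ _ AE_I2[OF refl] exp_sum_measurable]; simp add: K(2) d ccoeff_cdg)+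
  show "AE x in \<mu>. wick_Gamma e \<mu> t c d (\<lambda>x. \<Sum>i\<in>I. a i * exp_fun (Z i) x) (\<lambda>x. \<Sum>k\<in>K. b k * exp_fun (Y k) x) x =
      (\<Sum>(i, k)\<in>I \<times> K. a i * b k * exp (cinner_bilinear (cdg c (Z i)) (cdg t (cdg d (Y k)))) * exp_fun (cdg c (Z i) + cdg d (Y k)) x)"
    "wick_Gamma e \<mu> t c d (\<lambda>x. \<Sum>i\<in>I. a i * exp_fun (Z i) x) (\<lambda>x. \<Sum>k\<in>K. b k * exp_fun (Y k) x) \<in> borel_measurable \<mu>"
    unfolding wick_Gamma_def
    by (rule wick_product_exp_sum[OF t I(1) _ K(1) _ G1 G2]; simp add: I(2) K(2) c d)+
qed

end

section \<open>The probabilistic representation\<close>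

lemma nn_integral_product_of_pair:
  assumes "sigma_finite_measure N" and [measurable]: "u \<in> borel_measurable M" "v \<in> borel_measurable N"
  shows "(\<integral>\<^sup>+z. u (fst z) * v (snd z) \<partial>(M \<Otimes>\<^sub>M N)) = (\<integral>\<^sup>+x. u x \<partial>M) * (\<integral>\<^sup>+y. v y \<partial>N)"
proof -
  interpret N: sigma_finite_measure N by fact
  have "(\<integral>\<^sup>+z. u (fst z) * v (snd z) \<partial>(M \<Otimes>\<^sub>M N)) = (\<integral>\<^sup>+x. \<integral>\<^sup>+y. u x * v y \<partial>N \<partial>M)"
    by (subst N.nn_integral_fst[symmetric]) auto
  also have "\<dots> = (\<integral>\<^sup>+x. u x * (\<integral>\<^sup>+y. v y \<partial>N) \<partial>M)"
    by (intro nn_integral_cong nn_integral_cmult) measurable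
  also have "\<dots> = (\<integral>\<^sup>+x. u x \<partial>M) * (\<integral>\<^sup>+y. v y \<partial>N)"
    by (rule nn_integral_multc) measurable
  finally show ?thesis .
qed

text \<open>A measure on the product is determined by rectangles, on which the integrals factorise.
  Two applications lift rotation invariance from \<mu> to the triple product.\<close>

lemma distr_pair_componentwise:
  assumes A: "prob_space A" and B: "prob_space B"
    and f[measurable]: "(\<lambda>z. f (fst z) (snd z)) \<in> measurable (A \<Otimes>\<^sub>M A) A"
    and g[measurable]: "(\<lambda>z. g (fst z) (snd z)) \<in> measurable (B \<Otimes>\<^sub>M B) B"
    and fA: "distr (A \<Otimes>\<^sub>M A) A (\<lambda>z. f (fst z) (snd z)) = A"
    and gB: "distr (B \<Otimes>\<^sub>M B) B (\<lambda>z. g (fst z) (snd z)) = B"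
  shows "distr ((A \<Otimes>\<^sub>M B) \<Otimes>\<^sub>M (A \<Otimes>\<^sub>M B)) (A \<Otimes>\<^sub>M B)
    (\<lambda>z. (f (fst (fst z)) (fst (snd z)), g (snd (fst z)) (snd (snd z)))) = A \<Otimes>\<^sub>M B"
proof -
  interpret A: prob_space A by fact
  interpret B: prob_space B by fact
  interpret AB: pair_prob_space A B ..
  let ?h = "\<lambda>z. (f (fst (fst z)) (fst (snd z)), g (snd (fst z)) (snd (snd z)))"
  let ?D = "distr ((A \<Otimes>\<^sub>M B) \<Otimes>\<^sub>M (A \<Otimes>\<^sub>M B)) (A \<Otimes>\<^sub>M B) ?h"
  have f': "(\<lambda>z. f (u z) (v z)) \<in> measurable N A" if "u \<in> measurable N A" "v \<in> measurable N A" for u v N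
    using measurable_compose[OF measurable_Pair[OF that] f] by simp
  have g': "(\<lambda>z. g (u z) (v z)) \<in> measurable N B" if "u \<in> measurable N B" "v \<in> measurable N B" for u v N
    using measurable_compose[OF measurable_Pair[OF that] g] by simp
  have h[measurable]: "?h \<in> measurable ((A \<Otimes>\<^sub>M B) \<Otimes>\<^sub>M (A \<Otimes>\<^sub>M B)) (A \<Otimes>\<^sub>M B)"
    by (intro measurable_Pair f' g') measurable
  have marg: "(\<integral>\<^sup>+x. \<integral>\<^sup>+x'. indicator S (k x x') \<partial>C \<partial>C) = emeasure C S"
    if C: "prob_space C" and k[measurable]: "(\<lambda>z. k (fst z) (snd z)) \<in> measurable (C \<Otimes>\<^sub>M C) C"
      and kC: "distr (C \<Otimes>\<^sub>M C) C (\<lambda>z. k (fst z) (snd z)) = C" and S[measurable]: "S \<in> sets C" for C k S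
  proof -
    interpret C: prob_space C by fact
    have "emeasure C S = (\<integral>\<^sup>+x. indicator S x \<partial>distr (C \<Otimes>\<^sub>M C) C (\<lambda>z. k (fst z) (snd z)))"
      using kC S by simp
    also have "\<dots> = (\<integral>\<^sup>+z. indicator S (k (fst z) (snd z)) \<partial>(C \<Otimes>\<^sub>M C))"
      by (rule nn_integral_distr) measurable
    also have "\<dots> = (\<integral>\<^sup>+x. \<integral>\<^sup>+x'. indicator S (k x x') \<partial>C \<partial>C)"
      by (subst C.nn_integral_fst[symmetric]) auto
    finally show ?thesis ..
  qed
  have "A \<Otimes>\<^sub>M B = ?D"
  proof (rule pair_measure_eqI)
    show "sigma_finite_measure A" "sigma_finite_measure B" by unfold_locales
    show "sets (A \<Otimes>\<^sub>M B) = sets ?D" by simp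
    fix S R assume S[measurable]: "S \<in> sets A" and R[measurable]: "R \<in> sets B"
    have "emeasure ?D (S \<times> R) = (\<integral>\<^sup>+z. indicator (S \<times> R) z \<partial>?D)"
      by (rule nn_integral_indicator[symmetric]) auto
    also have "\<dots> = (\<integral>\<^sup>+z. indicator (S \<times> R) (?h z) \<partial>((A \<Otimes>\<^sub>M B) \<Otimes>\<^sub>M (A \<Otimes>\<^sub>M B)))"
      by (rule nn_integral_distr[OF h]) auto
    also have "\<dots> = (\<integral>\<^sup>+\<omega>. \<integral>\<^sup>+\<omega>'. indicator (S \<times> R) (?h (\<omega>, \<omega>')) \<partial>(A \<Otimes>\<^sub>M B) \<partial>(A \<Otimes>\<^sub>M B))"
      by (rule AB.nn_integral_fst[symmetric]) measurable
    also have "\<dots> = (\<integral>\<^sup>+\<omega>. (\<integral>\<^sup>+x. indicator S (f (fst \<omega>) x) \<partial>A) * (\<integral>\<^sup>+y. indicator R (g (snd \<omega>) y) \<partial>B) \<partial>(A \<Otimes>\<^sub>M B))"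
    proof (intro nn_integral_cong)
      fix \<omega> assume \<omega>: "\<omega> \<in> space (A \<Otimes>\<^sub>M B)"
      then have [measurable]: "(\<lambda>x. f (fst \<omega>) x) \<in> measurable A A" "(\<lambda>y. g (snd \<omega>) y) \<in> measurable B B"
        by (auto intro!: f' g' simp: space_pair_measure)
      have "(\<integral>\<^sup>+\<omega>'. indicator (S \<times> R) (?h (\<omega>, \<omega>')) \<partial>(A \<Otimes>\<^sub>M B)) =
          (\<integral>\<^sup>+\<omega>'. indicator S (f (fst \<omega>) (fst \<omega>')) * indicator R (g (snd \<omega>) (snd \<omega>')) \<partial>(A \<Otimes>\<^sub>M B))"
        by (simp add: indicator_times)
      also have "\<dots> = (\<integral>\<^sup>+x. indicator S (f (fst \<omega>) x) \<partial>A) * (\<integral>\<^sup>+y. indicator R (g (snd \<omega>) y) \<partial>B)"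
        by (rule nn_integral_product_of_pair[OF B.sigma_finite_measure_axioms]) measurable
      finally show "(\<integral>\<^sup>+\<omega>'. indicator (S \<times> R) (?h (\<omega>, \<omega>')) \<partial>(A \<Otimes>\<^sub>M B)) =
          (\<integral>\<^sup>+x. indicator S (f (fst \<omega>) x) \<partial>A) * (\<integral>\<^sup>+y. indicator R (g (snd \<omega>) y) \<partial>B)" .
    qed
    also have "\<dots> = (\<integral>\<^sup>+x. \<integral>\<^sup>+x'. indicator S (f x x') \<partial>A \<partial>A) * (\<integral>\<^sup>+y. \<integral>\<^sup>+y'. indicator R (g y y') \<partial>B \<partial>B)"
    proof (rule nn_integral_product_of_pair[OF B.sigma_finite_measure_axioms])
      have "(\<lambda>(x, x'). indicator S (f x x') :: ennreal) \<in> borel_measurable (A \<Otimes>\<^sub>M A)"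
        using measurable_compose[OF f borel_measurable_indicator[OF S]] by (simp add: split_def)
      then show "(\<lambda>x. \<integral>\<^sup>+x'. indicator S (f x x') \<partial>A) \<in> borel_measurable A"
        by (rule A.borel_measurable_nn_integral)
      have "(\<lambda>(y, y'). indicator R (g y y') :: ennreal) \<in> borel_measurable (B \<Otimes>\<^sub>M B)"
        using measurable_compose[OF g borel_measurable_indicator[OF R]] by (simp add: split_def)
      then show "(\<lambda>y. \<integral>\<^sup>+y'. indicator R (g y y') \<partial>B) \<in> borel_measurable B"
        by (rule B.borel_measurable_nn_integral)
    qed
    also have "\<dots> = emeasure A S * emeasure B R"
      using marg[OF A f fA S] marg[OF B g gB R] by simp
    finally show "emeasure A S * emeasure B R = emeasure ?D (S \<times> R)" ..
  qed
  then show ?thesis by simp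
qed

context white_noise
begin

section \<open>Three independent copies of the noise\<close>

sublocale P2: pair_prob_space \<mu> \<mu> ..

abbreviation "Om \<equiv> \<mu> \<Otimes>\<^sub>M (\<mu> \<Otimes>\<^sub>M \<mu>)"

sublocale P3: pair_prob_space \<mu> "\<mu> \<Otimes>\<^sub>M \<mu>" ..

text \<open>For \<omega> = (x, y, z) this is C x + A (P y + Q z) with diagonal operators.
  \<open>U\<close>, \<open>V\<close> and x itself are instances, so that one inequality can treat
  all the fields alike.\<close>

definition rv :: "(nat \<Rightarrow> real) \<Rightarrow> (nat \<Rightarrow> real) \<Rightarrow> (nat \<Rightarrow> real) \<Rightarrow> (nat \<Rightarrow> real) \<Rightarrow>
    ('a \<Rightarrow> real) \<times> ('a \<Rightarrow> real) \<times> ('a \<Rightarrow> real) \<Rightarrow> 'a \<Rightarrow> real" where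
  "rv c a p q \<omega> = dcomb c a (fst \<omega>) (dcomb p q (fst (snd \<omega>)) (snd (snd \<omega>)))"

definition unit_coeffs :: "(nat \<Rightarrow> real) \<Rightarrow> (nat \<Rightarrow> real) \<Rightarrow> bool" where
  "unit_coeffs a b \<longleftrightarrow> (\<forall>n. (a n)\<^sup>2 + (b n)\<^sup>2 = 1)"

lemma unit_coeffs_bounded:
  assumes "unit_coeffs a b" shows "bounded_seq a" "bounded_seq b"
proof -
  have "(a n)\<^sup>2 \<le> 1" "(b n)\<^sup>2 \<le> 1" for n
    using assms zero_le_power2[of "a n"] zero_le_power2[of "b n"] unfolding unit_coeffs_def by (smt (verit))+
  then show "bounded_seq a" "bounded_seq b" by (auto intro!: bounded_seqI[of _ 1] simp: abs_square_le_1)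
qed

lemma rv_apply:
  assumes "bounded_seq c" "bounded_seq a" "bounded_seq p" "bounded_seq q" "\<xi> \<in> tests"
  shows "rv c a p q \<omega> \<xi> = fst \<omega> (dg c \<xi>) + fst (snd \<omega>) (dg p (dg a \<xi>)) + snd (snd \<omega>) (dg q (dg a \<xi>))"
  using assms by (simp add: rv_def dcomb_apply)

lemma rv_measurable [measurable]:
  assumes "bounded_seq c" "bounded_seq a" "bounded_seq p" "bounded_seq q"
  shows "rv c a p q \<in> measurable Om \<mu>"
  unfolding rv_def[abs_def] using assms by measurable

lemma distr_rv:
  assumes ca: "unit_coeffs c a" and pq: "unit_coeffs p q"
  shows "distr Om \<mu> (rv c a p q) = \<mu>"
proof -
  note b = unit_coeffs_bounded[OF ca] unit_coeffs_bounded[OF pq]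
  let ?h = "\<lambda>w. dcomb p q (fst w) (snd w)"
  let ?k = "\<lambda>z. dcomb c a (fst z) (snd z)"
  have h[measurable]: "?h \<in> measurable (\<mu> \<Otimes>\<^sub>M \<mu>) \<mu>" and k[measurable]: "?k \<in> measurable (\<mu> \<Otimes>\<^sub>M \<mu>) \<mu>"
    using b by measurable
  have dh: "distr (\<mu> \<Otimes>\<^sub>M \<mu>) \<mu> ?h = \<mu>" and dk: "distr (\<mu> \<Otimes>\<^sub>M \<mu>) \<mu> ?k = \<mu>"
    using distr_dcomb b ca pq unfolding unit_coeffs_def by blast+
  have "distr Om (\<mu> \<Otimes>\<^sub>M \<mu>) (\<lambda>(x, w). (x, ?h w)) = distr \<mu> \<mu> (\<lambda>x. x) \<Otimes>\<^sub>M distr (\<mu> \<Otimes>\<^sub>M \<mu>) \<mu> ?h"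
    by (rule pair_measure_distr[symmetric]) (auto simp: dh sigma_finite_measure_axioms)
  also have "\<dots> = \<mu> \<Otimes>\<^sub>M \<mu>" by (simp add: dh)
  finally have 1: "distr Om (\<mu> \<Otimes>\<^sub>M \<mu>) (\<lambda>(x, w). (x, ?h w)) = \<mu> \<Otimes>\<^sub>M \<mu>" .
  have "distr Om \<mu> (rv c a p q) = distr (distr Om (\<mu> \<Otimes>\<^sub>M \<mu>) (\<lambda>(x, w). (x, ?h w))) \<mu> ?k"
    by (subst distr_distr) (auto simp: rv_def[abs_def] comp_def split_def)
  then show ?thesis using 1 dk by simp
qed

lemma integral_rv:
  fixes F :: "('a \<Rightarrow> real) \<Rightarrow> 'b::{banach, second_countable_topology}"
  assumes ca: "unit_coeffs c a" and pq: "unit_coeffs p q" and F: "F \<in> borel_measurable \<mu>"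
  shows "(\<integral>\<omega>. F (rv c a p q \<omega>) \<partial>Om) = (\<integral>x. F x \<partial>\<mu>)"
    and "integrable Om (\<lambda>\<omega>. F (rv c a p q \<omega>)) \<longleftrightarrow> integrable \<mu> F"
proof -
  note b = unit_coeffs_bounded[OF ca] unit_coeffs_bounded[OF pq]
  note m = rv_measurable[OF b]
  show "(\<integral>\<omega>. F (rv c a p q \<omega>) \<partial>Om) = (\<integral>x. F x \<partial>\<mu>)"
    using integral_distr[OF m F] distr_rv[OF ca pq] by simp
  show "integrable Om (\<lambda>\<omega>. F (rv c a p q \<omega>)) \<longleftrightarrow> integrable \<mu> F"
    using integrable_distr_eq[OF m F] distr_rv[OF ca pq] by simp
qed

section \<open>Rotations of independent copies\<close>

definition rot :: "real \<Rightarrow> real \<Rightarrow> ('a \<Rightarrow> real) \<Rightarrow> ('a \<Rightarrow> real) \<Rightarrow> 'a \<Rightarrow> real" where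
  "rot a b = dcomb (\<lambda>n. a) (\<lambda>n. b)"

lemma rot_apply: "x \<in> duals \<Longrightarrow> y \<in> duals \<Longrightarrow> \<xi> \<in> tests \<Longrightarrow> rot a b x y \<xi> = a * x \<xi> + b * y \<xi>"
  by (simp add: rot_def dcomb_apply dual_scaleR)

lemma rot_dual [simp, intro]: "x \<in> duals \<Longrightarrow> y \<in> duals \<Longrightarrow> rot a b x y \<in> duals"
  by (simp add: rot_def dcomb_dual)

lemma rot_measurable [measurable (raw)]:
  "f \<in> measurable N \<mu> \<Longrightarrow> g \<in> measurable N \<mu> \<Longrightarrow> (\<lambda>\<omega>. rot a b (f \<omega>) (g \<omega>)) \<in> measurable N \<mu>"
  unfolding rot_def by measurable auto

lemma dual_eqI:
  assumes "x \<in> duals" "y \<in> duals" "\<And>\<xi>. \<xi> \<in> tests \<Longrightarrow> x \<xi> = y \<xi>"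
  shows "x = y"
  using assms by (intro extensionalityI[of _ tests]) (auto simp: dual_space_def)

lemma distr_rot: "a\<^sup>2 + b\<^sup>2 = 1 \<Longrightarrow> distr (\<mu> \<Otimes>\<^sub>M \<mu>) \<mu> (\<lambda>z. rot a b (fst z) (snd z)) = \<mu>"
  unfolding rot_def by (intro distr_dcomb) auto

definition rot3 where
  "rot3 a b \<omega> \<omega>' = (rot a b (fst \<omega>) (fst \<omega>'),
    rot a b (fst (snd \<omega>)) (fst (snd \<omega>')), rot a b (snd (snd \<omega>)) (snd (snd \<omega>')))"

lemma rot3_measurable: "(\<lambda>z. rot3 a b (fst z) (snd z)) \<in> measurable (Om \<Otimes>\<^sub>M Om) Om"
  unfolding rot3_def by measurable

lemma distr_rot3:
  assumes "a\<^sup>2 + b\<^sup>2 = 1"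
  shows "distr (Om \<Otimes>\<^sub>M Om) Om (\<lambda>z. rot3 a b (fst z) (snd z)) = Om"
proof -
  let ?g = "\<lambda>w w'. (rot a b (fst w) (fst w'), rot a b (snd w) (snd w'))"
  have m: "(\<lambda>z. rot a b (fst z) (snd z)) \<in> measurable (\<mu> \<Otimes>\<^sub>M \<mu>) \<mu>" by measurable
  have d2: "distr ((\<mu> \<Otimes>\<^sub>M \<mu>) \<Otimes>\<^sub>M (\<mu> \<Otimes>\<^sub>M \<mu>)) (\<mu> \<Otimes>\<^sub>M \<mu>) (\<lambda>z. ?g (fst z) (snd z)) = \<mu> \<Otimes>\<^sub>M \<mu>"
    by (rule distr_pair_componentwise[OF prob_space_axioms prob_space_axioms m m distr_rot[OF assms] distr_rot[OF assms]])
  have m2: "(\<lambda>z. ?g (fst z) (snd z)) \<in> measurable ((\<mu> \<Otimes>\<^sub>M \<mu>) \<Otimes>\<^sub>M (\<mu> \<Otimes>\<^sub>M \<mu>)) (\<mu> \<Otimes>\<^sub>M \<mu>)" by measurable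
  show ?thesis
    unfolding rot3_def
    by (rule distr_pair_componentwise[OF prob_space_axioms P2.prob_space_axioms m m2 distr_rot[OF assms] d2])
qed

text \<open>A rotation acts by scalars and therefore commutes with all diagonal operators: rotating
  the sample point rotates every field. In this way correlated fields are split into independent
  increments simultaneously.\<close>

lemma rv_rot3:
  assumes "bounded_seq c" "bounded_seq a" "bounded_seq p" "bounded_seq q" "\<omega> \<in> space Om" "\<omega>' \<in> space Om"
  shows "rv c a p q (rot3 s u \<omega> \<omega>') = rot s u (rv c a p q \<omega>) (rv c a p q \<omega>')"
proof -
  have d: "fst \<omega> \<in> duals" "fst (snd \<omega>) \<in> duals" "snd (snd \<omega>) \<in> duals"
    "fst \<omega>' \<in> duals" "fst (snd \<omega>') \<in> duals" "snd (snd \<omega>') \<in> duals"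
    using assms by (auto simp: space_pair_measure space_mu)
  have rv: "rv c a p q \<omega> \<in> duals" "rv c a p q \<omega>' \<in> duals"
    using d assms by (auto simp: rv_def)
  show ?thesis
  proof (rule dual_eqI)
    show "rv c a p q (rot3 s u \<omega> \<omega>') \<in> duals" using d assms unfolding rv_def rot3_def by auto
    show "rot s u (rv c a p q \<omega>) (rv c a p q \<omega>') \<in> duals" using rv by auto
    show "rv c a p q (rot3 s u \<omega> \<omega>') \<xi> = rot s u (rv c a p q \<omega>) (rv c a p q \<omega>') \<xi>" if "\<xi> \<in> tests" for \<xi>
      using that rv d assms by (simp add: rv_apply rot_apply) (simp add: rot3_def rot_apply algebra_simps)
  qed
qed

lemma rv_dual: "bounded_seq c \<Longrightarrow> bounded_seq a \<Longrightarrow> bounded_seq p \<Longrightarrow> bounded_seq q \<Longrightarrow> \<omega> \<in> space Om \<Longrightarrow> rv c a p q \<omega> \<in> duals"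
  using measurable_space[OF rv_measurable] by (simp add: space_mu)

lemma rv_ceval:
  assumes "bounded_seq c" "bounded_seq a" "bounded_seq p" "bounded_seq q" "\<zeta> \<in> ctests"
  shows "ceval \<zeta> (rv c a p q \<omega>) = ceval (cdg c \<zeta>) (fst \<omega>) +
    (ceval (cdg p (cdg a \<zeta>)) (fst (snd \<omega>)) + ceval (cdg q (cdg a \<zeta>)) (snd (snd \<omega>)))"
  using assms by (auto simp: ceval_def rv_apply cdg_def complex_eq_iff)

lemma cb_split:
  assumes "unit_coeffs a b"
  shows "cinner_bilinear (cdg a \<zeta>) (cdg a \<theta>) + cinner_bilinear (cdg b \<zeta>) (cdg b \<theta>) = cinner_bilinear \<zeta> \<theta>"
proof -
  note b = unit_coeffs_bounded[OF assms]
  have "(\<lambda>n. a n * a n + b n * b n) = (\<lambda>n. 1)"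
    using assms by (auto simp: unit_coeffs_def power2_eq_square)
  then show ?thesis
    using cb_cdg_add[of "\<lambda>n. a n * a n" "\<lambda>n. b n * b n" \<zeta> \<theta>] b by (simp add: cb_cdg)
qed

text \<open>By independence the characteristic function factorises into that of a centred normal
  law, whose variance is read off.\<close>

lemma gaussian_sum_moments:
  assumes A: "A \<in> tests" and B: "B \<in> tests" and C: "C \<in> tests"
  defines "Z \<equiv> \<lambda>\<omega>. fst \<omega> A + fst (snd \<omega>) B + snd (snd \<omega>) C"
  shows "integrable Om (\<lambda>\<omega>. (Z \<omega>)\<^sup>2)" "(\<integral>\<omega>. (Z \<omega>)\<^sup>2 \<partial>Om) = (norm A)\<^sup>2 + (norm B)\<^sup>2 + (norm C)\<^sup>2"
proof -
  have Zm: "Z \<in> borel_measurable Om" unfolding Z_def using assms by measurable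
  have i: "integrable \<mu> (\<lambda>x. exp (\<i> * complex_of_real (s * x \<eta>)))" if "\<eta> \<in> tests" for \<eta> s
  proof -
    have [measurable]: "(\<lambda>x. x \<eta>) \<in> borel_measurable \<mu>" using that by simp
    show ?thesis by (intro integrable_const_bound[where B=1]) auto
  qed
  have char: "(\<integral>\<omega>. exp (\<i> * complex_of_real (s * Z \<omega>)) \<partial>Om) =
      exp (- complex_of_real (s\<^sup>2 * ((norm A)\<^sup>2 + (norm B)\<^sup>2 + (norm C)\<^sup>2) / 2))" for s
  proof -
    have "(\<integral>\<omega>. exp (\<i> * complex_of_real (s * Z \<omega>)) \<partial>Om) =
      (\<integral>\<omega>. exp (\<i> * complex_of_real (s * fst \<omega> A)) *
        (\<lambda>w. exp (\<i> * complex_of_real (s * fst w B)) * exp (\<i> * complex_of_real (s * snd w C))) (snd \<omega>) \<partial>Om)"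
      by (simp add: Z_def mult_exp_exp algebra_simps)
    also have "\<dots> = (\<integral>x. exp (\<i> * complex_of_real (s * x A)) \<partial>\<mu>) *
        ((\<integral>x. exp (\<i> * complex_of_real (s * x B)) \<partial>\<mu>) * (\<integral>x. exp (\<i> * complex_of_real (s * x C)) \<partial>\<mu>))"
      using integral_product_of_pair(2)[OF P2.prob_space_axioms i[OF A, of s]
          integral_product_of_pair(1)[OF prob_space_axioms i[OF B, of s] i[OF C, of s]]]
        integral_product_of_pair(2)[OF prob_space_axioms i[OF B, of s] i[OF C, of s]] by simp
    also have "\<dots> = exp (- complex_of_real (s\<^sup>2 * ((norm A)\<^sup>2 + (norm B)\<^sup>2 + (norm C)\<^sup>2) / 2))"
      unfolding char_line[OF A] char_line[OF B] char_line[OF C] mult_exp_exp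
      by (rule arg_cong[where f=exp]) (simp add: field_simps)
    finally show ?thesis .
  qed
  show "integrable Om (\<lambda>\<omega>. (Z \<omega>)\<^sup>2)" "(\<integral>\<omega>. (Z \<omega>)\<^sup>2 \<partial>Om) = (norm A)\<^sup>2 + (norm B)\<^sup>2 + (norm C)\<^sup>2"
    by (rule P3.centered_normal_moments(3,4)[OF Zm char]; simp)+
qed

lemma eval_moments:
  assumes "\<xi> \<in> tests"
  shows "integrable \<mu> (\<lambda>x. x \<xi>)" "(\<integral>x. x \<xi> \<partial>\<mu>) = 0" "integrable \<mu> (\<lambda>x. (x \<xi>)\<^sup>2)" "(\<integral>x. (x \<xi>)\<^sup>2 \<partial>\<mu>) = (norm \<xi>)\<^sup>2"
  by (rule centered_normal_moments[OF eval_measurable[OF assms] char_line[OF assms]]; simp)+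

end

section \<open>The conditional expectation kernel\<close>

locale wick_kernel = white_noise e lam \<mu>
  for e :: "nat \<Rightarrow> 'a::{real_inner, banach}" and lam \<mu> +
  fixes t c d :: "nat \<Rightarrow> real"
  assumes c_le: "\<bar>c n\<bar> \<le> 1" and d_le: "\<bar>d n\<bar> \<le> 1" and t_range: "0 \<le> t n" "t n \<le> 2"
    and cdt: "(1 - (c n)\<^sup>2) * (1 - (d n)\<^sup>2) \<ge> (t n - 1)\<^sup>2 * (c n)\<^sup>2 * (d n)\<^sup>2"
begin

text \<open>\<open>\<beta>\<close> is chosen to make the covariance of \<open>U\<close> and \<open>V\<close> below equal to \<open>t c d\<close>, and the
  hypothesis on \<open>C, D, T\<close> says that \<open>\<bar>\<beta>\<bar> \<le> 1\<close> is possible. Where \<open>\<alpha> \<gamma> = 0\<close> the covariance is right for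
  any \<open>\<beta>\<close>.\<close>

definition \<alpha> :: "nat \<Rightarrow> real" where "\<alpha> n = sqrt (1 - (c n)\<^sup>2)"
definition \<gamma> :: "nat \<Rightarrow> real" where "\<gamma> n = sqrt (1 - (d n)\<^sup>2)"
definition \<beta> :: "nat \<Rightarrow> real" where
  "\<beta> n = (if \<alpha> n * \<gamma> n = 0 then 0 else (t n - 1) * c n * d n / (\<alpha> n * \<gamma> n))"
definition \<delta> :: "nat \<Rightarrow> real" where "\<delta> n = sqrt (1 - (\<beta> n)\<^sup>2)"

lemma c2: "(c n)\<^sup>2 \<le> 1" and d2: "(d n)\<^sup>2 \<le> 1"
  using c_le d_le by (simp_all add: abs_square_le_1)

lemma \<alpha>_unit: "unit_coeffs c \<alpha>" and \<gamma>_unit: "unit_coeffs d \<gamma>"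
  using c2 d2 by (auto simp: unit_coeffs_def \<alpha>_def \<gamma>_def)

lemma \<beta>_cov: "\<alpha> n * \<gamma> n * \<beta> n = (t n - 1) * c n * d n"
proof (cases "\<alpha> n * \<gamma> n = 0")
  case True
  \<comment> \<open>Hypothesis \<open>cdt\<close> bounds the square of the right-hand side by
    (\<alpha> \<gamma>)^2, which is 0 here.\<close>
  have "(\<alpha> n)\<^sup>2 * (\<gamma> n)\<^sup>2 = (1 - (c n)\<^sup>2) * (1 - (d n)\<^sup>2)" using c2 d2 by (simp add: \<alpha>_def \<gamma>_def)
  then have "((t n - 1) * c n * d n)\<^sup>2 \<le> (\<alpha> n * \<gamma> n)\<^sup>2" using cdt[of n] by (simp add: power_mult_distrib)
  then have "((t n - 1) * c n * d n)\<^sup>2 \<le> 0" unfolding True by simp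
  then show ?thesis unfolding True by simp
next
  case False
  then show ?thesis by (simp add: \<beta>_def)
qed

lemma \<beta>_le: "(\<beta> n)\<^sup>2 \<le> 1"
proof (cases "\<alpha> n * \<gamma> n = 0")
  case False
  have "(\<alpha> n)\<^sup>2 * (\<gamma> n)\<^sup>2 = (1 - (c n)\<^sup>2) * (1 - (d n)\<^sup>2)" using c2 d2 by (simp add: \<alpha>_def \<gamma>_def)
  then have "(\<alpha> n * \<gamma> n * \<beta> n)\<^sup>2 \<le> (\<alpha> n * \<gamma> n)\<^sup>2"
    unfolding \<beta>_cov using cdt[of n] by (simp add: power_mult_distrib)
  then have "(\<alpha> n * \<gamma> n)\<^sup>2 * (\<beta> n)\<^sup>2 \<le> (\<alpha> n * \<gamma> n)\<^sup>2 * 1" by (simp add: power_mult_distrib)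
  moreover have "0 < (\<alpha> n * \<gamma> n)\<^sup>2" using False by (subst zero_less_power2)
  ultimately show ?thesis by (metis mult_le_cancel_left_pos)
qed (simp add: \<beta>_def)

lemma \<beta>_unit: "unit_coeffs \<beta> \<delta>"
  using \<beta>_le by (auto simp: unit_coeffs_def \<delta>_def)

lemma one_unit: "unit_coeffs (\<lambda>n. 1) (\<lambda>n. 0)"
  by (simp add: unit_coeffs_def)

lemma bounded_coeffs [simp]:
  "bounded_seq c" "bounded_seq \<alpha>" "bounded_seq d" "bounded_seq \<gamma>" "bounded_seq \<beta>" "bounded_seq \<delta>" "bounded_seq t"
  using unit_coeffs_bounded[OF \<alpha>_unit] unit_coeffs_bounded[OF \<gamma>_unit] unit_coeffs_bounded[OF \<beta>_unit]
    bounded_seqI[of t 2] t_range by (auto simp: abs_of_nonneg)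

definition U where "U = rv c \<alpha> (\<lambda>n. 1) (\<lambda>n. 0)"
definition V where "V = rv d \<gamma> \<beta> \<delta>"

lemma U_measurable [measurable]: "U \<in> measurable Om \<mu>" and V_measurable [measurable]: "V \<in> measurable Om \<mu>"
  unfolding U_def V_def by (auto intro: rv_measurable)

text \<open>The conditional expectation given the first coordinate, in the form of section
  integrals: a definite function, where \<open>wick_Gamma\<close> is only a chosen version.\<close>

definition ker :: "(('a \<Rightarrow> real) \<Rightarrow> complex) \<Rightarrow> (('a \<Rightarrow> real) \<Rightarrow> complex) \<Rightarrow> ('a \<Rightarrow> real) \<Rightarrow> complex" where
  "ker \<phi> \<psi> x = (\<integral>w. \<phi> (U (x, w)) * \<psi> (V (x, w)) \<partial>(\<mu> \<Otimes>\<^sub>M \<mu>))"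

text \<open>The vectors \<open>C\<close>, \<open>A\<close> and \<open>B\<close> collect what is
  paired with x, y and z. Integrating out y and z produces the exponential of half the pairing of
  \<open>A\<close> with itself plus half that of \<open>B\<close>. By the unit relations and
  \<open>\<beta>_cov\<close> the whole exponent becomes the pairing of c \<zeta> with t d \<theta>
  plus the exponent of \<open>exp_fun C\<close>.\<close>

lemma ker_exp_fun:
  assumes \<zeta>: "\<zeta> \<in> ctests" and \<theta>: "\<theta> \<in> ctests" and x: "x \<in> duals"
  shows "integrable (\<mu> \<Otimes>\<^sub>M \<mu>) (\<lambda>w. exp_fun \<zeta> (U (x, w)) * exp_fun \<theta> (V (x, w)))"
    and "ker (exp_fun \<zeta>) (exp_fun \<theta>) x =
      exp (cinner_bilinear (cdg c \<zeta>) (cdg t (cdg d \<theta>))) * exp_fun (cdg c \<zeta> + cdg d \<theta>) x"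
proof -
  define A where "A = cdg (\<lambda>n. 1) (cdg \<alpha> \<zeta>) + cdg \<beta> (cdg \<gamma> \<theta>)"
  define B where "B = cdg (\<lambda>n. 0) (cdg \<alpha> \<zeta>) + cdg \<delta> (cdg \<gamma> \<theta>)"
  define C where "C = cdg c \<zeta> + cdg d \<theta>"
  have in_ct: "cdg c \<zeta> \<in> ctests" "cdg d \<theta> \<in> ctests" "cdg (\<lambda>n. 1) (cdg \<alpha> \<zeta>) \<in> ctests" "cdg \<beta> (cdg \<gamma> \<theta>) \<in> ctests"
    "cdg (\<lambda>n. 0) (cdg \<alpha> \<zeta>) \<in> ctests" "cdg \<delta> (cdg \<gamma> \<theta>) \<in> ctests"
    by (intro cdg_ctests \<zeta> \<theta>; simp)+
  have ct: "A \<in> ctests" "B \<in> ctests" "C \<in> ctests"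
    unfolding A_def B_def C_def by (intro ctests_add in_ct)+
  define K where "K = exp (- cinner_bilinear \<zeta> \<zeta> / 2) * exp (- cinner_bilinear \<theta> \<theta> / 2) * exp (ceval C x)"
  have eq: "exp_fun \<zeta> (U (x, w)) * exp_fun \<theta> (V (x, w)) = K * (exp (ceval A (fst w)) * exp (ceval B (snd w)))"
    if w: "w \<in> space (\<mu> \<Otimes>\<^sub>M \<mu>)" for w
  proof -
    have d: "fst w \<in> duals" "snd w \<in> duals" using w by (auto simp: space_pair_measure space_mu)
    have "ceval \<zeta> (U (x, w)) + ceval \<theta> (V (x, w)) = ceval C x + ceval A (fst w) + ceval B (snd w)"
      unfolding A_def B_def C_def U_def V_def
      by (simp add: rv_ceval \<zeta> \<theta> ceval_add[OF in_ct(1,2) x] ceval_add[OF in_ct(3,4) d(1)] ceval_add[OF in_ct(5,6) d(2)] del: cdg_1)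
    then have "exp (ceval \<zeta> (U (x, w))) * exp (ceval \<theta> (V (x, w))) = exp (ceval C x) * (exp (ceval A (fst w)) * exp (ceval B (snd w)))"
      by (simp add: mult_exp_exp add.assoc)
    then show ?thesis unfolding exp_fun_ceval K_def by (simp add: mult_ac)
  qed
  have i: "integrable \<mu> (\<lambda>y. exp (ceval A y))" "integrable \<mu> (\<lambda>y. exp (ceval B y))"
    using ct by (auto intro!: expbdd_integrable expbdd_exp_ceval)
  note prod = integral_product_of_pair[OF prob_space_axioms i]
  show "integrable (\<mu> \<Otimes>\<^sub>M \<mu>) (\<lambda>w. exp_fun \<zeta> (U (x, w)) * exp_fun \<theta> (V (x, w)))"
    using integrable_mult_right[OF prod(1), of K] by (subst Bochner_Integration.integrable_cong[OF refl eq]) auto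
  have "ker (exp_fun \<zeta>) (exp_fun \<theta>) x = (\<integral>w. K * (exp (ceval A (fst w)) * exp (ceval B (snd w))) \<partial>(\<mu> \<Otimes>\<^sub>M \<mu>))"
    unfolding ker_def by (intro Bochner_Integration.integral_cong refl eq)
  also have "\<dots> = K * (exp (cinner_bilinear A A / 2) * exp (cinner_bilinear B B / 2))"
    using prod by (simp add: integral_exp_ceval ct)
  also have "\<dots> = exp (ceval C x + (cinner_bilinear A A + cinner_bilinear B B - cinner_bilinear \<zeta> \<zeta> - cinner_bilinear \<theta> \<theta>) / 2)"
    unfolding K_def mult_exp_exp by (rule arg_cong[where f=exp]) (simp add: field_simps)
  also have "cinner_bilinear A A + cinner_bilinear B B - cinner_bilinear \<zeta> \<zeta> - cinner_bilinear \<theta> \<theta> =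
      2 * cinner_bilinear (cdg c \<zeta>) (cdg t (cdg d \<theta>)) - cinner_bilinear C C"
  proof -
    have zero: "cdg (\<lambda>n. 0) (cdg \<alpha> \<zeta>) = (0, 0)" by (simp add: cdg_def)
    have cz: "cinner_bilinear (0, 0) \<kappa> = 0" "cinner_bilinear \<kappa> (0, 0) = 0" for \<kappa> :: "'a \<times> 'a"
      by (simp_all add: cinner_bilinear_def zero_complex.code)
    have 1: "cinner_bilinear \<zeta> \<zeta> = cinner_bilinear (cdg c \<zeta>) (cdg c \<zeta>) + cinner_bilinear (cdg \<alpha> \<zeta>) (cdg \<alpha> \<zeta>)"
      by (rule cb_split[OF \<alpha>_unit, symmetric])
    have 2: "cinner_bilinear \<theta> \<theta> = cinner_bilinear (cdg d \<theta>) (cdg d \<theta>) + (cinner_bilinear (cdg \<beta> (cdg \<gamma> \<theta>)) (cdg \<beta> (cdg \<gamma> \<theta>))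
        + cinner_bilinear (cdg \<delta> (cdg \<gamma> \<theta>)) (cdg \<delta> (cdg \<gamma> \<theta>)))"
      by (simp only: cb_split[OF \<beta>_unit] cb_split[OF \<gamma>_unit])
    have 3: "cinner_bilinear (cdg c \<zeta>) (cdg t (cdg d \<theta>)) =
        cinner_bilinear (cdg c \<zeta>) (cdg d \<theta>) + cinner_bilinear (cdg \<alpha> \<zeta>) (cdg \<beta> (cdg \<gamma> \<theta>))"
    proof -
      have "(\<lambda>n. c n * (t n * d n)) = (\<lambda>n. c n * d n + \<alpha> n * (\<beta> n * \<gamma> n))"
        using \<beta>_cov by (auto simp: algebra_simps)
      then show ?thesis
        by (simp add: cdg_cdg cb_cdg cb_cdg_add[symmetric])
    qed
    show ?thesis
      unfolding 1 2 3 A_def B_def C_def zero cdg_1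
      by (simp add: cb_add_left cb_add_right cz cb_commute[of "cdg \<beta> (cdg \<gamma> \<theta>)" "cdg \<alpha> \<zeta>"]
          cb_commute[of "cdg d \<theta>" "cdg c \<zeta>"] algebra_simps zero_prod_def[symmetric])
  qed
  also have "exp (ceval C x + (2 * cinner_bilinear (cdg c \<zeta>) (cdg t (cdg d \<theta>)) - cinner_bilinear C C) / 2) =
      exp (cinner_bilinear (cdg c \<zeta>) (cdg t (cdg d \<theta>))) * exp_fun C x"
    unfolding exp_fun_ceval mult_exp_exp by (rule arg_cong[where f=exp]) (simp add: field_simps)
  finally show "ker (exp_fun \<zeta>) (exp_fun \<theta>) x =
      exp (cinner_bilinear (cdg c \<zeta>) (cdg t (cdg d \<theta>))) * exp_fun (cdg c \<zeta> + cdg d \<theta>) x"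
    unfolding C_def .
qed

lemma ker_exp_sum:
  assumes I: "finite I" "\<And>i. i \<in> I \<Longrightarrow> Z i \<in> ctests" and K: "finite K" "\<And>k. k \<in> K \<Longrightarrow> Y k \<in> ctests" and x: "x \<in> duals"
  shows "integrable (\<mu> \<Otimes>\<^sub>M \<mu>) (\<lambda>w. (\<Sum>i\<in>I. a i * exp_fun (Z i) (U (x, w))) * (\<Sum>k\<in>K. b k * exp_fun (Y k) (V (x, w))))"
    and "ker (\<lambda>x. \<Sum>i\<in>I. a i * exp_fun (Z i) x) (\<lambda>x. \<Sum>k\<in>K. b k * exp_fun (Y k) x) x =
    (\<Sum>(i, k)\<in>I \<times> K. a i * b k * exp (cinner_bilinear (cdg c (Z i)) (cdg t (cdg d (Y k)))) * exp_fun (cdg c (Z i) + cdg d (Y k)) x)"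
proof -
  have eq: "(\<Sum>i\<in>I. a i * exp_fun (Z i) (U (x, w))) * (\<Sum>k\<in>K. b k * exp_fun (Y k) (V (x, w))) =
      (\<Sum>z\<in>I \<times> K. a (fst z) * b (snd z) * (exp_fun (Z (fst z)) (U (x, w)) * exp_fun (Y (snd z)) (V (x, w))))" for w
    unfolding sum_product sum.cartesian_product by (intro sum.cong refl) (auto simp: mult_ac)
  have i: "integrable (\<mu> \<Otimes>\<^sub>M \<mu>) (\<lambda>w. a (fst z) * b (snd z) * (exp_fun (Z (fst z)) (U (x, w)) * exp_fun (Y (snd z)) (V (x, w))))"
    if "z \<in> I \<times> K" for z
    using that I K x by (intro integrable_mult_right ker_exp_fun(1)) auto
  show "integrable (\<mu> \<Otimes>\<^sub>M \<mu>) (\<lambda>w. (\<Sum>i\<in>I. a i * exp_fun (Z i) (U (x, w))) * (\<Sum>k\<in>K. b k * exp_fun (Y k) (V (x, w))))"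
    unfolding eq by (rule Bochner_Integration.integrable_sum[OF i])
  have "ker (\<lambda>x. \<Sum>i\<in>I. a i * exp_fun (Z i) x) (\<lambda>x. \<Sum>k\<in>K. b k * exp_fun (Y k) x) x =
      (\<Sum>z\<in>I \<times> K. a (fst z) * b (snd z) * ker (exp_fun (Z (fst z))) (exp_fun (Y (snd z))) x)"
    unfolding ker_def eq using i by (subst Bochner_Integration.integral_sum) auto
  also have "\<dots> = (\<Sum>(i, k)\<in>I \<times> K. a i * b k * exp (cinner_bilinear (cdg c (Z i)) (cdg t (cdg d (Y k)))) * exp_fun (cdg c (Z i) + cdg d (Y k)) x)"
    using I K x by (intro sum.cong refl) (auto simp: ker_exp_fun(2) simp del: cdg_1)
  finally show "ker (\<lambda>x. \<Sum>i\<in>I. a i * exp_fun (Z i) x) (\<lambda>x. \<Sum>k\<in>K. b k * exp_fun (Y k) x) x =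
    (\<Sum>(i, k)\<in>I \<times> K. a i * b k * exp (cinner_bilinear (cdg c (Z i)) (cdg t (cdg d (Y k)))) * exp_fun (cdg c (Z i) + cdg d (Y k)) x)" .
qed

lemma wick_Gamma_ker:
  assumes "\<phi> \<in> Exp e lam" "\<psi> \<in> Exp e lam"
  shows "AE x in \<mu>. wick_Gamma e \<mu> t c d \<phi> \<psi> x = ker \<phi> \<psi> x"
    "wick_Gamma e \<mu> t c d \<phi> \<psi> \<in> borel_measurable \<mu>"
proof -
  obtain S a where S: "finite S" "S \<subseteq> ctests" "\<phi> = (\<lambda>x. \<Sum>\<zeta>\<in>S. a \<zeta> * exp_fun \<zeta> x)"
    using assms(1) by (rule Exp_cases)
  obtain R b where R: "finite R" "R \<subseteq> ctests" "\<psi> = (\<lambda>x. \<Sum>\<zeta>\<in>R. b \<zeta> * exp_fun \<zeta> x)"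
    using assms(2) by (rule Exp_cases)
  have S': "\<And>i. i \<in> S \<Longrightarrow> i \<in> ctests" and R': "\<And>i. i \<in> R \<Longrightarrow> i \<in> ctests" using S R by auto
  note W = wick_Gamma_exp_sum[where Z="\<lambda>i. i" and Y="\<lambda>k. k" and a=a and b=b,
      OF bounded_coeffs(7) t_range(1) bounded_coeffs(1,3) S(1) S' R(1) R']
  note W = W[simplified]
  show "AE x in \<mu>. wick_Gamma e \<mu> t c d \<phi> \<psi> x = ker \<phi> \<psi> x"
    using W(1) AE_space
  proof eventually_elim
    case (elim x)
    then show ?case
      unfolding S(3) R(3) using ker_exp_sum(2)[where Z="\<lambda>i. i" and Y="\<lambda>k. k" and a=a and b=b, OF S(1) S' R(1) R', of x]
      by (simp add: space_mu)
  qed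
  show "wick_Gamma e \<mu> t c d \<phi> \<psi> \<in> borel_measurable \<mu>"
    unfolding S(3) R(3) by (rule W(2))
qed

end

section \<open>The Gaussian Hoelder inequality\<close>

subsection \<open>One small step\<close>

text \<open>With y^3 in place of |y|^3, the difference of the two sides has the derivative y^3 / (1
  + y). It has the sign of y, so the minimum is at 0.\<close>

lemma ln_le_cubic:
  fixes x :: real
  assumes "-1 < x"
  shows "ln (1 + x) \<le> x - x\<^sup>2 / 2 + \<bar>x\<bar> ^ 3 / 3"
proof -
  define g where "g y = y - y\<^sup>2 / 2 + y ^ 3 / 3 - ln (1 + y)" for y :: real
  have deriv: "(g has_real_derivative y ^ 3 / (1 + y)) (at y)" if "-1 < y" for y
  proof -
    have "(g has_real_derivative (1 - y + y\<^sup>2 - 1 / (1 + y))) (at y)"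
      unfolding g_def by (rule derivative_eq_intros refl | use that in \<open>simp add: power2_eq_square\<close>)+
    also have "1 - y + y\<^sup>2 - 1 / (1 + y) = y ^ 3 / (1 + y)"
      using that by (simp add: field_simps power2_eq_square power3_eq_cube)
    finally show ?thesis .
  qed
  have g0: "g 0 = 0" by (simp add: g_def)
  have "0 \<le> g x"
  proof (cases "0 \<le> x")
    case True
    have "g 0 \<le> g x"
      by (rule DERIV_nonneg_imp_nondecreasing[OF True]) (use deriv in \<open>force intro!: divide_nonneg_nonneg\<close>)
    then show ?thesis using g0 by simp
  next
    case False
    have "g 0 \<le> g x"
    proof (rule DERIV_nonpos_imp_nonincreasing[of x 0 g])
      show "x \<le> 0" using False by simp
      fix y assume y: "x \<le> y" "y \<le> 0"
      have "y ^ 3 \<le> 0" using y by (simp add: power_le_zero_eq)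
      then have "y ^ 3 / (1 + y) \<le> 0" using y assms by (simp add: divide_nonpos_pos)
      then show "\<exists>z. (g has_real_derivative z) (at y) \<and> z \<le> 0" using deriv[of y] y assms by force
    qed
    then show ?thesis using g0 by simp
  qed
  moreover have "x ^ 3 \<le> \<bar>x\<bar> ^ 3" by (metis abs_ge_self power_abs)
  ultimately show ?thesis by (simp add: g_def)
qed

lemma exp_le_cubic:
  fixes w :: real
  assumes "\<bar>w\<bar> \<le> B"
  shows "exp w \<le> 1 + w + w\<^sup>2 / 2 + exp B * \<bar>w\<bar> ^ 3"
proof -
  obtain s where s: "\<bar>s\<bar> \<le> \<bar>w\<bar>" "exp w = (\<Sum>m<3. w ^ m / fact m) + exp s / fact 3 * w ^ 3"
    using Maclaurin_exp_le[of w 3] by blast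
  have "exp s / fact 3 * w ^ 3 \<le> exp s / fact 3 * \<bar>w\<bar> ^ 3"
    by (intro mult_left_mono) (metis abs_ge_self power_abs, simp)
  also have "\<dots> \<le> exp B * \<bar>w\<bar> ^ 3"
  proof (intro mult_right_mono)
    have "exp s / fact 3 \<le> exp s" by (simp add: fact_numeral)
    also have "\<dots> \<le> exp B" using s(1) assms by simp
    finally show "exp s / fact 3 \<le> exp B" .
  qed simp
  finally show ?thesis using s(2) by (simp add: eval_nat_numeral)
qed

text \<open>In logarithmic form the product is at most exp (u + v), with \<open>u\<close> linear in
  x and \<open>v\<close> of second order. Terms up to second order are kept exactly, because they
  decide the comparison of variances; whatever is of third order goes into one constant.\<close>

lemma prod_powr_upper:
  fixes a :: "'i \<Rightarrow> real"
  assumes I: "finite I" and a: "\<And>i. i \<in> I \<Longrightarrow> 0 \<le> a i" and k: "0 < k"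
  shows "\<exists>C\<ge>0. \<forall>x. (\<forall>i\<in>I. k \<le> 1 + x i \<and> 1 + x i \<le> 1 / k) \<longrightarrow>
    (\<Prod>i\<in>I. (1 + x i) powr a i) \<le> 1 + (\<Sum>i\<in>I. a i * x i) - (\<Sum>i\<in>I. a i * (x i)\<^sup>2) / 2
      + (\<Sum>i\<in>I. a i * x i)\<^sup>2 / 2 + C * (\<Sum>i\<in>I. \<bar>x i\<bar>) ^ 3"
proof -
  define A where "A = (\<Sum>i\<in>I. a i)"
  \<comment> \<open>For the sum m of all |x_i|, \<open>M\<close> bounds m, L m^2 bounds |v| and D m
    bounds |u + v|. The constant \<open>C\<close> adds the cubic errors of the logarithm, of (u +
    v)^2 / 2 and of the exponential.\<close>
  define M where "M = real (card I) * (1 + 1 / k)"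
  define L where "L = A * (1 + M)"
  define D where "D = A + L * M"
  define C where "C = A / 3 + A * L + L\<^sup>2 * M / 2 + exp (D * M) * D ^ 3"
  have A0: "0 \<le> A" and M0: "0 \<le> M" using a k by (auto simp: A_def M_def sum_nonneg)
  have L0: "0 \<le> L" using A0 M0 by (simp add: L_def)
  have D0: "0 \<le> D" using A0 M0 L0 by (simp add: D_def)
  have C0: "0 \<le> C" using A0 M0 L0 D0 by (simp add: C_def)
  show ?thesis
  proof (intro exI[of _ C] conjI allI impI C0)
    fix x :: "'i \<Rightarrow> real" assume x: "\<forall>i\<in>I. k \<le> 1 + x i \<and> 1 + x i \<le> 1 / k"
    define m where "m = (\<Sum>i\<in>I. \<bar>x i\<bar>)"
    define u where "u = (\<Sum>i\<in>I. a i * x i)"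
    define v where "v = (\<Sum>i\<in>I. a i * (- (x i)\<^sup>2 / 2 + \<bar>x i\<bar> ^ 3 / 3))"
    have m0: "0 \<le> m" by (simp add: m_def sum_nonneg)
    have xm: "\<bar>x i\<bar> \<le> m" if "i \<in> I" for i
      unfolding m_def by (rule member_le_sum[OF that]) (use I in auto)
    have mM: "m \<le> M"
    proof -
      have "\<bar>x i\<bar> \<le> 1 + 1 / k" if "i \<in> I" for i using x that k by (auto simp: abs_le_iff)
      then have "m \<le> (\<Sum>i\<in>I. 1 + 1 / k)" unfolding m_def by (rule sum_mono)
      then show ?thesis by (simp add: M_def)
    qed
    have weighted: "\<bar>\<Sum>i\<in>I. a i * y i\<bar> \<le> A * Y" if "\<And>i. i \<in> I \<Longrightarrow> \<bar>y i\<bar> \<le> Y" for y Y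
    proof -
      have "\<bar>\<Sum>i\<in>I. a i * y i\<bar> \<le> (\<Sum>i\<in>I. \<bar>a i * y i\<bar>)" by (rule sum_abs)
      also have "\<dots> \<le> (\<Sum>i\<in>I. a i * Y)"
        using that a by (intro sum_mono) (simp add: abs_mult mult_left_mono)
      finally show ?thesis by (simp add: A_def sum_distrib_right)
    qed
    have u: "\<bar>u\<bar> \<le> A * m" unfolding u_def by (rule weighted[OF xm])
    have v: "\<bar>v\<bar> \<le> L * m\<^sup>2"
    proof -
      have "\<bar>v\<bar> \<le> A * ((1 + M) * m\<^sup>2)"
        unfolding v_def
      proof (rule weighted)
        fix i assume i: "i \<in> I"
        have x2: "(x i)\<^sup>2 \<le> m\<^sup>2" using power_mono[OF xm[OF i], of 2] by simp
        have "\<bar>x i\<bar> ^ 3 = \<bar>x i\<bar> * (x i)\<^sup>2" by (simp add: power3_eq_cube power2_eq_square)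
        also have "\<dots> \<le> M * m\<^sup>2" using xm[OF i] mM x2 m0 by (intro mult_mono) auto
        finally have "\<bar>x i\<bar> ^ 3 \<le> M * m\<^sup>2" .
        moreover have "0 \<le> \<bar>x i\<bar> ^ 3" "0 \<le> (x i)\<^sup>2" by auto
        ultimately show "\<bar>- (x i)\<^sup>2 / 2 + \<bar>x i\<bar> ^ 3 / 3\<bar> \<le> (1 + M) * m\<^sup>2"
          using x2 unfolding distrib_right by linarith
      qed
      then show ?thesis by (simp add: L_def mult.assoc)
    qed
    have uv: "\<bar>u + v\<bar> \<le> D * m"
    proof -
      have "L * m\<^sup>2 \<le> L * (M * m)" using mM m0 L0 by (intro mult_left_mono) (auto simp: power2_eq_square mult_right_mono)
      then show ?thesis using u v by (simp add: D_def algebra_simps)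
    qed
    have uvB: "\<bar>u + v\<bar> \<le> D * M" using uv mult_left_mono[OF mM D0] by linarith
    have "(\<Prod>i\<in>I. (1 + x i) powr a i) = exp (\<Sum>i\<in>I. a i * ln (1 + x i))"
      using I x k by (subst exp_sum) (auto simp: powr_def intro!: prod.cong)
    also have "\<dots> \<le> exp (u + v)"
    proof -
      have "(\<Sum>i\<in>I. a i * ln (1 + x i)) \<le> (\<Sum>i\<in>I. a i * (x i + (- (x i)\<^sup>2 / 2 + \<bar>x i\<bar> ^ 3 / 3)))"
      proof (intro sum_mono mult_left_mono a)
        fix i assume "i \<in> I"
        then show "ln (1 + x i) \<le> x i + (- (x i)\<^sup>2 / 2 + \<bar>x i\<bar> ^ 3 / 3)"
          using ln_le_cubic[of "x i"] x k by force
      qed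
      then show ?thesis by (simp add: u_def v_def distrib_left sum.distrib)
    qed
    also have "\<dots> \<le> 1 + (u + v) + (u + v)\<^sup>2 / 2 + exp (D * M) * \<bar>u + v\<bar> ^ 3"
      by (rule exp_le_cubic[OF uvB])
    also have "\<dots> \<le> 1 + u - (\<Sum>i\<in>I. a i * (x i)\<^sup>2) / 2 + u\<^sup>2 / 2 + C * m ^ 3"
    proof -
      have "v \<le> - (\<Sum>i\<in>I. a i * (x i)\<^sup>2) / 2 + A / 3 * m ^ 3"
      proof -
        have "v = - (\<Sum>i\<in>I. a i * (x i)\<^sup>2) / 2 + (\<Sum>i\<in>I. a i * \<bar>x i\<bar> ^ 3) / 3"
          by (simp add: v_def right_diff_distrib sum_subtractf sum_divide_distrib)
        moreover have "(\<Sum>i\<in>I. a i * \<bar>x i\<bar> ^ 3) \<le> A * m ^ 3"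
          using weighted[of "\<lambda>i. \<bar>x i\<bar> ^ 3" "m ^ 3"] xm by (force intro: power_mono)
        ultimately show ?thesis by simp
      qed
      moreover have "(u + v)\<^sup>2 / 2 \<le> u\<^sup>2 / 2 + (A * L + L\<^sup>2 * M / 2) * m ^ 3"
      proof -
        have "u * v \<le> \<bar>u\<bar> * \<bar>v\<bar>" by (metis abs_ge_self abs_mult)
        also have "\<dots> \<le> (A * m) * (L * m\<^sup>2)" using u v A0 m0 by (intro mult_mono) auto
        finally have 1: "u * v \<le> A * L * m ^ 3" by (simp add: power2_eq_square power3_eq_cube mult_ac)
        have "v\<^sup>2 \<le> (L * m\<^sup>2)\<^sup>2" using power_mono[OF v, of 2] by simp
        also have "\<dots> = L\<^sup>2 * (m * m ^ 3)" by (simp add: power_mult_distrib eval_nat_numeral)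
        also have "\<dots> \<le> L\<^sup>2 * (M * m ^ 3)" using mM m0 by (intro mult_left_mono mult_right_mono) auto
        finally show ?thesis using 1 by (simp add: power2_sum algebra_simps)
      qed
      moreover have "exp (D * M) * \<bar>u + v\<bar> ^ 3 \<le> exp (D * M) * (D * m) ^ 3"
        using uv by (intro mult_left_mono power_mono) auto
      moreover have "C * m ^ 3 = A / 3 * m ^ 3 + (A * L + L\<^sup>2 * M / 2) * m ^ 3 + exp (D * M) * (D * m) ^ 3"
        unfolding C_def power_mult_distrib by (simp only: distrib_right mult.assoc)
      ultimately show ?thesis by linarith
    qed
    finally show "(\<Prod>i\<in>I. (1 + x i) powr a i) \<le> 1 + (\<Sum>i\<in>I. a i * x i) - (\<Sum>i\<in>I. a i * (x i)\<^sup>2) / 2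
      + (\<Sum>i\<in>I. a i * x i)\<^sup>2 / 2 + C * (\<Sum>i\<in>I. \<bar>x i\<bar>) ^ 3"
      unfolding u_def m_def .
  qed
qed

text \<open>From ln y >= 1 - 1/y and exp z >= 1 + z. The crude coefficient 1/k of the quadratic term
  is affordable: the bound is applied to means, which are of second order in the step, so that their
  squares are of fourth order.\<close>

lemma prod_powr_lower:
  fixes a x :: "'i \<Rightarrow> real"
  assumes I: "finite I" and a: "\<And>i. i \<in> I \<Longrightarrow> 0 \<le> a i" and k: "0 < k" and x: "\<And>i. i \<in> I \<Longrightarrow> k \<le> 1 + x i"
  shows "1 + (\<Sum>i\<in>I. a i * x i) - (\<Sum>i\<in>I. a i * (x i)\<^sup>2) / k \<le> (\<Prod>i\<in>I. (1 + x i) powr a i)"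
proof -
  have "1 + (\<Sum>i\<in>I. a i * x i) - (\<Sum>i\<in>I. a i * (x i)\<^sup>2) / k = 1 + (\<Sum>i\<in>I. a i * (x i - (x i)\<^sup>2 / k))"
    by (simp add: right_diff_distrib sum_subtractf sum_divide_distrib)
  also have "\<dots> \<le> 1 + (\<Sum>i\<in>I. a i * ln (1 + x i))"
  proof (intro add_left_mono sum_mono mult_left_mono a)
    fix i assume i: "i \<in> I"
    have p: "0 < 1 + x i" using x[OF i] k by linarith
    have "ln (1 / (1 + x i)) \<le> 1 / (1 + x i) - 1" using ln_le_minus_one[of "1 / (1 + x i)"] p by simp
    then have "1 - 1 / (1 + x i) \<le> ln (1 + x i)" using p by (simp add: ln_div)
    moreover have "(x i)\<^sup>2 / (1 + x i) \<le> (x i)\<^sup>2 / k" using x[OF i] k p by (intro divide_left_mono) auto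
    moreover have "1 - 1 / (1 + x i) = x i - (x i)\<^sup>2 / (1 + x i)" using p by (simp add: field_simps power2_eq_square)
    ultimately show "x i - (x i)\<^sup>2 / k \<le> ln (1 + x i)" by linarith
  qed
  also have "\<dots> \<le> exp (\<Sum>i\<in>I. a i * ln (1 + x i))" by (rule exp_ge_add_one_self)
  also have "\<dots> = (\<Prod>i\<in>I. (1 + x i) powr a i)"
    using I x k by (subst exp_sum) (force simp: powr_def intro!: prod.cong)+
  finally show ?thesis .
qed

text \<open>To second order in the step size \<open>s\<close> the inequality is the variance bound for the linear
  parts \<open>l i\<close>; the error is of order \<open>s\<^sup>3\<close>, so that \<open>n\<close> steps of size \<open>1 / sqrt n\<close> lose a
  factor tending to \<open>1\<close>.\<close>

lemma (in prob_space) small_step: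
  fixes a :: "'i \<Rightarrow> real" and R :: "'a \<Rightarrow> real"
  assumes I: "finite I" and a: "\<And>i. i \<in> I \<Longrightarrow> 0 \<le> a i" and k: "0 < k" "k \<le> 1" and K: "0 \<le> K"
    and Rm: "R \<in> borel_measurable M" and R1: "\<And>\<omega>. 1 \<le> R \<omega>" and R6: "integrable M (\<lambda>\<omega>. R \<omega> ^ 6)"
  shows "\<exists>C\<ge>0. \<forall>s x l. 0 < s \<longrightarrow> s \<le> 1 \<longrightarrow>
    (\<forall>i\<in>I. x i \<in> borel_measurable M \<and> l i \<in> borel_measurable M \<and> integral\<^sup>L M (l i) = 0 \<and>
      (\<forall>\<omega>\<in>space M. k \<le> 1 + x i \<omega> \<and> 1 + x i \<omega> \<le> 1 / k \<and> \<bar>l i \<omega>\<bar> \<le> K * R \<omega> \<and>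
        \<bar>x i \<omega> - s * l i \<omega>\<bar> \<le> K * s\<^sup>2 * (R \<omega>)\<^sup>2)) \<longrightarrow>
    (\<integral>\<omega>. (\<Sum>i\<in>I. a i * l i \<omega>)\<^sup>2 \<partial>M) \<le> (\<Sum>i\<in>I. a i * (\<integral>\<omega>. (l i \<omega>)\<^sup>2 \<partial>M)) \<longrightarrow>
    (\<integral>\<omega>. (\<Prod>i\<in>I. (1 + x i \<omega>) powr a i) \<partial>M) \<le> (1 + C * s ^ 3) * (\<Prod>i\<in>I. (1 + (\<integral>\<omega>. x i \<omega> \<partial>M)) powr a i)"
proof -
  have "\<exists>C\<ge>0. \<forall>x. (\<forall>i\<in>I. k \<le> 1 + x i \<and> 1 + x i \<le> 1 / k) \<longrightarrow>
    (\<Prod>i\<in>I. (1 + x i) powr a i) \<le> 1 + (\<Sum>i\<in>I. a i * x i) - (\<Sum>i\<in>I. a i * (x i)\<^sup>2) / 2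
      + (\<Sum>i\<in>I. a i * x i)\<^sup>2 / 2 + C * (\<Sum>i\<in>I. \<bar>x i\<bar>) ^ 3"
    by (rule prod_powr_upper[OF I _ k(1)]) (rule a)
  then obtain C1 where C1: "0 \<le> C1" "\<And>x. (\<forall>i\<in>I. k \<le> 1 + x i \<and> 1 + x i \<le> 1 / k) \<Longrightarrow>
    (\<Prod>i\<in>I. (1 + x i) powr a i) \<le> 1 + (\<Sum>i\<in>I. a i * x i) - (\<Sum>i\<in>I. a i * (x i)\<^sup>2) / 2
      + (\<Sum>i\<in>I. a i * x i)\<^sup>2 / 2 + C1 * (\<Sum>i\<in>I. \<bar>x i\<bar>) ^ 3"
    by blast
  define A where "A = (\<Sum>i\<in>I. a i)"
  \<comment> \<open>Increments are at most 2 K s R^2, so a cubic error costs s^3 R^6: hence the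
    sixth moment. \<open>C2\<close> collects the pointwise cubic errors, \<open>C3\<close> adds the
    squares of the means, and \<open>P0\<close> bounds the product on the right from below.\<close>
  define Q where "Q = (\<integral>\<omega>. R \<omega> ^ 6 \<partial>M)"
  define C2 where "C2 = 3 / 2 * A * K\<^sup>2 + 3 / 2 * A\<^sup>2 * K\<^sup>2 + C1 * (real (card I) * (2 * K)) ^ 3"
  define C3 where "C3 = C2 * Q + A * (K * Q)\<^sup>2 / k"
  define P0 where "P0 = k powr A"
  have A0: "0 \<le> A" using a by (simp add: A_def sum_nonneg)
  have Q0: "0 \<le> Q" unfolding Q_def using R1 by (intro integral_nonneg_AE AE_I2) (smt (verit) zero_le_power)
  have C20: "0 \<le> C2" using A0 K C1 by (simp add: C2_def)
  have C30: "0 \<le> C3" using C20 Q0 A0 K k by (simp add: C3_def)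
  have P0: "0 < P0" using k by (simp add: P0_def)
  have Rpow: "R \<omega> ^ j \<le> R \<omega> ^ 6" if "j \<le> 6" for \<omega> j using R1 that by (intro power_increasing) auto
  have Rnn: "0 \<le> R \<omega>" for \<omega> using R1[of \<omega>] by linarith
  have Rint: "integrable M (\<lambda>\<omega>. R \<omega> ^ j)" if "j \<le> 6" for j
    using Rpow[OF that] Rnn Rm by (intro Bochner_Integration.integrable_bound[OF R6]) (auto intro!: AE_I2)
  show ?thesis
  proof (intro exI[of _ "C3 / P0"] conjI allI impI)
    show "0 \<le> C3 / P0" using C30 P0 by simp
    fix s x l
    assume s: "0 < s" "s \<le> 1"
      and H: "\<forall>i\<in>I. x i \<in> borel_measurable M \<and> l i \<in> borel_measurable M \<and> integral\<^sup>L M (l i) = 0 \<and>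
        (\<forall>\<omega>\<in>space M. k \<le> 1 + x i \<omega> \<and> 1 + x i \<omega> \<le> 1 / k \<and> \<bar>l i \<omega>\<bar> \<le> K * R \<omega> \<and>
        \<bar>x i \<omega> - s * l i \<omega>\<bar> \<le> K * s\<^sup>2 * (R \<omega>)\<^sup>2)"
      and var: "(\<integral>\<omega>. (\<Sum>i\<in>I. a i * l i \<omega>)\<^sup>2 \<partial>M) \<le> (\<Sum>i\<in>I. a i * (\<integral>\<omega>. (l i \<omega>)\<^sup>2 \<partial>M))"
    have xm: "x i \<in> borel_measurable M" and lm: "l i \<in> borel_measurable M" and l0: "integral\<^sup>L M (l i) = 0"
      and xb: "\<And>\<omega>. \<omega> \<in> space M \<Longrightarrow> k \<le> 1 + x i \<omega> \<and> 1 + x i \<omega> \<le> 1 / k"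
      and lb: "\<And>\<omega>. \<omega> \<in> space M \<Longrightarrow> \<bar>l i \<omega>\<bar> \<le> K * R \<omega>"
      and xl: "\<And>\<omega>. \<omega> \<in> space M \<Longrightarrow> \<bar>x i \<omega> - s * l i \<omega>\<bar> \<le> K * s\<^sup>2 * (R \<omega>)\<^sup>2" if "i \<in> I" for i
      using H that by auto
    have xint: "integrable M (x i)" if "i \<in> I" for i
    proof (rule integrable_const_bound[where B="1 + 1 / k"])
      show "AE \<omega> in M. norm (x i \<omega>) \<le> 1 + 1 / k"
      proof (rule AE_I2)
        fix \<omega> assume "\<omega> \<in> space M"
        moreover have "0 < 1 / k" using k by simp
        ultimately show "norm (x i \<omega>) \<le> 1 + 1 / k" using xb[OF that, of \<omega>] k by (auto simp: abs_le_iff)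
      qed
    qed (rule xm[OF that])
    have lint: "integrable M (l i)" if "i \<in> I" for i
    proof (rule Bochner_Integration.integrable_bound[of M "\<lambda>\<omega>. K * R \<omega>"])
      show "integrable M (\<lambda>\<omega>. K * R \<omega>)" using Rint[of 1] by simp
      show "AE \<omega> in M. norm (l i \<omega>) \<le> norm (K * R \<omega>)"
      proof (rule AE_I2)
        fix \<omega> assume "\<omega> \<in> space M"
        then show "norm (l i \<omega>) \<le> norm (K * R \<omega>)" using lb[OF that, of \<omega>] by simp
      qed
    qed (rule lm[OF that])
    have l2int: "integrable M (\<lambda>\<omega>. (l i \<omega>)\<^sup>2)" if "i \<in> I" for i
    proof (rule Bochner_Integration.integrable_bound[of M "\<lambda>\<omega>. K\<^sup>2 * (R \<omega>)\<^sup>2"])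
      show "integrable M (\<lambda>\<omega>. K\<^sup>2 * (R \<omega>)\<^sup>2)" using Rint[of 2] by simp
      show "AE \<omega> in M. norm ((l i \<omega>)\<^sup>2) \<le> norm (K\<^sup>2 * (R \<omega>)\<^sup>2)"
      proof (rule AE_I2)
        fix \<omega> assume "\<omega> \<in> space M"
        from power_mono[OF lb[OF that this], of 2] show "norm ((l i \<omega>)\<^sup>2) \<le> norm (K\<^sup>2 * (R \<omega>)\<^sup>2)"
          by (simp add: power_mult_distrib)
      qed
    qed (use lm[OF that] in measurable)
    have wb: "\<bar>\<Sum>i\<in>I. a i * y i\<bar> \<le> A * Y" if "\<And>i. i \<in> I \<Longrightarrow> \<bar>y i\<bar> \<le> Y" for y Y
    proof -
      have "\<bar>\<Sum>i\<in>I. a i * y i\<bar> \<le> (\<Sum>i\<in>I. \<bar>a i * y i\<bar>)" by (rule sum_abs)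
      also have "\<dots> \<le> (\<Sum>i\<in>I. a i * Y)" using that a by (intro sum_mono) (simp add: abs_mult mult_left_mono)
      finally show ?thesis by (simp add: A_def sum_distrib_right)
    qed
    have slm: "(\<lambda>\<omega>. \<Sum>i\<in>I. a i * l i \<omega>) \<in> borel_measurable M"
      using lm by (intro borel_measurable_sum borel_measurable_times) auto
    have sl2int: "integrable M (\<lambda>\<omega>. (\<Sum>i\<in>I. a i * l i \<omega>)\<^sup>2)"
    proof (rule Bochner_Integration.integrable_bound[of M "\<lambda>\<omega>. (A * K)\<^sup>2 * (R \<omega>)\<^sup>2"])
      show "integrable M (\<lambda>\<omega>. (A * K)\<^sup>2 * (R \<omega>)\<^sup>2)" using Rint[of 2] by simp
      show "AE \<omega> in M. norm ((\<Sum>i\<in>I. a i * l i \<omega>)\<^sup>2) \<le> norm ((A * K)\<^sup>2 * (R \<omega>)\<^sup>2)"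
      proof (rule AE_I2)
        fix \<omega> assume "\<omega> \<in> space M"
        then have "\<bar>\<Sum>i\<in>I. a i * l i \<omega>\<bar> \<le> A * (K * R \<omega>)" using lb by (intro wb) auto
        from power_mono[OF this, of 2] show "norm ((\<Sum>i\<in>I. a i * l i \<omega>)\<^sup>2) \<le> norm ((A * K)\<^sup>2 * (R \<omega>)\<^sup>2)"
          by (simp add: power_mult_distrib mult_ac)
      qed
    qed (use slm in measurable)
    define m where "m i = (\<integral>\<omega>. x i \<omega> \<partial>M)" for i
    have pointwise: "(\<Prod>i\<in>I. (1 + x i \<omega>) powr a i) \<le> 1 + (\<Sum>i\<in>I. a i * x i \<omega>)
        + s\<^sup>2 / 2 * ((\<Sum>i\<in>I. a i * l i \<omega>)\<^sup>2 - (\<Sum>i\<in>I. a i * (l i \<omega>)\<^sup>2)) + C2 * s ^ 3 * R \<omega> ^ 6"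
      if w: "\<omega> \<in> space M" for \<omega>
    proof -
      let ?r = "R \<omega>"
      have r: "1 \<le> ?r" "0 \<le> ?r" using R1 Rnn by auto
      \<comment> \<open>As R >= 1, the bound K R is weakened to K R^2, so that the linear part and
        the remainder have a common majorant.\<close>
      have sl: "\<bar>s * l i \<omega>\<bar> \<le> K * s * ?r\<^sup>2" if "i \<in> I" for i
      proof -
        have "\<bar>s * l i \<omega>\<bar> \<le> s * (K * ?r)" using lb[OF that w] s by (simp add: abs_mult)
        also have "\<dots> \<le> s * (K * ?r\<^sup>2)" using r s K by (intro mult_left_mono) (auto simp: power2_eq_square)
        finally show ?thesis by (simp add: mult_ac)
      qed
      have xs: "\<bar>x i \<omega>\<bar> \<le> 2 * K * s * ?r\<^sup>2" if "i \<in> I" for i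
      proof -
        have "K * s\<^sup>2 * ?r\<^sup>2 \<le> K * s * ?r\<^sup>2"
          using s K by (intro mult_right_mono mult_left_mono) (auto simp: power2_eq_square mult_left_le)
        then show ?thesis using xl[OF that w] sl[OF that] by linarith
      qed
      \<comment> \<open>Factorisation of y^2 - z^2; it is used with B = 1 for the single terms and
        with B = A for the weighted sum.\<close>
      have diff_sq: "\<bar>y\<^sup>2 - z\<^sup>2\<bar> \<le> B * K * s\<^sup>2 * ?r\<^sup>2 * (B * 3 * K * s * ?r\<^sup>2)"
        if "\<bar>y - z\<bar> \<le> B * (K * s\<^sup>2 * ?r\<^sup>2)" "\<bar>y\<bar> \<le> B * (2 * K * s * ?r\<^sup>2)" "\<bar>z\<bar> \<le> B * (K * s * ?r\<^sup>2)" for y z B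
      proof -
        have "\<bar>y\<^sup>2 - z\<^sup>2\<bar> = \<bar>y - z\<bar> * \<bar>y + z\<bar>"
          by (simp add: abs_mult[symmetric] power2_eq_square algebra_simps)
        also have "\<dots> \<le> (B * (K * s\<^sup>2 * ?r\<^sup>2)) * (B * (2 * K * s * ?r\<^sup>2) + B * (K * s * ?r\<^sup>2))"
          using that abs_triangle_ineq[of y z] by (intro mult_mono) auto
        finally show ?thesis by (simp add: algebra_simps)
      qed
      have pw: "B * K * s\<^sup>2 * ?r\<^sup>2 * (B * 3 * K * s * ?r\<^sup>2) = 3 * B\<^sup>2 * K\<^sup>2 * s ^ 3 * ?r ^ 4" for B
        by (simp add: power2_eq_square power3_eq_cube power4_eq_xxxx mult_ac)
      have r46: "?r ^ 4 \<le> ?r ^ 6" by (rule Rpow) simp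
      have 1: "- (\<Sum>i\<in>I. a i * (x i \<omega>)\<^sup>2) / 2 \<le> - s\<^sup>2 / 2 * (\<Sum>i\<in>I. a i * (l i \<omega>)\<^sup>2) + 3 / 2 * A * K\<^sup>2 * s ^ 3 * ?r ^ 6"
      proof -
        have "\<bar>\<Sum>i\<in>I. a i * ((x i \<omega>)\<^sup>2 - (s * l i \<omega>)\<^sup>2)\<bar> \<le> A * (3 * 1\<^sup>2 * K\<^sup>2 * s ^ 3 * ?r ^ 4)"
        proof (rule wb)
          fix i assume i: "i \<in> I"
          show "\<bar>(x i \<omega>)\<^sup>2 - (s * l i \<omega>)\<^sup>2\<bar> \<le> 3 * 1\<^sup>2 * K\<^sup>2 * s ^ 3 * ?r ^ 4"
            unfolding pw[symmetric] by (rule diff_sq) (use xl[OF i w] xs[OF i] sl[OF i] in auto)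
        qed
        also have "\<dots> \<le> A * (3 * 1\<^sup>2 * K\<^sup>2 * s ^ 3 * ?r ^ 6)"
          using r46 A0 s by (intro mult_left_mono) auto
        finally have "\<bar>(\<Sum>i\<in>I. a i * (x i \<omega>)\<^sup>2) - s\<^sup>2 * (\<Sum>i\<in>I. a i * (l i \<omega>)\<^sup>2)\<bar> \<le> 3 * A * K\<^sup>2 * s ^ 3 * ?r ^ 6"
          by (simp add: right_diff_distrib sum_subtractf sum_distrib_left power_mult_distrib mult_ac)
        then show ?thesis by (simp add: abs_le_iff)
      qed
      have 2: "(\<Sum>i\<in>I. a i * x i \<omega>)\<^sup>2 / 2 \<le> s\<^sup>2 / 2 * (\<Sum>i\<in>I. a i * l i \<omega>)\<^sup>2 + 3 / 2 * A\<^sup>2 * K\<^sup>2 * s ^ 3 * ?r ^ 6"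
      proof -
        have "\<bar>(\<Sum>i\<in>I. a i * x i \<omega>)\<^sup>2 - (\<Sum>i\<in>I. a i * (s * l i \<omega>))\<^sup>2\<bar> \<le> 3 * A\<^sup>2 * K\<^sup>2 * s ^ 3 * ?r ^ 4"
          unfolding pw[symmetric]
        proof (rule diff_sq)
          have "(\<Sum>i\<in>I. a i * x i \<omega>) - (\<Sum>i\<in>I. a i * (s * l i \<omega>)) = (\<Sum>i\<in>I. a i * (x i \<omega> - s * l i \<omega>))"
            by (simp add: right_diff_distrib sum_subtractf)
          then show "\<bar>(\<Sum>i\<in>I. a i * x i \<omega>) - (\<Sum>i\<in>I. a i * (s * l i \<omega>))\<bar> \<le> A * (K * s\<^sup>2 * ?r\<^sup>2)"
            using wb[OF xl[OF _ w]] by simp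
          show "\<bar>\<Sum>i\<in>I. a i * x i \<omega>\<bar> \<le> A * (2 * K * s * ?r\<^sup>2)" by (rule wb[OF xs])
          show "\<bar>\<Sum>i\<in>I. a i * (s * l i \<omega>)\<bar> \<le> A * (K * s * ?r\<^sup>2)" by (rule wb[OF sl])
        qed
        moreover have "3 * A\<^sup>2 * K\<^sup>2 * s ^ 3 * ?r ^ 4 \<le> 3 * A\<^sup>2 * K\<^sup>2 * s ^ 3 * ?r ^ 6"
          using r46 s by (intro mult_left_mono) auto
        moreover have "(\<Sum>i\<in>I. a i * (s * l i \<omega>)) = s * (\<Sum>i\<in>I. a i * l i \<omega>)"
          by (simp add: sum_distrib_left mult_ac)
        ultimately show ?thesis by (simp add: abs_le_iff power_mult_distrib)
      qed
      have 3: "C1 * (\<Sum>i\<in>I. \<bar>x i \<omega>\<bar>) ^ 3 \<le> C1 * (real (card I) * (2 * K)) ^ 3 * s ^ 3 * ?r ^ 6"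
      proof -
        have "(\<Sum>i\<in>I. \<bar>x i \<omega>\<bar>) \<le> (\<Sum>i\<in>I. 2 * K * s * ?r\<^sup>2)" by (rule sum_mono[OF xs])
        then have "(\<Sum>i\<in>I. \<bar>x i \<omega>\<bar>) \<le> (real (card I) * (2 * K)) * (s * ?r\<^sup>2)" by simp
        then have "(\<Sum>i\<in>I. \<bar>x i \<omega>\<bar>) ^ 3 \<le> ((real (card I) * (2 * K)) * (s * ?r\<^sup>2)) ^ 3"
          by (intro power_mono sum_nonneg) auto
        then have "C1 * (\<Sum>i\<in>I. \<bar>x i \<omega>\<bar>) ^ 3 \<le> C1 * ((real (card I) * (2 * K)) * (s * ?r\<^sup>2)) ^ 3"
          using C1(1) by (rule mult_left_mono)
        also have "\<dots> = C1 * (real (card I) * (2 * K)) ^ 3 * s ^ 3 * ?r ^ 6"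
          by (simp only: power_mult_distrib power_mult[symmetric]) (simp add: mult_ac)
        finally show ?thesis .
      qed
      have "(\<Prod>i\<in>I. (1 + x i \<omega>) powr a i) \<le> 1 + (\<Sum>i\<in>I. a i * x i \<omega>) - (\<Sum>i\<in>I. a i * (x i \<omega>)\<^sup>2) / 2
          + (\<Sum>i\<in>I. a i * x i \<omega>)\<^sup>2 / 2 + C1 * (\<Sum>i\<in>I. \<bar>x i \<omega>\<bar>) ^ 3"
        using xb w by (intro C1(2)) auto
      then show ?thesis using 1 2 3 unfolding C2_def by (simp add: algebra_simps)
    qed
    \<comment> \<open>The linear part is centred, so the mean of x_i is only of order s^2.\<close>
    have mb: "\<bar>m i\<bar> \<le> K * s\<^sup>2 * Q" "k \<le> 1 + m i" if i: "i \<in> I" for i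
    proof -
      have "m i = (\<integral>\<omega>. x i \<omega> - s * l i \<omega> \<partial>M)" using xint[OF i] lint[OF i] l0[OF i] by (simp add: m_def)
      also have "\<bar>\<dots>\<bar> \<le> (\<integral>\<omega>. \<bar>x i \<omega> - s * l i \<omega>\<bar> \<partial>M)" by (rule integral_abs_bound)
      also have "\<dots> \<le> (\<integral>\<omega>. K * s\<^sup>2 * R \<omega> ^ 6 \<partial>M)"
      proof (rule integral_mono)
        show "integrable M (\<lambda>\<omega>. \<bar>x i \<omega> - s * l i \<omega>\<bar>)" using xint[OF i] lint[OF i] by simp
        show "integrable M (\<lambda>\<omega>. K * s\<^sup>2 * R \<omega> ^ 6)" using R6 by simp
        show "\<bar>x i \<omega> - s * l i \<omega>\<bar> \<le> K * s\<^sup>2 * R \<omega> ^ 6" if "\<omega> \<in> space M" for \<omega>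
          using xl[OF i that] mult_left_mono[OF Rpow[of 2 \<omega>], of "K * s\<^sup>2"] K by simp
      qed
      finally show "\<bar>m i\<bar> \<le> K * s\<^sup>2 * Q" by (simp add: Q_def)
      have "(\<integral>\<omega>. k - 1 \<partial>M) \<le> m i" unfolding m_def
      proof (rule integral_mono)
        show "k - 1 \<le> x i \<omega>" if "\<omega> \<in> space M" for \<omega> using xb[OF i that] by linarith
      qed (simp, rule xint[OF i])
      then show "k \<le> 1 + m i" by (simp add: prob_space)
    qed
    let ?P = "\<Prod>i\<in>I. (1 + m i) powr a i"
    have Pge: "P0 \<le> ?P"
    proof -
      have "P0 = (\<Prod>i\<in>I. k powr a i)"
      proof -
        have "(\<Prod>i\<in>I. k powr a i) = exp (\<Sum>i\<in>I. a i * ln k)" using k I by (subst exp_sum) (auto simp: powr_def)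
        then show ?thesis using k by (simp add: P0_def A_def powr_def sum_distrib_right)
      qed
      also have "\<dots> \<le> ?P" using mb(2) a k by (intro prod_mono) (auto intro!: powr_mono2)
      finally show ?thesis .
    qed
    have "(\<integral>\<omega>. (\<Prod>i\<in>I. (1 + x i \<omega>) powr a i) \<partial>M) \<le> (\<integral>\<omega>. 1 + (\<Sum>i\<in>I. a i * x i \<omega>)
        + s\<^sup>2 / 2 * ((\<Sum>i\<in>I. a i * l i \<omega>)\<^sup>2 - (\<Sum>i\<in>I. a i * (l i \<omega>)\<^sup>2)) + C2 * s ^ 3 * R \<omega> ^ 6 \<partial>M)"
    proof (rule integral_mono[OF _ _ pointwise])
      show "integrable M (\<lambda>\<omega>. \<Prod>i\<in>I. (1 + x i \<omega>) powr a i)"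
      proof (rule integrable_const_bound[where B="\<Prod>i\<in>I. (1 / k) powr a i"])
        show "AE \<omega> in M. norm (\<Prod>i\<in>I. (1 + x i \<omega>) powr a i) \<le> (\<Prod>i\<in>I. (1 / k) powr a i)"
        proof (rule AE_I2)
          fix \<omega> assume w: "\<omega> \<in> space M"
          have "(\<Prod>i\<in>I. (1 + x i \<omega>) powr a i) \<le> (\<Prod>i\<in>I. (1 / k) powr a i)"
          proof (intro prod_mono conjI powr_mono2)
            fix i assume i: "i \<in> I"
            show "0 \<le> 1 + x i \<omega>" "1 + x i \<omega> \<le> 1 / k" using xb[OF i w] k by auto
          qed (use a in auto)
          then show "norm (\<Prod>i\<in>I. (1 + x i \<omega>) powr a i) \<le> (\<Prod>i\<in>I. (1 / k) powr a i)"
            by (simp add: prod_nonneg)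
        qed
        show "(\<lambda>\<omega>. \<Prod>i\<in>I. (1 + x i \<omega>) powr a i) \<in> borel_measurable M"
          using xm by (intro borel_measurable_prod powr_real_measurable borel_measurable_add) auto
      qed
      show "integrable M (\<lambda>\<omega>. 1 + (\<Sum>i\<in>I. a i * x i \<omega>)
        + s\<^sup>2 / 2 * ((\<Sum>i\<in>I. a i * l i \<omega>)\<^sup>2 - (\<Sum>i\<in>I. a i * (l i \<omega>)\<^sup>2)) + C2 * s ^ 3 * R \<omega> ^ 6)"
        using xint l2int sl2int R6 by (intro Bochner_Integration.integrable_add Bochner_Integration.integrable_diff
            integrable_mult_right Bochner_Integration.integrable_sum) auto
    qed
    also have "\<dots> = 1 + (\<Sum>i\<in>I. a i * m i)
        + s\<^sup>2 / 2 * ((\<integral>\<omega>. (\<Sum>i\<in>I. a i * l i \<omega>)\<^sup>2 \<partial>M) - (\<Sum>i\<in>I. a i * (\<integral>\<omega>. (l i \<omega>)\<^sup>2 \<partial>M))) + C2 * s ^ 3 * Q"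
      using xint l2int sl2int R6
      by (simp add: Bochner_Integration.integral_sum Bochner_Integration.integrable_sum prob_space m_def Q_def)
    \<comment> \<open>Here the variance hypothesis disposes of the term of order s^2.\<close>
    also have "\<dots> \<le> 1 + (\<Sum>i\<in>I. a i * m i) + C2 * s ^ 3 * Q"
      using var by (simp add: mult_nonneg_nonpos)
    also have "\<dots> \<le> ?P + C3 * s ^ 3"
    proof -
      have "1 + (\<Sum>i\<in>I. a i * m i) - (\<Sum>i\<in>I. a i * (m i)\<^sup>2) / k \<le> ?P"
        by (rule prod_powr_lower[OF I a k(1) mb(2)])
      moreover have "(\<Sum>i\<in>I. a i * (m i)\<^sup>2) \<le> A * ((K * Q)\<^sup>2 * s ^ 3)"
      proof -
        have "\<bar>\<Sum>i\<in>I. a i * (m i)\<^sup>2\<bar> \<le> A * ((K * Q)\<^sup>2 * s ^ 3)"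
        proof (rule wb)
          fix i assume i: "i \<in> I"
          have "(m i)\<^sup>2 \<le> (K * s\<^sup>2 * Q)\<^sup>2" using power_mono[OF mb(1)[OF i], of 2] by simp
          also have "\<dots> = (K * Q)\<^sup>2 * s ^ 4" by (simp add: power_mult_distrib mult_ac)
          also have "\<dots> \<le> (K * Q)\<^sup>2 * s ^ 3" using s by (intro mult_left_mono power_decreasing) auto
          finally show "\<bar>(m i)\<^sup>2\<bar> \<le> (K * Q)\<^sup>2 * s ^ 3" by simp
        qed
        then show ?thesis by linarith
      qed
      then have "(\<Sum>i\<in>I. a i * (m i)\<^sup>2) / k \<le> A * ((K * Q)\<^sup>2 * s ^ 3) / k" using k by (intro divide_right_mono) auto
      ultimately show ?thesis by (simp add: C3_def algebra_simps)
    qed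
    \<comment> \<open>The additive error becomes a factor, the form in which losses can be
      accumulated over many steps.\<close>
    also have "\<dots> \<le> (1 + C3 / P0 * s ^ 3) * ?P"
    proof -
      have "C3 * s ^ 3 * 1 \<le> C3 * s ^ 3 * (?P / P0)"
        using C30 s Pge P0 by (intro mult_left_mono) auto
      then show ?thesis by (simp add: algebra_simps)
    qed
    finally show "(\<integral>\<omega>. (\<Prod>i\<in>I. (1 + x i \<omega>) powr a i) \<partial>M) \<le>
      (1 + C3 / P0 * s ^ 3) * (\<Prod>i\<in>I. (1 + (\<integral>\<omega>. x i \<omega> \<partial>M)) powr a i)"
      unfolding m_def .
  qed
qed

subsection \<open>Functions with a second order Taylor expansion\<close>

lemma continuous_on_Icc_abs_bounded:
  fixes h :: "real \<Rightarrow> real"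
  assumes "continuous_on {lo..hi} h"
  shows "\<exists>L. \<forall>y\<in>{lo..hi}. \<bar>h y\<bar> \<le> L"
proof -
  have "bounded (h ` {lo..hi})"
    by (rule compact_imp_bounded[OF compact_continuous_image[OF assms compact_Icc]])
  then show ?thesis unfolding bounded_iff by auto
qed

text \<open>Twice the mean value theorem. The auxiliary fact \<open>mvt\<close> admits the endpoints
  in either order, since the increments it is used for have no fixed sign.\<close>

lemma taylor_quadratic:
  fixes g g' g'' :: "real \<Rightarrow> real"
  assumes ab: "a \<in> {lo..hi}" "b \<in> {lo..hi}"
    and g: "\<And>y. y \<in> {lo..hi} \<Longrightarrow> (g has_real_derivative g' y) (at y)"
    and g': "\<And>y. y \<in> {lo..hi} \<Longrightarrow> (g' has_real_derivative g'' y) (at y)"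
    and L: "\<And>y. y \<in> {lo..hi} \<Longrightarrow> \<bar>g'' y\<bar> \<le> L"
  shows "\<bar>g b - g a - g' a * (b - a)\<bar> \<le> L * (b - a)\<^sup>2"
proof (cases "a = b")
  case False
  have mvt: "\<exists>z. min u v \<le> z \<and> z \<le> max u v \<and> h v - h u = h' z * (v - u)"
    if "u \<in> {lo..hi}" "v \<in> {lo..hi}" "\<And>y. y \<in> {lo..hi} \<Longrightarrow> (h has_real_derivative h' y) (at y)" for h h' :: "real \<Rightarrow> real" and u v
  proof (cases u v rule: linorder_cases)
    case less
    have "\<exists>z>u. z < v \<and> h v - h u = (v - u) * h' z" by (rule MVT2[OF less]) (use that in auto)
    then obtain z where "u < z" "z < v" "h v - h u = (v - u) * h' z" by blast
    then show ?thesis using less by (intro exI[of _ z]) (auto simp: mult.commute)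
  next
    case greater
    have "\<exists>z>v. z < u \<and> h u - h v = (u - v) * h' z" by (rule MVT2[OF greater]) (use that in auto)
    then obtain z where "v < z" "z < u" "h u - h v = (u - v) * h' z" by blast
    then show ?thesis using greater by (intro exI[of _ z]) (auto simp: algebra_simps)
  qed auto
  obtain z where z: "min a b \<le> z" "z \<le> max a b" "g b - g a = g' z * (b - a)" using mvt[OF ab g] by blast
  have zI: "z \<in> {lo..hi}" using z ab by auto
  obtain y where y: "min a z \<le> y" "y \<le> max a z" "g' z - g' a = g'' y * (z - a)" using mvt[OF ab(1) zI g'] by blast
  have yI: "y \<in> {lo..hi}" using y zI ab by auto
  have "g b - g a - g' a * (b - a) = (g' z - g' a) * (b - a)" unfolding z(3) by (simp only: left_diff_distrib)
  also have "\<dots> = g'' y * (z - a) * (b - a)" unfolding y(3) ..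
  also have "\<bar>\<dots>\<bar> = \<bar>g'' y\<bar> * (\<bar>z - a\<bar> * \<bar>b - a\<bar>)" by (simp add: abs_mult)
  also have "\<dots> \<le> L * (\<bar>b - a\<bar> * \<bar>b - a\<bar>)"
    using z L[OF yI] by (intro mult_mono) auto
  finally show ?thesis by (simp add: power2_eq_square abs_mult[symmetric])
qed simp

context white_noise
begin

text \<open>A first order expansion of F (x + y) in finitely many directions \<xi>, with derivatives
  \<open>w \<xi>\<close> and a quadratic remainder; \<open>rot 1 1 x y\<close> is x + y inside the
  dual space. One constant bounds the function, the derivatives and the remainder, so that
  \<open>avg\<close> preserves the whole package.\<close>

definition taylor :: "'a set \<Rightarrow> real \<Rightarrow> ('a \<Rightarrow> ('a \<Rightarrow> real) \<Rightarrow> real) \<Rightarrow> (('a \<Rightarrow> real) \<Rightarrow> real) \<Rightarrow> bool" where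
  "taylor \<Xi> K w F \<longleftrightarrow> F \<in> borel_measurable \<mu> \<and> (\<forall>x\<in>duals. \<bar>F x\<bar> \<le> K) \<and>
    (\<forall>\<xi>\<in>\<Xi>. w \<xi> \<in> borel_measurable \<mu> \<and> (\<forall>x\<in>duals. \<bar>w \<xi> x\<bar> \<le> K)) \<and>
    (\<forall>x\<in>duals. \<forall>y\<in>duals. \<bar>F (rot 1 1 x y) - F x - (\<Sum>\<xi>\<in>\<Xi>. w \<xi> x * y \<xi>)\<bar> \<le> K * (\<Sum>\<xi>\<in>\<Xi>. \<bar>y \<xi>\<bar>)\<^sup>2)"

definition smooth :: "(('a \<Rightarrow> real) \<Rightarrow> real) \<Rightarrow> bool" where
  "smooth F \<longleftrightarrow> (\<exists>\<Xi> K w. finite \<Xi> \<and> \<Xi> \<subseteq> tests \<and> 0 \<le> K \<and> taylor \<Xi> K w F)"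

lemma taylorD:
  assumes "taylor \<Xi> K w F"
  shows "F \<in> borel_measurable \<mu>" "x \<in> duals \<Longrightarrow> \<bar>F x\<bar> \<le> K"
    "\<xi> \<in> \<Xi> \<Longrightarrow> w \<xi> \<in> borel_measurable \<mu>" "\<xi> \<in> \<Xi> \<Longrightarrow> x \<in> duals \<Longrightarrow> \<bar>w \<xi> x\<bar> \<le> K"
    "x \<in> duals \<Longrightarrow> y \<in> duals \<Longrightarrow> \<bar>F (rot 1 1 x y) - F x - (\<Sum>\<xi>\<in>\<Xi>. w \<xi> x * y \<xi>)\<bar> \<le> K * (\<Sum>\<xi>\<in>\<Xi>. \<bar>y \<xi>\<bar>)\<^sup>2"
  using assms unfolding taylor_def by blast+

text \<open>Allows finitely many functions to share directions and constant; in an added direction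
  the derivative is 0.\<close>

lemma taylor_mono:
  assumes F: "taylor \<Xi> K w F" and \<Xi>: "finite \<Xi>'" "\<Xi> \<subseteq> \<Xi>'" and K: "0 \<le> K" "K \<le> K'"
  shows "taylor \<Xi>' K' (\<lambda>\<xi>. if \<xi> \<in> \<Xi> then w \<xi> else (\<lambda>x. 0)) F"
  unfolding taylor_def
proof (intro conjI ballI)
  note D = taylorD[OF F]
  show "F \<in> borel_measurable \<mu>" by (rule D)
  show "\<bar>F x\<bar> \<le> K'" if "x \<in> duals" for x using D(2)[OF that] K by linarith
  show "(if \<xi> \<in> \<Xi> then w \<xi> else (\<lambda>x. 0)) \<in> borel_measurable \<mu>" for \<xi> using D(3) by auto
  show "\<bar>(if \<xi> \<in> \<Xi> then w \<xi> else (\<lambda>x. 0)) x\<bar> \<le> K'" if "x \<in> duals" for \<xi> x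
    using D(4)[OF _ that, of \<xi>] K by (cases "\<xi> \<in> \<Xi>") auto
  fix x y assume x: "x \<in> duals" "y \<in> duals"
  have "(\<Sum>\<xi>\<in>\<Xi>'. (if \<xi> \<in> \<Xi> then w \<xi> else (\<lambda>x. 0)) x * y \<xi>) = (\<Sum>\<xi>\<in>\<Xi>. w \<xi> x * y \<xi>)"
    using \<Xi> by (intro sum.mono_neutral_cong_right) auto
  moreover have "K * (\<Sum>\<xi>\<in>\<Xi>. \<bar>y \<xi>\<bar>)\<^sup>2 \<le> K' * (\<Sum>\<xi>\<in>\<Xi>'. \<bar>y \<xi>\<bar>)\<^sup>2"
    using K \<Xi> by (intro mult_mono power_mono sum_mono2) (auto intro: sum_nonneg)
  ultimately show "\<bar>F (rot 1 1 x y) - F x - (\<Sum>\<xi>\<in>\<Xi>'. (if \<xi> \<in> \<Xi> then w \<xi> else (\<lambda>x. 0)) x * y \<xi>)\<bar> \<le> K' * (\<Sum>\<xi>\<in>\<Xi>'. \<bar>y \<xi>\<bar>)\<^sup>2"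
    using D(5)[OF x] by simp
qed

lemma smooth_const: "smooth (\<lambda>x. a)"
  unfolding smooth_def taylor_def
  by (intro exI[of _ "{}"] exI[of _ "\<bar>a\<bar>"] exI[of _ "\<lambda>\<xi> x. 0"]) auto

lemma smooth_add:
  assumes "smooth F" "smooth G" shows "smooth (\<lambda>x. F x + G x)"
proof -
  obtain A K u where F: "finite A" "A \<subseteq> tests" "0 \<le> K" "taylor A K u F" using assms(1) by (auto simp: smooth_def)
  obtain B L v where G: "finite B" "B \<subseteq> tests" "0 \<le> L" "taylor B L v G" using assms(2) by (auto simp: smooth_def)
  let ?u = "\<lambda>\<xi>. if \<xi> \<in> A then u \<xi> else (\<lambda>x. 0)" and ?v = "\<lambda>\<xi>. if \<xi> \<in> B then v \<xi> else (\<lambda>x. 0)"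
  have F': "taylor (A \<union> B) K ?u F" by (rule taylor_mono[OF F(4)]) (use F G in auto)
  have G': "taylor (A \<union> B) L ?v G" by (rule taylor_mono[OF G(4)]) (use F G in auto)
  note DF = taylorD[OF F'] and DG = taylorD[OF G']
  have "taylor (A \<union> B) (K + L) (\<lambda>\<xi> x. ?u \<xi> x + ?v \<xi> x) (\<lambda>x. F x + G x)"
    unfolding taylor_def
  proof (intro conjI ballI)
    show "(\<lambda>x. F x + G x) \<in> borel_measurable \<mu>" by (intro borel_measurable_add DF(1) DG(1))
    show "\<bar>F x + G x\<bar> \<le> K + L" if "x \<in> duals" for x using DF(2)[OF that] DG(2)[OF that] by linarith
    fix \<xi> assume \<xi>: "\<xi> \<in> A \<union> B"
    show "(\<lambda>x. ?u \<xi> x + ?v \<xi> x) \<in> borel_measurable \<mu>" by (intro borel_measurable_add DF(3)[OF \<xi>] DG(3)[OF \<xi>])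
    show "\<bar>?u \<xi> x + ?v \<xi> x\<bar> \<le> K + L" if "x \<in> duals" for x using DF(4)[OF \<xi> that] DG(4)[OF \<xi> that] by linarith
  next
    fix x y assume x: "x \<in> duals" "y \<in> duals"
    have "(\<Sum>\<xi>\<in>A \<union> B. (?u \<xi> x + ?v \<xi> x) * y \<xi>) = (\<Sum>\<xi>\<in>A \<union> B. ?u \<xi> x * y \<xi>) + (\<Sum>\<xi>\<in>A \<union> B. ?v \<xi> x * y \<xi>)"
      by (simp add: distrib_right sum.distrib)
    then show "\<bar>F (rot 1 1 x y) + G (rot 1 1 x y) - (F x + G x) - (\<Sum>\<xi>\<in>A \<union> B. (?u \<xi> x + ?v \<xi> x) * y \<xi>)\<bar>
        \<le> (K + L) * (\<Sum>\<xi>\<in>A \<union> B. \<bar>y \<xi>\<bar>)\<^sup>2"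
      using DF(5)[OF x] DG(5)[OF x] unfolding distrib_right by linarith
  qed
  then show ?thesis using F G unfolding smooth_def by (intro exI conjI) auto
qed

lemma smooth_compose:
  assumes F: "smooth F" and F_range: "\<And>x. x \<in> duals \<Longrightarrow> F x \<in> {lo..hi}"
    and g: "\<And>y. y \<in> {lo..hi} \<Longrightarrow> (g has_real_derivative g' y) (at y)"
    and g': "\<And>y. y \<in> {lo..hi} \<Longrightarrow> (g' has_real_derivative g'' y) (at y)"
    and L: "\<And>y. y \<in> {lo..hi} \<Longrightarrow> \<bar>g'' y\<bar> \<le> L"
  shows "smooth (\<lambda>x. g (F x))"
proof -
  obtain A K w where F: "finite A" "A \<subseteq> tests" "0 \<le> K" "taylor A K w F" using assms(1) by (auto simp: smooth_def)
  note D = taylorD[OF F(4)]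
  have Fr: "F x \<in> {lo..hi}" if "x \<in> duals" for x by (rule F_range[OF that])
  have cont: "continuous_on {lo..hi} g" "continuous_on {lo..hi} g'"
    by (intro continuous_at_imp_continuous_on ballI DERIV_isCont[OF g] DERIV_isCont[OF g']; assumption)+
  obtain M1 where M1: "\<And>y. y \<in> {lo..hi} \<Longrightarrow> \<bar>g y\<bar> \<le> M1"
    using continuous_on_Icc_abs_bounded[OF cont(1)] by blast
  obtain M2 where M2: "\<And>y. y \<in> {lo..hi} \<Longrightarrow> \<bar>g' y\<bar> \<le> M2"
    using continuous_on_Icc_abs_bounded[OF cont(2)] by blast
  \<comment> \<open>The summands account for the values of g, for the new derivatives g' w, and for
    the second order term of g, in which E^2 <= 4 K^2 S^2.\<close>
  define M where "M = max 0 M1 + max 0 M2 * K + max 0 L * (4 * K\<^sup>2)"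
  have ne: "F x \<in> {lo..hi} \<Longrightarrow> 0 \<le> L" for x using L[of "F x"] by force
  have Fm: "F \<in> measurable \<mu> (restrict_space borel {lo..hi})"
    using D(1) Fr by (auto simp: measurable_restrict_space2_iff space_mu)
  have comp_meas: "(\<lambda>x. h (F x)) \<in> borel_measurable \<mu>" if "continuous_on {lo..hi} h" for h :: "real \<Rightarrow> real"
    using measurable_compose[OF Fm borel_measurable_continuous_on_restrict[OF that]] .
  have "taylor A M (\<lambda>\<xi> x. g' (F x) * w \<xi> x) (\<lambda>x. g (F x))"
    unfolding taylor_def
  proof (intro conjI ballI)
    have nn: "0 \<le> max 0 M2 * K" "0 \<le> max 0 L * (4 * K\<^sup>2)" "0 \<le> max 0 M1" using F(3) by auto
    show "(\<lambda>x. g (F x)) \<in> borel_measurable \<mu>" by (rule comp_meas[OF cont(1)])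
    show "\<bar>g (F x)\<bar> \<le> M" if "x \<in> duals" for x using M1[OF Fr[OF that]] nn unfolding M_def by linarith
    show "(\<lambda>x. g' (F x) * w \<xi> x) \<in> borel_measurable \<mu>" if "\<xi> \<in> A" for \<xi>
      by (intro borel_measurable_times comp_meas[OF cont(2)] D(3)[OF that])
    show "\<bar>g' (F x) * w \<xi> x\<bar> \<le> M" if "\<xi> \<in> A" "x \<in> duals" for \<xi> x
    proof -
      have "\<bar>g' (F x) * w \<xi> x\<bar> \<le> max 0 M2 * K"
        unfolding abs_mult using M2[OF Fr[OF that(2)]] D(4)[OF that] by (intro mult_mono) auto
      then show ?thesis using nn unfolding M_def by linarith
    qed
    fix x y assume x: "x \<in> duals" "y \<in> duals"
    define S where "S = (\<Sum>\<xi>\<in>A. \<bar>y \<xi>\<bar>)"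
    define E where "E = F (rot 1 1 x y) - F x"
    define W where "W = (\<Sum>\<xi>\<in>A. w \<xi> x * y \<xi>)"
    have S0: "0 \<le> S" by (simp add: S_def sum_nonneg)
    have r: "rot 1 1 x y \<in> duals" using x by auto
    have EW: "\<bar>E - W\<bar> \<le> K * S\<^sup>2" unfolding E_def W_def S_def by (rule D(5)[OF x])
    have W: "\<bar>W\<bar> \<le> K * S"
    proof -
      have "\<bar>W\<bar> \<le> (\<Sum>\<xi>\<in>A. \<bar>w \<xi> x * y \<xi>\<bar>)" unfolding W_def by (rule sum_abs)
      also have "\<dots> \<le> (\<Sum>\<xi>\<in>A. K * \<bar>y \<xi>\<bar>)"
        using D(4) x by (intro sum_mono) (simp add: abs_mult mult_right_mono)
      finally show ?thesis by (simp add: S_def sum_distrib_left)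
    qed
    have E2: "E\<^sup>2 \<le> 4 * K\<^sup>2 * S\<^sup>2"
    proof -
      \<comment> \<open>For S <= 1 this comes from the expansion of \<open>F\<close>, for S > 1 from
        its boundedness.\<close>
      have "\<bar>E\<bar> \<le> 2 * K * S"
      proof (cases "S \<le> 1")
        case True
        then have "K * S\<^sup>2 \<le> K * S" using S0 F(3) by (intro mult_left_mono) (auto simp: power2_eq_square mult_left_le)
        then show ?thesis using EW W by linarith
      next
        case False
        have "\<bar>E\<bar> \<le> 2 * K" using D(2)[OF x(1)] D(2)[OF r] by (simp add: E_def)
        also have "\<dots> \<le> 2 * K * S" using False F(3) by (simp add: mult_le_cancel_left1)
        finally show ?thesis .
      qed
      from power_mono[OF this, of 2] show ?thesis by (simp add: power_mult_distrib)
    qed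
    have T: "\<bar>g (F (rot 1 1 x y)) - g (F x) - g' (F x) * E\<bar> \<le> L * E\<^sup>2"
      unfolding E_def by (rule taylor_quadratic[OF Fr[OF x(1)] Fr[OF r] g g' L])
    have "L * E\<^sup>2 \<le> max 0 L * (4 * K\<^sup>2 * S\<^sup>2)" using E2 by (intro mult_mono) auto
    moreover have "\<bar>g' (F x) * E - g' (F x) * W\<bar> \<le> max 0 M2 * (K * S\<^sup>2)"
      unfolding right_diff_distrib[symmetric] abs_mult using EW M2[OF Fr[OF x(1)]] by (intro mult_mono) auto
    moreover have "0 \<le> max 0 M1 * S\<^sup>2" by simp
    moreover have "M * S\<^sup>2 = max 0 M1 * S\<^sup>2 + max 0 M2 * (K * S\<^sup>2) + max 0 L * (4 * K\<^sup>2 * S\<^sup>2)"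
      unfolding M_def by (simp only: distrib_right mult.assoc)
    moreover have "(\<Sum>\<xi>\<in>A. g' (F x) * w \<xi> x * y \<xi>) = g' (F x) * W" by (simp add: W_def sum_distrib_left mult_ac)
    ultimately show "\<bar>g (F (rot 1 1 x y)) - g (F x) - (\<Sum>\<xi>\<in>A. g' (F x) * w \<xi> x * y \<xi>)\<bar> \<le> M * (\<Sum>\<xi>\<in>A. \<bar>y \<xi>\<bar>)\<^sup>2"
      using T unfolding S_def[symmetric] by linarith
  qed
  moreover have "0 \<le> M" using F(3) by (simp add: M_def)
  ultimately show ?thesis using F unfolding smooth_def by blast
qed

lemma smooth_trigonometric:
  assumes \<xi>: "\<xi> \<in> tests" and f: "\<And>y. (f has_real_derivative f' y) (at y)" "\<And>y. (f' has_real_derivative f'' y) (at y)"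
    and b: "\<And>y. \<bar>f y\<bar> \<le> 1" "\<And>y. \<bar>f' y\<bar> \<le> 1" "\<And>y. \<bar>f'' y\<bar> \<le> 1"
  shows "smooth (\<lambda>x. f (x \<xi>))"
proof -
  have m: "(\<lambda>x. h (x \<xi>)) \<in> borel_measurable \<mu>" if "\<And>y. (h has_real_derivative h' y) (at y)" for h h' :: "real \<Rightarrow> real"
  proof -
    have "continuous_on UNIV h" using that by (meson DERIV_isCont continuous_at_imp_continuous_on)
    then show ?thesis using measurable_compose[OF eval_measurable[OF \<xi>] borel_measurable_continuous_onI] by blast
  qed
  have "taylor {\<xi>} 1 (\<lambda>\<xi> x. f' (x \<xi>)) (\<lambda>x. f (x \<xi>))"
    unfolding taylor_def
  proof (intro conjI ballI)
    fix x y assume x: "x \<in> duals" "y \<in> duals"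
    let ?lo = "min (x \<xi>) (x \<xi> + y \<xi>)" and ?hi = "max (x \<xi>) (x \<xi> + y \<xi>)"
    have "\<bar>f (x \<xi> + y \<xi>) - f (x \<xi>) - f' (x \<xi>) * ((x \<xi> + y \<xi>) - x \<xi>)\<bar> \<le> 1 * ((x \<xi> + y \<xi>) - x \<xi>)\<^sup>2"
      by (rule taylor_quadratic[of _ ?lo ?hi]) (use f b in auto)
    then show "\<bar>f (rot 1 1 x y \<xi>) - f (x \<xi>) - (\<Sum>\<xi>\<in>{\<xi>}. f' (x \<xi>) * y \<xi>)\<bar> \<le> 1 * (\<Sum>\<xi>\<in>{\<xi>}. \<bar>y \<xi>\<bar>)\<^sup>2"
      using x \<xi> by (simp add: rot_apply)
  qed (use b m[OF f(1)] m[OF f(2)] in auto)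
  then show ?thesis unfolding smooth_def using \<xi> by (intro exI[of _ "{\<xi>}"] exI conjI) auto
qed

lemma smooth_cmult: "smooth F \<Longrightarrow> smooth (\<lambda>x. a * F x)"
proof -
  assume F: "smooth F"
  then obtain A K w where "finite A" "A \<subseteq> tests" "0 \<le> K" "taylor A K w F" by (auto simp: smooth_def)
  then have "F x \<in> {-K..K}" if "x \<in> duals" for x using taylorD(2)[of A K w F x] that by (auto simp: abs_le_iff)
  from smooth_compose[OF F this, where g="\<lambda>y. a * y" and g'="\<lambda>y. a" and g''="\<lambda>y. 0" and L=0]
  show ?thesis by (auto intro!: derivative_eq_intros)
qed

lemma smooth_cong:
  assumes "smooth F" "\<And>x. x \<in> duals \<Longrightarrow> F x = G x" shows "smooth G"
proof -
  obtain A K w where F: "finite A" "A \<subseteq> tests" "0 \<le> K" "taylor A K w F" using assms(1) by (auto simp: smooth_def)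
  have "G \<in> borel_measurable \<mu>" using taylorD(1)[OF F(4)] assms(2)
    by (subst measurable_cong[of _ _ F]) (auto simp: space_mu)
  then have "taylor A K w G" using F(4) assms(2) unfolding taylor_def by (auto simp: rot_dual)
  then show ?thesis using F unfolding smooth_def by blast
qed

lemma smooth_Re_Im_trigs:
  assumes "g \<in> trigs" shows "smooth (\<lambda>x. Re (g x)) \<and> smooth (\<lambda>x. Im (g x))"
  using assms
proof (induction rule: trigs_induct)
  case zero
  then show ?case by (simp add: smooth_const)
next
  case (Cons a \<xi> h)
  have c: "smooth (\<lambda>x. cos (x \<xi>))"
    by (rule smooth_trigonometric[OF Cons(1), of cos "\<lambda>y. - sin y" "\<lambda>y. - cos y"])
      (auto intro!: derivative_eq_intros)
  have s: "smooth (\<lambda>x. sin (x \<xi>))"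
    by (rule smooth_trigonometric[OF Cons(1), of sin cos "\<lambda>y. - sin y"])
      (auto intro!: derivative_eq_intros)
  have "smooth (\<lambda>x. (Re a * cos (x \<xi>) + (- Im a) * sin (x \<xi>)) + Re (h x))"
    "smooth (\<lambda>x. (Re a * sin (x \<xi>) + Im a * cos (x \<xi>)) + Im (h x))"
    by (intro smooth_add smooth_cmult c s conjunct1[OF Cons.IH] conjunct2[OF Cons.IH])+
  then show ?case by (simp add: Re_exp Im_exp)
next
  case (cong f g)
  then show ?case using smooth_cong[of "\<lambda>x. Re (f x)" "\<lambda>x. Re (g x)"] smooth_cong[of "\<lambda>x. Im (f x)" "\<lambda>x. Im (g x)"] by auto
qed

text \<open>The shift by \<epsilon> keeps the base of the power in a compact interval of positive
  numbers, on which the power has a bounded second derivative.\<close>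

lemma smooth_trigs_power:
  assumes \<phi>: "\<phi> \<in> trigs" and \<epsilon>: "0 < \<epsilon>"
  shows "smooth (\<lambda>x. ((cmod (\<phi> x))\<^sup>2 + \<epsilon>) powr q)"
proof -
  obtain K where K: "\<And>x. x \<in> duals \<Longrightarrow> cmod (\<phi> x) \<le> K" using trigs_bounded[OF \<phi>] by blast
  have sq: "smooth (\<lambda>x. (F x)\<^sup>2)" if F: "smooth F" "\<And>x. x \<in> duals \<Longrightarrow> F x \<in> {-K..K}" for F
    by (rule smooth_compose[OF F, of "\<lambda>y. y\<^sup>2" "\<lambda>y. 2 * y" "\<lambda>y. 2" 2]) (auto intro!: derivative_eq_intros)
  have "smooth (\<lambda>x. (Re (\<phi> x))\<^sup>2)" "smooth (\<lambda>x. (Im (\<phi> x))\<^sup>2)"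
  proof -
    have "\<bar>Re (\<phi> x)\<bar> \<le> K" "\<bar>Im (\<phi> x)\<bar> \<le> K" if "x \<in> duals" for x
      using order_trans[OF abs_Re_le_cmod K[OF that]] order_trans[OF abs_Im_le_cmod K[OF that]] by auto
    then have "Re (\<phi> x) \<in> {-K..K}" "Im (\<phi> x) \<in> {-K..K}" if "x \<in> duals" for x
      using that by (auto simp: abs_le_iff minus_le_iff)
    then show "smooth (\<lambda>x. (Re (\<phi> x))\<^sup>2)" "smooth (\<lambda>x. (Im (\<phi> x))\<^sup>2)"
      using sq[of "\<lambda>x. Re (\<phi> x)"] sq[of "\<lambda>x. Im (\<phi> x)"] smooth_Re_Im_trigs[OF \<phi>] by blast+
  qed
  then have G: "smooth (\<lambda>x. (cmod (\<phi> x))\<^sup>2 + \<epsilon>)"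
    unfolding cmod_power2 by (intro smooth_add smooth_const)
  have r: "(cmod (\<phi> x))\<^sup>2 + \<epsilon> \<in> {\<epsilon>..K\<^sup>2 + \<epsilon>}" if "x \<in> duals" for x
    using power_mono[OF K[OF that], of 2] by auto
  have "continuous_on {\<epsilon>..K\<^sup>2 + \<epsilon>} (\<lambda>y. q * ((q - 1) * y powr (q - 2)))"
    using \<epsilon> by (intro continuous_intros) auto
  from continuous_on_Icc_abs_bounded[OF this] obtain L where L: "\<And>y. y \<in> {\<epsilon>..K\<^sup>2 + \<epsilon>} \<Longrightarrow> \<bar>q * ((q - 1) * y powr (q - 2))\<bar> \<le> L"
    by blast
  show ?thesis
  proof (rule smooth_compose[OF G r _ _ L])
    fix y assume "y \<in> {\<epsilon>..K\<^sup>2 + \<epsilon>}"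
    then have y: "0 < y" using \<epsilon> by auto
    show "((\<lambda>y. y powr q) has_real_derivative q * y powr (q - 1)) (at y)"
      using has_real_derivative_powr[OF y] .
    show "((\<lambda>y. q * y powr (q - 1)) has_real_derivative q * ((q - 1) * y powr (q - 2))) (at y)"
      using DERIV_cmult[OF has_real_derivative_powr[OF y, of "q - 1"], of q] by simp
  qed
qed

subsection \<open>Averaging\<close>

text \<open>The Gaussian mean of \<open>F\<close> around \<open>x\<close> at scale \<open>s\<close>,
  that is, the heat semigroup.\<close>

definition avg :: "real \<Rightarrow> (('a \<Rightarrow> real) \<Rightarrow> real) \<Rightarrow> ('a \<Rightarrow> real) \<Rightarrow> real" where
  "avg s F x = (\<integral>y. F (rot 1 s x y) \<partial>\<mu>)"

lemma rot_section_measurable [measurable (raw)]: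
  "F \<in> borel_measurable \<mu> \<Longrightarrow> x \<in> duals \<Longrightarrow> (\<lambda>y. F (rot a b x y)) \<in> borel_measurable \<mu>"
  by (rule measurable_compose[where N=\<mu>]) (auto simp: space_mu)

lemma integrable_rot:
  fixes F :: "('a \<Rightarrow> real) \<Rightarrow> real"
  assumes "F \<in> borel_measurable \<mu>" "x \<in> duals" "\<And>x. x \<in> duals \<Longrightarrow> \<bar>F x\<bar> \<le> K"
  shows "integrable \<mu> (\<lambda>y. F (rot a b x y))"
  using assms rot_section_measurable[OF assms(1,2)]
  by (intro integrable_const_bound[where B=K]) (auto intro!: AE_I2 simp: space_mu)

lemma avg_measurable: "F \<in> borel_measurable \<mu> \<Longrightarrow> avg s F \<in> borel_measurable \<mu>"
  unfolding avg_def[abs_def]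
  by (rule borel_measurable_lebesgue_integral)
    (auto simp: split_def intro!: measurable_compose[OF rot_measurable, of fst _ snd])

lemma avg_bounds:
  assumes "F \<in> borel_measurable \<mu>" "\<And>x. x \<in> duals \<Longrightarrow> lo \<le> F x \<and> F x \<le> hi" "x \<in> duals"
  shows "lo \<le> avg s F x" "avg s F x \<le> hi"
proof -
  have i: "integrable \<mu> (\<lambda>y. F (rot 1 s x y))"
  proof (rule integrable_rot[OF assms(1,3)])
    show "\<bar>F y\<bar> \<le> max \<bar>lo\<bar> \<bar>hi\<bar>" if "y \<in> duals" for y using assms(2)[OF that] by (auto simp: abs_le_iff max_def)
  qed
  have "(\<integral>y. lo \<partial>\<mu>) \<le> avg s F x" "avg s F x \<le> (\<integral>y. hi \<partial>\<mu>)"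
    unfolding avg_def
    by (rule integral_mono[OF _ i] integral_mono[OF i];
        use assms(2)[OF rot_dual[OF assms(3)]] in \<open>simp add: space_mu\<close>)+
  then show "lo \<le> avg s F x" "avg s F x \<le> hi" by (simp_all add: prob_space)
qed

text \<open>Averaging commutes with translations, so the expansion can be integrated with the same
  directions and the same \<open>K\<close>. Thanks to this uniformity one error constant serves all
  steps of the iteration.\<close>

lemma taylor_avg:
  assumes F: "taylor \<Xi> K w F" and \<Xi>: "finite \<Xi>" "\<Xi> \<subseteq> tests" and K: "0 \<le> K"
  shows "taylor \<Xi> K (\<lambda>\<xi>. avg s (w \<xi>)) (avg s F)"
  unfolding taylor_def
proof (intro conjI ballI)
  note D = taylorD[OF F]
  have bd: "- K \<le> F x \<and> F x \<le> K" if "x \<in> duals" for x using D(2)[OF that] by linarith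
  have bw: "- K \<le> w \<xi> x \<and> w \<xi> x \<le> K" if "\<xi> \<in> \<Xi>" "x \<in> duals" for \<xi> x using D(4)[OF that] by linarith
  show "avg s F \<in> borel_measurable \<mu>" by (rule avg_measurable[OF D(1)])
  show "\<bar>avg s F x\<bar> \<le> K" if "x \<in> duals" for x using avg_bounds[OF D(1) bd that, of s] by linarith
  show "avg s (w \<xi>) \<in> borel_measurable \<mu>" if "\<xi> \<in> \<Xi>" for \<xi> by (rule avg_measurable[OF D(3)[OF that]])
  show "\<bar>avg s (w \<xi>) x\<bar> \<le> K" if "\<xi> \<in> \<Xi>" "x \<in> duals" for \<xi> x
    using avg_bounds[OF D(3)[OF that(1)] bw[OF that(1)] that(2), of s] by linarith
  fix x z assume x: "x \<in> duals" "z \<in> duals"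
  have r: "rot 1 1 x z \<in> duals" using x by auto
  have comm: "rot 1 s (rot 1 1 x z) y = rot 1 1 (rot 1 s x y) z" if "y \<in> duals" for y
    using x that by (intro dual_eqI) (auto simp: rot_apply rot_dual)
  have iF: "integrable \<mu> (\<lambda>y. F (rot 1 s u y))" if "u \<in> duals" for u
    by (rule integrable_rot[OF D(1) that D(2)])
  have iw: "integrable \<mu> (\<lambda>y. w \<xi> (rot 1 s x y))" if "\<xi> \<in> \<Xi>" for \<xi>
    by (rule integrable_rot[OF D(3)[OF that] x(1) D(4)[OF that]])
  let ?D = "\<lambda>y. F (rot 1 s (rot 1 1 x z) y) - F (rot 1 s x y) - (\<Sum>\<xi>\<in>\<Xi>. w \<xi> (rot 1 s x y) * z \<xi>)"
  have eq: "avg s F (rot 1 1 x z) - avg s F x - (\<Sum>\<xi>\<in>\<Xi>. avg s (w \<xi>) x * z \<xi>) =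
      (\<integral>y. F (rot 1 s (rot 1 1 x z) y) - F (rot 1 s x y) - (\<Sum>\<xi>\<in>\<Xi>. w \<xi> (rot 1 s x y) * z \<xi>) \<partial>\<mu>)"
    unfolding avg_def using iF[OF r] iF[OF x(1)] iw
    by (simp add: Bochner_Integration.integral_sum Bochner_Integration.integrable_sum)
  have le: "\<bar>\<integral>y. ?D y \<partial>\<mu>\<bar> \<le> (\<integral>y. K * (\<Sum>\<xi>\<in>\<Xi>. \<bar>z \<xi>\<bar>)\<^sup>2 \<partial>\<mu>)"
  proof (rule order_trans[OF integral_abs_bound integral_mono])
    show "integrable \<mu> (\<lambda>y. \<bar>F (rot 1 s (rot 1 1 x z) y) - F (rot 1 s x y) - (\<Sum>\<xi>\<in>\<Xi>. w \<xi> (rot 1 s x y) * z \<xi>)\<bar>)"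
      using iF[OF r] iF[OF x(1)] iw by (intro integrable_abs Bochner_Integration.integrable_diff Bochner_Integration.integrable_sum) auto
    fix y assume "y \<in> space \<mu>"
    then have y: "y \<in> duals" by (simp add: space_mu)
    show "\<bar>F (rot 1 s (rot 1 1 x z) y) - F (rot 1 s x y) - (\<Sum>\<xi>\<in>\<Xi>. w \<xi> (rot 1 s x y) * z \<xi>)\<bar> \<le> K * (\<Sum>\<xi>\<in>\<Xi>. \<bar>z \<xi>\<bar>)\<^sup>2"
      unfolding comm[OF y] using x y by (intro D(5)) auto
  qed simp
  have const: "(\<integral>y. k \<partial>\<mu>) = k" for k :: real by (simp add: prob_space)
  show "\<bar>avg s F (rot 1 1 x z) - avg s F x - (\<Sum>\<xi>\<in>\<Xi>. avg s (w \<xi>) x * z \<xi>)\<bar> \<le> K * (\<Sum>\<xi>\<in>\<Xi>. \<bar>z \<xi>\<bar>)\<^sup>2"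
    using le unfolding eq const .
qed

end

subsection \<open>Iterating the step\<close>

context white_noise
begin

sublocale P6: pair_prob_space Om Om ..

lemma integral_rot:
  fixes F :: "('a \<Rightarrow> real) \<Rightarrow> real"
  assumes F: "F \<in> borel_measurable \<mu>" "\<And>x. x \<in> duals \<Longrightarrow> \<bar>F x\<bar> \<le> K" and ab: "a\<^sup>2 + b\<^sup>2 = 1"
  shows "(\<integral>x. \<integral>y. F (rot a b x y) \<partial>\<mu> \<partial>\<mu>) = (\<integral>x. F x \<partial>\<mu>)"
proof -
  have m: "(\<lambda>z. rot a b (fst z) (snd z)) \<in> measurable (\<mu> \<Otimes>\<^sub>M \<mu>) \<mu>" by measurable
  have i: "integrable (\<mu> \<Otimes>\<^sub>M \<mu>) (\<lambda>z. F (rot a b (fst z) (snd z)))"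
    using measurable_compose[OF m F(1)] F(2)
    by (intro P2.integrable_const_bound[where B=K]) (auto intro!: AE_I2 simp: space_pair_measure space_mu)
  have "(\<integral>x. F x \<partial>\<mu>) = (\<integral>x. F x \<partial>distr (\<mu> \<Otimes>\<^sub>M \<mu>) \<mu> (\<lambda>z. rot a b (fst z) (snd z)))"
    by (simp only: distr_rot[OF ab])
  also have "\<dots> = (\<integral>z. F (rot a b (fst z) (snd z)) \<partial>(\<mu> \<Otimes>\<^sub>M \<mu>))" by (rule integral_distr[OF m F(1)])
  also have "\<dots> = (\<integral>x. \<integral>y. F (rot a b x y) \<partial>\<mu> \<partial>\<mu>)" using P2.integral_fst'[OF i] by simp
  finally show ?thesis ..
qed

lemma integral_rot3:
  fixes g :: "('a \<Rightarrow> real) \<times> ('a \<Rightarrow> real) \<times> ('a \<Rightarrow> real) \<Rightarrow> real"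
  assumes g: "g \<in> borel_measurable Om" "\<And>\<omega>. \<omega> \<in> space Om \<Longrightarrow> \<bar>g \<omega>\<bar> \<le> K" and ab: "a\<^sup>2 + b\<^sup>2 = 1"
  shows "(\<integral>\<omega>. \<integral>\<omega>'. g (rot3 a b \<omega> \<omega>') \<partial>Om \<partial>Om) = (\<integral>\<omega>. g \<omega> \<partial>Om)"
    and "integrable Om (\<lambda>\<omega>. \<integral>\<omega>'. g (rot3 a b \<omega> \<omega>') \<partial>Om)"
proof -
  note m = rot3_measurable[of a b]
  have i: "integrable (Om \<Otimes>\<^sub>M Om) (\<lambda>z. g (rot3 a b (fst z) (snd z)))"
    using measurable_compose[OF m g(1)] g(2) measurable_space[OF m]
    by (intro P6.integrable_const_bound[where B=K]) (auto intro!: AE_I2)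
  have "(\<integral>\<omega>. g \<omega> \<partial>Om) = (\<integral>\<omega>. g \<omega> \<partial>distr (Om \<Otimes>\<^sub>M Om) Om (\<lambda>z. rot3 a b (fst z) (snd z)))"
    by (simp only: distr_rot3[OF ab])
  also have "\<dots> = (\<integral>z. g (rot3 a b (fst z) (snd z)) \<partial>(Om \<Otimes>\<^sub>M Om))" by (rule integral_distr[OF m g(1)])
  also have "\<dots> = (\<integral>\<omega>. \<integral>\<omega>'. g (rot3 a b \<omega> \<omega>') \<partial>Om \<partial>Om)" using P6.integral_fst'[OF i] by simp
  finally show "(\<integral>\<omega>. \<integral>\<omega>'. g (rot3 a b \<omega> \<omega>') \<partial>Om \<partial>Om) = (\<integral>\<omega>. g \<omega> \<partial>Om)" ..
  show "integrable Om (\<lambda>\<omega>. \<integral>\<omega>'. g (rot3 a b \<omega> \<omega>') \<partial>Om)" using P6.integrable_fst'[OF i] by simp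
qed

context
  fixes I :: "'i set" and cf af pf qf :: "'i \<Rightarrow> nat \<Rightarrow> real" and \<theta> :: "'i \<Rightarrow> real"
    and G :: "'i \<Rightarrow> ('a \<Rightarrow> real) \<times> ('a \<Rightarrow> real) \<times> ('a \<Rightarrow> real) \<Rightarrow> 'a \<Rightarrow> real"
  assumes finI: "finite I" and \<theta>: "\<And>i. i \<in> I \<Longrightarrow> 0 \<le> \<theta> i"
    and units: "\<And>i. i \<in> I \<Longrightarrow> unit_coeffs (cf i) (af i)" "\<And>i. i \<in> I \<Longrightarrow> unit_coeffs (pf i) (qf i)"
    and G_def: "\<And>i. G i = rv (cf i) (af i) (pf i) (qf i)"
    and variance: "\<And>\<eta>. (\<And>i. i \<in> I \<Longrightarrow> \<eta> i \<in> tests) \<Longrightarrow>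
      (\<integral>\<omega>. (\<Sum>i\<in>I. \<theta> i * G i \<omega> (\<eta> i))\<^sup>2 \<partial>Om) \<le> (\<Sum>i\<in>I. \<theta> i * (norm (\<eta> i))\<^sup>2)"
begin

lemma G_measurable: "i \<in> I \<Longrightarrow> G i \<in> measurable Om \<mu>"
  and G_dual: "i \<in> I \<Longrightarrow> \<omega> \<in> space Om \<Longrightarrow> G i \<omega> \<in> duals"
  using unit_coeffs_bounded[OF units(1)] unit_coeffs_bounded[OF units(2)]
  by (auto simp: G_def intro: rv_measurable rv_dual)

lemma G_rot3: "i \<in> I \<Longrightarrow> \<omega> \<in> space Om \<Longrightarrow> \<omega>' \<in> space Om \<Longrightarrow> G i (rot3 a b \<omega> \<omega>') = rot a b (G i \<omega>) (G i \<omega>')"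
  using unit_coeffs_bounded[OF units(1)] unit_coeffs_bounded[OF units(2)] by (simp add: G_def rv_rot3)

lemma integral_G:
  fixes F :: "('a \<Rightarrow> real) \<Rightarrow> 'b::{banach, second_countable_topology}"
  assumes "i \<in> I" "F \<in> borel_measurable \<mu>"
  shows "(\<integral>\<omega>. F (G i \<omega>) \<partial>Om) = (\<integral>x. F x \<partial>\<mu>)" "integrable Om (\<lambda>\<omega>. F (G i \<omega>)) \<longleftrightarrow> integrable \<mu> F"
  unfolding G_def by (rule integral_rv[OF units(1)[OF assms(1)] units(2)[OF assms(1)] assms(2)])+

lemma prod_powr_bound:
  assumes "\<And>i. i \<in> I \<Longrightarrow> 0 \<le> y i \<and> y i \<le> B"
  shows "\<bar>\<Prod>i\<in>I. y i powr \<theta> i\<bar> \<le> (\<Prod>i\<in>I. B powr \<theta> i)"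
proof -
  have "(\<Prod>i\<in>I. y i powr \<theta> i) \<le> (\<Prod>i\<in>I. B powr \<theta> i)"
    using assms \<theta> by (intro prod_mono conjI powr_mono2) auto
  moreover have "0 \<le> (\<Prod>i\<in>I. y i powr \<theta> i)" by (intro prod_nonneg) auto
  ultimately show ?thesis by simp
qed

text \<open>After division by the value at the base point, X_i = F_i (x_i + s G_i) / F_i (x_i) - 1
  has the linear part s G_i (\<eta>_i), and \<open>variance\<close> at these \<eta>_i is the
  variance hypothesis of \<open>small_step\<close>. Values between k and 1/k have quotients between
  k^2 and 1/k^2. The constant is uniform in the functions, the base points and the step size, as the
  iteration demands.\<close>

lemma single_step:
  assumes \<Xi>: "finite \<Xi>" "\<Xi> \<subseteq> tests" and k: "0 < k" "k \<le> 1" and K: "0 \<le> K"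
  shows "\<exists>C\<ge>0. \<forall>s::real. \<forall>F w x. 0 < s \<longrightarrow> s \<le> 1 \<longrightarrow>
    (\<forall>i\<in>I. taylor \<Xi> K (w i) (F i) \<and> (\<forall>y\<in>duals. k \<le> F i y \<and> F i y \<le> 1 / k) \<and> x i \<in> duals) \<longrightarrow>
    (\<integral>\<omega>. (\<Prod>i\<in>I. F i (rot 1 s (x i) (G i \<omega>)) powr \<theta> i) \<partial>Om) \<le> (1 + C * s ^ 3) * (\<Prod>i\<in>I. avg s (F i) (x i) powr \<theta> i)"
proof -
  define R where "R \<omega> = 1 + (\<Sum>i\<in>I. \<Sum>\<xi>\<in>\<Xi>. \<bar>G i \<omega> \<xi>\<bar>)" for \<omega>
  have R1: "1 \<le> R \<omega>" for \<omega> by (simp add: R_def sum_nonneg)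
  have ev: "(\<lambda>\<omega>. G i \<omega> \<xi>) \<in> borel_measurable Om" if "i \<in> I" "\<xi> \<in> tests" for i \<xi>
    by (rule measurable_eval[OF G_measurable[OF that(1)] that(2)])
  have "Lp Om 6 (\<lambda>\<omega>. complex_of_real \<bar>G i \<omega> \<xi>\<bar>)" if "i \<in> I" "\<xi> \<in> \<Xi>" for i \<xi>
  proof -
    have \<xi>: "\<xi> \<in> tests" using that \<Xi> by auto
    have L: "Lp \<mu> 6 (\<lambda>x. complex_of_real (x \<xi>))" by (intro expbdd_Lp expbdd_eval \<xi>) simp
    have "(\<lambda>x. cmod (complex_of_real (x \<xi>)) powr 6) \<in> borel_measurable \<mu>"
      using Lp_measurable[OF L] by measurable
    then have "integrable Om (\<lambda>\<omega>. cmod (complex_of_real (G i \<omega> \<xi>)) powr 6)"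
      using integral_G(2)[OF that(1), of "\<lambda>x. cmod (complex_of_real (x \<xi>)) powr 6"] Lp_integrable[OF L] by blast
    then show ?thesis using ev[OF that(1) \<xi>] by (simp add: Lp_def)
  qed
  then have "Lp Om 6 (\<lambda>\<omega>. 1 + (\<Sum>i\<in>I. \<Sum>\<xi>\<in>\<Xi>. complex_of_real \<bar>G i \<omega> \<xi>\<bar>))"
    by (intro Lp_add Lp_sum finI \<Xi>) (auto simp: Lp_def)
  then have LR: "Lp Om 6 (\<lambda>\<omega>. complex_of_real (R \<omega>))" by (simp add: R_def)
  have Rm: "R \<in> borel_measurable Om"
    unfolding R_def[abs_def] using \<Xi>
    by (intro borel_measurable_add borel_measurable_const borel_measurable_sum borel_measurable_abs ev) auto
  have R6: "integrable Om (\<lambda>\<omega>. R \<omega> ^ 6)"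
  proof -
    have "cmod (complex_of_real (R \<omega>)) powr 6 = R \<omega> ^ 6" for \<omega>
      using R1[of \<omega>] powr_realpow[of "R \<omega>" 6] by simp
    then show ?thesis using Lp_integrable[OF LR] by simp
  qed
  have k2: "0 < k\<^sup>2" "k\<^sup>2 \<le> 1" using k by (auto simp: power_le_one)
  have Kk: "0 \<le> K / k" using K k by simp
  have "\<exists>C\<ge>0. \<forall>s::real. \<forall>x l. 0 < s \<longrightarrow> s \<le> 1 \<longrightarrow>
    (\<forall>i\<in>I. x i \<in> borel_measurable Om \<and> l i \<in> borel_measurable Om \<and> integral\<^sup>L Om (l i) = 0 \<and>
      (\<forall>\<omega>\<in>space Om. k\<^sup>2 \<le> 1 + x i \<omega> \<and> 1 + x i \<omega> \<le> 1 / k\<^sup>2 \<and> \<bar>l i \<omega>\<bar> \<le> K / k * R \<omega> \<and>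
        \<bar>x i \<omega> - s * l i \<omega>\<bar> \<le> K / k * s\<^sup>2 * (R \<omega>)\<^sup>2)) \<longrightarrow>
    (\<integral>\<omega>. (\<Sum>i\<in>I. \<theta> i * l i \<omega>)\<^sup>2 \<partial>Om) \<le> (\<Sum>i\<in>I. \<theta> i * (\<integral>\<omega>. (l i \<omega>)\<^sup>2 \<partial>Om)) \<longrightarrow>
    (\<integral>\<omega>. (\<Prod>i\<in>I. (1 + x i \<omega>) powr \<theta> i) \<partial>Om) \<le> (1 + C * s ^ 3) * (\<Prod>i\<in>I. (1 + (\<integral>\<omega>. x i \<omega> \<partial>Om)) powr \<theta> i)"
    by (rule P3.small_step[OF finI \<theta> k2 Kk Rm R1 R6])
  then obtain C where C: "0 \<le> C" "\<forall>s::real. \<forall>x l. 0 < s \<longrightarrow> s \<le> 1 \<longrightarrow>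
    (\<forall>i\<in>I. x i \<in> borel_measurable Om \<and> l i \<in> borel_measurable Om \<and> integral\<^sup>L Om (l i) = 0 \<and>
      (\<forall>\<omega>\<in>space Om. k\<^sup>2 \<le> 1 + x i \<omega> \<and> 1 + x i \<omega> \<le> 1 / k\<^sup>2 \<and> \<bar>l i \<omega>\<bar> \<le> K / k * R \<omega> \<and>
        \<bar>x i \<omega> - s * l i \<omega>\<bar> \<le> K / k * s\<^sup>2 * (R \<omega>)\<^sup>2)) \<longrightarrow>
    (\<integral>\<omega>. (\<Sum>i\<in>I. \<theta> i * l i \<omega>)\<^sup>2 \<partial>Om) \<le> (\<Sum>i\<in>I. \<theta> i * (\<integral>\<omega>. (l i \<omega>)\<^sup>2 \<partial>Om)) \<longrightarrow>
    (\<integral>\<omega>. (\<Prod>i\<in>I. (1 + x i \<omega>) powr \<theta> i) \<partial>Om) \<le> (1 + C * s ^ 3) * (\<Prod>i\<in>I. (1 + (\<integral>\<omega>. x i \<omega> \<partial>Om)) powr \<theta> i)"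
    by (elim exE conjE) (rule that)
  show ?thesis
  proof (intro exI[of _ C] conjI allI impI C(1))
    fix s :: real and F w x
    assume s: "0 < s" "s \<le> 1" and H: "\<forall>i\<in>I. taylor \<Xi> K (w i) (F i) \<and> (\<forall>y\<in>duals. k \<le> F i y \<and> F i y \<le> 1 / k) \<and> x i \<in> duals"
    have HT: "taylor \<Xi> K (w i) (F i)" and HF: "\<And>y. y \<in> duals \<Longrightarrow> k \<le> F i y \<and> F i y \<le> 1 / k" and Hx: "x i \<in> duals"
      if "i \<in> I" for i using H that by auto
    have Fx: "0 < F i (x i)" if "i \<in> I" for i using HF[OF that Hx[OF that]] k by linarith
    define X where "X i \<omega> = F i (rot 1 s (x i) (G i \<omega>)) / F i (x i) - 1" for i \<omega>
    define \<eta> where "\<eta> i = (\<Sum>\<xi>\<in>\<Xi>. (w i \<xi> (x i) / F i (x i)) *\<^sub>R \<xi>)" for i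
    define l where "l i \<omega> = G i \<omega> (\<eta> i)" for i \<omega>
    have \<eta>: "\<eta> i \<in> tests" for i unfolding \<eta>_def using \<Xi> by (intro tests_sum tests_scaleR) auto
    have l_alt: "l i \<omega> = (\<Sum>\<xi>\<in>\<Xi>. w i \<xi> (x i) / F i (x i) * G i \<omega> \<xi>)" if "i \<in> I" "\<omega> \<in> space Om" for i \<omega>
      unfolding l_def \<eta>_def using G_dual[OF that] \<Xi> by (subst dual_sum) (auto intro!: sum.cong tests_scaleR simp: dual_scaleR subset_iff)
    have rotd: "rot 1 s (x i) (G i \<omega>) \<in> duals" if "i \<in> I" "\<omega> \<in> space Om" for i \<omega>
      using G_dual[OF that] Hx[OF that(1)] by auto
    have Frm: "(\<lambda>\<omega>. F i (rot 1 s (x i) (G i \<omega>))) \<in> borel_measurable Om" if "i \<in> I" for i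
      using measurable_compose[OF G_measurable[OF that] rot_section_measurable[OF taylorD(1)[OF HT[OF that]] Hx[OF that]]] .
    have Fi: "integrable Om (\<lambda>\<omega>. F i (rot 1 s (x i) (G i \<omega>)))" if "i \<in> I" for i
      using Frm[OF that] taylorD(2)[OF HT[OF that] rotd[OF that]]
      by (intro P3.integrable_const_bound[where B=K]) (auto intro!: AE_I2)
    have "(\<integral>\<omega>. (\<Prod>i\<in>I. (1 + X i \<omega>) powr \<theta> i) \<partial>Om) \<le> (1 + C * s ^ 3) * (\<Prod>i\<in>I. (1 + (\<integral>\<omega>. X i \<omega> \<partial>Om)) powr \<theta> i)"
    proof (rule C(2)[THEN spec, THEN spec, THEN spec, THEN mp, OF s(1), THEN mp, OF s(2), THEN mp, THEN mp]; (intro ballI)?)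
      fix i assume i: "i \<in> I"
      show "X i \<in> borel_measurable Om \<and> l i \<in> borel_measurable Om \<and> integral\<^sup>L Om (l i) = 0 \<and>
        (\<forall>\<omega>\<in>space Om. k\<^sup>2 \<le> 1 + X i \<omega> \<and> 1 + X i \<omega> \<le> 1 / k\<^sup>2 \<and> \<bar>l i \<omega>\<bar> \<le> K / k * R \<omega> \<and>
        \<bar>X i \<omega> - s * l i \<omega>\<bar> \<le> K / k * s\<^sup>2 * (R \<omega>)\<^sup>2)"
      proof (intro conjI ballI)
        show "X i \<in> borel_measurable Om" unfolding X_def[abs_def] using Frm[OF i] by measurable
        show "l i \<in> borel_measurable Om" unfolding l_def[abs_def] by (rule ev[OF i \<eta>])
        show "integral\<^sup>L Om (l i) = 0"
          unfolding l_def[abs_def] using integral_G(1)[OF i eval_measurable[OF \<eta>]] eval_moments(2)[OF \<eta>] by simp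
        fix \<omega> assume \<omega>: "\<omega> \<in> space Om"
        have G: "G i \<omega> \<in> duals" by (rule G_dual[OF i \<omega>])
        have b1: "k \<le> F i (rot 1 s (x i) (G i \<omega>))" "F i (rot 1 s (x i) (G i \<omega>)) \<le> 1 / k"
          using HF[OF i rotd[OF i \<omega>]] by auto
        have b2: "k \<le> F i (x i)" "F i (x i) \<le> 1 / k" using HF[OF i Hx[OF i]] by auto
        have "k / (1 / k) \<le> F i (rot 1 s (x i) (G i \<omega>)) / F i (x i)" using b1 b2 k by (intro frac_le) auto
        then show "k\<^sup>2 \<le> 1 + X i \<omega>" by (simp add: X_def power2_eq_square)
        have "F i (rot 1 s (x i) (G i \<omega>)) / F i (x i) \<le> (1 / k) / k" using b1 b2 k by (intro frac_le) auto
        then show "1 + X i \<omega> \<le> 1 / k\<^sup>2" by (simp add: X_def power2_eq_square)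
        have wF: "\<bar>w i \<xi> (x i) / F i (x i)\<bar> \<le> K / k" if "\<xi> \<in> \<Xi>" for \<xi>
          using taylorD(4)[OF HT[OF i] that Hx[OF i]] b2 k K by (simp add: abs_divide frac_le)
        have SR: "(\<Sum>\<xi>\<in>\<Xi>. \<bar>G i \<omega> \<xi>\<bar>) \<le> R \<omega>"
        proof -
          have "(\<Sum>\<xi>\<in>\<Xi>. \<bar>G i \<omega> \<xi>\<bar>) \<le> (\<Sum>i\<in>I. \<Sum>\<xi>\<in>\<Xi>. \<bar>G i \<omega> \<xi>\<bar>)"
            by (rule member_le_sum[OF i _ finI]) (simp add: sum_nonneg)
          then show ?thesis by (simp add: R_def)
        qed
        have "\<bar>l i \<omega>\<bar> \<le> (\<Sum>\<xi>\<in>\<Xi>. \<bar>w i \<xi> (x i) / F i (x i) * G i \<omega> \<xi>\<bar>)"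
          unfolding l_alt[OF i \<omega>] by (rule sum_abs)
        also have "\<dots> \<le> (\<Sum>\<xi>\<in>\<Xi>. K / k * \<bar>G i \<omega> \<xi>\<bar>)"
          unfolding abs_mult by (intro sum_mono mult_right_mono wF) auto
        also have "\<dots> \<le> K / k * R \<omega>"
          unfolding sum_distrib_left[symmetric] by (rule mult_left_mono[OF SR Kk])
        finally show "\<bar>l i \<omega>\<bar> \<le> K / k * R \<omega>" .
        \<comment> \<open>\<open>rot s 0 y y\<close> stands for the multiple s y inside the dual
          space.\<close>
        have sc: "rot s 0 (G i \<omega>) (G i \<omega>) \<in> duals" using G by auto
        have r11: "rot 1 1 (x i) (rot s 0 (G i \<omega>) (G i \<omega>)) = rot 1 s (x i) (G i \<omega>)"
          using G Hx[OF i] by (intro dual_eqI) (auto simp: rot_apply rot_dual)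
        have scv: "rot s 0 (G i \<omega>) (G i \<omega>) \<xi> = s * G i \<omega> \<xi>" if "\<xi> \<in> \<Xi>" for \<xi>
          using G that \<Xi> by (subst rot_apply) auto
        have "\<bar>F i (rot 1 s (x i) (G i \<omega>)) - F i (x i) - (\<Sum>\<xi>\<in>\<Xi>. w i \<xi> (x i) * (s * G i \<omega> \<xi>))\<bar> \<le> K * (\<Sum>\<xi>\<in>\<Xi>. \<bar>s * G i \<omega> \<xi>\<bar>)\<^sup>2"
          using taylorD(5)[OF HT[OF i] Hx[OF i] sc] unfolding r11 by (simp add: scv cong: sum.cong)
        also have "\<dots> = K * s\<^sup>2 * (\<Sum>\<xi>\<in>\<Xi>. \<bar>G i \<omega> \<xi>\<bar>)\<^sup>2"
          using s by (simp add: abs_mult sum_distrib_left[symmetric] power_mult_distrib)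
        also have "\<dots> \<le> K * s\<^sup>2 * (R \<omega>)\<^sup>2"
          using SR K by (intro mult_left_mono power_mono) (auto intro: sum_nonneg)
        finally have main: "\<bar>F i (rot 1 s (x i) (G i \<omega>)) - F i (x i) - (\<Sum>\<xi>\<in>\<Xi>. w i \<xi> (x i) * (s * G i \<omega> \<xi>))\<bar> \<le> K * s\<^sup>2 * (R \<omega>)\<^sup>2" .
        have "X i \<omega> - s * l i \<omega> = (F i (rot 1 s (x i) (G i \<omega>)) - F i (x i) - (\<Sum>\<xi>\<in>\<Xi>. w i \<xi> (x i) * (s * G i \<omega> \<xi>))) / F i (x i)"
          unfolding l_alt[OF i \<omega>] X_def using Fx[OF i]
          by (simp add: diff_divide_distrib sum_divide_distrib sum_distrib_left mult_ac)
        then have "\<bar>X i \<omega> - s * l i \<omega>\<bar> = \<bar>F i (rot 1 s (x i) (G i \<omega>)) - F i (x i) - (\<Sum>\<xi>\<in>\<Xi>. w i \<xi> (x i) * (s * G i \<omega> \<xi>))\<bar> / F i (x i)"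
          using Fx[OF i] by (simp add: abs_divide)
        also have "\<dots> \<le> K * s\<^sup>2 * (R \<omega>)\<^sup>2 / k" using main b2 k K by (intro frac_le) auto
        finally show "\<bar>X i \<omega> - s * l i \<omega>\<bar> \<le> K / k * s\<^sup>2 * (R \<omega>)\<^sup>2" by simp
      qed
    next
      have "(\<integral>\<omega>. (l i \<omega>)\<^sup>2 \<partial>Om) = (norm (\<eta> i))\<^sup>2" if i: "i \<in> I" for i
      proof -
        have "(\<lambda>x. (x (\<eta> i))\<^sup>2) \<in> borel_measurable \<mu>" using \<eta> by measurable
        from integral_G(1)[OF i this] show ?thesis unfolding l_def by (simp only: eval_moments(4)[OF \<eta>])
      qed
      then show "(\<integral>\<omega>. (\<Sum>i\<in>I. \<theta> i * l i \<omega>)\<^sup>2 \<partial>Om) \<le> (\<Sum>i\<in>I. \<theta> i * (\<integral>\<omega>. (l i \<omega>)\<^sup>2 \<partial>Om))"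
        using variance[of \<eta>, OF \<eta>] by (simp add: l_def)
    qed
    moreover have "(\<integral>\<omega>. (\<Prod>i\<in>I. (1 + X i \<omega>) powr \<theta> i) \<partial>Om) =
        (\<integral>\<omega>. (\<Prod>i\<in>I. F i (rot 1 s (x i) (G i \<omega>)) powr \<theta> i) \<partial>Om) / (\<Prod>i\<in>I. F i (x i) powr \<theta> i)"
    proof -
      have "(\<integral>\<omega>. (\<Prod>i\<in>I. (1 + X i \<omega>) powr \<theta> i) \<partial>Om) =
          (\<integral>\<omega>. (\<Prod>i\<in>I. F i (rot 1 s (x i) (G i \<omega>)) powr \<theta> i) / (\<Prod>i\<in>I. F i (x i) powr \<theta> i) \<partial>Om)"
      proof (intro Bochner_Integration.integral_cong refl)
        fix \<omega> assume \<omega>: "\<omega> \<in> space Om"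
        have "(1 + X i \<omega>) powr \<theta> i = F i (rot 1 s (x i) (G i \<omega>)) powr \<theta> i / F i (x i) powr \<theta> i" if i: "i \<in> I" for i
        proof -
          have "0 \<le> F i (rot 1 s (x i) (G i \<omega>))" using HF[OF i rotd[OF i \<omega>]] k by linarith
          then show ?thesis unfolding X_def using Fx[OF i] by (simp add: powr_divide)
        qed
        then show "(\<Prod>i\<in>I. (1 + X i \<omega>) powr \<theta> i) = (\<Prod>i\<in>I. F i (rot 1 s (x i) (G i \<omega>)) powr \<theta> i) / (\<Prod>i\<in>I. F i (x i) powr \<theta> i)"
          by (simp add: prod_dividef)
      qed
      then show ?thesis by simp
    qed
    moreover have "(\<Prod>i\<in>I. (1 + (\<integral>\<omega>. X i \<omega> \<partial>Om)) powr \<theta> i) = (\<Prod>i\<in>I. avg s (F i) (x i) powr \<theta> i) / (\<Prod>i\<in>I. F i (x i) powr \<theta> i)"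
    proof -
      have "(1 + (\<integral>\<omega>. X i \<omega> \<partial>Om)) powr \<theta> i = avg s (F i) (x i) powr \<theta> i / F i (x i) powr \<theta> i" if i: "i \<in> I" for i
      proof -
        have "(\<integral>\<omega>. X i \<omega> \<partial>Om) = (\<integral>\<omega>. F i (rot 1 s (x i) (G i \<omega>)) \<partial>Om) / F i (x i) - 1"
          unfolding X_def using Fi[OF i] by (simp add: P3.prob_space)
        also have "(\<integral>\<omega>. F i (rot 1 s (x i) (G i \<omega>)) \<partial>Om) = avg s (F i) (x i)"
          unfolding avg_def by (rule integral_G(1)[OF i rot_section_measurable[OF taylorD(1)[OF HT[OF i]] Hx[OF i]]])
        finally have "1 + (\<integral>\<omega>. X i \<omega> \<partial>Om) = avg s (F i) (x i) / F i (x i)" by simp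
        moreover have "k \<le> avg s (F i) (x i)" by (rule avg_bounds(1)[OF taylorD(1)[OF HT[OF i]] HF[OF i] Hx[OF i]])
        ultimately show ?thesis using Fx[OF i] k by (simp add: powr_divide)
      qed
      then show ?thesis by (simp add: prod_dividef)
    qed
    moreover have "0 < (\<Prod>i\<in>I. F i (x i) powr \<theta> i)" using Fx by (intro prod_pos) (auto simp: less_imp_neq[symmetric])
    ultimately show "(\<integral>\<omega>. (\<Prod>i\<in>I. F i (rot 1 s (x i) (G i \<omega>)) powr \<theta> i) \<partial>Om) \<le> (1 + C * s ^ 3) * (\<Prod>i\<in>I. avg s (F i) (x i) powr \<theta> i)"
      by (simp add: divide_le_cancel)
  qed
qed

text \<open>A field at scale sqrt (n + 1) s is distributed like the field at scale sqrt n s plus an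
  independent increment at scale s. Given the former, \<open>step\<close> integrates out the
  increment and replaces each F_i by \<open>avg s (F i)\<close>, which obeys the same bounds; for
  this reason the induction runs over all functions.\<close>

lemma many_steps:
  assumes s: "0 < s" and C: "0 \<le> C" and \<Xi>: "finite \<Xi>" "\<Xi> \<subseteq> tests" and k: "0 < k" and K: "0 \<le> K"
    and step: "\<And>F w x. (\<And>i. i \<in> I \<Longrightarrow> taylor \<Xi> K (w i) (F i) \<and> (\<forall>y\<in>duals. k \<le> F i y \<and> F i y \<le> 1 / k) \<and> x i \<in> duals) \<Longrightarrow>
      (\<integral>\<omega>. (\<Prod>i\<in>I. F i (rot 1 s (x i) (G i \<omega>)) powr \<theta> i) \<partial>Om) \<le> (1 + C) * (\<Prod>i\<in>I. avg s (F i) (x i) powr \<theta> i)"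
    and F: "\<And>i. i \<in> I \<Longrightarrow> taylor \<Xi> K (w i) (F i) \<and> (\<forall>y\<in>duals. k \<le> F i y \<and> F i y \<le> 1 / k)"
  shows "(\<integral>\<omega>. (\<Prod>i\<in>I. F i (rot (sqrt (real n) * s) 0 (G i \<omega>) (G i \<omega>)) powr \<theta> i) \<partial>Om) \<le>
    (1 + C) ^ n * (\<Prod>i\<in>I. (\<integral>y. F i (rot (sqrt (real n) * s) 0 y y) \<partial>\<mu>) powr \<theta> i)"
  using F
proof (induction n arbitrary: F w)
  case 0
  obtain z where z: "z \<in> duals" using not_empty by (auto simp: space_mu)
  \<comment> \<open>At scale 0 all fields are the zero functional, so both sides are the same
    constant.\<close>
  have zero: "rot 0 0 y y = rot 0 0 z z" if "y \<in> duals" for y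
    using that z by (intro dual_eqI) (auto simp: rot_apply rot_dual)
  have "(\<integral>\<omega>. (\<Prod>i\<in>I. F i (rot 0 0 (G i \<omega>) (G i \<omega>)) powr \<theta> i) \<partial>Om) = (\<integral>\<omega>. (\<Prod>i\<in>I. F i (rot 0 0 z z) powr \<theta> i) \<partial>Om)"
    by (intro Bochner_Integration.integral_cong refl prod.cong) (simp add: zero[OF G_dual])
  moreover have "(\<integral>y. F i (rot 0 0 y y) \<partial>\<mu>) = (\<integral>y. F i (rot 0 0 z z) \<partial>\<mu>)" for i
    by (intro Bochner_Integration.integral_cong refl) (simp add: zero space_mu)
  ultimately show ?case by (simp add: prob_space P3.prob_space)
next
  case (Suc n)
  define \<tau> where "\<tau> = sqrt (real n) * s"
  define \<tau>' where "\<tau>' = sqrt (real (Suc n)) * s"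
  \<comment> \<open>Rotating two independent copies by (a, b) and scaling by \<tau>' gives \<tau>
    times the one plus s times the other.\<close>
  define a where "a = \<tau> / \<tau>'"
  define b where "b = s / \<tau>'"
  have \<tau>': "0 < \<tau>'" using s by (simp add: \<tau>'_def)
  have ab: "a\<^sup>2 + b\<^sup>2 = 1"
  proof -
    have "\<tau>\<^sup>2 + s\<^sup>2 = \<tau>'\<^sup>2" by (simp add: \<tau>_def \<tau>'_def power_mult_distrib algebra_simps)
    then show ?thesis using \<tau>' by (simp add: a_def b_def power_divide add_divide_distrib[symmetric])
  qed
  have comb: "rot \<tau>' 0 (rot a b x y) (rot a b x y) = rot 1 s (rot \<tau> 0 x x) y" if "x \<in> duals" "y \<in> duals" for x y
    using that \<tau>' by (intro dual_eqI) (auto simp: rot_apply rot_dual a_def b_def distrib_left)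
  have T: "taylor \<Xi> K (w i) (F i)" and FB: "\<And>y. y \<in> duals \<Longrightarrow> k \<le> F i y \<and> F i y \<le> 1 / k" if "i \<in> I" for i
    using Suc.prems that by auto
  have sm: "(\<lambda>y. H (rot u 0 y y)) \<in> borel_measurable \<mu>" if "H \<in> borel_measurable \<mu>" for H :: "('a \<Rightarrow> real) \<Rightarrow> real" and u
    by (rule measurable_compose[OF _ that]) measurable
  define g where "g \<omega> = (\<Prod>i\<in>I. F i (rot \<tau>' 0 (G i \<omega>) (G i \<omega>)) powr \<theta> i)" for \<omega>
  define h where "h \<omega> = (\<Prod>i\<in>I. avg s (F i) (rot \<tau> 0 (G i \<omega>) (G i \<omega>)) powr \<theta> i)" for \<omega>
  have gm: "g \<in> borel_measurable Om"
    unfolding g_def[abs_def]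
    by (intro borel_measurable_prod powr_real_measurable measurable_compose[OF G_measurable sm] taylorD(1)[OF T]) auto
  have hm: "h \<in> borel_measurable Om"
    unfolding h_def[abs_def]
    by (intro borel_measurable_prod powr_real_measurable measurable_compose[OF G_measurable sm] avg_measurable taylorD(1)[OF T]) auto
  have gb: "\<bar>g \<omega>\<bar> \<le> (\<Prod>i\<in>I. (1 / k) powr \<theta> i)" if "\<omega> \<in> space Om" for \<omega>
    unfolding g_def using FB[OF _ rot_dual[OF G_dual G_dual]] that k by (intro prod_powr_bound) (meson less_imp_le order_trans)
  have AT: "taylor \<Xi> K (\<lambda>\<xi>. avg s (w i \<xi>)) (avg s (F i))" if "i \<in> I" for i
    by (rule taylor_avg[OF T[OF that] \<Xi> K])
  have AB: "k \<le> avg s (F i) y \<and> avg s (F i) y \<le> 1 / k" if "i \<in> I" "y \<in> duals" for i y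
    using avg_bounds[OF taylorD(1)[OF T[OF that(1)]] FB[OF that(1)] that(2)] by blast
  have hb: "\<bar>h \<omega>\<bar> \<le> (\<Prod>i\<in>I. (1 / k) powr \<theta> i)" if "\<omega> \<in> space Om" for \<omega>
    unfolding h_def using AB[OF _ rot_dual[OF G_dual G_dual]] that k by (intro prod_powr_bound) (meson less_imp_le order_trans)
  have hi: "integrable Om h" using hm hb by (intro P3.integrable_const_bound) (auto intro!: AE_I2)
  have "(\<integral>\<omega>. g \<omega> \<partial>Om) = (\<integral>\<omega>. \<integral>\<omega>'. g (rot3 a b \<omega> \<omega>') \<partial>Om \<partial>Om)"
    by (rule integral_rot3(1)[OF gm gb ab, symmetric])
  also have "\<dots> \<le> (\<integral>\<omega>. (1 + C) * h \<omega> \<partial>Om)"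
  proof (rule integral_mono[OF integral_rot3(2)[OF gm gb ab]])
    show "integrable Om (\<lambda>\<omega>. (1 + C) * h \<omega>)" using hi by simp
    fix \<omega> assume \<omega>: "\<omega> \<in> space Om"
    have "(\<integral>\<omega>'. g (rot3 a b \<omega> \<omega>') \<partial>Om) = (\<integral>\<omega>'. (\<Prod>i\<in>I. F i (rot 1 s (rot \<tau> 0 (G i \<omega>) (G i \<omega>)) (G i \<omega>')) powr \<theta> i) \<partial>Om)"
      unfolding g_def
      by (intro Bochner_Integration.integral_cong refl prod.cong) (simp add: G_rot3 \<omega> comb G_dual)
    also have "\<dots> \<le> (1 + C) * h \<omega>"
      unfolding h_def by (rule step) (use T FB G_dual[OF _ \<omega>] in auto)
    finally show "(\<integral>\<omega>'. g (rot3 a b \<omega> \<omega>') \<partial>Om) \<le> (1 + C) * h \<omega>" .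
  qed
  also have "\<dots> = (1 + C) * (\<integral>\<omega>. h \<omega> \<partial>Om)" by simp
  also have "\<dots> \<le> (1 + C) * ((1 + C) ^ n * (\<Prod>i\<in>I. (\<integral>y. avg s (F i) (rot \<tau> 0 y y) \<partial>\<mu>) powr \<theta> i))"
  proof (rule mult_left_mono)
    show "(\<integral>\<omega>. h \<omega> \<partial>Om) \<le> (1 + C) ^ n * (\<Prod>i\<in>I. (\<integral>y. avg s (F i) (rot \<tau> 0 y y) \<partial>\<mu>) powr \<theta> i)"
      unfolding h_def \<tau>_def
    proof (rule Suc.IH)
      fix i assume i: "i \<in> I"
      show "taylor \<Xi> K ((\<lambda>i \<xi>. avg s (w i \<xi>)) i) (avg s (F i)) \<and> (\<forall>y\<in>duals. k \<le> avg s (F i) y \<and> avg s (F i) y \<le> 1 / k)"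
        using AT[OF i] AB[OF i] by blast
    qed
  qed (use C in simp)
  also have "(\<Prod>i\<in>I. (\<integral>y. avg s (F i) (rot \<tau> 0 y y) \<partial>\<mu>) powr \<theta> i) = (\<Prod>i\<in>I. (\<integral>y. F i (rot \<tau>' 0 y y) \<partial>\<mu>) powr \<theta> i)"
  proof (intro prod.cong refl arg_cong2[where f="(powr)"])
    fix i assume i: "i \<in> I"
    have "(\<integral>y. avg s (F i) (rot \<tau> 0 y y) \<partial>\<mu>) = (\<integral>x. \<integral>y. F i (rot \<tau>' 0 (rot a b x y) (rot a b x y)) \<partial>\<mu> \<partial>\<mu>)"
      unfolding avg_def by (intro Bochner_Integration.integral_cong refl) (simp add: comb space_mu)
    also have "\<dots> = (\<integral>y. F i (rot \<tau>' 0 y y) \<partial>\<mu>)"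
      by (rule integral_rot[OF sm[OF taylorD(1)[OF T[OF i]]] taylorD(2)[OF T[OF i] rot_dual] ab])
    finally show "(\<integral>y. avg s (F i) (rot \<tau> 0 y y) \<partial>\<mu>) = (\<integral>y. F i (rot \<tau>' 0 y y) \<partial>\<mu>)" .
  qed
  finally show ?case unfolding g_def \<tau>'_def by (simp add: mult_ac)
qed

text \<open>The directions and bounds of the finitely many functions are merged, so that
  \<open>single_step\<close> yields a single constant for all n. With s = 1 / sqrt n the total loss
  (1 + C s^3)^n is at most exp (C / sqrt n).\<close>

lemma gaussian_hoelder:
  assumes F: "\<And>i. i \<in> I \<Longrightarrow> smooth (F i)" and k: "0 < k" "\<And>i x. i \<in> I \<Longrightarrow> x \<in> duals \<Longrightarrow> k \<le> F i x"
  shows "(\<integral>\<omega>. (\<Prod>i\<in>I. F i (G i \<omega>) powr \<theta> i) \<partial>Om) \<le> (\<Prod>i\<in>I. (\<integral>y. F i y \<partial>\<mu>) powr \<theta> i)"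
proof -
  have "\<forall>i\<in>I. \<exists>\<Xi>. \<exists>K. \<exists>w. finite \<Xi> \<and> \<Xi> \<subseteq> tests \<and> 0 \<le> K \<and> taylor \<Xi> K w (F i)" using F unfolding smooth_def by blast
  from bchoice[OF this] obtain \<Xi>0 where "\<forall>i\<in>I. \<exists>K. \<exists>w. finite (\<Xi>0 i) \<and> \<Xi>0 i \<subseteq> tests \<and> 0 \<le> K \<and> taylor (\<Xi>0 i) K w (F i)" ..
  from bchoice[OF this] obtain K0 where "\<forall>i\<in>I. \<exists>w. finite (\<Xi>0 i) \<and> \<Xi>0 i \<subseteq> tests \<and> 0 \<le> K0 i \<and> taylor (\<Xi>0 i) (K0 i) w (F i)" ..
  from bchoice[OF this] obtain w0 where T0: "\<forall>i\<in>I. finite (\<Xi>0 i) \<and> \<Xi>0 i \<subseteq> tests \<and> 0 \<le> K0 i \<and> taylor (\<Xi>0 i) (K0 i) (w0 i) (F i)" ..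
  define \<Xi> where "\<Xi> = (\<Union>i\<in>I. \<Xi>0 i)"
  define K where "K = (\<Sum>i\<in>I. K0 i)"
  define w where "w i = (\<lambda>\<xi>. if \<xi> \<in> \<Xi>0 i then w0 i \<xi> else (\<lambda>x. 0))" for i
  \<comment> \<open>The values have to lie between k0 and 1/k0; k0 <= 1 / (K + 1) takes care of the
    upper bound \<open>K\<close>.\<close>
  define k0 where "k0 = min (min k 1) (1 / (K + 1))"
  have \<Xi>: "finite \<Xi>" "\<Xi> \<subseteq> tests" using T0 finI by (auto simp: \<Xi>_def)
  have K: "0 \<le> K" using T0 by (auto simp: K_def intro: sum_nonneg)
  have T: "taylor \<Xi> K (w i) (F i)" if "i \<in> I" for i
    unfolding w_def
  proof (rule taylor_mono)
    show "taylor (\<Xi>0 i) (K0 i) (w0 i) (F i)" "0 \<le> K0 i" using T0 that by auto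
    show "K0 i \<le> K" unfolding K_def by (rule member_le_sum[OF that]) (use T0 finI in auto)
    show "finite \<Xi>" by (rule \<Xi>)
    show "\<Xi>0 i \<subseteq> \<Xi>" using that by (auto simp: \<Xi>_def)
  qed
  have k0: "0 < k0" "k0 \<le> 1" using k K by (auto simp: k0_def)
  have B: "k0 \<le> F i y \<and> F i y \<le> 1 / k0" if "i \<in> I" "y \<in> duals" for i y
  proof
    have "k0 \<le> k" by (simp add: k0_def)
    then show "k0 \<le> F i y" using k(2)[OF that] by linarith
    have "k0 \<le> 1 / (K + 1)" by (simp add: k0_def)
    then have "K + 1 \<le> 1 / k0" using k0 K by (simp add: field_simps)
    then show "F i y \<le> 1 / k0" using taylorD(2)[OF T[OF that(1)] that(2)] by linarith
  qed
  obtain C where C: "0 \<le> C" and step: "\<forall>s::real. \<forall>F w x. 0 < s \<longrightarrow> s \<le> 1 \<longrightarrow>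
    (\<forall>i\<in>I. taylor \<Xi> K (w i) (F i) \<and> (\<forall>y\<in>duals. k0 \<le> F i y \<and> F i y \<le> 1 / k0) \<and> x i \<in> duals) \<longrightarrow>
    (\<integral>\<omega>. (\<Prod>i\<in>I. F i (rot 1 s (x i) (G i \<omega>)) powr \<theta> i) \<partial>Om) \<le> (1 + C * s ^ 3) * (\<Prod>i\<in>I. avg s (F i) (x i) powr \<theta> i)"
    using single_step[OF \<Xi> k0 K] by blast
  have r1: "rot 1 0 y y = y" if "y \<in> duals" for y using that by (intro dual_eqI) (auto simp: rot_apply)
  let ?L = "\<integral>\<omega>. (\<Prod>i\<in>I. F i (G i \<omega>) powr \<theta> i) \<partial>Om" and ?R = "\<Prod>i\<in>I. (\<integral>y. F i y \<partial>\<mu>) powr \<theta> i"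
  have R0: "0 \<le> ?R" by (intro prod_nonneg) auto
  have main: "?L \<le> exp (C / sqrt (real n)) * ?R" if n: "0 < n" for n
  proof -
    define s where "s = 1 / sqrt (real n)"
    have s: "0 < s" "s \<le> 1" "sqrt (real n) * s = 1" using n by (auto simp: s_def)
    have "(\<integral>\<omega>. (\<Prod>i\<in>I. F i (rot (sqrt (real n) * s) 0 (G i \<omega>) (G i \<omega>)) powr \<theta> i) \<partial>Om) \<le>
        (1 + C * s ^ 3) ^ n * (\<Prod>i\<in>I. (\<integral>y. F i (rot (sqrt (real n) * s) 0 y y) \<partial>\<mu>) powr \<theta> i)"
    proof (rule many_steps[OF s(1) _ \<Xi> k0(1) K])
      show "0 \<le> C * s ^ 3" using C s by simp
      show "taylor \<Xi> K (w i) (F i) \<and> (\<forall>y\<in>duals. k0 \<le> F i y \<and> F i y \<le> 1 / k0)" if "i \<in> I" for i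
        using T[OF that] B[OF that] by blast
    qed (use step s in blast)
    moreover have "(\<integral>\<omega>. (\<Prod>i\<in>I. F i (rot 1 0 (G i \<omega>) (G i \<omega>)) powr \<theta> i) \<partial>Om) = ?L"
      by (intro Bochner_Integration.integral_cong refl prod.cong) (simp add: r1 G_dual)
    moreover have "(\<integral>y. F i (rot 1 0 y y) \<partial>\<mu>) = (\<integral>y. F i y \<partial>\<mu>)" for i
      by (intro Bochner_Integration.integral_cong refl) (simp add: r1 space_mu)
    ultimately have "?L \<le> (1 + C * s ^ 3) ^ n * ?R" unfolding s(3) by simp
    also have "\<dots> \<le> exp (C / sqrt (real n)) * ?R"
    proof (rule mult_right_mono[OF _ R0])
      have "(1 + C * s ^ 3) ^ n \<le> exp (C * s ^ 3) ^ n"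
        using C s by (intro power_mono) (auto simp: add.commute exp_ge_add_one_self)
      also have "\<dots> = exp (real n * (C * s ^ 3))" by (rule exp_of_nat_mult[symmetric])
      also have "real n * (C * s ^ 3) = C * s * (sqrt (real n) * s)\<^sup>2"
        by (simp add: power_mult_distrib power2_eq_square power3_eq_cube)
      also have "\<dots> = C / sqrt (real n)" unfolding s(3) by (simp add: s_def)
      finally show "(1 + C * s ^ 3) ^ n \<le> exp (C / sqrt (real n))" .
    qed
    finally show ?thesis .
  qed
  have "(\<lambda>n. exp (C * inverse (sqrt (real n))) * ?R) \<longlonglongrightarrow> exp (C * 0) * ?R"
    by (intro tendsto_intros tendsto_inverse_0_at_top filterlim_compose[OF sqrt_at_top filterlim_real_sequentially])
  then have lim: "(\<lambda>n. exp (C / sqrt (real n)) * ?R) \<longlonglongrightarrow> ?R" by (simp add: divide_inverse)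
  have "\<forall>\<^sub>F n in sequentially. ?L \<le> exp (C / sqrt (real n)) * ?R"
    using eventually_gt_at_top[of 0] by eventually_elim (rule main)
  then show ?thesis by (rule tendsto_lowerbound[OF lim]) simp
qed

end

end

section \<open>The exponent condition as a quadratic form\<close>

lemma quadratic_form_nonneg:
  fixes A B f a b :: real
  assumes "0 \<le> A" "0 \<le> B" "f\<^sup>2 \<le> A * B"
  shows "0 \<le> A * a\<^sup>2 + 2 * f * a * b + B * b\<^sup>2"
proof (cases "A = 0")
  case True
  then have "f = 0" using assms by simp
  then show ?thesis using assms by simp
next
  case False
  have "A * (A * a\<^sup>2 + 2 * f * a * b + B * b\<^sup>2) = (A * a + f * b)\<^sup>2 + (A * B - f\<^sup>2) * b\<^sup>2"
    by (simp add: power2_eq_square algebra_simps)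
  also have "\<dots> \<ge> 0" using assms by simp
  finally show ?thesis using False assms by (simp add: zero_le_mult_iff)
qed

lemma quadratic_form_negative:
  fixes A B f :: real
  assumes "A * B < f\<^sup>2"
  shows "\<exists>a b. A * a\<^sup>2 + 2 * f * a * b + B * b\<^sup>2 < 0"
proof (cases "B = 0")
  case True
  then have "f \<noteq> 0" using assms by auto
  \<comment> \<open>With B = 0 the form is affine in the second variable, and this choice gives it
    the value -1.\<close>
  then have "A * 1\<^sup>2 + 2 * f * 1 * (- (A + 1) / (2 * f)) + B * (- (A + 1) / (2 * f))\<^sup>2 < 0"
    using True by simp
  then show ?thesis by blast
next
  case False
  show ?thesis
  proof (cases "B < 0")
    case True
    then have "A * 0\<^sup>2 + 2 * f * 0 * 1 + B * 1\<^sup>2 < 0" by simp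
    then show ?thesis by blast
  next
    case False
    then have "0 < B" using \<open>B \<noteq> 0\<close> by simp
    then have "B * (A * B - f\<^sup>2) < 0" using assms by (simp add: mult_pos_neg)
    \<comment> \<open>At the point (B, - f) the form has the value B (A B - f^2).\<close>
    then have "A * B\<^sup>2 + 2 * f * B * (- f) + B * (- f)\<^sup>2 < 0" by (simp add: power2_eq_square algebra_simps)
    then show ?thesis by blast
  qed
qed

text \<open>The denominator is positive unless c = d = 0, and in that case the cleared inequality is
  true, in accordance with the value \<infinity> of the fraction.\<close>

lemma exponent_cond_iff:
  assumes "p > 1" "q > 1" "r > 1" "0 \<le> t"
  shows "exponent_cond p q r c d t \<longleftrightarrow>
      (r - 1) * ((q - 1) * c\<^sup>2 + (p - 1) * d\<^sup>2 + 2 * c\<^sup>2 * d\<^sup>2 * t) \<le> (p - 1) * (q - 1) - c\<^sup>2 * d\<^sup>2 * t\<^sup>2"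
proof (cases "c = 0 \<and> d = 0")
  case False
  have "0 \<le> (q - 1) * c\<^sup>2" "0 \<le> (p - 1) * d\<^sup>2" "0 \<le> 2 * c\<^sup>2 * d\<^sup>2 * t" using assms by auto
  moreover have "0 < (q - 1) * c\<^sup>2 \<or> 0 < (p - 1) * d\<^sup>2" using assms False by auto
  ultimately have "0 < (q - 1) * c\<^sup>2 + (p - 1) * d\<^sup>2 + 2 * c\<^sup>2 * d\<^sup>2 * t" by linarith
  then show ?thesis unfolding exponent_cond_def using False by (subst pos_le_divide_eq) auto
qed (use assms in \<open>simp add: exponent_cond_def\<close>)

text \<open>With x = p - 1 + c^2 t the reciprocal term is c^2 / x, also for c = 0, so the convention
  causes no exception. Both conditions then clear to the same polynomial inequality.\<close>

lemma exponent_cond_recip_iff: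
  assumes "p > 1" "q > 1" "r > 1" "0 \<le> t"
  shows "exponent_cond p q r c d t \<longleftrightarrow> exponent_cond_recip p q r c d t"
proof -
  define x y where "x = p - 1 + c\<^sup>2 * t" and "y = q - 1 + d\<^sup>2 * t"
  have x: "0 < x" and y: "0 < y" using assms by (simp_all add: x_def y_def add_pos_nonneg)
  have "(p - 1) / c\<^sup>2 + t = x / c\<^sup>2" if "c \<noteq> 0" using that by (simp add: x_def field_simps)
  moreover have "(q - 1) / d\<^sup>2 + t = y / d\<^sup>2" if "d \<noteq> 0" using that by (simp add: y_def field_simps)
  ultimately have "recip_term p c t = c\<^sup>2 / x" "recip_term q d t = d\<^sup>2 / y"
    by (auto simp: recip_term_def)
  then have "recip_term p c t + recip_term q d t = (c\<^sup>2 * y + d\<^sup>2 * x) / (x * y)"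
    using x y by (simp add: field_simps)
  then have "exponent_cond_recip p q r c d t \<longleftrightarrow> (c\<^sup>2 * y + d\<^sup>2 * x) * (r - 1 + t) \<le> x * y"
    using x y assms by (simp add: exponent_cond_recip_def divide_le_eq le_divide_eq mult.commute)
  also have "\<dots> \<longleftrightarrow> (r - 1) * ((q - 1) * c\<^sup>2 + (p - 1) * d\<^sup>2 + 2 * c\<^sup>2 * d\<^sup>2 * t) \<le> (p - 1) * (q - 1) - c\<^sup>2 * d\<^sup>2 * t\<^sup>2"
    by (simp add: x_def y_def power2_eq_square algebra_simps)
  finally show ?thesis using exponent_cond_iff[OF assms] by simp
qed

text \<open>The condition is the discriminant inequality f^2 <= A B. This alone would also allow a
  negative form; that A and B are nonnegative follows from the cleared condition, which bounds (r -
  1) (q - 1) c^2 and (r - 1) (p - 1) d^2 by (p - 1) (q - 1).\<close>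

lemma exponent_cond_quadratic:
  assumes pqr: "p > 1" "q > 1" "r > 1" and t: "0 \<le> t"
  shows "exponent_cond p q r c d t \<longleftrightarrow>
    (\<forall>a b. (r - 1) * (c * a + d * b)\<^sup>2 + 2 * t * c * d * a * b \<le> (p - 1) * a\<^sup>2 + (q - 1) * b\<^sup>2)" (is "_ \<longleftrightarrow> ?Q")
proof -
  define A B f where "A = (p - 1) - (r - 1) * c\<^sup>2" and "B = (q - 1) - (r - 1) * d\<^sup>2" and "f = - (t + (r - 1)) * c * d"
  have form: "(r - 1) * (c * a + d * b)\<^sup>2 + 2 * t * c * d * a * b \<le> (p - 1) * a\<^sup>2 + (q - 1) * b\<^sup>2 \<longleftrightarrow>
      0 \<le> A * a\<^sup>2 + 2 * f * a * b + B * b\<^sup>2" for a b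
    by (simp add: A_def B_def f_def power2_eq_square algebra_simps)
  have E: "exponent_cond p q r c d t \<longleftrightarrow> f\<^sup>2 \<le> A * B"
    unfolding exponent_cond_iff[OF pqr t] by (simp add: A_def B_def f_def power2_eq_square algebra_simps)
  show ?thesis
  proof
    assume H: "exponent_cond p q r c d t"
    have nn: "0 \<le> (r - 1) * ((q - 1) * c\<^sup>2)" "0 \<le> (r - 1) * ((p - 1) * d\<^sup>2)"
      "0 \<le> (r - 1) * (2 * c\<^sup>2 * d\<^sup>2 * t)" "0 \<le> c\<^sup>2 * d\<^sup>2 * t\<^sup>2" using pqr t by auto
    have "(r - 1) * ((q - 1) * c\<^sup>2) + (r - 1) * ((p - 1) * d\<^sup>2) \<le> (p - 1) * (q - 1)"
      using H nn unfolding exponent_cond_iff[OF pqr t] distrib_left by linarith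
    then have "0 \<le> (q - 1) * A" "0 \<le> (p - 1) * B"
      using nn by (simp_all add: A_def B_def algebra_simps)
    then have "0 \<le> A" "0 \<le> B" using pqr by (auto simp: zero_le_mult_iff)
    then show ?Q unfolding form using quadratic_form_nonneg H E by blast
  next
    assume ?Q
    then show "exponent_cond p q r c d t"
      unfolding form E using quadratic_form_negative[of A B f] by (meson not_le)
  qed
qed

text \<open>On the left stands the variance of the weighted sum of the three fields at one
  eigenvector, one square per independent noise. The unit relations and \<open>cov\<close> simplify
  it, and after the elimination of the third variable the form of
  \<open>exponent_cond_quadratic\<close> is left.\<close>

lemma exponent_cond_variance:
  fixes a b w :: real
  assumes pqr: "p > 1" "q > 1" "r > 1" and t: "0 \<le> t" and cond: "exponent_cond p q r c d t"
    and units: "c\<^sup>2 + \<alpha>\<^sup>2 = 1" "d\<^sup>2 + \<gamma>\<^sup>2 = 1" "\<beta>\<^sup>2 + \<delta>\<^sup>2 = 1" and cov: "\<alpha> * \<gamma> * \<beta> = (t - 1) * c * d"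
  defines "\<sigma> \<equiv> 1 - 1 / r"
  shows "(1 / p * (c * a) + 1 / q * (d * b) + \<sigma> * w)\<^sup>2 + (1 / p * (\<alpha> * a) + 1 / q * (\<beta> * (\<gamma> * b)))\<^sup>2 + (1 / q * (\<delta> * (\<gamma> * b)))\<^sup>2
    \<le> 1 / p * a\<^sup>2 + 1 / q * b\<^sup>2 + \<sigma> * w\<^sup>2"
proof -
  define x y z where "x = a / p" and "y = b / q" and "z = \<sigma> * w"
  have "(1 / p * (c * a) + 1 / q * (d * b) + \<sigma> * w)\<^sup>2 + (1 / p * (\<alpha> * a) + 1 / q * (\<beta> * (\<gamma> * b)))\<^sup>2 + (1 / q * (\<delta> * (\<gamma> * b)))\<^sup>2
      = (c * x + d * y + z)\<^sup>2 + (\<alpha> * x + \<beta> * \<gamma> * y)\<^sup>2 + (\<delta> * \<gamma> * y)\<^sup>2"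
    by (simp add: x_def y_def z_def algebra_simps)
  also have "\<dots> = (c\<^sup>2 + \<alpha>\<^sup>2) * x\<^sup>2 + (d\<^sup>2 + \<gamma>\<^sup>2 * (\<beta>\<^sup>2 + \<delta>\<^sup>2)) * y\<^sup>2 + z\<^sup>2 + 2 * (c * x + d * y) * z + 2 * (c * d + \<alpha> * \<gamma> * \<beta>) * x * y"
    by (simp add: power2_eq_square algebra_simps)
  also have "\<dots> = x\<^sup>2 + y\<^sup>2 + z\<^sup>2 + 2 * (c * x + d * y) * z + 2 * t * c * d * x * y"
    unfolding units cov mult_1_right by (simp add: algebra_simps units)
  \<comment> \<open>Equality holds at z = (r - 1) (c x + d y), so eliminating the third variable in
    this way loses nothing.\<close>
  also have "2 * (c * x + d * y) * z \<le> (r - 1) * (c * x + d * y)\<^sup>2 + z\<^sup>2 / (r - 1)"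
  proof -
    have "0 \<le> ((r - 1) * (c * x + d * y) - z)\<^sup>2 / (r - 1)" using pqr by simp
    also have "\<dots> = (r - 1) * (c * x + d * y)\<^sup>2 - 2 * (c * x + d * y) * z + z\<^sup>2 / (r - 1)"
    proof -
      have "(R * S - z)\<^sup>2 / R = R * S\<^sup>2 - 2 * S * z + z\<^sup>2 / R" if "R \<noteq> 0" for R S :: real
        using that by (simp add: field_simps power2_eq_square)
      from this[of "r - 1" "c * x + d * y"] show ?thesis using pqr by simp
    qed
    finally show ?thesis by simp
  qed
  also have "x\<^sup>2 + y\<^sup>2 + z\<^sup>2 + ((r - 1) * (c * x + d * y)\<^sup>2 + z\<^sup>2 / (r - 1)) + 2 * t * c * d * x * y
      \<le> x\<^sup>2 + y\<^sup>2 + z\<^sup>2 + z\<^sup>2 / (r - 1) + ((p - 1) * x\<^sup>2 + (q - 1) * y\<^sup>2)"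
    using cond unfolding exponent_cond_quadratic[OF pqr t] by (smt (verit))
  also have "\<dots> = p * x\<^sup>2 + q * y\<^sup>2 + (z\<^sup>2 + z\<^sup>2 / (r - 1))" by (simp add: algebra_simps)
  also have "z\<^sup>2 + z\<^sup>2 / (r - 1) = \<sigma> * w\<^sup>2"
    using pqr by (simp add: z_def \<sigma>_def field_simps power2_eq_square)
  also have "p * x\<^sup>2 + q * y\<^sup>2 = 1 / p * a\<^sup>2 + 1 / q * b\<^sup>2"
    using pqr by (simp add: x_def y_def power2_eq_square)
  finally show ?thesis by simp
qed

section \<open>Hoelder's inequality for the kernel\<close>

lemma (in white_noise) integral_trigs_regularized:
  assumes f: "f \<in> trigs" and p: "0 < p"
  shows "(\<lambda>n. \<integral>x. ((cmod (f x))\<^sup>2 + 1 / real (Suc n)) powr (p / 2) \<partial>\<mu>) \<longlonglongrightarrow> (\<integral>x. cmod (f x) powr p \<partial>\<mu>)"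
proof -
  note [measurable] = trigs_measurable[OF f]
  obtain K where K: "\<And>x. x \<in> duals \<Longrightarrow> cmod (f x) \<le> K" using trigs_bounded[OF f] by blast
  have sq: "cmod (f x) powr p = ((cmod (f x))\<^sup>2) powr (p / 2)" for x
    using powr_powr[of "cmod (f x)" 2 "p / 2"] by simp
  show ?thesis
    unfolding sq
  proof (rule integral_dominated_convergence[where w="\<lambda>x. (K\<^sup>2 + 1) powr (p / 2)"])
    show "AE x in \<mu>. (\<lambda>n. ((cmod (f x))\<^sup>2 + 1 / real (Suc n)) powr (p / 2)) \<longlonglongrightarrow> ((cmod (f x))\<^sup>2) powr (p / 2)"
    proof (rule AE_I2)
      fix x
      have "(\<lambda>n. (cmod (f x))\<^sup>2 + 1 / real (Suc n)) \<longlonglongrightarrow> (cmod (f x))\<^sup>2 + 0"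
        by (intro tendsto_add tendsto_const) (rule LIMSEQ_Suc[OF lim_1_over_n])
      then show "(\<lambda>n. ((cmod (f x))\<^sup>2 + 1 / real (Suc n)) powr (p / 2)) \<longlonglongrightarrow> ((cmod (f x))\<^sup>2) powr (p / 2)"
        using p by (intro tendsto_powr2) auto
    qed
    show "AE x in \<mu>. norm (((cmod (f x))\<^sup>2 + 1 / real (Suc n)) powr (p / 2)) \<le> (K\<^sup>2 + 1) powr (p / 2)" for n
    proof (rule AE_I2)
      fix x assume "x \<in> space \<mu>"
      then have "(cmod (f x))\<^sup>2 \<le> K\<^sup>2" using K by (intro power_mono) (auto simp: space_mu)
      moreover have "1 / real (Suc n) \<le> 1" by simp
      ultimately have "(cmod (f x))\<^sup>2 + 1 / real (Suc n) \<le> K\<^sup>2 + 1" by linarith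
      then show "norm (((cmod (f x))\<^sup>2 + 1 / real (Suc n)) powr (p / 2)) \<le> (K\<^sup>2 + 1) powr (p / 2)"
        using p by (simp add: powr_mono2)
    qed
  qed measurable
qed

context wick_kernel
begin

lemma fst_rv: "\<omega> \<in> space Om \<Longrightarrow> rv (\<lambda>n. 1) (\<lambda>n. 0) (\<lambda>n. 1) (\<lambda>n. 0) \<omega> = fst \<omega>"
proof (rule dual_eqI)
  assume \<omega>: "\<omega> \<in> space Om"
  then show "rv (\<lambda>n. 1) (\<lambda>n. 0) (\<lambda>n. 1) (\<lambda>n. 0) \<omega> \<in> duals" by (intro rv_dual) auto
  have d: "fst \<omega> \<in> duals" "fst (snd \<omega>) \<in> duals" "snd (snd \<omega>) \<in> duals"
    using \<omega> by (auto simp: space_pair_measure space_mu)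
  then show "fst \<omega> \<in> duals" by simp
  show "rv (\<lambda>n. 1) (\<lambda>n. 0) (\<lambda>n. 1) (\<lambda>n. 0) \<omega> \<xi> = fst \<omega> \<xi>" if "\<xi> \<in> tests" for \<xi>
    using d that by (simp add: rv_apply)
qed

end

locale wick_kernel_bounded = wick_kernel e lam \<mu> t c d
  for e :: "nat \<Rightarrow> 'a::{real_inner, banach}" and lam \<mu> t c d +
  fixes p q r :: real
  assumes p: "1 < p" and q: "1 < q" and r: "1 < r" and cond: "exponent_cond p q r (c n) (d n) (t n)"
begin

text \<open>The exponent conjugate to \<open>r\<close>.\<close>

definition s where "s = r / (r - 1)"

lemma s: "1 < s" "1 / s = 1 - 1 / r"
  using r by (auto simp: s_def field_simps)

text \<open>\<open>A\<close>, \<open>B\<close> and \<open>C\<close> collect the vectors paired with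
  the independent x, y and z, so the variance is the sum of their squared norms. In the basis this
  sum is compared eigenvector by eigenvector.\<close>

lemma variance_bound:
  assumes \<eta>: "\<eta>1 \<in> tests" "\<eta>2 \<in> tests" "\<eta>3 \<in> tests"
  shows "(\<integral>\<omega>. (1 / p * U \<omega> \<eta>1 + 1 / q * V \<omega> \<eta>2 + (1 - 1 / r) * fst \<omega> \<eta>3)\<^sup>2 \<partial>Om) \<le>
    1 / p * (norm \<eta>1)\<^sup>2 + 1 / q * (norm \<eta>2)\<^sup>2 + (1 - 1 / r) * (norm \<eta>3)\<^sup>2"
proof -
  define A where "A = (1 / p) *\<^sub>R dg c \<eta>1 + (1 / q) *\<^sub>R dg d \<eta>2 + (1 - 1 / r) *\<^sub>R \<eta>3"
  define B where "B = (1 / p) *\<^sub>R dg \<alpha> \<eta>1 + (1 / q) *\<^sub>R dg \<beta> (dg \<gamma> \<eta>2)"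
  define C where "C = (1 / q) *\<^sub>R dg \<delta> (dg \<gamma> \<eta>2)"
  have m1: "dg c \<eta>1 \<in> tests" "dg d \<eta>2 \<in> tests" "dg \<alpha> \<eta>1 \<in> tests" "dg \<beta> (dg \<gamma> \<eta>2) \<in> tests" "dg \<delta> (dg \<gamma> \<eta>2) \<in> tests"
    using \<eta> by auto
  have mem: "A \<in> tests" "B \<in> tests" "C \<in> tests"
    unfolding A_def B_def C_def by (intro tests_add tests_scaleR m1 \<eta>)+
  have "(\<integral>\<omega>. (1 / p * U \<omega> \<eta>1 + 1 / q * V \<omega> \<eta>2 + (1 - 1 / r) * fst \<omega> \<eta>3)\<^sup>2 \<partial>Om) =
      (\<integral>\<omega>. (fst \<omega> A + fst (snd \<omega>) B + snd (snd \<omega>) C)\<^sup>2 \<partial>Om)"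
  proof (intro Bochner_Integration.integral_cong refl)
    fix \<omega> assume \<omega>: "\<omega> \<in> space Om"
    have d: "fst \<omega> \<in> duals" "fst (snd \<omega>) \<in> duals" "snd (snd \<omega>) \<in> duals"
      using \<omega> by (auto simp: space_pair_measure space_mu)
    have U: "U \<omega> \<eta>1 = fst \<omega> (dg c \<eta>1) + fst (snd \<omega>) (dg \<alpha> \<eta>1)"
      unfolding U_def using d \<eta> by (simp add: rv_apply)
    have V: "V \<omega> \<eta>2 = fst \<omega> (dg d \<eta>2) + fst (snd \<omega>) (dg \<beta> (dg \<gamma> \<eta>2)) + snd (snd \<omega>) (dg \<delta> (dg \<gamma> \<eta>2))"
      unfolding V_def using \<eta> by (simp add: rv_apply)
    have "fst \<omega> A = 1 / p * fst \<omega> (dg c \<eta>1) + 1 / q * fst \<omega> (dg d \<eta>2) + (1 - 1 / r) * fst \<omega> \<eta>3"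
      unfolding A_def
      by (simp only: dual_add[OF d(1) tests_add[OF tests_scaleR[OF m1(1)] tests_scaleR[OF m1(2)]] tests_scaleR[OF \<eta>(3)]]
          dual_add[OF d(1) tests_scaleR[OF m1(1)] tests_scaleR[OF m1(2)]] dual_scaleR[OF d(1) m1(1)] dual_scaleR[OF d(1) m1(2)]
          dual_scaleR[OF d(1) \<eta>(3)])
    moreover have "fst (snd \<omega>) B = 1 / p * fst (snd \<omega>) (dg \<alpha> \<eta>1) + 1 / q * fst (snd \<omega>) (dg \<beta> (dg \<gamma> \<eta>2))"
      unfolding B_def
      by (simp only: dual_add[OF d(2) tests_scaleR[OF m1(3)] tests_scaleR[OF m1(4)]] dual_scaleR[OF d(2) m1(3)] dual_scaleR[OF d(2) m1(4)])
    moreover have "snd (snd \<omega>) C = 1 / q * snd (snd \<omega>) (dg \<delta> (dg \<gamma> \<eta>2))"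
      unfolding C_def by (simp only: dual_scaleR[OF d(3) m1(5)])
    ultimately show "(1 / p * U \<omega> \<eta>1 + 1 / q * V \<omega> \<eta>2 + (1 - 1 / r) * fst \<omega> \<eta>3)\<^sup>2 = (fst \<omega> A + fst (snd \<omega>) B + snd (snd \<omega>) C)\<^sup>2"
      unfolding U V by (simp only: distrib_left ac_simps)
  qed
  also have "\<dots> = (norm A)\<^sup>2 + (norm B)\<^sup>2 + (norm C)\<^sup>2" by (rule gaussian_sum_moments(2)[OF mem])
  also have "\<dots> \<le> 1 / p * (norm \<eta>1)\<^sup>2 + 1 / q * (norm \<eta>2)\<^sup>2 + (1 - 1 / r) * (norm \<eta>3)\<^sup>2"
  proof (rule sums_le)
    show "(\<lambda>n. (e n \<bullet> A)\<^sup>2 + (e n \<bullet> B)\<^sup>2 + (e n \<bullet> C)\<^sup>2) sums ((norm A)\<^sup>2 + (norm B)\<^sup>2 + (norm C)\<^sup>2)"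
      by (intro sums_add norm_sums)
    show "(\<lambda>n. 1 / p * (e n \<bullet> \<eta>1)\<^sup>2 + 1 / q * (e n \<bullet> \<eta>2)\<^sup>2 + (1 - 1 / r) * (e n \<bullet> \<eta>3)\<^sup>2) sums
        (1 / p * (norm \<eta>1)\<^sup>2 + 1 / q * (norm \<eta>2)\<^sup>2 + (1 - 1 / r) * (norm \<eta>3)\<^sup>2)"
      by (intro sums_add sums_mult norm_sums)
    fix n
    have A: "e n \<bullet> A = 1 / p * (c n * (e n \<bullet> \<eta>1)) + 1 / q * (d n * (e n \<bullet> \<eta>2)) + (1 - 1 / r) * (e n \<bullet> \<eta>3)"
      unfolding A_def by (simp only: inner_add_right inner_scaleR_right coeff_dg bounded_coeffs)
    have B: "e n \<bullet> B = 1 / p * (\<alpha> n * (e n \<bullet> \<eta>1)) + 1 / q * (\<beta> n * (\<gamma> n * (e n \<bullet> \<eta>2)))"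
      unfolding B_def by (simp only: inner_add_right inner_scaleR_right coeff_dg bounded_coeffs)
    have C: "e n \<bullet> C = 1 / q * (\<delta> n * (\<gamma> n * (e n \<bullet> \<eta>2)))"
      unfolding C_def by (simp only: inner_add_right inner_scaleR_right coeff_dg bounded_coeffs)
    show "(e n \<bullet> A)\<^sup>2 + (e n \<bullet> B)\<^sup>2 + (e n \<bullet> C)\<^sup>2 \<le> 1 / p * (e n \<bullet> \<eta>1)\<^sup>2 + 1 / q * (e n \<bullet> \<eta>2)\<^sup>2 + (1 - 1 / r) * (e n \<bullet> \<eta>3)\<^sup>2"
      unfolding A B C
      by (rule exponent_cond_variance[OF p q r t_range(1) cond])
        (use \<alpha>_unit \<gamma>_unit \<beta>_unit \<beta>_cov in \<open>auto simp: unit_coeffs_def\<close>)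
  qed
  finally show ?thesis .
qed

lemma hoelder_smooth:
  assumes F: "smooth F1" "smooth F2" "smooth F3" and k: "0 < k" "\<And>x. x \<in> duals \<Longrightarrow> k \<le> F1 x \<and> k \<le> F2 x \<and> k \<le> F3 x"
  shows "(\<integral>\<omega>. F1 (U \<omega>) powr (1 / p) * F2 (V \<omega>) powr (1 / q) * F3 (fst \<omega>) powr (1 / s) \<partial>Om) \<le>
    (\<integral>x. F1 x \<partial>\<mu>) powr (1 / p) * (\<integral>x. F2 x \<partial>\<mu>) powr (1 / q) * (\<integral>x. F3 x \<partial>\<mu>) powr (1 / s)"
proof -
  let ?I = "{0, 1, 2::nat}"
  let ?cf = "\<lambda>i::nat. if i = 0 then c else if i = 1 then d else (\<lambda>n. 1)"
  let ?af = "\<lambda>i::nat. if i = 0 then \<alpha> else if i = 1 then \<gamma> else (\<lambda>n. 0)"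
  let ?pf = "\<lambda>i::nat. if i = 1 then \<beta> else (\<lambda>n. 1)"
  let ?qf = "\<lambda>i::nat. if i = 1 then \<delta> else (\<lambda>n. 0)"
  let ?\<theta> = "\<lambda>i::nat. if i = 0 then 1 / p else if i = 1 then 1 / q else 1 - 1 / r"
  let ?G = "\<lambda>i. rv (?cf i) (?af i) (?pf i) (?qf i)"
  let ?F = "\<lambda>i::nat. if i = 0 then F1 else if i = 1 then F2 else F3"
  have "(\<integral>\<omega>. (\<Prod>i\<in>?I. ?F i (?G i \<omega>) powr ?\<theta> i) \<partial>Om) \<le> (\<Prod>i\<in>?I. (\<integral>x. ?F i x \<partial>\<mu>) powr ?\<theta> i)"
  proof (rule gaussian_hoelder[of ?I ?\<theta> ?cf ?af ?pf ?qf ?G])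
    show "0 \<le> ?\<theta> i" for i using p q r by simp
    show "unit_coeffs (?cf i) (?af i)" for i using \<alpha>_unit \<gamma>_unit one_unit by simp
    show "unit_coeffs (?pf i) (?qf i)" for i using \<beta>_unit one_unit by simp
    show "smooth (?F i)" for i using F by simp
    show "0 < k" by fact
    show "k \<le> ?F i x" if "x \<in> duals" for i x using k that by simp
    fix \<eta> :: "nat \<Rightarrow> 'a" assume \<eta>: "\<And>i. i \<in> ?I \<Longrightarrow> \<eta> i \<in> tests"
    have "(\<integral>\<omega>. (\<Sum>i\<in>?I. ?\<theta> i * ?G i \<omega> (\<eta> i))\<^sup>2 \<partial>Om) =
        (\<integral>\<omega>. (1 / p * U \<omega> (\<eta> 0) + 1 / q * V \<omega> (\<eta> 1) + (1 - 1 / r) * fst \<omega> (\<eta> 2))\<^sup>2 \<partial>Om)"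
      by (intro Bochner_Integration.integral_cong refl) (simp add: U_def V_def fst_rv add.assoc)
    also have "\<dots> \<le> 1 / p * (norm (\<eta> 0))\<^sup>2 + 1 / q * (norm (\<eta> 1))\<^sup>2 + (1 - 1 / r) * (norm (\<eta> 2))\<^sup>2"
      by (rule variance_bound) (simp_all add: \<eta>)
    also have "\<dots> = (\<Sum>i\<in>?I. ?\<theta> i * (norm (\<eta> i))\<^sup>2)" by simp
    finally show "(\<integral>\<omega>. (\<Sum>i\<in>?I. ?\<theta> i * ?G i \<omega> (\<eta> i))\<^sup>2 \<partial>Om) \<le> (\<Sum>i\<in>?I. ?\<theta> i * (norm (\<eta> i))\<^sup>2)" .
  qed auto
  moreover have "(\<integral>\<omega>. (\<Prod>i\<in>?I. ?F i (?G i \<omega>) powr ?\<theta> i) \<partial>Om) =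
      (\<integral>\<omega>. F1 (U \<omega>) powr (1 / p) * F2 (V \<omega>) powr (1 / q) * F3 (fst \<omega>) powr (1 / s) \<partial>Om)"
    by (intro Bochner_Integration.integral_cong refl) (simp add: U_def V_def fst_rv s)
  ultimately show ?thesis by (simp add: s mult.assoc)
qed

text \<open>Applied to (|f|^2 + \<epsilon>)^(p/2) and its analogues, \<open>hoelder_smooth\<close>
  involves the roots sqrt (|f|^2 + \<epsilon>), which majorise |f|. On the right-hand side
  \<epsilon> = 1 / (n + 1) tends to 0 by \<open>integral_trigs_regularized\<close>.\<close>

lemma hoelder_trigs:
  assumes f: "f \<in> trigs" and g: "g \<in> trigs" and h: "h \<in> trigs"
  shows "(\<integral>\<omega>. cmod (f (U \<omega>)) * cmod (g (V \<omega>)) * cmod (h (fst \<omega>)) \<partial>Om) \<le> Lp_norm \<mu> p f * Lp_norm \<mu> q g * Lp_norm \<mu> s h"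
proof (rule tendsto_lowerbound)
  let ?F = "\<lambda>f p n x. ((cmod (f x))\<^sup>2 + 1 / real (Suc n)) powr (p / 2)"
  let ?R = "\<lambda>n. (\<integral>x. ?F f p n x \<partial>\<mu>) powr (1 / p) * (\<integral>x. ?F g q n x \<partial>\<mu>) powr (1 / q) * (\<integral>x. ?F h s n x \<partial>\<mu>) powr (1 / s)"
  show "?R \<longlonglongrightarrow> Lp_norm \<mu> p f * Lp_norm \<mu> q g * Lp_norm \<mu> s h"
    unfolding Lp_norm_def using p q s(1)
    by (intro tendsto_mult tendsto_powr2 integral_trigs_regularized f g h tendsto_const always_eventually allI integral_nonneg_AE AE_I2) auto
  show "\<forall>\<^sub>F n in sequentially. (\<integral>\<omega>. cmod (f (U \<omega>)) * cmod (g (V \<omega>)) * cmod (h (fst \<omega>)) \<partial>Om) \<le> ?R n"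
  proof (rule always_eventually, rule allI)
    fix n
    define \<epsilon> where "\<epsilon> = 1 / real (Suc n)"
    have \<epsilon>: "0 < \<epsilon>" by (simp add: \<epsilon>_def)
    define k where "k = min (\<epsilon> powr (p / 2)) (min (\<epsilon> powr (q / 2)) (\<epsilon> powr (s / 2)))"
    have mn: "\<epsilon> powr (m / 2) \<le> ?F u m n x" if "0 < m" for u m and x :: "'a \<Rightarrow> real"
      unfolding \<epsilon>_def[symmetric] using that \<epsilon> by (intro powr_mono2) auto
    have root: "?F u m n x powr (1 / m) = sqrt ((cmod (u x))\<^sup>2 + \<epsilon>)" if "0 < m" for u m and x :: "'a \<Rightarrow> real"
      unfolding \<epsilon>_def[symmetric] using that \<epsilon> by (simp add: powr_powr powr_half_sqrt)
    have le: "cmod (u x) \<le> sqrt ((cmod (u x))\<^sup>2 + \<epsilon>)" for u :: "('a \<Rightarrow> real) \<Rightarrow> complex" and x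
      using \<epsilon> by (intro real_le_rsqrt) simp
    note [measurable] = trigs_measurable[OF f] trigs_measurable[OF g] trigs_measurable[OF h]
    have "(\<integral>\<omega>. cmod (f (U \<omega>)) * cmod (g (V \<omega>)) * cmod (h (fst \<omega>)) \<partial>Om) \<le>
        (\<integral>\<omega>. ?F f p n (U \<omega>) powr (1 / p) * ?F g q n (V \<omega>) powr (1 / q) * ?F h s n (fst \<omega>) powr (1 / s) \<partial>Om)"
    proof -
      have pos: "0 < p" "0 < q" "0 < s" using p q s by auto
      obtain K1 where K1: "\<And>x. x \<in> duals \<Longrightarrow> cmod (f x) \<le> K1" using trigs_bounded[OF f] by blast
      obtain K2 where K2: "\<And>x. x \<in> duals \<Longrightarrow> cmod (g x) \<le> K2" using trigs_bounded[OF g] by blast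
      obtain K3 where K3: "\<And>x. x \<in> duals \<Longrightarrow> cmod (h x) \<le> K3" using trigs_bounded[OF h] by blast
      have dual: "U \<omega> \<in> duals" "V \<omega> \<in> duals" "fst \<omega> \<in> duals" if "\<omega> \<in> space Om" for \<omega>
        using measurable_space[OF U_measurable that] measurable_space[OF V_measurable that] that
        by (auto simp: space_mu space_pair_measure)
      have bd: "sqrt ((cmod (u x))\<^sup>2 + \<epsilon>) \<le> sqrt (K\<^sup>2 + \<epsilon>)" if "cmod (u x) \<le> K" for u K and x :: "'a \<Rightarrow> real"
        using that by (intro real_sqrt_le_mono add_right_mono power_mono) auto
      show ?thesis
        unfolding root[OF pos(1)] root[OF pos(2)] root[OF pos(3)]
      proof (rule integral_mono_AE')
        show "integrable Om (\<lambda>\<omega>. sqrt ((cmod (f (U \<omega>)))\<^sup>2 + \<epsilon>) * sqrt ((cmod (g (V \<omega>)))\<^sup>2 + \<epsilon>) * sqrt ((cmod (h (fst \<omega>)))\<^sup>2 + \<epsilon>))"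
        proof (rule P3.integrable_const_bound)
          show "AE \<omega> in Om. norm (sqrt ((cmod (f (U \<omega>)))\<^sup>2 + \<epsilon>) * sqrt ((cmod (g (V \<omega>)))\<^sup>2 + \<epsilon>) * sqrt ((cmod (h (fst \<omega>)))\<^sup>2 + \<epsilon>))
              \<le> sqrt (K1\<^sup>2 + \<epsilon>) * sqrt (K2\<^sup>2 + \<epsilon>) * sqrt (K3\<^sup>2 + \<epsilon>)"
          proof (rule AE_I2)
            fix \<omega> assume \<omega>: "\<omega> \<in> space Om"
            have nn: "0 \<le> sqrt (y\<^sup>2 + \<epsilon>)" for y using \<epsilon> by simp
            have "sqrt ((cmod (f (U \<omega>)))\<^sup>2 + \<epsilon>) * sqrt ((cmod (g (V \<omega>)))\<^sup>2 + \<epsilon>) * sqrt ((cmod (h (fst \<omega>)))\<^sup>2 + \<epsilon>)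
              \<le> sqrt (K1\<^sup>2 + \<epsilon>) * sqrt (K2\<^sup>2 + \<epsilon>) * sqrt (K3\<^sup>2 + \<epsilon>)"
              by (intro mult_mono bd K1 K2 K3 dual \<omega> nn mult_nonneg_nonneg)
            then show "norm (sqrt ((cmod (f (U \<omega>)))\<^sup>2 + \<epsilon>) * sqrt ((cmod (g (V \<omega>)))\<^sup>2 + \<epsilon>) * sqrt ((cmod (h (fst \<omega>)))\<^sup>2 + \<epsilon>))
              \<le> sqrt (K1\<^sup>2 + \<epsilon>) * sqrt (K2\<^sup>2 + \<epsilon>) * sqrt (K3\<^sup>2 + \<epsilon>)"
              unfolding real_norm_def using nn by (subst abs_of_nonneg) (auto intro!: mult_nonneg_nonneg)
          qed
        qed measurable
        show "AE \<omega> in Om. cmod (f (U \<omega>)) * cmod (g (V \<omega>)) * cmod (h (fst \<omega>)) \<le>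
            sqrt ((cmod (f (U \<omega>)))\<^sup>2 + \<epsilon>) * sqrt ((cmod (g (V \<omega>)))\<^sup>2 + \<epsilon>) * sqrt ((cmod (h (fst \<omega>)))\<^sup>2 + \<epsilon>)"
          using \<epsilon> by (intro AE_I2 mult_mono le mult_nonneg_nonneg) auto
        show "AE \<omega> in Om. 0 \<le> sqrt ((cmod (f (U \<omega>)))\<^sup>2 + \<epsilon>) * sqrt ((cmod (g (V \<omega>)))\<^sup>2 + \<epsilon>) * sqrt ((cmod (h (fst \<omega>)))\<^sup>2 + \<epsilon>)"
          using \<epsilon> by (intro AE_I2 mult_nonneg_nonneg) auto
      qed
    qed
    also have "\<dots> \<le> ?R n"
    proof (rule hoelder_smooth[where k=k])
      show "smooth (?F f p n)" "smooth (?F g q n)" "smooth (?F h s n)"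
        using f g h by (auto intro!: smooth_trigs_power)
      show "0 < k" using \<epsilon> by (simp add: k_def)
      show "k \<le> ?F f p n x \<and> k \<le> ?F g q n x \<and> k \<le> ?F h s n x" for x
        using mn[of p f x] mn[of q g x] mn[of s h x] p q s by (simp add: k_def min_le_iff_disj)
    qed
    finally show "(\<integral>\<omega>. cmod (f (U \<omega>)) * cmod (g (V \<omega>)) * cmod (h (fst \<omega>)) \<partial>Om) \<le> ?R n" .
  qed
qed simp

end

section \<open>From trigonometric polynomials to L^p\<close>

lemma Lp_AE_subseq:
  assumes f: "\<And>n. Lp M p (f n)" "Lp M p g" and p: "1 \<le> p" and lim: "(\<lambda>n. Lp_norm M p (\<lambda>x. g x - f n x)) \<longlonglongrightarrow> 0"
  obtains k :: "nat \<Rightarrow> nat" where "strict_mono k" "AE x in M. (\<lambda>n. f (k n) x) \<longlonglongrightarrow> g x"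
proof -
  let ?u = "\<lambda>n x. cmod (g x - f n x) powr p"
  have i: "integrable M (?u n)" for n using Lp_integrable[OF Lp_diff[OF f(2) f(1) p]] .
  have "(\<integral>x. norm (?u n x) \<partial>M) = Lp_norm M p (\<lambda>x. g x - f n x) powr p" for n
    using p by (simp add: Lp_norm_powr)
  moreover have "(\<lambda>n. Lp_norm M p (\<lambda>x. g x - f n x) powr p) \<longlonglongrightarrow> 0 powr p"
    using p by (intro tendsto_powr2 lim tendsto_const) auto
  ultimately have "(\<lambda>n. \<integral>x. norm (?u n x) \<partial>M) \<longlonglongrightarrow> 0" using p by simp
  from tendsto_L1_AE_subseq[of M ?u, OF i this]
  obtain k :: "nat \<Rightarrow> nat" where k: "strict_mono k" "AE x in M. (\<lambda>n. ?u (k n) x) \<longlonglongrightarrow> 0" by blast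
  have "AE x in M. (\<lambda>n. f (k n) x) \<longlonglongrightarrow> g x"
    using k(2)
  proof eventually_elim
    case (elim x)
    have "(\<lambda>n. ?u (k n) x powr (1 / p)) \<longlonglongrightarrow> 0 powr (1 / p)"
      using p by (intro tendsto_powr2 elim tendsto_const) auto
    then have "(\<lambda>n. cmod (g x - f (k n) x)) \<longlonglongrightarrow> 0" using p by (simp add: powr_powr)
    then have "(\<lambda>n. g x - f (k n) x) \<longlonglongrightarrow> 0" by (rule tendsto_norm_zero_cancel)
    then have "(\<lambda>n. g x - (g x - f (k n) x)) \<longlonglongrightarrow> g x - 0" by (intro tendsto_diff tendsto_const)
    then show ?case by simp
  qed
  with k(1) show ?thesis by (rule that)
qed

context white_noise
begin

lemma trigs_Lp:
  assumes f: "f \<in> trigs" and p: "0 < p"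
  shows "Lp \<mu> p f"
proof -
  obtain K where "\<forall>x\<in>duals. cmod (f x) \<le> K" using trigs_bounded[OF f] ..
  then have "expbdd f" by (intro expbdd_bounded[OF trigs_measurable[OF f], of K]) simp
  then show ?thesis using p by (rule expbdd_Lp)
qed

text \<open>Convergence almost everywhere accompanies that of the norms because
  \<open>hoelder_nn\<close> applies Fatou's lemma on the triple product, where such convergence can
  be pulled back along the fields.\<close>

lemma trigs_AE_approximation:
  assumes f: "Lp \<mu> p f" and p: "1 \<le> p"
  obtains g where "\<And>n. g n \<in> trigs" "AE x in \<mu>. (\<lambda>n. g n x) \<longlonglongrightarrow> f x"
    "(\<lambda>n. Lp_norm \<mu> p (g n)) \<longlonglongrightarrow> Lp_norm \<mu> p f"
proof -
  have "\<forall>n. \<exists>g. g \<in> trigs \<and> Lp_norm \<mu> p (\<lambda>x. f x - g x) < 1 / real (Suc n)"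
  proof
    fix n
    have "0 < 1 / real (Suc n)" by simp
    from trigs_dense[OF f p this] show "\<exists>g. g \<in> trigs \<and> Lp_norm \<mu> p (\<lambda>x. f x - g x) < 1 / real (Suc n)" by blast
  qed
  from choice[OF this] obtain g where g: "\<And>n. g n \<in> trigs" "\<And>n. Lp_norm \<mu> p (\<lambda>x. f x - g n x) < 1 / real (Suc n)" by blast
  have L: "Lp \<mu> p (g n)" for n using g(1) p by (intro trigs_Lp) auto
  have lim: "(\<lambda>n. Lp_norm \<mu> p (\<lambda>x. f x - g n x)) \<longlonglongrightarrow> 0"
  proof (rule tendsto_sandwich[where f="\<lambda>n. 0" and h="\<lambda>n. 1 / real (Suc n)"])
    show "\<forall>\<^sub>F n in sequentially. Lp_norm \<mu> p (\<lambda>x. f x - g n x) \<le> 1 / real (Suc n)"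
      using g(2) by (intro always_eventually allI less_imp_le)
    show "(\<lambda>n. 1 / real (Suc n)) \<longlonglongrightarrow> 0" by (rule LIMSEQ_Suc[OF lim_1_over_n])
  qed auto
  obtain k :: "nat \<Rightarrow> nat" where k: "strict_mono k" "AE x in \<mu>. (\<lambda>n. g (k n) x) \<longlonglongrightarrow> f x"
    using Lp_AE_subseq[of \<mu> p g f, OF L f p lim] .
  have norms: "(\<lambda>n. Lp_norm \<mu> p (g n)) \<longlonglongrightarrow> Lp_norm \<mu> p f"
  proof (rule LIM_zero_cancel, rule tendsto_rabs_zero_cancel, rule tendsto_sandwich[OF _ _ tendsto_const lim])
    show "\<forall>\<^sub>F n in sequentially. \<bar>Lp_norm \<mu> p (g n) - Lp_norm \<mu> p f\<bar> \<le> Lp_norm \<mu> p (\<lambda>x. f x - g n x)"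
      using Lp_norm_abs_diff[OF L f p] by (simp add: Lp_norm_minus_commute[of \<mu> p f])
  qed simp
  show ?thesis
  proof (rule that[of "\<lambda>n. g (k n)"])
    show "(\<lambda>n. Lp_norm \<mu> p (g (k n))) \<longlonglongrightarrow> Lp_norm \<mu> p f"
      using LIMSEQ_subseq_LIMSEQ[OF norms k(1)] by (simp add: comp_def)
  qed (use g k in auto)
qed

end

context wick_kernel
begin

lemma distr_U: "distr Om \<mu> U = \<mu>" and distr_V: "distr Om \<mu> V = \<mu>" and distr_fst: "distr Om \<mu> fst = \<mu>"
proof -
  show "distr Om \<mu> U = \<mu>" unfolding U_def by (rule distr_rv[OF \<alpha>_unit one_unit])
  show "distr Om \<mu> V = \<mu>" unfolding V_def by (rule distr_rv[OF \<gamma>_unit \<beta>_unit])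
  have "distr Om \<mu> fst = distr Om \<mu> (rv (\<lambda>n. 1) (\<lambda>n. 0) (\<lambda>n. 1) (\<lambda>n. 0))"
    by (rule distr_cong) (simp_all add: fst_rv)
  then show "distr Om \<mu> fst = \<mu>" using distr_rv[OF one_unit one_unit] by simp
qed

lemma AE_U: "AE x in \<mu>. P x \<Longrightarrow> AE \<omega> in Om. P (U \<omega>)"
  using AE_distrD[OF U_measurable, of P] by (simp only: distr_U)

lemma AE_V: "AE x in \<mu>. P x \<Longrightarrow> AE \<omega> in Om. P (V \<omega>)"
  using AE_distrD[OF V_measurable, of P] by (simp only: distr_V)

lemma AE_fst: "AE x in \<mu>. P x \<Longrightarrow> AE \<omega> in Om. P (fst \<omega>)"
  using AE_distrD[OF measurable_fst, of P \<mu> "\<mu> \<Otimes>\<^sub>M \<mu>"] by (simp only: distr_fst)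

end

context wick_kernel_bounded
begin

text \<open>Fatou's lemma along trigonometric approximations; null sets of \<mu> pull back to null
  sets because \<open>U\<close>, \<open>V\<close> and the projection have the law \<mu>. The
  integral is the nonnegative one, as integrability of the product is itself deduced from this
  bound.\<close>

lemma hoelder_nn:
  assumes f: "Lp \<mu> p f" and g: "Lp \<mu> q g" and h: "Lp \<mu> s h"
  shows "(\<integral>\<^sup>+\<omega>. ennreal (cmod (f (U \<omega>)) * cmod (g (V \<omega>)) * cmod (h (fst \<omega>))) \<partial>Om) \<le> ennreal (Lp_norm \<mu> p f * Lp_norm \<mu> q g * Lp_norm \<mu> s h)"
proof -
  have ps: "1 \<le> p" "1 \<le> q" "1 \<le> s" using p q s by auto
  obtain f' where f': "\<And>n. f' n \<in> trigs" "AE x in \<mu>. (\<lambda>n. f' n x) \<longlonglongrightarrow> f x" "(\<lambda>n. Lp_norm \<mu> p (f' n)) \<longlonglongrightarrow> Lp_norm \<mu> p f"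
    by (rule trigs_AE_approximation[OF f ps(1)], rule that)
  obtain g' where g': "\<And>n. g' n \<in> trigs" "AE x in \<mu>. (\<lambda>n. g' n x) \<longlonglongrightarrow> g x" "(\<lambda>n. Lp_norm \<mu> q (g' n)) \<longlonglongrightarrow> Lp_norm \<mu> q g"
    by (rule trigs_AE_approximation[OF g ps(2)], rule that)
  obtain h' where h': "\<And>n. h' n \<in> trigs" "AE x in \<mu>. (\<lambda>n. h' n x) \<longlonglongrightarrow> h x" "(\<lambda>n. Lp_norm \<mu> s (h' n)) \<longlonglongrightarrow> Lp_norm \<mu> s h"
    by (rule trigs_AE_approximation[OF h ps(3)], rule that)
  note [measurable] = trigs_measurable[OF f'(1)] trigs_measurable[OF g'(1)] trigs_measurable[OF h'(1)]
  let ?u = "\<lambda>n \<omega>. cmod (f' n (U \<omega>)) * cmod (g' n (V \<omega>)) * cmod (h' n (fst \<omega>))"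
  let ?R = "\<lambda>n. Lp_norm \<mu> p (f' n) * Lp_norm \<mu> q (g' n) * Lp_norm \<mu> s (h' n)"
  have trig: "(\<integral>\<^sup>+\<omega>. ennreal (?u n \<omega>) \<partial>Om) \<le> ennreal (?R n)" for n
  proof -
    obtain K1 where K1: "\<And>x. x \<in> duals \<Longrightarrow> cmod (f' n x) \<le> K1" using trigs_bounded[OF f'(1)] by blast
    obtain K2 where K2: "\<And>x. x \<in> duals \<Longrightarrow> cmod (g' n x) \<le> K2" using trigs_bounded[OF g'(1)] by blast
    obtain K3 where K3: "\<And>x. x \<in> duals \<Longrightarrow> cmod (h' n x) \<le> K3" using trigs_bounded[OF h'(1)] by blast
    have dual: "U \<omega> \<in> duals" "V \<omega> \<in> duals" "fst \<omega> \<in> duals" if "\<omega> \<in> space Om" for \<omega>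
      using measurable_space[OF U_measurable that] measurable_space[OF V_measurable that] that
      by (auto simp: space_mu space_pair_measure)
    have i: "integrable Om (?u n)"
    proof (rule P3.integrable_const_bound)
      show "AE \<omega> in Om. norm (?u n \<omega>) \<le> \<bar>K1\<bar> * \<bar>K2\<bar> * \<bar>K3\<bar>"
      proof (rule AE_I2)
        fix \<omega> assume \<omega>: "\<omega> \<in> space Om"
        have "cmod (f' n (U \<omega>)) \<le> \<bar>K1\<bar>" "cmod (g' n (V \<omega>)) \<le> \<bar>K2\<bar>" "cmod (h' n (fst \<omega>)) \<le> \<bar>K3\<bar>"
          using K1[OF dual(1)[OF \<omega>]] K2[OF dual(2)[OF \<omega>]] K3[OF dual(3)[OF \<omega>]] by linarith+
        then have "?u n \<omega> \<le> \<bar>K1\<bar> * \<bar>K2\<bar> * \<bar>K3\<bar>" by (intro mult_mono mult_nonneg_nonneg) auto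
        then show "norm (?u n \<omega>) \<le> \<bar>K1\<bar> * \<bar>K2\<bar> * \<bar>K3\<bar>" by simp
      qed
    qed measurable
    have "(\<integral>\<^sup>+\<omega>. ennreal (?u n \<omega>) \<partial>Om) = ennreal (\<integral>\<omega>. ?u n \<omega> \<partial>Om)"
      by (rule nn_integral_eq_integral[OF i]) simp
    then show ?thesis using hoelder_trigs[OF f'(1) g'(1) h'(1), of n n n] by (simp add: ennreal_leI)
  qed
  have "(\<integral>\<^sup>+\<omega>. ennreal (cmod (f (U \<omega>)) * cmod (g (V \<omega>)) * cmod (h (fst \<omega>))) \<partial>Om) \<le> (\<integral>\<^sup>+\<omega>. liminf (\<lambda>n. ennreal (?u n \<omega>)) \<partial>Om)"
  proof (rule nn_integral_mono_AE)
    show "AE \<omega> in Om. ennreal (cmod (f (U \<omega>)) * cmod (g (V \<omega>)) * cmod (h (fst \<omega>))) \<le> liminf (\<lambda>n. ennreal (?u n \<omega>))"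
      using AE_U[OF f'(2)] AE_V[OF g'(2)] AE_fst[OF h'(2)]
    proof eventually_elim
      case (elim \<omega>)
      have "(\<lambda>n. ennreal (?u n \<omega>)) \<longlonglongrightarrow> ennreal (cmod (f (U \<omega>)) * cmod (g (V \<omega>)) * cmod (h (fst \<omega>)))"
        by (intro tendsto_ennrealI tendsto_mult tendsto_norm elim)
      then have "liminf (\<lambda>n. ennreal (?u n \<omega>)) = ennreal (cmod (f (U \<omega>)) * cmod (g (V \<omega>)) * cmod (h (fst \<omega>)))"
        by (rule lim_imp_Liminf[rotated]) simp
      then show ?case by simp
    qed
  qed
  also have "\<dots> \<le> liminf (\<lambda>n. \<integral>\<^sup>+\<omega>. ennreal (?u n \<omega>) \<partial>Om)"
    by (intro nn_integral_liminf) measurable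
  also have "\<dots> \<le> liminf (\<lambda>n. ennreal (?R n))"
    by (intro Liminf_mono always_eventually allI trig)
  also have "\<dots> = ennreal (Lp_norm \<mu> p f * Lp_norm \<mu> q g * Lp_norm \<mu> s h)"
    by (rule lim_imp_Liminf) (intro trivial_limit_sequentially tendsto_ennrealI tendsto_mult f' g' h')+
  finally show ?thesis .
qed

lemma integrable_UV:
  assumes f: "Lp \<mu> p f" and g: "Lp \<mu> q g"
  shows "integrable Om (\<lambda>\<omega>. f (U \<omega>) * g (V \<omega>))"
proof (rule integrableI_bounded)
  note [measurable] = Lp_measurable[OF f] Lp_measurable[OF g]
  show "(\<lambda>\<omega>. f (U \<omega>) * g (V \<omega>)) \<in> borel_measurable Om" by measurable
  have "Lp \<mu> s (\<lambda>x. 1)" by (simp add: Lp_def)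
  from hoelder_nn[OF f g this] show "(\<integral>\<^sup>+\<omega>. ennreal (norm (f (U \<omega>) * g (V \<omega>))) \<partial>Om) < \<infinity>"
    by (simp add: norm_mult le_less_trans[OF _ ennreal_less_top])
qed

lemma AE_integrable_UV:
  assumes "Lp \<mu> p f" "Lp \<mu> q g"
  shows "AE x in \<mu>. integrable (\<mu> \<Otimes>\<^sub>M \<mu>) (\<lambda>w. f (U (x, w)) * g (V (x, w)))"
  using P3.AE_integrable_fst'[OF integrable_UV[OF assms]] .

lemma ker_measurable:
  assumes f: "f \<in> borel_measurable \<mu>" and g: "g \<in> borel_measurable \<mu>"
  shows "ker f g \<in> borel_measurable \<mu>"
proof -
  have "(\<lambda>\<omega>. f (U \<omega>) * g (V \<omega>)) \<in> borel_measurable Om" using f g by measurable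
  then show ?thesis unfolding ker_def[abs_def] by (intro P2.borel_measurable_lebesgue_integral) (simp add: split_def)
qed

text \<open>Duality with the extremal test function: |ker f g| is paired with its own power of
  exponent r - 1, which gives y <= K y^(1/s) for the r-th moment y and hence y^(1/r) <= K. The
  truncation \<open>m N\<close> makes y finite, and \<open>Lp_fatou\<close> removes it.\<close>

lemma ker_bound:
  assumes f: "Lp \<mu> p f" and g: "Lp \<mu> q g"
  shows "Lp \<mu> r (ker f g)" "Lp_norm \<mu> r (ker f g) \<le> Lp_norm \<mu> p f * Lp_norm \<mu> q g"
proof -
  note [measurable] = Lp_measurable[OF f] Lp_measurable[OF g]
  note Bm[measurable] = ker_measurable[OF Lp_measurable[OF f] Lp_measurable[OF g]]
  define K where "K = Lp_norm \<mu> p f * Lp_norm \<mu> q g"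
  have K0: "0 \<le> K" by (simp add: K_def)
  define m where "m N x = min (cmod (ker f g x)) (real N)" for N x
  have m0: "0 \<le> m N x" "m N x \<le> real N" "m N x \<le> cmod (ker f g x)" for N x by (auto simp: m_def)
  have mm[measurable]: "m N \<in> borel_measurable \<mu>" for N unfolding m_def[abs_def] by measurable
  have mi: "integrable \<mu> (\<lambda>x. m N x powr r)" for N
    using m0 r by (intro integrable_const_bound[where B="real N powr r"]) (auto intro!: AE_I2 powr_mono2)
  have L: "Lp \<mu> r (\<lambda>x. complex_of_real (m N x))" for N
    using mi m0 by (simp add: Lp_def)
  have norm: "Lp_norm \<mu> r (\<lambda>x. complex_of_real (m N x)) \<le> K" for N
  proof -
    let ?h = "\<lambda>x. complex_of_real (m N x powr (r - 1))"
    define y where "y = (\<integral>x. m N x powr r \<partial>\<mu>)"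
    have y0: "0 \<le> y" by (simp add: y_def integral_nonneg_AE)
    have rs: "(r - 1) * s = r" using r by (simp add: s_def)
    have h: "Lp \<mu> s ?h" using mi by (simp add: Lp_def powr_powr rs)
    have hn: "Lp_norm \<mu> s ?h = y powr (1 / s)" by (simp add: Lp_norm_def powr_powr rs y_def)
    have "ennreal y = (\<integral>\<^sup>+x. ennreal (m N x powr r) \<partial>\<mu>)"
      unfolding y_def by (rule nn_integral_eq_integral[symmetric, OF mi]) simp
    also have "\<dots> \<le> (\<integral>\<^sup>+x. \<integral>\<^sup>+w. ennreal (cmod (f (U (x, w))) * cmod (g (V (x, w))) * cmod (?h x)) \<partial>(\<mu> \<Otimes>\<^sub>M \<mu>) \<partial>\<mu>)"
    proof (rule nn_integral_mono_AE)
      show "AE x in \<mu>. ennreal (m N x powr r) \<le> (\<integral>\<^sup>+w. ennreal (cmod (f (U (x, w))) * cmod (g (V (x, w))) * cmod (?h x)) \<partial>(\<mu> \<Otimes>\<^sub>M \<mu>))"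
        using AE_integrable_UV[OF f g] AE_space
      proof eventually_elim
        case (elim x)
        have meas: "(\<lambda>w. (x, w)) \<in> measurable (\<mu> \<Otimes>\<^sub>M \<mu>) Om" using elim(2) by measurable
        have [measurable]: "(\<lambda>w. U (x, w)) \<in> measurable (\<mu> \<Otimes>\<^sub>M \<mu>) \<mu>" "(\<lambda>w. V (x, w)) \<in> measurable (\<mu> \<Otimes>\<^sub>M \<mu>) \<mu>"
          using measurable_compose[OF meas U_measurable] measurable_compose[OF meas V_measurable] by auto
        have "m N x powr r = m N x * m N x powr (r - 1)"
          using m0(1)[of N x] powr_add[of "m N x" 1 "r - 1"] by (cases "m N x = 0") auto
        also have "\<dots> \<le> cmod (ker f g x) * m N x powr (r - 1)" by (intro mult_right_mono m0) simp
        finally have "ennreal (m N x powr r) \<le> ennreal (cmod (ker f g x)) * ennreal (m N x powr (r - 1))"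
          by (simp add: ennreal_mult[symmetric] ennreal_leI)
        also have "ennreal (cmod (ker f g x)) \<le> (\<integral>\<^sup>+w. ennreal (cmod (f (U (x, w)) * g (V (x, w)))) \<partial>(\<mu> \<Otimes>\<^sub>M \<mu>))"
          unfolding ker_def by (rule integral_norm_bound_ennreal[OF elim(1)])
        also have "(\<integral>\<^sup>+w. ennreal (cmod (f (U (x, w)) * g (V (x, w)))) \<partial>(\<mu> \<Otimes>\<^sub>M \<mu>)) * ennreal (m N x powr (r - 1)) =
            (\<integral>\<^sup>+w. ennreal (cmod (f (U (x, w)) * g (V (x, w)))) * ennreal (m N x powr (r - 1)) \<partial>(\<mu> \<Otimes>\<^sub>M \<mu>))"
          by (rule nn_integral_multc[symmetric]) measurable
        also have "\<dots> = (\<integral>\<^sup>+w. ennreal (cmod (f (U (x, w))) * cmod (g (V (x, w))) * cmod (?h x)) \<partial>(\<mu> \<Otimes>\<^sub>M \<mu>))"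
          by (simp add: ennreal_mult[symmetric] norm_mult)
        finally show ?case by (simp add: mult_right_mono)
      qed
    qed
    also have "\<dots> = (\<integral>\<^sup>+\<omega>. ennreal (cmod (f (U \<omega>)) * cmod (g (V \<omega>)) * cmod (?h (fst \<omega>))) \<partial>Om)"
      by (subst P2.nn_integral_fst[symmetric]) (simp_all, measurable)
    also have "\<dots> \<le> ennreal (K * y powr (1 / s))"
      using hoelder_nn[OF f g h] unfolding hn K_def .
    finally have yK: "y \<le> K * y powr (1 / s)" using K0 by (subst (asm) ennreal_le_iff) auto
    have "y powr (1 / r) \<le> K"
    proof (cases "y = 0")
      case False
      then have "y = y powr (1 / r) * y powr (1 / s)" using y0 by (simp add: powr_add[symmetric] s)
      then have "y powr (1 / r) * y powr (1 / s) \<le> K * y powr (1 / s)" using yK by simp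
      moreover have "0 < y powr (1 / s)" using False by simp
      ultimately show ?thesis by (rule mult_right_le_imp_le)
    qed (simp add: K0)
    then show ?thesis using m0 by (simp add: Lp_norm_def y_def)
  qed
  have lim: "AE x in \<mu>. (\<lambda>N. complex_of_real (m N x)) \<longlonglongrightarrow> complex_of_real (cmod (ker f g x))"
  proof (rule AE_I2)
    fix x
    have "\<forall>\<^sub>F N in sequentially. complex_of_real (m N x) = complex_of_real (cmod (ker f g x))"
      using eventually_ge_at_top[of "nat \<lceil>cmod (ker f g x)\<rceil>"]
    proof eventually_elim
      case (elim N)
      then have "cmod (ker f g x) \<le> real N" by linarith
      then show ?case by (simp add: m_def)
    qed
    then show "(\<lambda>N. complex_of_real (m N x)) \<longlonglongrightarrow> complex_of_real (cmod (ker f g x))" by (rule tendsto_eventually)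
  qed
  have r0: "0 < r" using r by simp
  have F: "Lp \<mu> r (\<lambda>x. complex_of_real (cmod (ker f g x)))" "Lp_norm \<mu> r (\<lambda>x. complex_of_real (cmod (ker f g x))) \<le> K"
    by (rule Lp_fatou[OF L lim _ norm r0], measurable)+
  then show "Lp \<mu> r (ker f g)" "Lp_norm \<mu> r (ker f g) \<le> Lp_norm \<mu> p f * Lp_norm \<mu> q g"
    by (auto simp: Lp_def Lp_norm_def K_def Bm)
qed

text \<open>Additivity is claimed almost everywhere, namely at those x for which the section
  integrals exist.\<close>

lemma bounded_bilinear_ker: "bounded_bilinear_Lp \<mu> p q r ker"
  unfolding bounded_bilinear_Lp_def
proof (intro conjI allI impI exI[of _ 1])
  fix \<phi> \<phi>' \<psi> \<psi>' a assume \<phi>: "Lp \<mu> p \<phi>" and \<psi>: "Lp \<mu> q \<psi>"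
  show "Lp \<mu> r (ker \<phi> \<psi>)" by (rule ker_bound[OF \<phi> \<psi>])
  show "Lp_norm \<mu> r (ker \<phi> \<psi>) \<le> 1 * Lp_norm \<mu> p \<phi> * Lp_norm \<mu> q \<psi>" using ker_bound(2)[OF \<phi> \<psi>] by simp
  show "AE x in \<mu>. ker (\<lambda>y. a * \<phi> y) \<psi> x = a * ker \<phi> \<psi> x"
    by (rule AE_I2) (simp add: ker_def mult.assoc)
  show "AE x in \<mu>. ker \<phi> (\<lambda>y. a * \<psi> y) x = a * ker \<phi> \<psi> x"
    by (rule AE_I2) (simp add: ker_def mult.left_commute)
next
  fix \<phi> \<phi>' \<psi> assume "Lp \<mu> p \<phi>" "Lp \<mu> p \<phi>'" "Lp \<mu> q \<psi>"
  then show "AE x in \<mu>. ker (\<lambda>y. \<phi> y + \<phi>' y) \<psi> x = ker \<phi> \<psi> x + ker \<phi>' \<psi> x"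
    using AE_integrable_UV[of \<phi> \<psi>] AE_integrable_UV[of \<phi>' \<psi>]
    by (auto simp: ker_def distrib_right elim: eventually_elim2)
next
  fix \<phi> \<psi> \<psi>' assume "Lp \<mu> p \<phi>" "Lp \<mu> q \<psi>" "Lp \<mu> q \<psi>'"
  then show "AE x in \<mu>. ker \<phi> (\<lambda>y. \<psi> y + \<psi>' y) x = ker \<phi> \<psi> x + ker \<phi> \<psi>' x"
    using AE_integrable_UV[of \<phi> \<psi>] AE_integrable_UV[of \<phi> \<psi>']
    by (auto simp: ker_def distrib_left elim: eventually_elim2)
qed

end

section \<open>Density of the exponential functions\<close>

text \<open>A bounded bilinear map comes with some constant K. When F \<phi> \<psi> is split into F
  f g, F (\<phi> - f) \<psi> and F f (\<psi> - g), this K multiplies only small quantities, so the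
  constant 1 from the dense set prevails. The lemma serves for every extension, not just for
  \<open>ker\<close>.\<close>

lemma bilinear_bound_dense:
  assumes F: "bounded_bilinear_Lp M p q r F" and pqr: "1 \<le> p" "1 \<le> q" "1 \<le> r"
    and dense: "\<And>f \<epsilon>. Lp M p f \<Longrightarrow> 0 < \<epsilon> \<Longrightarrow> \<exists>g\<in>S. Lp M p g \<and> Lp_norm M p (\<lambda>x. f x - g x) < \<epsilon>"
      "\<And>f \<epsilon>. Lp M q f \<Longrightarrow> 0 < \<epsilon> \<Longrightarrow> \<exists>g\<in>S. Lp M q g \<and> Lp_norm M q (\<lambda>x. f x - g x) < \<epsilon>"
    and bound: "\<And>\<phi> \<psi>. \<phi> \<in> S \<Longrightarrow> \<psi> \<in> S \<Longrightarrow> Lp_norm M r (F \<phi> \<psi>) \<le> Lp_norm M p \<phi> * Lp_norm M q \<psi>"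
    and \<phi>: "Lp M p \<phi>" and \<psi>: "Lp M q \<psi>"
  shows "Lp_norm M r (F \<phi> \<psi>) \<le> Lp_norm M p \<phi> * Lp_norm M q \<psi>"
proof -
  have L: "Lp M r (F f g)" if "Lp M p f" "Lp M q g" for f g
    using F that unfolding bounded_bilinear_Lp_def by blast
  have add1: "AE x in M. F (\<lambda>y. f y + f' y) g x = F f g x + F f' g x" if "Lp M p f" "Lp M p f'" "Lp M q g" for f f' g
    using F that unfolding bounded_bilinear_Lp_def by blast
  have add2: "AE x in M. F f (\<lambda>y. g y + g' y) x = F f g x + F f g' x" if "Lp M p f" "Lp M q g" "Lp M q g'" for f g g'
    using F that unfolding bounded_bilinear_Lp_def by blast
  obtain K0 where "\<forall>f g. Lp M p f \<longrightarrow> Lp M q g \<longrightarrow> Lp_norm M r (F f g) \<le> K0 * Lp_norm M p f * Lp_norm M q g"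
    using F unfolding bounded_bilinear_Lp_def by blast
  then have K0: "Lp_norm M r (F f g) \<le> K0 * Lp_norm M p f * Lp_norm M q g" if "Lp M p f" "Lp M q g" for f g
    using that by blast
  define K where "K = \<bar>K0\<bar>"
  have K: "Lp_norm M r (F f g) \<le> K * (Lp_norm M p f * Lp_norm M q g)" if "Lp M p f" "Lp M q g" for f g
  proof -
    have "K0 * (Lp_norm M p f * Lp_norm M q g) \<le> K * (Lp_norm M p f * Lp_norm M q g)"
      unfolding K_def by (intro mult_right_mono abs_ge_self mult_nonneg_nonneg Lp_norm_nonneg)
    then show ?thesis using K0[OF that] by (simp add: mult.assoc)
  qed
  have K_nonneg: "0 \<le> K" by (simp add: K_def)
  define A B where "A = Lp_norm M p \<phi>" and "B = Lp_norm M q \<psi>"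
  have main: "Lp_norm M r (F \<phi> \<psi>) \<le> (A + \<epsilon>) * (B + \<epsilon>) + K * (\<epsilon> * B) + K * ((A + \<epsilon>) * \<epsilon>)" if \<epsilon>: "0 < \<epsilon>" for \<epsilon>
  proof -
    obtain f where f: "f \<in> S" "Lp M p f" "Lp_norm M p (\<lambda>x. \<phi> x - f x) < \<epsilon>" using dense(1)[OF \<phi> \<epsilon>] by blast
    obtain g where g: "g \<in> S" "Lp M q g" "Lp_norm M q (\<lambda>x. \<psi> x - g x) < \<epsilon>" using dense(2)[OF \<psi> \<epsilon>] by blast
    let ?f = "\<lambda>x. \<phi> x - f x" and ?g = "\<lambda>x. \<psi> x - g x"
    have fL: "Lp M p ?f" and gL: "Lp M q ?g" using Lp_diff \<phi> \<psi> f g pqr by blast+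
    have fA: "Lp_norm M p f \<le> A + \<epsilon>"
      using Lp_norm_triangle_sub[OF f(2) \<phi> pqr(1)] f(3) Lp_norm_minus_commute[of M p \<phi> f] by (simp add: A_def)
    have gB: "Lp_norm M q g \<le> B + \<epsilon>"
      using Lp_norm_triangle_sub[OF g(2) \<psi> pqr(2)] g(3) Lp_norm_minus_commute[of M q \<psi> g] by (simp add: B_def)
    have nn: "0 \<le> A" "0 \<le> B" by (simp_all add: A_def B_def)
    note Ls = L[OF f(2) g(2)] L[OF fL \<psi>] L[OF f(2) gL]
    have "AE x in M. F \<phi> \<psi> x = F f g x + (F ?f \<psi> x + F f ?g x)"
      using add1[OF f(2) fL \<psi>] add2[OF f(2) g(2) gL] by eventually_elim simp
    then have "Lp_norm M r (F \<phi> \<psi>) = Lp_norm M r (\<lambda>x. F f g x + (F ?f \<psi> x + F f ?g x))"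
      by (rule Lp_norm_AE_cong[OF _ Lp_measurable[OF L[OF \<phi> \<psi>]] Lp_measurable[OF Lp_add[OF Ls(1) Lp_add[OF Ls(2,3) pqr(3)] pqr(3)]]])
    also have "\<dots> \<le> Lp_norm M r (F f g) + (Lp_norm M r (F ?f \<psi>) + Lp_norm M r (F f ?g))"
      using Lp_norm_triangle[OF Ls(1) Lp_add[OF Ls(2,3) pqr(3)] pqr(3)] Lp_norm_triangle[OF Ls(2,3) pqr(3)] by linarith
    also have "Lp_norm M r (F f g) \<le> (A + \<epsilon>) * (B + \<epsilon>)"
      by (rule order_trans[OF bound[OF f(1) g(1)]]) (intro mult_mono fA gB Lp_norm_nonneg; use nn \<epsilon> in simp)
    also have "Lp_norm M r (F ?f \<psi>) \<le> K * (\<epsilon> * B)"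
      by (rule order_trans[OF K[OF fL \<psi>]]) (intro mult_mono mult_left_mono K_nonneg less_imp_le[OF f(3)] Lp_norm_nonneg; use nn \<epsilon> in \<open>simp add: B_def\<close>)
    also have "Lp_norm M r (F f ?g) \<le> K * ((A + \<epsilon>) * \<epsilon>)"
      by (rule order_trans[OF K[OF f(2) gL]]) (intro mult_mono mult_left_mono fA K_nonneg less_imp_le[OF g(3)] Lp_norm_nonneg; use nn \<epsilon> in simp)
    finally show ?thesis by simp
  qed
  have "((\<lambda>\<epsilon>. (A + \<epsilon>) * (B + \<epsilon>) + K * (\<epsilon> * B) + K * ((A + \<epsilon>) * \<epsilon>)) \<longlongrightarrow> (A + 0) * (B + 0) + K * (0 * B) + K * ((A + 0) * 0)) (at_right 0)"
    by (intro tendsto_intros)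
  then have "((\<lambda>\<epsilon>. (A + \<epsilon>) * (B + \<epsilon>) + K * (\<epsilon> * B) + K * ((A + \<epsilon>) * \<epsilon>)) \<longlongrightarrow> A * B) (at_right 0)" by simp
  then have "Lp_norm M r (F \<phi> \<psi>) \<le> A * B"
    by (rule tendsto_lowerbound) (use main in \<open>auto simp: eventually_at_right_less intro: eventually_at_rightI[of 0 1]\<close>)
  then show ?thesis by (simp add: A_def B_def)
qed

context white_noise
begin

text \<open>Different indices may carry the same vector, whereas \<open>Exp\<close> sums over a set
  of vectors; so the coefficients over each fibre of \<open>Z\<close> are added up.\<close>

lemma exp_sum_Exp:
  assumes I: "finite I" "\<And>i. i \<in> I \<Longrightarrow> Z i \<in> ctests"
  shows "(\<lambda>x. \<Sum>i\<in>I. a i * exp_fun (Z i) x) \<in> Exp e lam"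
proof -
  have "(\<Sum>i\<in>I. a i * exp_fun (Z i) x) = (\<Sum>\<zeta>\<in>Z ` I. (\<Sum>i\<in>{i \<in> I. Z i = \<zeta>}. a i) * exp_fun \<zeta> x)" for x
    unfolding sum.image_gen[OF I(1), of _ Z] sum_distrib_right by (intro sum.cong refl) simp
  moreover have "finite (Z ` I)" "Z ` I \<subseteq> ctests" by (simp add: I(1), rule image_subsetI, rule I(2))
  ultimately show ?thesis
    unfolding Exp_def
    by (intro CollectI exI[of _ "Z ` I"] exI[of _ "\<lambda>\<zeta>. \<Sum>i\<in>{i \<in> I. Z i = \<zeta>}. a i"] conjI ext)
qed

text \<open>At the purely imaginary vector (0, \<xi>), \<open>exp_fun\<close> is a multiple of exp
  (i x \<xi>). The agreement is on the dual space, where alone \<open>trigs\<close> prescribes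
  values.\<close>

lemma trigs_Exp:
  assumes "f \<in> trigs"
  shows "\<exists>g\<in>Exp e lam. \<forall>x\<in>duals. f x = g x"
proof -
  obtain l where l: "set l \<subseteq> UNIV \<times> tests" "\<And>x. x \<in> duals \<Longrightarrow> f x = (\<Sum>(a, \<xi>)\<leftarrow>l. a * exp (\<i> * complex_of_real (x \<xi>)))"
    using assms unfolding trigs_def by blast
  define Z where "Z i = (0 :: 'a, snd (l ! i))" for i
  define a where "a i = fst (l ! i) * exp (cinner_bilinear (Z i) (Z i) / 2)" for i
  define I where "I = {0..<length l}"
  have mem: "snd (l ! i) \<in> tests" if "i \<in> I" for i
    using that subsetD[OF l(1) nth_mem[of i l]] by (simp add: I_def mem_Times_iff)
  have term_eq: "a i * exp_fun (Z i) x = fst (l ! i) * exp (\<i> * complex_of_real (x (snd (l ! i))))" if "x \<in> duals" for i x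
  proof -
    have "ceval (Z i) x = \<i> * complex_of_real (x (snd (l ! i)))"
      using that by (simp add: Z_def ceval_alt)
    moreover have one: "exp (cinner_bilinear (Z i) (Z i) / 2) * exp (- cinner_bilinear (Z i) (Z i) / 2) = 1"
      by (simp add: mult_exp_exp)
    have "a i * exp_fun (Z i) x = fst (l ! i) * exp (ceval (Z i) x) *
        (exp (cinner_bilinear (Z i) (Z i) / 2) * exp (- cinner_bilinear (Z i) (Z i) / 2))"
      unfolding a_def exp_fun_ceval by (simp only: mult_ac)
    ultimately show ?thesis unfolding one by simp
  qed
  have "f x = (\<Sum>i\<in>I. a i * exp_fun (Z i) x)" if "x \<in> duals" for x
    unfolding l(2)[OF that] sum_list_sum_nth I_def length_map
    by (intro sum.cong refl) (simp add: term_eq[OF that] split_def)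
  moreover have "(\<lambda>x. \<Sum>i\<in>I. a i * exp_fun (Z i) x) \<in> Exp e lam"
    by (rule exp_sum_Exp) (auto simp: I_def Z_def mem[unfolded I_def])
  ultimately show ?thesis by (intro bexI[of _ "\<lambda>x. \<Sum>i\<in>I. a i * exp_fun (Z i) x"]) auto
qed

lemma Exp_Lp:
  assumes "\<phi> \<in> Exp e lam" "0 < p"
  shows "Lp \<mu> p \<phi>"
proof -
  obtain S a where S: "finite S" "S \<subseteq> ctests" "\<phi> = (\<lambda>x. \<Sum>\<zeta>\<in>S. a \<zeta> * exp_fun \<zeta> x)"
    using assms(1) by (rule Exp_cases)
  have "expbdd \<phi>"
    unfolding S(3) using S(1,2) by (intro expbdd_sum expbdd_cmult expbdd_exp_fun) auto
  then show ?thesis using assms(2) by (rule expbdd_Lp)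
qed

lemma Exp_dense:
  assumes f: "Lp \<mu> p f" and p: "1 \<le> p" and \<epsilon>: "0 < \<epsilon>"
  shows "\<exists>g\<in>Exp e lam. Lp \<mu> p g \<and> Lp_norm \<mu> p (\<lambda>x. f x - g x) < \<epsilon>"
proof -
  obtain h where h: "h \<in> trigs" "Lp_norm \<mu> p (\<lambda>x. f x - h x) < \<epsilon>" using trigs_dense[OF f p \<epsilon>] by blast
  obtain g where g: "g \<in> Exp e lam" "\<And>x. x \<in> duals \<Longrightarrow> h x = g x" using trigs_Exp[OF h(1)] by blast
  have gL: "Lp \<mu> p g" using Exp_Lp[OF g(1)] p by simp
  have "Lp_norm \<mu> p (\<lambda>x. f x - h x) = Lp_norm \<mu> p (\<lambda>x. f x - g x)"
    unfolding Lp_norm_def by (intro arg_cong2[where f="(powr)"] Bochner_Integration.integral_cong refl) (simp add: g(2) space_mu)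
  then show ?thesis using g(1) gL h(2) by (intro bexI[of _ g]) simp_all
qed

lemma integral_exp_eval:
  assumes "\<xi> \<in> tests"
  shows "(\<integral>x. exp (s * x \<xi>) \<partial>\<mu>) = exp (s\<^sup>2 * (norm \<xi>)\<^sup>2 / 2)"
proof -
  have "complex_of_real (\<integral>x. exp (s * x \<xi>) \<partial>\<mu>) = (\<integral>x. exp (ceval (s *\<^sub>R \<xi>, 0) x) \<partial>\<mu>)"
    unfolding integral_complex_of_real[symmetric] using assms
    by (intro Bochner_Integration.integral_cong refl) (simp add: ceval_alt exp_of_real dual_scaleR space_mu del: of_real_mult)
  also have "\<dots> = exp (cinner_bilinear (s *\<^sub>R \<xi>, 0) (s *\<^sub>R \<xi>, 0) / 2)"
    using assms by (intro integral_exp_ceval) auto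
  also have "cinner_bilinear (s *\<^sub>R \<xi>, 0) (s *\<^sub>R \<xi>, 0) / 2 = complex_of_real (s\<^sup>2 * (norm \<xi>)\<^sup>2 / 2)"
    by (simp add: cinner_bilinear_def complex_eq_iff power2_norm_eq_inner) (simp add: power2_eq_square)
  finally show ?thesis unfolding exp_of_real of_real_eq_iff .
qed

text \<open>The growth rates p - 1, q - 1 and r - 1 found here are the coefficients that the
  quadratic form compares in \<open>not_bounded\<close>.\<close>

lemma Lp_norm_exp_fun:
  assumes \<xi>: "\<xi> \<in> tests" and p: "0 < p"
  shows "Lp_norm \<mu> p (exp_fun (\<xi>, 0)) = exp ((p - 1) * (norm \<xi>)\<^sup>2 / 2)"
proof -
  have "cmod (exp_fun (\<xi>, 0) x) powr p = exp (- p * (norm \<xi>)\<^sup>2 / 2) * exp (p * x \<xi>)" if "x \<in> duals" for x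
  proof -
    have "cmod (exp_fun (\<xi>, 0) x) = exp (x \<xi> - (norm \<xi>)\<^sup>2 / 2)"
      by (simp add: exp_fun_def cinner_bilinear_def power2_norm_eq_inner)
    then show ?thesis by (simp add: exp_powr_real mult_exp_exp field_simps)
  qed
  then have "(\<integral>x. cmod (exp_fun (\<xi>, 0) x) powr p \<partial>\<mu>) = (\<integral>x. exp (- p * (norm \<xi>)\<^sup>2 / 2) * exp (p * x \<xi>) \<partial>\<mu>)"
    by (intro Bochner_Integration.integral_cong refl) (simp add: space_mu)
  also have "\<dots> = exp (- p * (norm \<xi>)\<^sup>2 / 2) * exp (p\<^sup>2 * (norm \<xi>)\<^sup>2 / 2)"
    by (simp add: integral_exp_eval[OF \<xi>])
  also have "\<dots> = exp (p * ((p - 1) * (norm \<xi>)\<^sup>2 / 2))"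
    by (simp add: mult_exp_exp power2_eq_square field_simps)
  finally show ?thesis using p by (simp add: Lp_norm_def exp_powr_real)
qed

lemma dg_e: "bounded_seq b \<Longrightarrow> dg b (e n) = b n *\<^sub>R e n"
  by (rule coeff_eqI) (simp add: e_inner)

end

section \<open>Boundedness and its failure\<close>

context wick_kernel_bounded
begin

lemma wick_Gamma_bound:
  assumes \<phi>: "\<phi> \<in> Exp e lam" and \<psi>: "\<psi> \<in> Exp e lam"
  shows "Lp \<mu> r (wick_Gamma e \<mu> t c d \<phi> \<psi>)"
    "Lp_norm \<mu> r (wick_Gamma e \<mu> t c d \<phi> \<psi>) \<le> Lp_norm \<mu> p \<phi> * Lp_norm \<mu> q \<psi>"
proof -
  have L: "Lp \<mu> p \<phi>" "Lp \<mu> q \<psi>" using Exp_Lp[OF \<phi>] Exp_Lp[OF \<psi>] p q by auto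
  note W = wick_Gamma_ker[OF \<phi> \<psi>]
  have W': "AE x in \<mu>. ker \<phi> \<psi> x = wick_Gamma e \<mu> t c d \<phi> \<psi> x" using W(1) by eventually_elim simp
  show "Lp \<mu> r (wick_Gamma e \<mu> t c d \<phi> \<psi>)" by (rule Lp_AE_cong[OF ker_bound(1)[OF L] W' W(2)])
  have "Lp_norm \<mu> r (wick_Gamma e \<mu> t c d \<phi> \<psi>) = Lp_norm \<mu> r (ker \<phi> \<psi>)"
    by (rule Lp_norm_AE_cong[OF W(1,2) Lp_measurable[OF ker_bound(1)[OF L]]])
  then show "Lp_norm \<mu> r (wick_Gamma e \<mu> t c d \<phi> \<psi>) \<le> Lp_norm \<mu> p \<phi> * Lp_norm \<mu> q \<psi>"
    using ker_bound(2)[OF L] by simp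
qed

lemma bounded_wick_Gamma: "bounded_Lp_on \<mu> p q r (Exp e lam) (wick_Gamma e \<mu> t c d)"
  unfolding bounded_Lp_on_def using wick_Gamma_bound by (intro exI[of _ 1]) simp

lemma ker_extension: "continuous_bilinear_extension \<mu> p q r (Exp e lam) (wick_Gamma e \<mu> t c d) ker"
  unfolding continuous_bilinear_extension_def
proof (intro conjI ballI bounded_bilinear_ker)
  fix \<phi> \<psi> assume "\<phi> \<in> Exp e lam" "\<psi> \<in> Exp e lam"
  from wick_Gamma_ker(1)[OF this] show "AE x in \<mu>. ker \<phi> \<psi> x = wick_Gamma e \<mu> t c d \<phi> \<psi> x"
    by eventually_elim simp
qed

text \<open>\<open>F\<close> brings a bound with a constant of its own; density of the exponential
  functions improves it to the constant 1 of \<open>wick_Gamma_bound\<close>.\<close>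

lemma extension_bound:
  assumes F: "continuous_bilinear_extension \<mu> p q r (Exp e lam) (wick_Gamma e \<mu> t c d) F"
    and \<phi>: "Lp \<mu> p \<phi>" and \<psi>: "Lp \<mu> q \<psi>"
  shows "Lp \<mu> r (F \<phi> \<psi>)" "Lp_norm \<mu> r (F \<phi> \<psi>) \<le> Lp_norm \<mu> p \<phi> * Lp_norm \<mu> q \<psi>"
proof -
  have B: "bounded_bilinear_Lp \<mu> p q r F" using F by (simp add: continuous_bilinear_extension_def)
  have L: "Lp \<mu> r (F f g)" if "Lp \<mu> p f" "Lp \<mu> q g" for f g
    using B that unfolding bounded_bilinear_Lp_def by blast
  show "Lp \<mu> r (F \<phi> \<psi>)" by (rule L[OF \<phi> \<psi>])
  have ps: "1 \<le> p" "1 \<le> q" "1 \<le> r" using p q r by auto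
  show "Lp_norm \<mu> r (F \<phi> \<psi>) \<le> Lp_norm \<mu> p \<phi> * Lp_norm \<mu> q \<psi>"
  proof (rule bilinear_bound_dense[OF B ps Exp_dense[OF _ ps(1)] Exp_dense[OF _ ps(2)] _ \<phi> \<psi>])
    fix f g assume fg: "f \<in> Exp e lam" "g \<in> Exp e lam"
    have L': "Lp \<mu> p f" "Lp \<mu> q g" using Exp_Lp[OF fg(1)] Exp_Lp[OF fg(2)] p q by auto
    have "AE x in \<mu>. F f g x = wick_Gamma e \<mu> t c d f g x"
      using F fg by (simp add: continuous_bilinear_extension_def)
    then have "Lp_norm \<mu> r (F f g) = Lp_norm \<mu> r (wick_Gamma e \<mu> t c d f g)"
      by (rule Lp_norm_AE_cong[OF _ Lp_measurable[OF L[OF L']] wick_Gamma_ker(2)[OF fg]])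
    then show "Lp_norm \<mu> r (F f g) \<le> Lp_norm \<mu> p f * Lp_norm \<mu> q g" using wick_Gamma_bound(2)[OF fg] by simp
  qed
qed

end

context wick_kernel
begin

text \<open>Exponential functions with the vectors \<open>x u e\<^sub>n\<close> and \<open>x v e\<^sub>n\<close>, \<open>x \<rightarrow> \<infinity>\<close>, violate every bound if the
  quadratic form takes a negative value at \<open>(u, v)\<close>.\<close>

lemma not_bounded:
  assumes pqr: "1 < p" "1 < q" "1 < r" and fail: "\<not> exponent_cond p q r (c n) (d n) (t n)"
  shows "\<not> bounded_Lp_on \<mu> p q r (Exp e lam) (wick_Gamma e \<mu> t c d)"
proof
  assume "bounded_Lp_on \<mu> p q r (Exp e lam) (wick_Gamma e \<mu> t c d)"
  then obtain k where "\<forall>\<phi>\<in>Exp e lam. \<forall>\<psi>\<in>Exp e lam. Lp \<mu> r (wick_Gamma e \<mu> t c d \<phi> \<psi>) \<and>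
      Lp_norm \<mu> r (wick_Gamma e \<mu> t c d \<phi> \<psi>) \<le> k * Lp_norm \<mu> p \<phi> * Lp_norm \<mu> q \<psi>"
    unfolding bounded_Lp_on_def ..
  then have k: "Lp_norm \<mu> r (wick_Gamma e \<mu> t c d \<phi> \<psi>) \<le> k * Lp_norm \<mu> p \<phi> * Lp_norm \<mu> q \<psi>"
    if "\<phi> \<in> Exp e lam" "\<psi> \<in> Exp e lam" for \<phi> \<psi>
    by (simp add: that)
  obtain u v where uv: "(p - 1) * u\<^sup>2 + (q - 1) * v\<^sup>2 < (r - 1) * (c n * u + d n * v)\<^sup>2 + 2 * t n * c n * d n * u * v"
    using fail unfolding exponent_cond_quadratic[OF pqr t_range(1)] by (auto simp: not_le)
  \<comment> \<open>Half the excess of the quadratic form. All norms are exponentials of multiples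
    of x^2, and x^2 m is the surplus of the left exponent.\<close>
  define m where "m = ((r - 1) * (c n * u + d n * v)\<^sup>2 + 2 * t n * c n * d n * u * v - ((p - 1) * u\<^sup>2 + (q - 1) * v\<^sup>2)) / 2"
  have m: "0 < m" using uv by (simp add: m_def)
  \<comment> \<open>Chosen with x^2 m = |k|, so that the alleged bound becomes exp |k| <= k.\<close>
  define x where "x = sqrt (\<bar>k\<bar> / m)"
  define \<zeta> where "\<zeta> = ((x * u) *\<^sub>R e n, 0 :: 'a)"
  define \<theta> where "\<theta> = ((x * v) *\<^sub>R e n, 0 :: 'a)"
  define w where "w = x * (c n * u + d n * v)"
  have ct: "\<zeta> \<in> ctests" "\<theta> \<in> ctests" by (auto simp: \<zeta>_def \<theta>_def)
  have E: "exp_fun \<zeta> \<in> Exp e lam" if "\<zeta> \<in> ctests" for \<zeta>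
    using exp_sum_Exp[of "{0::nat}" "\<lambda>_. \<zeta>" "\<lambda>_. 1"] that by simp
  have norm_e: "norm (e n) = 1" by (simp add: norm_eq_sqrt_inner e_inner)
  have cdgs: "cdg c \<zeta> = ((c n * (x * u)) *\<^sub>R e n, 0)" "cdg d \<theta> = ((d n * (x * v)) *\<^sub>R e n, 0)"
    "cdg t (cdg d \<theta>) = ((t n * (d n * (x * v))) *\<^sub>R e n, 0)"
    \<comment> \<open>The instances at 0 say that diagonal operators map 0 to 0.\<close>
    using dg_scaleR[of c 0 0] dg_scaleR[of d 0 0] dg_scaleR[of t 0 0]
    by (simp_all add: cdg_def \<zeta>_def \<theta>_def dg_scaleR dg_e mult_ac)
  have sum: "cdg c \<zeta> + cdg d \<theta> = (w *\<^sub>R e n, 0)"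
  proof -
    have w: "w = c n * (x * u) + d n * (x * v)" by (simp add: w_def distrib_left mult_ac)
    show ?thesis unfolding w cdgs by (simp add: scaleR_add_left)
  qed
  have cb: "cinner_bilinear (cdg c \<zeta>) (cdg t (cdg d \<theta>)) = complex_of_real (x\<^sup>2 * (t n * c n * d n * u * v))"
    unfolding cdgs(3) cdgs(1) by (simp add: cinner_bilinear_def e_inner complex_eq_iff power2_eq_square)
  have W: "AE y in \<mu>. wick_Gamma e \<mu> t c d (exp_fun \<zeta>) (exp_fun \<theta>) y =
      exp (complex_of_real (x\<^sup>2 * (t n * c n * d n * u * v))) * exp_fun (w *\<^sub>R e n, 0) y"
    using wick_Gamma_ker(1)[OF E[OF ct(1)] E[OF ct(2)]] AE_space
    by eventually_elim (simp add: ker_exp_fun(2)[OF ct] cb sum space_mu)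
  have we: "w *\<^sub>R e n \<in> tests" by auto
  have mE: "exp_fun (w *\<^sub>R e n, 0) \<in> borel_measurable \<mu>"
    using we by (intro expbdd_measurable expbdd_exp_fun) auto
  have "Lp_norm \<mu> r (wick_Gamma e \<mu> t c d (exp_fun \<zeta>) (exp_fun \<theta>)) =
      Lp_norm \<mu> r (\<lambda>y. exp (complex_of_real (x\<^sup>2 * (t n * c n * d n * u * v))) * exp_fun (w *\<^sub>R e n, 0) y)"
    using mE by (intro Lp_norm_AE_cong[OF W wick_Gamma_ker(2)[OF E[OF ct(1)] E[OF ct(2)]]]) measurable
  also have "\<dots> = exp (x\<^sup>2 * (t n * c n * d n * u * v)) * exp ((r - 1) * w\<^sup>2 / 2)"
    using pqr by (subst Lp_norm_cmult) (simp_all add: Lp_norm_exp_fun[OF we] norm_e)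
  finally have lhs: "Lp_norm \<mu> r (wick_Gamma e \<mu> t c d (exp_fun \<zeta>) (exp_fun \<theta>)) =
      exp (x\<^sup>2 * (t n * c n * d n * u * v) + (r - 1) * w\<^sup>2 / 2)" by (simp add: mult_exp_exp)
  have rhs: "Lp_norm \<mu> p (exp_fun \<zeta>) = exp ((p - 1) * (x * u)\<^sup>2 / 2)" "Lp_norm \<mu> q (exp_fun \<theta>) = exp ((q - 1) * (x * v)\<^sup>2 / 2)"
    using pqr unfolding \<zeta>_def \<theta>_def by (subst Lp_norm_exp_fun; auto simp: norm_e)+
  let ?R = "exp ((p - 1) * (x * u)\<^sup>2 / 2 + (q - 1) * (x * v)\<^sup>2 / 2)"
  have "x\<^sup>2 * (t n * c n * d n * u * v) + (r - 1) * w\<^sup>2 / 2 = x\<^sup>2 * m + ((p - 1) * (x * u)\<^sup>2 / 2 + (q - 1) * (x * v)\<^sup>2 / 2)"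
    unfolding w_def power_mult_distrib by (simp add: m_def field_simps)
  then have "exp (x\<^sup>2 * m) * ?R \<le> k * ?R"
    using k[OF E[OF ct(1)] E[OF ct(2)]] unfolding lhs rhs by (simp add: exp_add mult.assoc)
  then have "exp (x\<^sup>2 * m) \<le> k" by (rule mult_right_le_imp_le) simp
  moreover have "x\<^sup>2 * m = \<bar>k\<bar>" using m by (simp add: x_def)
  ultimately have "exp \<bar>k\<bar> \<le> k" by simp
  then show False using exp_ge_add_one_self[of "\<bar>k\<bar>"] by linarith
qed

end

theorem theorem5p4:
  fixes e :: "nat \<Rightarrow> 'a::{real_inner, banach}"
    and lam :: "nat \<Rightarrow> real"
    and \<mu> :: "('a \<Rightarrow> real) measure"
    and T C D :: "'a \<Rightarrow> 'a"
    and t c d :: "nat \<Rightarrow> real"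
    and p q r :: real
  assumes triple: "gelfand_data e lam"
    and mu: "white_noise_measure e lam \<mu>"
    and T: "bounded_linear T" "\<And>n. T (e n) = t n *\<^sub>R e n" "\<And>n. 0 \<le> t n \<and> t n \<le> 2"
    and C: "bounded_linear C" "\<And>n. C (e n) = c n *\<^sub>R e n" "onorm C \<le> 1"
    and D: "bounded_linear D" "\<And>n. D (e n) = d n *\<^sub>R e n" "onorm D \<le> 1"
    and CDT: "\<And>n. (1 - (c n)\<^sup>2) * (1 - (d n)\<^sup>2) \<ge> (t n - 1)\<^sup>2 * (c n)\<^sup>2 * (d n)\<^sup>2"
    and pqr: "p > 1" "q > 1" "r > 1"
  shows "((\<forall>n. exponent_cond p q r (c n) (d n) (t n)) \<longleftrightarrow>
          (\<forall>n. exponent_cond_recip p q r (c n) (d n) (t n)))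
       \<and> ((\<forall>n. exponent_cond p q r (c n) (d n) (t n)) \<longrightarrow>
           bounded_Lp_on \<mu> p q r (Exp e lam) (wick_Gamma e \<mu> t c d) \<and>
           (\<exists>F. continuous_bilinear_extension \<mu> p q r (Exp e lam) (wick_Gamma e \<mu> t c d) F) \<and>
           (\<forall>F. continuous_bilinear_extension \<mu> p q r (Exp e lam) (wick_Gamma e \<mu> t c d) F \<longrightarrow>
              (\<forall>\<phi> \<psi>. Lp \<mu> p \<phi> \<longrightarrow> Lp \<mu> q \<psi> \<longrightarrow>
                 Lp \<mu> r (F \<phi> \<psi>) \<and>
                 Lp_norm \<mu> r (F \<phi> \<psi>) \<le> Lp_norm \<mu> p \<phi> * Lp_norm \<mu> q \<psi>)))
       \<and> (\<not> (\<forall>n. exponent_cond p q r (c n) (d n) (t n)) \<longrightarrow>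
           \<not> bounded_Lp_on \<mu> p q r (Exp e lam) (wick_Gamma e \<mu> t c d))"
proof -
  \<comment> \<open>The operator norms of C and D enter as the eigenvalue bounds |c n| <= 1 and |d
    n| <= 1; these come from the orthonormal basis alone and are ready before
    \<open>wick_kernel\<close> asks for them.\<close>
  interpret triple: gelfand_triple e lam by (rule gelfand_triple.intro[OF triple])
  interpret wick_kernel e lam \<mu> t c d
    using mu T(3) CDT triple.eigenvalue_bound[OF C] triple.eigenvalue_bound[OF D]
    by unfold_locales auto
  show ?thesis
  proof (intro conjI impI)
    show "(\<forall>n. exponent_cond p q r (c n) (d n) (t n)) \<longleftrightarrow> (\<forall>n. exponent_cond_recip p q r (c n) (d n) (t n))"
      using exponent_cond_recip_iff[OF pqr t_range(1)] by simp
  next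
    assume cond: "\<forall>n. exponent_cond p q r (c n) (d n) (t n)"
    interpret wick_kernel_bounded e lam \<mu> t c d p q r
      using pqr cond by unfold_locales auto
    show "bounded_Lp_on \<mu> p q r (Exp e lam) (wick_Gamma e \<mu> t c d)" by (rule bounded_wick_Gamma)
    show "\<exists>F. continuous_bilinear_extension \<mu> p q r (Exp e lam) (wick_Gamma e \<mu> t c d) F" using ker_extension by blast
    show "\<forall>F. continuous_bilinear_extension \<mu> p q r (Exp e lam) (wick_Gamma e \<mu> t c d) F \<longrightarrow>
        (\<forall>\<phi> \<psi>. Lp \<mu> p \<phi> \<longrightarrow> Lp \<mu> q \<psi> \<longrightarrow> Lp \<mu> r (F \<phi> \<psi>) \<and> Lp_norm \<mu> r (F \<phi> \<psi>) \<le> Lp_norm \<mu> p \<phi> * Lp_norm \<mu> q \<psi>)"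
      using extension_bound by blast
  next
    assume "\<not> (\<forall>n. exponent_cond p q r (c n) (d n) (t n))"
    then obtain n where "\<not> exponent_cond p q r (c n) (d n) (t n)" by blast
    then show "\<not> bounded_Lp_on \<mu> p q r (Exp e lam) (wick_Gamma e \<mu> t c d)" by (rule not_bounded[OF pqr])
  qed
qed

end
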